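(* The decomposition group $G$ acts on $\mathbb B$ by $\sigma(B^\bullet(a,\delta))=B^\bullet(\sigma(a),\delta)$ and $\sigma([(B_i)_i])=[(\sigma(B_i))_i]$, and the map $$\mathbb B/G\longrightarrow\mathbb V,\qquad [B]_G\longmapsto(\omega_B)|_{K(x)}$$ (where $[B]_G$ is the $G$-orbit of $B$) is well defined and is an isomorphism of posets, $\mathbb B/G$ carrying the ordering induced from $\mathbb B$.
   Context: $(K,v)$ is an arbitrary valued field, $\overline K$ an algebraic closure, $\bar v$ a fixed extension of $v$ to $\overline K$ with value group $\Gamma$ (divisible closure of $vK$), $G=\{\sigma\in\operatorname{Aut}(\overline K/K)\mid\bar v\circ\sigma=\bar v\}$ the decomposition group. Quasi-cuts $\delta=(\delta^L,\delta^R)$: $\delta^L\le\delta^R$, $\delta^L\cup\delta^R=\Gamma$; $\operatorname{Qcuts}(\Gamma)=\Gamma\sqcup\operatorname{Cuts}(\Gamma)$ ($\gamma\leftrightarrow(\Gamma_{\le\gamma},\Gamma_{\ge\gamma})$; cuts have $\delta^L<\delta^R$), totally ordered by $\delta\le\epsilon\iff\delta^L\subseteq\epsilon^L,\ \delta^R\supseteq\epsilon^R$. Balls $B(a,\gamma)=\{c\in\overline K:\bar v(c-a)\ge\gamma\}$ ($\gamma\in\Gamma$), $B(a,\delta)=\{c:\bar v(c-a)>\delta^L\}$ ($\delta$ a cut). $\mathbb B_{\mathrm{qcut}}$: pointed balls $B^\bullet(a,\delta)=(B(a,\delta),\delta)$, ordered by $B^\bullet(a,\delta)\le B^\bullet(b,\epsilon)\iff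 B(a,\delta)\supseteq B(b,\epsilon)$ and $\delta\le\epsilon$. $x_\delta=\delta$ for $\delta\in\Gamma$; for a cut, $\Gamma(\delta)=x_\delta\mathbb Z\oplus\Gamma$ ordered with $\delta^L<x_\delta<\delta^R$; $\omega_{B^\bullet(a,\delta)}(\sum a_n(x-a)^n)=\min_n\{\bar v(a_n)+nx_\delta\}$. $\mathbb B_\infty$: classes under mutual cofinality of strictly decreasing nests $\mathcal B=(B_i)$ of closed balls with radii in $\Gamma$ and empty intersection; $\omega_{\mathcal B}(f)=\max_i\omega_{B_i}(f)$. $\mathbb B=\mathbb B_\infty\sqcup\mathbb B_{\mathrm{qcut}}$ with the order of $\mathbb B_{\mathrm{qcut}}$, elements of $\mathbb B_\infty$ pairwise incomparable, and $B^\bullet\le[\mathcal B]$ iff the underlying ball of $B^\bullet$ contains some $B_i$. $\mathbb V$ is the set of equivalence classes of valuations on $K(x)$ whose restriction to $K$ is equivalent to $v$ (equivalence: $\nu=\iota\circ\mu$ for an order isomorphism $\iota$ of value groups), with its canonical partial order: $\mu\le\nu$ iff $\mu(f)\le\nu(f)$ for all $f\in K[x]$, understood for inequivalent $\mu,\nu$ as: for each $f$ there is $\gamma\in\Gamma$ with $\mu(f)\le\gamma\le\nu(f)$. *)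

theory Defs
  imports "HOL-Computational_Algebra.Polynomial" "HOL-Computational_Algebra.Fraction_Field"
begin

text \<open>K is the type 'k, its algebraic closure is the type 'l with embedding iota;
  vb is the fixed extension of v to L (so v = vb o iota); vb is only meaningful on
  nonzero elements (the value infinity of 0 is never used).\<close>

definition is_val_L :: "('l::field \<Rightarrow> 'g::linordered_ab_group_add) \<Rightarrow> bool" where
  "is_val_L vb \<longleftrightarrow>
     (\<forall>a b. a \<noteq> 0 \<longrightarrow> b \<noteq> 0 \<longrightarrow> vb (a * b) = vb a + vb b) \<and>
     (\<forall>a b. a \<noteq> 0 \<longrightarrow> b \<noteq> 0 \<longrightarrow> a + b \<noteq> 0 \<longrightarrow> min (vb a) (vb b) \<le> vb (a + b))"

text \<open>Gamma = value group of vb (the divisible hull of vK since L is algebraic over K).\<close>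
definition Gam :: "('l::field \<Rightarrow> 'g) \<Rightarrow> 'g set" where
  "Gam vb = vb ` (UNIV - {0})"

definition Gdec :: "('k \<Rightarrow> 'l::field) \<Rightarrow> ('l \<Rightarrow> 'g) \<Rightarrow> ('l \<Rightarrow> 'l) set" where
  "Gdec iota vb = {\<sigma>. bij \<sigma> \<and> (\<forall>a b. \<sigma> (a + b) = \<sigma> a + \<sigma> b) \<and> (\<forall>a b. \<sigma> (a * b) = \<sigma> a * \<sigma> b)
      \<and> (\<forall>c. \<sigma> (iota c) = iota c) \<and> (\<forall>a. a \<noteq> 0 \<longrightarrow> vb (\<sigma> a) = vb a)}"

text \<open>A quasi-cut is a pair (delta^L, delta^R) of subsets of Gamma with delta^L \<le> delta^R and
  union Gamma. gamma in Gamma is identified with (Gamma_{<=gamma}, Gamma_{>=gamma}); these are exactly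
  the quasi-cuts with nonempty intersection; the others are the cuts.\<close>

definition qcut :: "('l::field \<Rightarrow> 'g::linordered_ab_group_add) \<Rightarrow> 'g set \<times> 'g set \<Rightarrow> bool" where
  "qcut vb \<delta> \<longleftrightarrow> fst \<delta> \<union> snd \<delta> = Gam vb \<and> (\<forall>l\<in>fst \<delta>. \<forall>r\<in>snd \<delta>. l \<le> r)"

definition is_principal :: "'g set \<times> 'g set \<Rightarrow> bool" where
  "is_principal \<delta> \<longleftrightarrow> fst \<delta> \<inter> snd \<delta> \<noteq> {}"

definition pval :: "'g set \<times> 'g set \<Rightarrow> 'g" where
  "pval \<delta> = (THE \<gamma>. \<gamma> \<in> fst \<delta> \<inter> snd \<delta>)"

definition pq :: "('l::field \<Rightarrow> 'g::linordered_ab_group_add) \<Rightarrow> 'g \<Rightarrow> 'g set \<times> 'g set" where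
  "pq vb \<gamma> = ({l \<in> Gam vb. l \<le> \<gamma>}, {r \<in> Gam vb. \<gamma> \<le> r})"

definition le_qcut :: "'g set \<times> 'g set \<Rightarrow> 'g set \<times> 'g set \<Rightarrow> bool" where
  "le_qcut \<delta> \<epsilon> \<longleftrightarrow> fst \<delta> \<subseteq> fst \<epsilon> \<and> snd \<epsilon> \<subseteq> snd \<delta>"

definition vcball :: "('l::field \<Rightarrow> 'g::linordered_ab_group_add) \<Rightarrow> 'l \<Rightarrow> 'g \<Rightarrow> 'l set" where
  "vcball vb a \<gamma> = {c. c = a \<or> \<gamma> \<le> vb (c - a)}"

definition vball :: "('l::field \<Rightarrow> 'g::linordered_ab_group_add) \<Rightarrow> 'l \<Rightarrow> 'g set \<times> 'g set \<Rightarrow> 'l set" where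
  "vball vb a \<delta> = (if is_principal \<delta> then vcball vb a (pval \<delta>)
      else {c. c = a \<or> (\<forall>l\<in>fst \<delta>. l < vb (c - a))})"

definition Bqcut :: "('l::field \<Rightarrow> 'g::linordered_ab_group_add) \<Rightarrow> ('l set \<times> ('g set \<times> 'g set)) set" where
  "Bqcut vb = {(vball vb a \<delta>, \<delta>) | a \<delta>. qcut vb \<delta>}"

definition closed_balls :: "('l::field \<Rightarrow> 'g::linordered_ab_group_add) \<Rightarrow> 'l set set" where
  "closed_balls vb = {vcball vb a \<gamma> | a \<gamma>. \<gamma> \<in> Gam vb}"

text \<open>A (strictly decreasing) nest of closed balls with radii in Gamma and empty intersection,
  represented by its set of members (a chain under inclusion).\<close>
definition nest :: "('l::field \<Rightarrow> 'g::linordered_ab_group_add) \<Rightarrow> 'l set set \<Rightarrow> bool" where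
  "nest vb N \<longleftrightarrow> N \<noteq> {} \<and> N \<subseteq> closed_balls vb \<and> (\<forall>B\<in>N. \<forall>B'\<in>N. B \<subseteq> B' \<or> B' \<subseteq> B) \<and> \<Inter>N = {}"

definition cofinal_eq :: "'l set set \<Rightarrow> 'l set set \<Rightarrow> bool" where
  "cofinal_eq N M \<longleftrightarrow> (\<forall>B\<in>N. \<exists>B'\<in>M. B' \<subseteq> B) \<and> (\<forall>B\<in>M. \<exists>B'\<in>N. B' \<subseteq> B)"

definition Binf :: "('l::field \<Rightarrow> 'g::linordered_ab_group_add) \<Rightarrow> 'l set set set set" where
  "Binf vb = {{M. nest vb M \<and> cofinal_eq N M} | N. nest vb N}"

type_synonym ('l,'g) bspace = "('l set \<times> ('g set \<times> 'g set)) + 'l set set set"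

definition BB :: "('l::field \<Rightarrow> 'g::linordered_ab_group_add) \<Rightarrow> ('l,'g) bspace set" where
  "BB vb = Inl ` Bqcut vb \<union> Inr ` Binf vb"

fun leB :: "('l,'g::linorder) bspace \<Rightarrow> ('l,'g) bspace \<Rightarrow> bool" where
  "leB (Inl (B, \<delta>)) (Inl (B', \<epsilon>)) \<longleftrightarrow> B' \<subseteq> B \<and> le_qcut \<delta> \<epsilon>"
| "leB (Inl (B, \<delta>)) (Inr C) \<longleftrightarrow> (\<exists>N\<in>C. \<exists>Bi\<in>N. Bi \<subseteq> B)"
| "leB (Inr C) (Inl _) \<longleftrightarrow> False"
| "leB (Inr C) (Inr D) \<longleftrightarrow> C = D"

text \<open>Action of sigma (sigma(B(a,delta)) = B(sigma a, delta) is the image of the ball).\<close>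
fun act :: "('l \<Rightarrow> 'l) \<Rightarrow> ('l,'g) bspace \<Rightarrow> ('l,'g) bspace" where
  "act \<sigma> (Inl (B, \<delta>)) = Inl (\<sigma> ` B, \<delta>)"
| "act \<sigma> (Inr C) = Inr ((\<lambda>N. (\<lambda>Bi. \<sigma> ` Bi) ` N) ` C)"

definition nsm :: "nat \<Rightarrow> 'g::ab_group_add \<Rightarrow> 'g" where
  "nsm n g = (\<Sum>i<n. g)"

definition zsm :: "int \<Rightarrow> 'g::ab_group_add \<Rightarrow> 'g" where
  "zsm k g = (if 0 \<le> k then nsm (nat k) g else - nsm (nat (-k)) g)"

text \<open>An element (n, gamma) of int \<times> Gamma represents n*x_delta + gamma in
  Gamma(delta) = x_delta Z + Gamma (for principal delta, x_delta = delta and Gamma(delta) = Gamma).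
  le_Gd is the ordering of Gamma(delta): n x + gamma \<le> m x + eta iff k x + c \<le> 0 with
  k = n - m, c = gamma - eta, where delta^L < x_delta < delta^R (resp. x_delta = delta).\<close>
definition le_Gd :: "'g set \<times> 'g set \<Rightarrow> int \<times> 'g::linordered_ab_group_add \<Rightarrow> int \<times> 'g \<Rightarrow> bool" where
  "le_Gd \<delta> s t = (let k = fst s - fst t; c = snd s - snd t in
      (k = 0 \<and> c \<le> 0) \<or> (k > 0 \<and> (\<exists>r\<in>snd \<delta>. zsm k r + c \<le> 0))
      \<or> (k < 0 \<and> (\<exists>l\<in>fst \<delta>. zsm k l + c \<le> 0)))"

definition norm_Gd :: "'g set \<times> 'g set \<Rightarrow> int \<times> 'g::linordered_ab_group_add \<Rightarrow> int \<times> 'g" where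
  "norm_Gd \<delta> s = (if is_principal \<delta> then (0, snd s + zsm (fst s) (pval \<delta>)) else s)"

text \<open>omega_{B(a,delta)}(sum a_n (x-a)^n) = min_n (vb(a_n) + n x_delta), for f in L[x], f \<noteq> 0.\<close>
definition omega :: "('l::field \<Rightarrow> 'g::linordered_ab_group_add) \<Rightarrow> 'l \<Rightarrow> 'g set \<times> 'g set \<Rightarrow> 'l poly \<Rightarrow> int \<times> 'g" where
  "omega vb a \<delta> f = (let T = {(int n, vb (coeff (pcompose f [:a, 1:]) n)) | n. coeff (pcompose f [:a, 1:]) n \<noteq> 0}
     in norm_Gd \<delta> (SOME t. t \<in> T \<and> (\<forall>s\<in>T. le_Gd \<delta> t s)))"

definition omega_nest :: "('l::field \<Rightarrow> 'g::linordered_ab_group_add) \<Rightarrow> 'l set set \<Rightarrow> 'l poly \<Rightarrow> 'g" where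
  "omega_nest vb N f = Greatest (\<lambda>t. \<exists>B\<in>N. \<exists>a \<gamma>. \<gamma> \<in> Gam vb \<and> B = vcball vb a \<gamma> \<and>
       t = snd (omega vb a (pq vb \<gamma>) f))"

definition oag :: "'c set \<Rightarrow> ('c \<Rightarrow> 'c \<Rightarrow> bool) \<Rightarrow> ('c \<Rightarrow> 'c \<Rightarrow> 'c) \<Rightarrow> 'c \<Rightarrow> bool" where
  "oag Gc le add z \<longleftrightarrow> z \<in> Gc \<and> (\<forall>x\<in>Gc. \<forall>y\<in>Gc. add x y \<in> Gc)
     \<and> (\<forall>x\<in>Gc. \<forall>y\<in>Gc. \<forall>w\<in>Gc. add (add x y) w = add x (add y w))
     \<and> (\<forall>x\<in>Gc. \<forall>y\<in>Gc. add x y = add y x) \<and> (\<forall>x\<in>Gc. add z x = x)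
     \<and> (\<forall>x\<in>Gc. \<exists>y\<in>Gc. add x y = z)
     \<and> (\<forall>x\<in>Gc. le x x) \<and> (\<forall>x\<in>Gc. \<forall>y\<in>Gc. le x y \<and> le y x \<longrightarrow> x = y)
     \<and> (\<forall>x\<in>Gc. \<forall>y\<in>Gc. \<forall>w\<in>Gc. le x y \<and> le y w \<longrightarrow> le x w)
     \<and> (\<forall>x\<in>Gc. \<forall>y\<in>Gc. le x y \<or> le y x)
     \<and> (\<forall>x\<in>Gc. \<forall>y\<in>Gc. \<forall>w\<in>Gc. le x y \<longrightarrow> le (add x w) (add y w))"

text \<open>Valuation on K(x) = 'k poly fract (value infinity at 0 left implicit).\<close>
definition is_valKx :: "'c set \<Rightarrow> ('c \<Rightarrow> 'c \<Rightarrow> bool) \<Rightarrow> ('c \<Rightarrow> 'c \<Rightarrow> 'c) \<Rightarrow> 'c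
     \<Rightarrow> ('k::field poly fract \<Rightarrow> 'c) \<Rightarrow> bool" where
  "is_valKx Gc le add z \<mu> \<longleftrightarrow> oag Gc le add z \<and> (\<forall>u. u \<noteq> 0 \<longrightarrow> \<mu> u \<in> Gc)
     \<and> (\<forall>u w. u \<noteq> 0 \<longrightarrow> w \<noteq> 0 \<longrightarrow> \<mu> (u * w) = add (\<mu> u) (\<mu> w))
     \<and> (\<forall>u w. u \<noteq> 0 \<longrightarrow> w \<noteq> 0 \<longrightarrow> u + w \<noteq> 0 \<longrightarrow> le (\<mu> u) (\<mu> (u + w)) \<or> le (\<mu> w) (\<mu> (u + w)))"

definition cst :: "'k::field \<Rightarrow> 'k poly fract" where
  "cst c = Fract [:c:] 1"

definition restr_equiv :: "('k::field \<Rightarrow> 'l) \<Rightarrow> ('l \<Rightarrow> 'g::linorder) \<Rightarrow> ('c \<Rightarrow> 'c \<Rightarrow> bool)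
     \<Rightarrow> ('k poly fract \<Rightarrow> 'c) \<Rightarrow> bool" where
  "restr_equiv iota vb le \<mu> \<longleftrightarrow> (\<exists>j. bij_betw j ((\<lambda>c. \<mu> (cst c)) ` (UNIV - {0})) ((\<lambda>c. vb (iota c)) ` (UNIV - {0}))
      \<and> (\<forall>x\<in>(\<lambda>c. \<mu> (cst c)) ` (UNIV - {0}). \<forall>y\<in>(\<lambda>c. \<mu> (cst c)) ` (UNIV - {0}). le x y \<longleftrightarrow> j x \<le> j y)
      \<and> (\<forall>c. c \<noteq> 0 \<longrightarrow> j (\<mu> (cst c)) = vb (iota c)))"

text \<open>The equivalence class of a valuation mu is represented by the relation
  {(u,w). mu(u) \<le> mu(w)} on K(x)^*; two valuations are equivalent iff these coincide.\<close>
definition vrel :: "('c \<Rightarrow> 'c \<Rightarrow> bool) \<Rightarrow> ('k::field poly fract \<Rightarrow> 'c) \<Rightarrow> ('k poly fract \<times> 'k poly fract) set" where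
  "vrel le \<mu> = {(u, w). u \<noteq> 0 \<and> w \<noteq> 0 \<and> le (\<mu> u) (\<mu> w)}"

text \<open>Classes of valuations on K(x) with values in an ordered abelian group carried by the type 'c.
  The set VV of the paper is the union of Vset over all types 'c.\<close>
definition Vset :: "('k::field \<Rightarrow> 'l) \<Rightarrow> ('l \<Rightarrow> 'g::linorder) \<Rightarrow> 'c itself \<Rightarrow> ('k poly fract \<times> 'k poly fract) set set" where
  "Vset iota vb _ = {vrel le \<mu> | (Gc :: 'c set) le add z \<mu>. is_valKx Gc le add z \<mu> \<and> restr_equiv iota vb le \<mu>}"

text \<open>The partial order on VV: mu \<le> nu iff equal, or for each nonzero f in K[x] there is
  gamma = mu(c)/n in Gamma (c in K^*, n \<ge> 1) with mu(f) \<le> gamma \<le> nu(f).\<close>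
definition Vle :: "('k::field poly fract \<times> 'k poly fract) set \<Rightarrow> ('k poly fract \<times> 'k poly fract) set \<Rightarrow> bool" where
  "Vle R S \<longleftrightarrow> R = S \<or> (\<forall>f::'k poly. f \<noteq> 0 \<longrightarrow>
      (\<exists>c n. c \<noteq> 0 \<and> n > 0 \<and> (Fract (f ^ n) 1, cst c) \<in> R \<and> (cst c, Fract (f ^ n) 1) \<in> S))"

text \<open>Class of the restriction to K(x) of a valuation omega on L[x] (compared via
  omega(p/q) \<le> omega(r/s) iff omega(p s) \<le> omega(r q)).\<close>
definition restr_rel :: "('k::field \<Rightarrow> 'l::field) \<Rightarrow> ('l poly \<Rightarrow> 'v) \<Rightarrow> ('v \<Rightarrow> 'v \<Rightarrow> bool)
     \<Rightarrow> ('k poly fract \<times> 'k poly fract) set" where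
  "restr_rel iota w le = {(u, u'). \<exists>p q r s. p \<noteq> 0 \<and> q \<noteq> 0 \<and> r \<noteq> 0 \<and> s \<noteq> 0 \<and>
      u = Fract p q \<and> u' = Fract r s \<and>
      le (w (map_poly iota (p * s))) (w (map_poly iota (r * q)))}"

fun Phi :: "('k::field \<Rightarrow> 'l::field) \<Rightarrow> ('l \<Rightarrow> 'g::linordered_ab_group_add) \<Rightarrow> ('l,'g) bspace
     \<Rightarrow> ('k poly fract \<times> 'k poly fract) set" where
  "Phi iota vb (Inl (B, \<delta>)) = restr_rel iota (omega vb (SOME a. B = vball vb a \<delta>) \<delta>) (le_Gd \<delta>)"
| "Phi iota vb (Inr C) = restr_rel iota (omega_nest vb (SOME N. N \<in> C)) (\<le>)"

end

theory Submission
  imports Defs "HOL-Library.Product_Plus" "HOL-Analysis.Function_Topology"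
begin

text \<open>
  Every valuation is compared with \<open>\<Gamma>\<close> only: a flag \<open>s\<close> selects between \<open>l \<le> \<rho>(f)\<close> and \<open>l < \<rho>(f)\<close>,
  so valuations with different value groups can be compared on \<open>F[x]\<close>.

  The core is a lifting theorem over an arbitrary subfield \<open>F\<close> of the algebraic closure: if
  \<open>\<omega>\<^sub>Y \<le> \<rho>\<close> on \<open>F[x]\<close>, then \<open>\<rho>\<close> is the restriction of some \<open>\<omega>\<^sub>Z\<close> with \<open>Y \<le> Z\<close>. Take a maximal chain of
  balls above \<open>Y\<close> with \<open>\<omega> \<le> \<rho>\<close>. If its intersection is a ball \<open>Z\<close> with \<open>\<omega>\<^sub>Z \<noteq> \<rho>\<close>, a polynomial \<open>\<phi>\<close> of
  least degree with \<open>\<omega>\<^sub>Z(\<phi>) < \<rho>(\<phi>)\<close> has a root in \<open>Z\<close>, and shrinking \<open>Z\<close> around this root gives a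
  larger element below \<open>\<rho>\<close>; if the intersection is empty, the chain is a nest defining \<open>\<rho>\<close>.

  Starting at the ball of radius \<open>-\<infinity>\<close> this yields surjectivity. Applied to the valuations
  \<open>f \<mapsto> v(f(b))\<close> it extends valued embeddings of subfields one element at a time, which produces
  elements of the decomposition group. If \<open>\<omega>\<^sub>X\<close> and \<open>\<omega>\<^sub>Y\<close> agree on \<open>K[x]\<close> and \<open>a\<close> is a center of
  the ball \<open>X\<close>, lifting \<open>Y\<close> to the point \<open>a\<close> gives a conjugate of \<open>a\<close> in \<open>Y\<close>; for nests one
  concludes by compactness of the group. The statement on the order is lifting followed by injectivity.
\<close>

section \<open>Multiples in ordered groups and the ordered group of a quasi-cut\<close>

text \<open>Two obstacles shape the proof. For a radius in \<Gamma> the minimum defining \<omega>(f)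
  may be attained by several terms. Ties are broken by moving the radius infinitesimally to its
  right (\<open>cutp\<close>): then one monomial leads, leading monomials multiply, and their
  exponents detect roots. A polynomial with a root in the open ball has positive leading exponent,
  one without has exponent 0, so the two never cancel in a sum; this is what makes expansions in a
  least-degree polynomial computable. Next, \<rho> is known only through levels in \<Gamma>, whereas
  \<omega>(f) may lie in a gap. Bounds on products are therefore split into bounds on the factors by
  divisibility of \<Gamma>, and comparisons of polynomials with constants of K are shown to
  determine the whole class, even when its value group is larger than \<Gamma>. Lifting is needed
  over fields other than K because a homomorphism is extended while already defined on an
  intermediate field. A point is the ball of infinite radius; a polynomial vanishing there has
  infinite value, which rules out larger balls and nests.\<close>

lemma nsm_0 [simp]: "nsm 0 g = 0"
  by (simp add: nsm_def)

lemma nsm_Suc [simp]: "nsm (Suc n) g = nsm n g + g"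
  by (simp add: nsm_def add.commute)

lemma nsm_add_left: "nsm (m + n) g = nsm m g + nsm n g"
  by (induction n) (simp_all add: algebra_simps)

lemma nsm_add_right: "nsm n (g + h) = nsm n g + nsm n h"
  by (induction n) (simp_all add: algebra_simps)

lemma zsm_0 [simp]: "zsm 0 g = 0"
  by (simp add: zsm_def)

lemma zsm_1 [simp]: "zsm 1 g = g"
  by (simp add: zsm_def)

lemma zsm_of_nat [simp]: "zsm (int n) g = nsm n g"
  by (simp add: zsm_def)

lemma zsm_minus_left: "zsm (- k) g = - zsm k g"
  by (auto simp: zsm_def)

lemma zsm_plus_1: "zsm (k + 1) g = zsm k g + g"
proof (cases "0 \<le> k")
  case True
  then have "nat (k + 1) = Suc (nat k)" by simp
  then show ?thesis using True by (simp add: zsm_def)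
next
  case False
  then obtain n where n: "k = - int (Suc n)"
    by (metis int_cases not_le of_nat_0_le_iff)
  have "k + 1 = - int n" using n by simp
  then have "zsm (k + 1) g = - nsm n g" by (simp only: zsm_minus_left zsm_of_nat)
  moreover have "zsm k g = - nsm (Suc n) g" unfolding n by (simp only: zsm_minus_left zsm_of_nat)
  ultimately show ?thesis by simp
qed

lemma zsm_add_left: "zsm (j + k) g = zsm j g + zsm k g"
proof (induction k rule: int_induct[where k = 0])
  case (step1 i)
  then show ?case using zsm_plus_1[of "j + i" g] zsm_plus_1[of i g] by (simp add: add.assoc)
next
  case (step2 i)
  have "zsm (j + i) g = zsm (j + (i - 1)) g + g" using zsm_plus_1[of "j + (i - 1)" g] by simp
  moreover have "zsm i g = zsm (i - 1) g + g" using zsm_plus_1[of "i - 1" g] by simp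
  ultimately show ?case using step2 by (simp add: algebra_simps)
qed simp

lemma zsm_diff_left: "zsm (j - k) g = zsm j g - zsm k g"
  using zsm_add_left[of j "- k" g] by (simp add: zsm_minus_left)

lemma nsm_mono: "g \<le> h \<Longrightarrow> nsm n g \<le> nsm n (h::'g::linordered_ab_group_add)"
  by (induction n) (auto intro: add_mono)

lemma nsm_strict_mono: "g < h \<Longrightarrow> 0 < n \<Longrightarrow> nsm n g < nsm n (h::'g::linordered_ab_group_add)"
proof (induction n)
  case (Suc n)
  then show ?case using nsm_mono[of g h n] by (auto intro: add_le_less_mono)
qed simp

lemma nsm_le_iff: "0 < n \<Longrightarrow> nsm n g \<le> nsm n h \<longleftrightarrow> g \<le> (h::'g::linordered_ab_group_add)"
  by (meson linorder_not_less nsm_mono nsm_strict_mono)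

lemma zsm_mono: "0 \<le> k \<Longrightarrow> g \<le> h \<Longrightarrow> zsm k g \<le> zsm k (h::'g::linordered_ab_group_add)"
  by (simp add: zsm_def nsm_mono)

lemma zsm_strict_mono: "0 < k \<Longrightarrow> g < h \<Longrightarrow> zsm k g < zsm k (h::'g::linordered_ab_group_add)"
  by (simp add: zsm_def nsm_strict_mono)

lemma zsm_antimono: "k \<le> 0 \<Longrightarrow> g \<le> h \<Longrightarrow> zsm k h \<le> zsm k (g::'g::linordered_ab_group_add)"
  using zsm_mono[of "- k" g h] by (simp add: zsm_minus_left)

lemma nsm_nsm: "nsm m (nsm n g) = nsm (m * n) g"
  by (induction m) (simp_all add: nsm_add_left algebra_simps)

text \<open>\<^term>\<open>ngd \<delta> k c\<close> says that \<open>k x\<^sub>\<delta> + c \<le> 0\<close>.\<close>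

definition ngd :: "'g::linordered_ab_group_add set \<times> 'g set \<Rightarrow> int \<Rightarrow> 'g \<Rightarrow> bool" where
  "ngd \<delta> k c \<longleftrightarrow> (k = 0 \<and> c \<le> 0) \<or> (k > 0 \<and> (\<exists>r\<in>snd \<delta>. zsm k r + c \<le> 0))
      \<or> (k < 0 \<and> (\<exists>l\<in>fst \<delta>. zsm k l + c \<le> 0))"

lemma le_Gd_iff: "le_Gd \<delta> s t \<longleftrightarrow> ngd \<delta> (fst s - fst t) (snd s - snd t)"
  by (simp add: le_Gd_def ngd_def Let_def)

section \<open>Algebraically closed valued fields and the order defined by a quasi-cut\<close>

locale vfield =
  fixes vb :: "'l::field \<Rightarrow> 'g::linordered_ab_group_add"
  assumes val: "is_val_L vb"
    and alg_closed: "\<forall>p :: 'l poly. degree p > 0 \<longrightarrow> (\<exists>z. poly p z = 0)"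
begin

lemma v_mult: "a \<noteq> 0 \<Longrightarrow> b \<noteq> 0 \<Longrightarrow> vb (a * b) = vb a + vb b"
  using val by (auto simp: is_val_L_def)

lemma v_add: "a \<noteq> 0 \<Longrightarrow> b \<noteq> 0 \<Longrightarrow> a + b \<noteq> 0 \<Longrightarrow> min (vb a) (vb b) \<le> vb (a + b)"
  using val by (auto simp: is_val_L_def)

lemma v_1 [simp]: "vb 1 = 0"
  using v_mult[of 1 1] by simp

lemma v_minus [simp]: "vb (- a) = vb a"
proof (cases "a = 0")
  case False
  have "vb (-1) + vb (-1) = vb 1" using v_mult[of "-1" "-1"] by simp
  then have "vb (-1) = 0" by simp
  then show ?thesis using v_mult[of "-1" a] False by simp
qed simp

lemma v_power: "a \<noteq> 0 \<Longrightarrow> vb (a ^ n) = nsm n (vb a)"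
  by (induction n) (auto simp: v_mult add.commute)

lemma v_inverse: "a \<noteq> 0 \<Longrightarrow> vb (inverse a) = - vb a"
  using v_mult[of a "inverse a"] by (simp add: eq_neg_iff_add_eq_0 add.commute)

lemma v_diff_commute: "vb (a - b) = vb (b - a)"
  using v_minus[of "a - b"] by simp

text \<open>The value of 0 is treated as infinite: every level lies below it. With this default
  evaluation at a point, where polynomials may vanish, still counts as a valuation.\<close>

definition vge :: "bool \<Rightarrow> 'l \<Rightarrow> 'g \<Rightarrow> bool" where
  "vge s a l \<longleftrightarrow> a = 0 \<or> (if s then l < vb a else l \<le> vb a)"

lemma vge_add: "vge s a l \<Longrightarrow> vge s b l \<Longrightarrow> vge s (a + b) l"
  using v_add[of a b] by (cases "a = 0 \<or> b = 0 \<or> a + b = 0")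
    (auto simp: vge_def min_def split: if_splits)

lemma vge_minus [simp]: "vge s (- a) l \<longleftrightarrow> vge s a l"
  by (auto simp: vge_def)

lemma vge_diff: "vge s a l \<Longrightarrow> vge s b l \<Longrightarrow> vge s (a - b) l"
  using vge_add[of s a l "- b"] by simp

lemma vge_0 [simp]: "vge s 0 l"
  by (simp add: vge_def)

lemma vge_sum: "(\<And>i. i \<in> A \<Longrightarrow> vge s (h i) l) \<Longrightarrow> vge s (sum h A) l"
  by (induction A rule: infinite_finite_induct) (auto intro: vge_add)

lemma v_add_eq:
  assumes "a \<noteq> 0" "vge True b (vb a)"
  shows "a + b \<noteq> 0" "vb (a + b) = vb a"
proof -
  show nz: "a + b \<noteq> 0"
    using assms v_minus[of a] by (auto simp: vge_def eq_neg_iff_add_eq_0[symmetric] add_eq_0_iff)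
  have "vge False (a + b) (vb a)"
    using assms by (intro vge_add) (auto simp: vge_def)
  moreover have "\<not> vge True (a + b) (vb a)"
    using vge_diff[of True "a + b" "vb a" b] assms by (auto simp: vge_def)
  ultimately show "vb (a + b) = vb a" using nz by (auto simp: vge_def)
qed

abbreviation "\<Gamma> \<equiv> Gam vb"

lemma v_in [simp]: "a \<noteq> 0 \<Longrightarrow> vb a \<in> \<Gamma>"
  by (auto simp: Gam_def)

lemma Gam_E: "g \<in> \<Gamma> \<Longrightarrow> (\<And>a. a \<noteq> 0 \<Longrightarrow> vb a = g \<Longrightarrow> P) \<Longrightarrow> P"
  by (auto simp: Gam_def)

lemma Gam_0 [simp]: "0 \<in> \<Gamma>"
  using v_in[of 1] by simp

lemma Gam_add [simp]: "g \<in> \<Gamma> \<Longrightarrow> h \<in> \<Gamma> \<Longrightarrow> g + h \<in> \<Gamma>"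
  by (metis Gam_E v_mult v_in mult_eq_0_iff)

lemma Gam_minus [simp]: "g \<in> \<Gamma> \<Longrightarrow> - g \<in> \<Gamma>"
  by (metis Gam_E v_inverse v_in inverse_nonzero_iff_nonzero)

lemma Gam_diff [simp]: "g \<in> \<Gamma> \<Longrightarrow> h \<in> \<Gamma> \<Longrightarrow> g - h \<in> \<Gamma>"
  using Gam_add[of g "- h"] by simp

lemma Gam_nsm [simp]: "g \<in> \<Gamma> \<Longrightarrow> nsm n g \<in> \<Gamma>"
  by (induction n) auto

lemma Gam_zsm [simp]: "g \<in> \<Gamma> \<Longrightarrow> zsm n g \<in> \<Gamma>"
  by (auto simp: zsm_def)

text \<open>An n-th root exists in the algebraically closed field. Divisibility is what provides the
  levels of \<Gamma> at which a radius is tested later.\<close>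

lemma Gam_divide:
  assumes "g \<in> \<Gamma>" "0 < n"
  shows "\<exists>h\<in>\<Gamma>. nsm n h = g"
proof -
  obtain a where a: "a \<noteq> 0" "vb a = g" using assms(1) by (rule Gam_E)
  have "degree (monom 1 n + [:- a:]) = n"
    using assms(2) degree_add_eq_left[of "[:- a:]" "monom 1 n"] by (simp add: degree_monom_eq)
  then obtain z where "poly (monom 1 n + [:- a:]) z = 0" using alg_closed assms(2) by metis
  then have z: "z ^ n = a" by (simp add: poly_monom)
  then have "z \<noteq> 0" using a(1) assms(2) by auto
  then show ?thesis using v_power[of z n] z a by (intro bexI[of _ "vb z"]) auto
qed

lemma Gam_zdivide: "g \<in> \<Gamma> \<Longrightarrow> 0 < k \<Longrightarrow> \<exists>h\<in>\<Gamma>. zsm k h = g"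
  using Gam_divide[of g "nat k"] by (simp add: zsm_def)

lemma qcut_le: "qcut vb \<delta> \<Longrightarrow> l \<in> fst \<delta> \<Longrightarrow> r \<in> snd \<delta> \<Longrightarrow> l \<le> r"
  by (simp add: qcut_def)

lemma qcut_in_or: "qcut vb \<delta> \<Longrightarrow> g \<in> \<Gamma> \<Longrightarrow> g \<in> fst \<delta> \<or> g \<in> snd \<delta>"
  by (auto simp: qcut_def)

lemma qcut_fst: "qcut vb \<delta> \<Longrightarrow> g \<in> fst \<delta> \<Longrightarrow> g \<in> \<Gamma>"
  by (auto simp: qcut_def)

lemma qcut_snd: "qcut vb \<delta> \<Longrightarrow> g \<in> snd \<delta> \<Longrightarrow> g \<in> \<Gamma>"
  by (auto simp: qcut_def)

text \<open>Transitivity and additivity of the order in one statement. For equal signs of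
  \<open>k\<close> and \<open>j\<close> the better of the two witnesses (\<open>min\<close> on the
  right side, \<open>max\<close> on the left) serves both. For opposite signs either witness works,
  since l \<le> r across the quasi-cut, and the sign of \<open>k + j\<close> decides which one is
  required.\<close>

lemma ngd_add:
  assumes q: "qcut vb \<delta>" and "ngd \<delta> k c" "ngd \<delta> j d"
  shows "ngd \<delta> (k + j) (c + d)"
proof -
  have wlog: "ngd \<delta> (k + j) (c + d)" if kj: "ngd \<delta> k c" "ngd \<delta> j d" and "j \<le> k" for k c j d
  proof -
    consider "k > 0" "j > 0" | "k > 0" "j = 0" | "k > 0" "j < 0" | "k = 0" "j = 0" | "k = 0" "j < 0" | "k < 0" "j < 0"
      using \<open>j \<le> k\<close> by linarith
    then show ?thesis
    proof cases
      case 1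
      then obtain r s where r: "r \<in> snd \<delta>" "zsm k r + c \<le> 0" "s \<in> snd \<delta>" "zsm j s + d \<le> 0"
        using kj by (auto simp: ngd_def)
      have "zsm (k + j) (min r s) + (c + d) = (zsm k (min r s) + c) + (zsm j (min r s) + d)"
        by (simp add: zsm_add_left algebra_simps)
      also have "\<dots> \<le> (zsm k r + c) + (zsm j s + d)"
        using 1 by (intro add_mono zsm_mono) auto
      also have "\<dots> \<le> 0" using r by (simp add: add_nonpos_nonpos)
      finally show ?thesis using 1 r by (auto simp: ngd_def min_def split: if_splits)
    next
      case 2
      then obtain r where "r \<in> snd \<delta>" "zsm k r + c \<le> 0" "d \<le> 0" using kj by (auto simp: ngd_def)
      then show ?thesis using 2 by (auto simp: ngd_def add.assoc[symmetric] intro!: add_nonpos_nonpos bexI[of _ r])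
    next
      case 3
      then obtain r l where r: "r \<in> snd \<delta>" "zsm k r + c \<le> 0" "l \<in> fst \<delta>" "zsm j l + d \<le> 0"
        using kj by (auto simp: ngd_def)
      have lr: "l \<le> r" using qcut_le[OF q] r by auto
      have A: "zsm (k + j) r + (c + d) \<le> 0"
      proof -
        have "zsm (k + j) r + (c + d) = (zsm k r + c) + (zsm j r + d)"
          by (simp add: zsm_add_left algebra_simps)
        also have "\<dots> \<le> (zsm k r + c) + (zsm j l + d)"
          using 3 zsm_antimono[OF _ lr, of j] by simp
        also have "\<dots> \<le> 0" using r by (simp add: add_nonpos_nonpos)
        finally show ?thesis .
      qed
      have B: "zsm (k + j) l + (c + d) \<le> 0"
      proof -
        have "zsm (k + j) l + (c + d) = (zsm k l + c) + (zsm j l + d)"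
          by (simp add: zsm_add_left algebra_simps)
        also have "\<dots> \<le> (zsm k r + c) + (zsm j l + d)"
          using 3 zsm_mono[OF _ lr, of k] by simp
        also have "\<dots> \<le> 0" using r by (simp add: add_nonpos_nonpos)
        finally show ?thesis .
      qed
      show ?thesis using A B r by (cases "k + j" "0::int" rule: linorder_cases) (auto simp: ngd_def)
    next
      case 4
      then show ?thesis using kj by (auto simp: ngd_def add_nonpos_nonpos)
    next
      case 5
      then obtain r where "r \<in> fst \<delta>" "zsm j r + d \<le> 0" "c \<le> 0" using kj by (auto simp: ngd_def)
      then have "c + (zsm j r + d) \<le> 0" by (simp add: add_nonpos_nonpos)
      then show ?thesis using 5 \<open>r \<in> fst \<delta>\<close> by (auto simp: ngd_def algebra_simps intro!: bexI[of _ r])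
    next
      case 6
      then obtain r s where r: "r \<in> fst \<delta>" "zsm k r + c \<le> 0" "s \<in> fst \<delta>" "zsm j s + d \<le> 0"
        using kj by (auto simp: ngd_def)
      have "zsm (k + j) (max r s) + (c + d) = (zsm k (max r s) + c) + (zsm j (max r s) + d)"
        by (simp add: zsm_add_left algebra_simps)
      also have "\<dots> \<le> (zsm k r + c) + (zsm j s + d)"
        using 6 by (intro add_mono zsm_antimono) auto
      also have "\<dots> \<le> 0" using r by (simp add: add_nonpos_nonpos)
      finally show ?thesis using 6 r by (auto simp: ngd_def max_def split: if_splits)
    qed
  qed
  show ?thesis
    using wlog[of k c j d] wlog[of j d k c] assms by (cases "j \<le> k") (auto simp: add.commute)
qed

text \<open>By divisibility the inequality k x + c \<le> 0 compares x with the level -c/k of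
  \<Gamma>, which lies on one side of the quasi-cut.\<close>

lemma ngd_total:
  assumes q: "qcut vb \<delta>" and c: "c \<in> \<Gamma>"
  shows "ngd \<delta> k c \<or> ngd \<delta> (- k) (- c)"
proof -
  have wlog: "ngd \<delta> k c \<or> ngd \<delta> (- k) (- c)" if k: "k > 0" and c: "c \<in> \<Gamma>" for k c
  proof -
    obtain g where g: "g \<in> \<Gamma>" "zsm k g = - c" using Gam_zdivide[of "- c" k] c k by auto
    then show ?thesis using qcut_in_or[OF q g(1)] k
      by (auto simp: ngd_def zsm_minus_left intro!: bexI[of _ g])
  qed
  show ?thesis
    using wlog[of k c] wlog[of "- k" "- c"] c by (cases k "0::int" rule: linorder_cases) (auto simp: ngd_def)
qed

text \<open>An equality k x + c = 0 with k \<noteq> 0 would force witnesses from the left and the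
  right side to coincide, which only a principal quasi-cut allows.\<close>

lemma ngd_antisym:
  assumes q: "qcut vb \<delta>" and np: "\<not> is_principal \<delta>" and "ngd \<delta> k c" "ngd \<delta> (- k) (- c)"
  shows "k = 0 \<and> c = 0"
proof -
  have wlog: False if k: "k > 0" and kc: "ngd \<delta> k c" "ngd \<delta> (- k) (- c)" for k c
  proof -
    obtain l r where lr: "r \<in> snd \<delta>" "zsm k r + c \<le> 0" "l \<in> fst \<delta>" "zsm (- k) l - c \<le> 0"
      using k kc by (auto simp: ngd_def)
    have "zsm k r \<le> - c" using add_mono[OF lr(2) order_refl[of "- c"]] by simp
    also have "- c \<le> zsm k l"
      using lr(4) by (simp add: zsm_minus_left minus_le_iff)
    finally have "zsm k r \<le> zsm k l" .
    then have "r \<le> l" using zsm_strict_mono[OF k, of l r] by force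
    then have "r = l" using qcut_le[OF q lr(3,1)] by simp
    then show False using lr np by (auto simp: is_principal_def)
  qed
  show ?thesis
    using wlog[of k c] wlog[of "- k" "- c"] assms(3,4)
    by (cases k "0::int" rule: linorder_cases) (auto simp: ngd_def)
qed

end


section \<open>The valuation of a ball\<close>

lemma finite_preorder_min:
  assumes "finite T" "T \<noteq> {}"
    and total: "\<And>s t. s \<in> T \<Longrightarrow> t \<in> T \<Longrightarrow> le s t \<or> le t s"
    and trans: "\<And>s t u. s \<in> T \<Longrightarrow> t \<in> T \<Longrightarrow> u \<in> T \<Longrightarrow> le s t \<Longrightarrow> le t u \<Longrightarrow> le s u"
  shows "\<exists>t\<in>T. \<forall>s\<in>T. le t s"
  using assms
proof (induction T rule: finite_ne_induct)
  case (insert x T)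
  have "\<exists>t\<in>T. \<forall>s\<in>T. le t s"
    by (rule insert.IH) (use insert.prems in blast)+
  then obtain t where t: "t \<in> T" "\<forall>s\<in>T. le t s" by blast
  have xx: "le x x" using insert.prems(1)[of x x] by simp
  show ?case
  proof (cases "le t x")
    case True
    then show ?thesis using t by blast
  next
    case False
    then have "le x t" using insert.prems(1)[of x t] t(1) by blast
    then have "le x s" if "s \<in> T" for s
      using t that insert.prems(2)[of x t s] by blast
    then show ?thesis using xx by blast
  qed
qed blast

text \<open>For a radius \<gamma> in \<Gamma> this is the cut immediately to the right of \<gamma>,
  whose ball is the open ball of radius \<gamma>; a cut is left unchanged.\<close>

definition cutp :: "'g set \<times> 'g set \<Rightarrow> 'g set \<times> 'g set" where
  "cutp \<delta> = (fst \<delta>, snd \<delta> - fst \<delta>)"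

lemma fst_cutp [simp]: "fst (cutp \<delta>) = fst \<delta>"
  by (simp add: cutp_def)

lemma cutp_cutp [simp]: "cutp (cutp \<delta>) = cutp \<delta>"
  by (auto simp: cutp_def)

lemma not_principal_cutp [simp]: "\<not> is_principal (cutp \<delta>)"
  by (auto simp: cutp_def is_principal_def)

context vfield
begin

lemma qcut_cutp [simp]: "qcut vb \<delta> \<Longrightarrow> qcut vb (cutp \<delta>)"
  by (auto simp: cutp_def qcut_def)

lemma le_refl [simp]: "le_Gd \<delta> s s"
  by (simp add: le_Gd_iff ngd_def)

lemma le_trans:
  assumes "qcut vb \<delta>" "le_Gd \<delta> s t" "le_Gd \<delta> t u" shows "le_Gd \<delta> s u"
  using ngd_add[OF assms(1), of "fst s - fst t" "snd s - snd t" "fst t - fst u" "snd t - snd u"] assms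
  by (simp add: le_Gd_iff)

lemma le_total:
  assumes "qcut vb \<delta>" "snd s \<in> \<Gamma>" "snd t \<in> \<Gamma>" shows "le_Gd \<delta> s t \<or> le_Gd \<delta> t s"
  using ngd_total[OF assms(1), of "snd s - snd t" "fst s - fst t"] assms
  by (simp add: le_Gd_iff)

lemma le_antisym:
  assumes "qcut vb \<delta>" "\<not> is_principal \<delta>" "le_Gd \<delta> s t" "le_Gd \<delta> t s" shows "s = t"
  using ngd_antisym[OF assms(1,2), of "fst s - fst t" "snd s - snd t"] assms
  by (simp add: le_Gd_iff prod_eq_iff)

lemma le_add_mono:
  assumes "qcut vb \<delta>" "le_Gd \<delta> s t" "le_Gd \<delta> u w" shows "le_Gd \<delta> (s + u) (t + w)"
  using ngd_add[OF assms(1), of "fst s - fst t" "snd s - snd t" "fst u - fst w" "snd u - snd w"] assms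
  by (simp add: le_Gd_iff algebra_simps)

lemma le_add_cancel [simp]: "le_Gd \<delta> (s + u) (t + u) \<longleftrightarrow> le_Gd \<delta> s t"
  by (simp add: le_Gd_iff)

lemma le_add_cancel_left [simp]: "le_Gd \<delta> (u + s) (u + t) \<longleftrightarrow> le_Gd \<delta> s t"
  by (simp add: le_Gd_iff)

lemma le_same_fst [simp]: "le_Gd \<delta> (k, g) (k, h) \<longleftrightarrow> g \<le> h"
  by (simp add: le_Gd_iff ngd_def)

lemma le_cutpD: "le_Gd (cutp \<delta>) s t \<Longrightarrow> le_Gd \<delta> s t"
  by (auto simp: le_Gd_iff ngd_def cutp_def)

text \<open>For a nonpositive coefficient of x only the left side of the quasi-cut is consulted, and
  \<open>cutp\<close> keeps that side.\<close>

lemma le_cutp_iff: "fst s \<le> fst t \<Longrightarrow> le_Gd (cutp \<delta>) s t \<longleftrightarrow> le_Gd \<delta> s t"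
  by (auto simp: le_Gd_iff ngd_def cutp_def)

section \<open>Leading monomials of Taylor expansions\<close>

definition mterms :: "'l \<Rightarrow> 'l poly \<Rightarrow> (int \<times> 'g) set" where
  "mterms a f = {(int n, vb (coeff (pcompose f [:a, 1:]) n)) | n. coeff (pcompose f [:a, 1:]) n \<noteq> 0}"

text \<open>Among the terms of least value the order of \<open>cutp \<delta>\<close> selects the one
  of least exponent, as x slightly above \<gamma> makes higher powers slightly larger. That order is
  antisymmetric for every quasi-cut, which justifies \<open>THE\<close>.\<close>

definition lmon :: "'l \<Rightarrow> 'g set \<times> 'g set \<Rightarrow> 'l poly \<Rightarrow> int \<times> 'g" where
  "lmon a \<delta> f = (THE t. t \<in> mterms a f \<and> (\<forall>s\<in>mterms a f. le_Gd (cutp \<delta>) t s))"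

lemma shift_eq_0_iff: "pcompose f [:a, 1:] = 0 \<longleftrightarrow> f = (0::'l poly)"
  by (simp add: pcompose_eq_0_iff)

lemma mterms_finite: "finite (mterms a f)"
proof -
  have "mterms a f \<subseteq> (\<lambda>n. (int n, vb (coeff (pcompose f [:a, 1:]) n))) ` {..degree (pcompose f [:a, 1:])}"
    by (auto simp: mterms_def le_degree)
  then show ?thesis by (rule finite_subset) simp
qed

lemma mterms_nonempty: "f \<noteq> 0 \<Longrightarrow> mterms a f \<noteq> {}"
  using shift_eq_0_iff[of f a] leading_coeff_0_iff[of "pcompose f [:a, 1:]"] unfolding mterms_def by blast

lemma mterms_snd: "t \<in> mterms a f \<Longrightarrow> snd t \<in> \<Gamma>"
  by (auto simp: mterms_def)

lemma lmon_spec: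
  assumes "qcut vb \<delta>" "f \<noteq> 0"
  shows "lmon a \<delta> f \<in> mterms a f" "\<And>s. s \<in> mterms a f \<Longrightarrow> le_Gd (cutp \<delta>) (lmon a \<delta> f) s"
proof -
  let ?P = "\<lambda>t. t \<in> mterms a f \<and> (\<forall>s\<in>mterms a f. le_Gd (cutp \<delta>) t s)"
  have ex: "\<exists>t\<in>mterms a f. \<forall>s\<in>mterms a f. le_Gd (cutp \<delta>) t s"
  proof (rule finite_preorder_min[OF mterms_finite mterms_nonempty[OF assms(2)]])
    show "le_Gd (cutp \<delta>) s t \<or> le_Gd (cutp \<delta>) t s" if "s \<in> mterms a f" "t \<in> mterms a f" for s t
      using that by (intro le_total qcut_cutp assms(1) mterms_snd)
    show "le_Gd (cutp \<delta>) s u" if "le_Gd (cutp \<delta>) s t" "le_Gd (cutp \<delta>) t u" for s t u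
      using that le_trans[OF qcut_cutp[OF assms(1)]] by blast
  qed
  have "\<exists>!t. ?P t"
    using ex assms(1) le_antisym[OF qcut_cutp[OF assms(1)] not_principal_cutp] by blast
  from theI'[OF this] have "?P (lmon a \<delta> f)" by (simp add: lmon_def)
  then show "lmon a \<delta> f \<in> mterms a f" "\<And>s. s \<in> mterms a f \<Longrightarrow> le_Gd (cutp \<delta>) (lmon a \<delta> f) s" by auto
qed

lemma lmon_eqI:
  assumes "qcut vb \<delta>" "t \<in> mterms a f" "\<And>s. s \<in> mterms a f \<Longrightarrow> le_Gd (cutp \<delta>) t s"
  shows "lmon a \<delta> f = t"
  unfolding lmon_def
  by (rule the_equality) (use assms le_antisym[OF qcut_cutp[OF assms(1)] not_principal_cutp] in auto)

lemma lmon_in: "qcut vb \<delta> \<Longrightarrow> f \<noteq> 0 \<Longrightarrow> snd (lmon a \<delta> f) \<in> \<Gamma>"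
  using lmon_spec(1) mterms_snd by blast

lemma lmon_nonneg: "qcut vb \<delta> \<Longrightarrow> f \<noteq> 0 \<Longrightarrow> 0 \<le> fst (lmon a \<delta> f)"
  using lmon_spec(1)[of \<delta> f a] by (auto simp: mterms_def)

text \<open>Gauss's lemma. In degree \<open>i0 + j0\<close> the product coefficient has a single
  summand of least value, since another pair of the same total degree and no larger value would
  equal the leading pair by antisymmetry; so nothing cancels there. Every other coefficient is
  bounded below by one of its summands.\<close>

lemma lmon_mult:
  assumes q: "qcut vb \<delta>" and nz: "f \<noteq> 0" "g \<noteq> 0"
  shows "lmon a \<delta> (f * g) = lmon a \<delta> f + lmon a \<delta> g"
proof -
  define F G where FG: "F = pcompose f [:a, 1:]" "G = pcompose g [:a, 1:]"
  obtain i0 where i0: "lmon a \<delta> f = (int i0, vb (coeff F i0))" "coeff F i0 \<noteq> 0"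
    using lmon_spec(1)[OF q nz(1), of a] by (auto simp: mterms_def FG)
  obtain j0 where j0: "lmon a \<delta> g = (int j0, vb (coeff G j0))" "coeff G j0 \<noteq> 0"
    using lmon_spec(1)[OF q nz(2), of a] by (auto simp: mterms_def FG)
  have qc: "qcut vb (cutp \<delta>)" using q by simp
  let ?m = "vb (coeff F i0) + vb (coeff G j0)"
  have ge: "le_Gd (cutp \<delta>) (int (i0 + j0), ?m) (int (i + j), vb (coeff F i) + vb (coeff G j))"
    if "coeff F i \<noteq> 0" "coeff G j \<noteq> 0" for i j
  proof -
    have "le_Gd (cutp \<delta>) (lmon a \<delta> f) (int i, vb (coeff F i))"
      using that by (intro lmon_spec(2)[OF q nz(1)]) (auto simp: mterms_def FG)
    moreover have "le_Gd (cutp \<delta>) (lmon a \<delta> g) (int j, vb (coeff G j))"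
      using that by (intro lmon_spec(2)[OF q nz(2)]) (auto simp: mterms_def FG)
    ultimately have "le_Gd (cutp \<delta>) (lmon a \<delta> f + lmon a \<delta> g) ((int i, vb (coeff F i)) + (int j, vb (coeff G j)))"
      by (rule le_add_mono[OF qc])
    then show ?thesis by (simp add: i0 j0)
  qed
  have gt: "i = i0 \<and> j = j0" if "coeff F i \<noteq> 0" "coeff G j \<noteq> 0" "i + j = i0 + j0"
    "vb (coeff F i) + vb (coeff G j) \<le> ?m" for i j
  proof -
    have f: "le_Gd (cutp \<delta>) (int i0, vb (coeff F i0)) (int i, vb (coeff F i))"
      using that lmon_spec(2)[OF q nz(1), where s = "(int i, vb (coeff F i))" and a = a] by (auto simp: mterms_def FG i0)
    have g: "le_Gd (cutp \<delta>) (int j0, vb (coeff G j0)) (int j, vb (coeff G j))"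
      using that lmon_spec(2)[OF q nz(2), where s = "(int j, vb (coeff G j))" and a = a] by (auto simp: mterms_def FG j0)
    have "le_Gd (cutp \<delta>) (int i + int j, vb (coeff F i) + vb (coeff G j)) (int i0 + int j0, ?m)"
      using that by (simp flip: of_nat_add)
    then have "le_Gd (cutp \<delta>) ((int i, vb (coeff F i)) + (int j, vb (coeff G j))) ((int i0, vb (coeff F i0)) + (int j0, vb (coeff G j0)))"
      by simp
    moreover have "le_Gd (cutp \<delta>) ((int i0, vb (coeff F i0)) + (int j0, vb (coeff G j0))) ((int i0, vb (coeff F i0)) + (int j, vb (coeff G j)))"
      using g by (simp only: le_add_cancel_left)
    ultimately have "le_Gd (cutp \<delta>) ((int i, vb (coeff F i)) + (int j, vb (coeff G j))) ((int i0, vb (coeff F i0)) + (int j, vb (coeff G j)))"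
      using le_trans[OF qc] by blast
    then have "le_Gd (cutp \<delta>) (int i, vb (coeff F i)) (int i0, vb (coeff F i0))"
      by (simp only: le_add_cancel)
    then have "i = i0" using le_antisym[OF qc not_principal_cutp f] by simp
    then show ?thesis using that by simp
  qed
  have prod: "pcompose (f * g) [:a, 1:] = F * G" by (simp add: FG pcompose_mult)
  let ?n0 = "i0 + j0"
  have split: "coeff (F * G) ?n0 = coeff F i0 * coeff G j0 + (\<Sum>i\<in>{..?n0} - {i0}. coeff F i * coeff G (?n0 - i))"
    unfolding coeff_mult by (subst sum.remove[of _ i0]) auto
  have v0: "vb (coeff F i0 * coeff G j0) = ?m" using i0 j0 by (simp add: v_mult)
  have rest: "vge True (\<Sum>i\<in>{..?n0} - {i0}. coeff F i * coeff G (?n0 - i)) (vb (coeff F i0 * coeff G j0))"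
  proof (rule vge_sum)
    fix i assume i: "i \<in> {..?n0} - {i0}"
    show "vge True (coeff F i * coeff G (?n0 - i)) (vb (coeff F i0 * coeff G j0))"
      using gt[of i "?n0 - i"] i unfolding v0 vge_def by (auto simp: v_mult not_le[symmetric])
  qed
  have c0: "coeff (F * G) ?n0 \<noteq> 0" "vb (coeff (F * G) ?n0) = ?m"
    using v_add_eq[OF _ rest] i0 j0 v0 unfolding split by auto
  have "lmon a \<delta> (f * g) = (int ?n0, ?m)"
  proof (rule lmon_eqI[OF q])
    show "(int ?n0, ?m) \<in> mterms a (f * g)" using c0 unfolding mterms_def prod by fastforce
    fix s assume "s \<in> mterms a (f * g)"
    then obtain n where n: "s = (int n, vb (coeff (F * G) n))" "coeff (F * G) n \<noteq> 0"
      by (auto simp: mterms_def prod)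
    \<comment> \<open>Otherwise all summands, and with them the coefficient, would have value larger
      than the coefficient.\<close>
    have "\<exists>i\<le>n. \<not> vge True (coeff F i * coeff G (n - i)) (vb (coeff (F * G) n))"
    proof (rule ccontr)
      assume "\<not> ?thesis"
      then have "vge True (coeff (F * G) n) (vb (coeff (F * G) n))"
        unfolding coeff_mult by (intro vge_sum) auto
      then show False using n(2) by (auto simp: vge_def)
    qed
    then obtain i where i: "i \<le> n" "coeff F i \<noteq> 0" "coeff G (n - i) \<noteq> 0"
      "vb (coeff F i) + vb (coeff G (n - i)) \<le> vb (coeff (F * G) n)"
      by (auto simp: vge_def v_mult)
    have "le_Gd (cutp \<delta>) (int ?n0, ?m) (int n, vb (coeff F i) + vb (coeff G (n - i)))"
      using ge[OF i(2,3)] i(1) by simp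
    moreover have "le_Gd (cutp \<delta>) (int n, vb (coeff F i) + vb (coeff G (n - i))) s"
      using i n by simp
    ultimately show "le_Gd (cutp \<delta>) (int ?n0, ?m) s" using le_trans[OF qc] by blast
  qed
  then show ?thesis by (simp add: i0 j0)
qed

lemma mterms_minus [simp]: "mterms a (- f) = mterms a f"
  by (simp add: mterms_def pcompose_uminus)

lemma lmon_minus [simp]: "lmon a \<delta> (- f) = lmon a \<delta> f"
  by (simp add: lmon_def)

lemma mterms_add:
  assumes "t \<in> mterms a (f + g)"
  shows "\<exists>s. fst s = fst t \<and> snd s \<le> snd t \<and> (s \<in> mterms a f \<or> s \<in> mterms a g)"
proof -
  define F G where FG: "F = pcompose f [:a, 1:]" "G = pcompose g [:a, 1:]"
  obtain n where n: "t = (int n, vb (coeff F n + coeff G n))" "coeff F n + coeff G n \<noteq> 0"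
    using assms by (auto simp: mterms_def FG pcompose_add)
  consider "coeff F n = 0" | "coeff G n = 0" | "coeff F n \<noteq> 0" "coeff G n \<noteq> 0" by blast
  then show ?thesis
  proof cases
    case 1
    then show ?thesis using n by (intro exI[of _ t]) (auto simp: mterms_def FG)
  next
    case 2
    then show ?thesis using n by (intro exI[of _ t]) (auto simp: mterms_def FG)
  next
    case 3
    have F: "(int n, vb (coeff F n)) \<in> mterms a f" and G: "(int n, vb (coeff G n)) \<in> mterms a g"
      using 3 by (auto simp: mterms_def FG)
    show ?thesis
      using v_add[OF 3 n(2)] n F G by (cases "vb (coeff F n) \<le> vb (coeff G n)") force+
  qed
qed

section \<open>Bounds for the valuation of a ball\<close>

text \<open>Bounds are read in the order of \<open>\<delta>\<close> itself; \<open>cutp\<close>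
  enters only through the choice of the monomial that represents the minimum.\<close>

definition qv :: "'l \<Rightarrow> 'g set \<times> 'g set \<Rightarrow> bool \<Rightarrow> 'l poly \<Rightarrow> 'g \<Rightarrow> bool" where
  "qv a \<delta> s f l \<longleftrightarrow> f = 0 \<or>
     (if s then \<not> le_Gd \<delta> (lmon a \<delta> f) (0, l) else le_Gd \<delta> (0, l) (lmon a \<delta> f))"

definition tge :: "'g set \<times> 'g set \<Rightarrow> bool \<Rightarrow> int \<times> 'g \<Rightarrow> 'g \<Rightarrow> bool" where
  "tge \<delta> s t l \<longleftrightarrow> (if s then \<not> le_Gd \<delta> t (0, l) else le_Gd \<delta> (0, l) t)"

lemma qv_tge: "qv a \<delta> s f l \<longleftrightarrow> f = 0 \<or> tge \<delta> s (lmon a \<delta> f) l"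
  by (simp add: qv_def tge_def)

lemma tge_mono: "qcut vb \<delta> \<Longrightarrow> tge \<delta> s t l \<Longrightarrow> le_Gd \<delta> t u \<Longrightarrow> tge \<delta> s u l"
  unfolding tge_def using le_trans[of \<delta> "(0, l)" t u] le_trans[of \<delta> t u "(0, l)"] by (auto split: if_splits)

lemma tge_fst_0 [simp]: "tge \<delta> s (0, g) l \<longleftrightarrow> (if s then l < g else l \<le> g)"
  by (auto simp: tge_def)

lemma tge_weaken:
  assumes q: "qcut vb \<delta>" and g: "snd t \<in> \<Gamma>" "l \<in> \<Gamma>" "l' \<in> \<Gamma>" and t: "tge \<delta> s t l"
    and l: "l' < l \<or> l' = l \<and> (s' \<longrightarrow> s)"
  shows "tge \<delta> s' t l'"
proof -
  have ge: "le_Gd \<delta> (0, l) t" using t le_total[OF q g(1), of "(0, l)"] g by (auto simp: tge_def split: if_splits)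
  show ?thesis
  proof (cases "l' < l")
    case True
    have "le_Gd \<delta> (0, l') t" using le_trans[OF q _ ge, of "(0, l')"] True by simp
    moreover have "\<not> le_Gd \<delta> t (0, l')" using le_trans[OF q ge, of "(0, l')"] True by auto
    ultimately show ?thesis by (simp add: tge_def)
  next
    case False
    then show ?thesis using l t ge by (auto simp: tge_def)
  qed
qed

text \<open>A minimum is bounded below exactly when all terms are. This removes the choice of a
  leading monomial and makes sums and changes of radius a termwise matter.\<close>

lemma qv_mterms:
  assumes "qcut vb \<delta>" "l \<in> \<Gamma>"
  shows "qv a \<delta> s f l \<longleftrightarrow> (\<forall>t\<in>mterms a f. tge \<delta> s t l)"
proof (cases "f = 0")
  case True
  then show ?thesis by (simp add: qv_def mterms_def)
next
  case False
  then show ?thesis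
    using lmon_spec(1)[OF assms(1) False, of a] tge_mono[OF assms(1), of s "lmon a \<delta> f" l]
      le_cutpD[OF lmon_spec(2)[OF assms(1) False, of _ a]] by (auto simp: qv_tge)
qed

lemma qv_0 [simp]: "qv a \<delta> s 0 l"
  by (simp add: qv_def)

lemma qv_minus [simp]: "qv a \<delta> s (- f) l \<longleftrightarrow> qv a \<delta> s f l"
  by (simp add: qv_def)

lemma qv_weaken:
  assumes "qcut vb \<delta>" "l \<in> \<Gamma>" "l' \<in> \<Gamma>" "qv a \<delta> s f l" "l' < l \<or> l' = l \<and> (s' \<longrightarrow> s)"
  shows "qv a \<delta> s' f l'"
  using tge_weaken[OF assms(1) lmon_in[OF assms(1)] assms(2,3) _ assms(5), of f a] assms(4)
  by (cases "f = 0") (simp_all add: qv_tge)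

lemma qv_add:
  assumes "qcut vb \<delta>" "l \<in> \<Gamma>" "qv a \<delta> s f l" "qv a \<delta> s g l"
  shows "qv a \<delta> s (f + g) l"
  unfolding qv_mterms[OF assms(1,2)]
proof
  fix t assume "t \<in> mterms a (f + g)"
  then obtain u where u: "fst u = fst t" "snd u \<le> snd t" "u \<in> mterms a f \<or> u \<in> mterms a g"
    using mterms_add by blast
  have "tge \<delta> s u l" using assms u qv_mterms[OF assms(1,2)] by blast
  moreover have "le_Gd \<delta> u t" using u by (cases u; cases t) auto
  ultimately show "tge \<delta> s t l" using tge_mono[OF assms(1)] by blast
qed

lemma qv_diff:
  assumes "qcut vb \<delta>" "l \<in> \<Gamma>" "qv a \<delta> s f l" "qv a \<delta> s g l"
  shows "qv a \<delta> s (f - g) l"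
  using qv_add[OF assms(1,2,3), of "- g"] assms by simp

lemma qv_sum:
  assumes "qcut vb \<delta>" "l \<in> \<Gamma>" "\<And>i. i \<in> A \<Longrightarrow> qv a \<delta> s (h i) l"
  shows "qv a \<delta> s (sum h A) l"
  using assms(3) by (induction A rule: infinite_finite_induct) (auto intro: qv_add assms)

text \<open>One strict bound makes the sum strict, hence the disjunction of the flags.\<close>

lemma tge_add:
  assumes q: "qcut vb \<delta>" and g: "snd t \<in> \<Gamma>" "snd u \<in> \<Gamma>" "l \<in> \<Gamma>" "l' \<in> \<Gamma>"
    and "tge \<delta> s t l" "tge \<delta> s' u l'"
  shows "tge \<delta> (s \<or> s') (t + u) (l + l')"
proof -
  have t: "le_Gd \<delta> (0, l) t" and u: "le_Gd \<delta> (0, l') u"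
    using assms(6,7) le_total[OF q g(1), of "(0, l)"] le_total[OF q g(2), of "(0, l')"] g
    by (auto simp: tge_def split: if_splits)
  have "le_Gd \<delta> (0, l + l') (t + u)" using le_add_mono[OF q t u] by simp
  moreover have "\<not> le_Gd \<delta> (t + u) (0, l + l')" if "s \<or> s'"
  proof
    assume *: "le_Gd \<delta> (t + u) (0, l + l')"
    have "le_Gd \<delta> (t + (0, l')) (t + u)" using u by simp
    then have "le_Gd \<delta> (t + (0, l')) ((0, l) + (0, l'))" using le_trans[OF q _ *] by simp
    then have 1: "le_Gd \<delta> t (0, l)" by (simp only: le_add_cancel)
    have "le_Gd \<delta> ((0, l) + u) (t + u)" using t by simp
    then have "le_Gd \<delta> ((0, l) + u) ((0, l) + (0, l'))" using le_trans[OF q _ *] by simp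
    then have 2: "le_Gd \<delta> u (0, l')" by (simp only: le_add_cancel_left)
    show False using 1 2 that assms(6,7) by (auto simp: tge_def)
  qed
  ultimately show ?thesis by (auto simp: tge_def)
qed

text \<open>A failed bound is an upper bound, strict exactly when the flag is \<open>False\<close>.
  The sum is strictly below as soon as one flag is \<open>False\<close>, hence the
  conjunction.\<close>

lemma tge_add_neg:
  assumes q: "qcut vb \<delta>" and g: "snd t \<in> \<Gamma>" "snd u \<in> \<Gamma>" "l \<in> \<Gamma>" "l' \<in> \<Gamma>"
    and "\<not> tge \<delta> s t l" "\<not> tge \<delta> s' u l'"
  shows "\<not> tge \<delta> (s \<and> s') (t + u) (l + l')"
proof -
  have t: "le_Gd \<delta> t (0, l)" and u: "le_Gd \<delta> u (0, l')"
    using assms(6,7) le_total[OF q g(1), of "(0, l)"] le_total[OF q g(2), of "(0, l')"] g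
    by (auto simp: tge_def split: if_splits)
  have "le_Gd \<delta> (t + u) (0, l + l')" using le_add_mono[OF q t u] by simp
  moreover have "\<not> le_Gd \<delta> (0, l + l') (t + u)" if "\<not> (s \<and> s')"
  proof
    assume *: "le_Gd \<delta> (0, l + l') (t + u)"
    then have *: "le_Gd \<delta> ((0, l) + (0, l')) (t + u)" by simp
    have "le_Gd \<delta> (t + u) (t + (0, l'))" using u by simp
    then have "le_Gd \<delta> ((0, l) + (0, l')) (t + (0, l'))" using le_trans[OF q *] by blast
    then have 1: "le_Gd \<delta> (0, l) t" by (simp only: le_add_cancel)
    have "le_Gd \<delta> (t + u) ((0, l) + u)" using t by simp
    then have "le_Gd \<delta> ((0, l) + (0, l')) ((0, l) + u)" using le_trans[OF q *] by blast
    then have 2: "le_Gd \<delta> (0, l') u" by (simp only: le_add_cancel_left)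
    show False using 1 2 that assms(6,7) by (auto simp: tge_def)
  qed
  ultimately show ?thesis by (auto simp: tge_def)
qed

lemma qv_mult:
  assumes q: "qcut vb \<delta>" and "l \<in> \<Gamma>" "l' \<in> \<Gamma>" "qv a \<delta> s f l" "qv a \<delta> s' g l'"
  shows "qv a \<delta> (s \<or> s') (f * g) (l + l')"
  using tge_add[OF q _ _ assms(2,3), of "lmon a \<delta> f" "lmon a \<delta> g" s s'] assms(4,5) lmon_in[OF q]
  by (cases "f = 0 \<or> g = 0") (auto simp: qv_tge lmon_mult[OF q])

lemma qv_mult_neg:
  assumes q: "qcut vb \<delta>" and "l \<in> \<Gamma>" "l' \<in> \<Gamma>" "\<not> qv a \<delta> s f l" "\<not> qv a \<delta> s' g l'"
  shows "\<not> qv a \<delta> (s \<and> s') (f * g) (l + l')"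
  using tge_add_neg[OF q _ _ assms(2,3), of "lmon a \<delta> f" "lmon a \<delta> g" s s'] assms(4,5) lmon_in[OF q]
  by (cases "f = 0 \<or> g = 0") (auto simp: qv_tge lmon_mult[OF q])

lemma lmon_const:
  assumes "qcut vb \<delta>" "c \<noteq> 0" shows "lmon a \<delta> [:c:] = (0, vb c)"
proof -
  have "mterms a [:c:] = {(0, vb c)}" using assms by (auto simp: mterms_def coeff_pCons' split: if_splits)
  then show ?thesis using lmon_spec(1)[OF assms(1), of "[:c:]" a] assms by simp
qed

lemma qv_const: "qcut vb \<delta> \<Longrightarrow> qv a \<delta> s [:c:] l \<longleftrightarrow> vge s c l"
  by (cases "c = 0") (auto simp: qv_tge lmon_const vge_def)

lemma mterms_linear:
  "mterms a [:- c, 1:] = insert (1, 0) (if a = c then {} else {(0, vb (a - c))})"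
proof -
  have co: "coeff (pcompose [:- c, 1:] [:a, 1:]) n = (if n = 0 then a - c else if n = 1 then 1 else 0)" for n
    by (auto simp: pcompose_pCons coeff_pCons split: nat.splits)
  have nz: "coeff (pcompose [:- c, 1:] [:a, 1:]) n \<noteq> 0 \<longleftrightarrow> n = 1 \<or> n = 0 \<and> a \<noteq> c" for n
    unfolding co by simp
  have "mterms a [:- c, 1:] = {(int n, vb (if n = 0 then a - c else if n = 1 then 1 else 0)) | n. n = 1 \<or> n = 0 \<and> a \<noteq> c}"
    unfolding mterms_def nz unfolding co ..
  also have "\<dots> = insert (1, 0) (if a = c then {} else {(0, vb (a - c))})"
    by (cases "a = c") force+
  finally show ?thesis .
qed

text \<open>A single description for closed balls and for balls of cuts, through the right side of
  the quasi-cut; it allows both kinds to be treated alike.\<close>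

lemma vball_iff:
  assumes q: "qcut vb \<delta>"
  shows "c \<in> vball vb a \<delta> \<longleftrightarrow> c = a \<or> vb (c - a) \<in> snd \<delta>"
proof (cases "c = a")
  case False
  then have g: "vb (c - a) \<in> \<Gamma>" by simp
  show ?thesis
  proof (cases "is_principal \<delta>")
    case True
    then obtain p where p: "p \<in> fst \<delta>" "p \<in> snd \<delta>" by (auto simp: is_principal_def)
    have pv: "pval \<delta> = p" unfolding pval_def
      by (rule the_equality) (use p q in \<open>auto simp: qcut_def intro: antisym\<close>)
    have "vb (c - a) \<in> snd \<delta> \<longleftrightarrow> p \<le> vb (c - a)"
      using p g q qcut_in_or[OF q g] qcut_le[OF q] by (metis antisym)
    then show ?thesis using True False by (simp add: vball_def vcball_def pv)
  next
    case np: False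
    have "vb (c - a) \<in> snd \<delta> \<longleftrightarrow> (\<forall>l\<in>fst \<delta>. l < vb (c - a))"
      using g qcut_in_or[OF q g] qcut_le[OF q] np
      by (auto simp: is_principal_def order_less_le)
    then show ?thesis using np False by (simp add: vball_def)
  qed
qed (auto simp: vball_def vcball_def)

lemma vball_self [simp]: "a \<in> vball vb a \<delta>"
  by (simp add: vball_def vcball_def)

lemma snd_up: "qcut vb \<delta> \<Longrightarrow> r \<in> snd \<delta> \<Longrightarrow> r \<le> g \<Longrightarrow> g \<in> \<Gamma> \<Longrightarrow> g \<in> snd \<delta>"
  using qcut_in_or[of \<delta> g] qcut_le[of \<delta> g r] by (metis antisym)

lemma fst_down: "qcut vb \<delta> \<Longrightarrow> r \<in> fst \<delta> \<Longrightarrow> g \<le> r \<Longrightarrow> g \<in> \<Gamma> \<Longrightarrow> g \<in> fst \<delta>"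
  using qcut_in_or[of \<delta> g] qcut_le[of \<delta> r g] by (metis antisym)

lemma le_1_0: "qcut vb \<delta> \<Longrightarrow> g \<in> \<Gamma> \<Longrightarrow> le_Gd \<delta> (1, 0) (0, g) \<longleftrightarrow> g \<in> snd \<delta>"
  using snd_up[of \<delta> _ g] by (auto simp: le_Gd_iff ngd_def)

section \<open>Roots and leading exponents\<close>

text \<open>The factor x - c = (x - a) + (a - c) is led by x - a, because a nonzero constant term a
  - c has larger value. Leading exponents add up, and that of the cofactor is nonnegative.\<close>

lemma lmon_root:
  assumes q: "qcut vb \<delta>" and f: "f \<noteq> 0" and r: "poly f c = 0" and c: "c \<in> vball vb a (cutp \<delta>)"
  shows "fst (lmon a \<delta> f) \<ge> 1"
proof -
  obtain g where g: "f = [:- c, 1:] * g" using r by (metis dvdE poly_eq_0_iff_dvd)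
  have gnz: "g \<noteq> 0" using f g by auto
  have "lmon a \<delta> [:- c, 1:] = (1, 0)"
  proof (rule lmon_eqI[OF q])
    fix s assume "s \<in> mterms a [:- c, 1:]"
    then show "le_Gd (cutp \<delta>) (1, 0) s"
      using c by (auto simp: mterms_linear vball_iff q le_1_0 v_diff_commute[of a c] split: if_splits)
  qed (simp add: mterms_linear)
  then have "lmon a \<delta> f = (1, 0) + lmon a \<delta> g" using lmon_mult[OF q _ gnz, of "[:- c, 1:]"] g by simp
  then show ?thesis using lmon_nonneg[OF q gnz, of a] by simp
qed

text \<open>Equivalently f / f(a) is 1 plus a polynomial of positive \<omega>. This form contains
  \<omega>(f) = v(f(a)) and, with the control of the error term, is stable under products.\<close>

definition unit_at :: "'l \<Rightarrow> 'g set \<times> 'g set \<Rightarrow> 'l poly \<Rightarrow> bool" where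
  "unit_at a \<delta> f \<longleftrightarrow> poly f a \<noteq> 0 \<and> qv a \<delta> True (f - [:poly f a:]) (vb (poly f a))"

lemma unit_at_qv:
  assumes q: "qcut vb \<delta>" and u: "unit_at a \<delta> f" and l: "l \<in> \<Gamma>"
  shows "qv a \<delta> s f l \<longleftrightarrow> (if s then l < vb (poly f a) else l \<le> vb (poly f a))"
proof -
  let ?k = "vb (poly f a)"
  have u': "poly f a \<noteq> 0" "qv a \<delta> True (f - [:poly f a:]) ?k" using u by (auto simp: unit_at_def)
  have k: "?k \<in> \<Gamma>" using u' by simp
  have ge: "qv a \<delta> False f ?k"
    using qv_add[OF q k qv_weaken[OF q k k u'(2)], of False "[:poly f a:]"] qv_const[OF q] u' by (simp add: vge_def)
  have ngt: "\<not> qv a \<delta> True f ?k"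
    using qv_diff[OF q k _ u'(2), of f] qv_const[OF q] u' by (auto simp: vge_def)
  have "qv a \<delta> s f l" if "l < ?k \<or> l = ?k \<and> \<not> s"
    by (rule qv_weaken[OF q k l ge]) (use that in auto)
  moreover have "l < ?k \<or> l = ?k \<and> \<not> s" if "qv a \<delta> s f l"
    using qv_weaken[OF q l k that, of True] ngt by fastforce
  ultimately show ?thesis by (auto simp: order_le_less)
qed

lemma unit_at_lmon:
  assumes q: "qcut vb \<delta>" and np: "\<not> is_principal \<delta>" and u: "unit_at a \<delta> f"
  shows "lmon a \<delta> f = (0, vb (poly f a))"
proof -
  have f: "f \<noteq> 0" "vb (poly f a) \<in> \<Gamma>" using u by (auto simp: unit_at_def)
  show ?thesis
    using unit_at_qv[OF q u f(2), of False] unit_at_qv[OF q u f(2), of True] f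
    by (intro le_antisym[OF q np]) (auto simp: qv_def)
qed

lemma unit_at_mult:
  assumes q: "qcut vb \<delta>" and "unit_at a \<delta> f" "unit_at a \<delta> g"
  shows "unit_at a \<delta> (f * g)"
proof -
  have nz: "poly f a \<noteq> 0" "poly g a \<noteq> 0" using assms by (auto simp: unit_at_def)
  let ?k = "vb (poly f a) + vb (poly g a)"
  have eq: "f * g - [:poly (f * g) a:] = (f - [:poly f a:]) * g + [:poly f a:] * (g - [:poly g a:])"
    by (simp add: algebra_simps)
  have "qv a \<delta> (True \<or> False) ((f - [:poly f a:]) * g) ?k"
    using assms nz by (intro qv_mult[OF q]) (auto simp: unit_at_def unit_at_qv[OF q assms(3)])
  moreover have "qv a \<delta> (False \<or> True) ([:poly f a:] * (g - [:poly g a:])) ?k"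
    using assms nz by (intro qv_mult[OF q]) (auto simp: unit_at_def qv_const[OF q] vge_def)
  ultimately have "qv a \<delta> True (f * g - [:poly (f * g) a:]) ?k"
    unfolding eq using nz by (intro qv_add[OF q]) auto
  then show ?thesis using nz by (simp add: unit_at_def v_mult)
qed

text \<open>Over the algebraically closed field f is a product of linear factors. For a root c
  outside the ball, x - c = (a - c) + (x - a) is led by its constant term, so each factor is a unit
  at a.\<close>

lemma no_root_unit:
  assumes q: "qcut vb \<delta>" and "f \<noteq> 0" "\<And>c. poly f c = 0 \<Longrightarrow> c \<notin> vball vb a \<delta>"
  shows "unit_at a \<delta> f"
  using assms(2,3)
proof (induction "degree f" arbitrary: f)
  case 0
  then obtain c where "f = [:c:]" by (metis degree_0_id degree_eq_zeroE)
  then show ?case using 0 by (auto simp: unit_at_def)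
next
  case (Suc n)
  then obtain c where c: "poly f c = 0" using alg_closed by (metis zero_less_Suc)
  then obtain g where g: "f = [:- c, 1:] * g" by (metis dvdE poly_eq_0_iff_dvd)
  have gnz: "g \<noteq> 0" using Suc.prems g by auto
  have "degree f = Suc (degree g)" using gnz unfolding g by (subst degree_mult_eq) auto
  then have "unit_at a \<delta> g" using Suc.hyps Suc.prems g gnz by auto
  moreover have "unit_at a \<delta> [:- c, 1:]"
  proof -
    have ca: "c \<noteq> a" "vb (c - a) \<notin> snd \<delta>" using Suc.prems(2)[OF c] by (auto simp: vball_iff[OF q])
    have eq: "[:- c, 1:] - [:poly [:- c, 1:] a:] = [:- a, 1:]" by simp
    have nle: "\<not> le_Gd \<delta> (1, 0) (0, vb (a - c))"
      using ca le_1_0[OF q, of "vb (a - c)"] by (simp add: v_diff_commute[of a c])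
    have "qv a \<delta> True [:- a, 1:] (vb (a - c))"
      using qv_mterms[OF q, of "vb (a - c)" a True "[:- a, 1:]"] ca nle by (simp add: mterms_linear tge_def)
    then show ?thesis using ca unfolding unit_at_def eq by simp
  qed
  ultimately show ?case unfolding g by (intro unit_at_mult[OF q])
qed

end


section \<open>Polynomials with coefficients in a subfield\<close>

definition polys :: "'a::field set \<Rightarrow> 'a poly set" where
  "polys F = {f. \<forall>i. coeff f i \<in> F}"

definition subfld :: "'a::field set \<Rightarrow> bool" where
  "subfld F \<longleftrightarrow> 0 \<in> F \<and> 1 \<in> F \<and> (\<forall>a\<in>F. \<forall>b\<in>F. a + b \<in> F \<and> a * b \<in> F) \<and>
     (\<forall>a\<in>F. - a \<in> F \<and> inverse a \<in> F)"

lemma subfld_sum: "subfld F \<Longrightarrow> (\<And>i. i \<in> A \<Longrightarrow> h i \<in> F) \<Longrightarrow> sum h A \<in> F"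
  by (induction A rule: infinite_finite_induct) (auto simp: subfld_def)

lemma polys_0: "subfld F \<Longrightarrow> 0 \<in> polys F"
  by (simp add: polys_def subfld_def)

lemma polys_const: "subfld F \<Longrightarrow> c \<in> F \<Longrightarrow> [:c:] \<in> polys F"
  by (auto simp: polys_def subfld_def coeff_pCons' )

lemma polys_monom: "subfld F \<Longrightarrow> c \<in> F \<Longrightarrow> monom c n \<in> polys F"
  by (auto simp: polys_def subfld_def)

lemma polys_add: "subfld F \<Longrightarrow> f \<in> polys F \<Longrightarrow> g \<in> polys F \<Longrightarrow> f + g \<in> polys F"
  by (auto simp: polys_def subfld_def)

lemma polys_minus: "subfld F \<Longrightarrow> f \<in> polys F \<Longrightarrow> - f \<in> polys F"
  by (auto simp: polys_def subfld_def)

lemma polys_diff: "subfld F \<Longrightarrow> f \<in> polys F \<Longrightarrow> g \<in> polys F \<Longrightarrow> f - g \<in> polys F"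
  using polys_add[of F f "- g"] polys_minus[of F g] by simp

lemma polys_mult: "subfld F \<Longrightarrow> f \<in> polys F \<Longrightarrow> g \<in> polys F \<Longrightarrow> f * g \<in> polys F"
  unfolding polys_def by (auto simp: coeff_mult intro!: subfld_sum) (auto simp: subfld_def)

text \<open>The polynomials have coefficients in the whole field and F is only a subset, so long
  division is carried out with the coefficients kept in F.\<close>

lemma polys_division:
  assumes F: "subfld F" and "f \<in> polys F" and g: "g \<in> polys F" "g \<noteq> 0"
  shows "\<exists>q\<in>polys F. \<exists>r\<in>polys F. f = q * g + r \<and> (r = 0 \<or> degree r < degree g)"
  using assms(2)
proof (induction "degree f" arbitrary: f rule: less_induct)
  case less
  show ?case
  proof (cases "f = 0 \<or> degree f < degree g")
    case True
    then show ?thesis using less.prems polys_0[OF F] by (intro bexI[of _ 0] bexI[of _ f]) auto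
  next
    case False
    let ?m = "monom (lead_coeff f * inverse (lead_coeff g)) (degree f - degree g)"
    let ?f = "f - ?m * g"
    have lc: "lead_coeff f * inverse (lead_coeff g) \<in> F"
      using F less.prems g by (auto simp: polys_def subfld_def)
    have mP: "?m \<in> polys F" by (rule polys_monom[OF F lc])
    have fP: "?f \<in> polys F" by (intro polys_diff[OF F] polys_mult[OF F] mP less.prems g)
    have lcnz: "lead_coeff f * inverse (lead_coeff g) \<noteq> 0" using False g by simp
    have deg: "degree (?m * g) = degree f"
      using False g lcnz by (subst degree_mult_eq) (auto simp: degree_monom_eq monom_eq_0_iff)
    have "coeff (?m * g) (degree f) = lead_coeff f"
      using False g lcnz deg lead_coeff_mult[of ?m g] by (simp add: degree_monom_eq)
    then have "?f = 0 \<or> degree ?f < degree f"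
      using deg by (intro eq_zero_or_degree_less) (auto intro: degree_diff_le)
    then have "\<exists>q\<in>polys F. \<exists>r\<in>polys F. ?f = q * g + r \<and> (r = 0 \<or> degree r < degree g)"
    proof
      assume "?f = 0"
      then show ?thesis using polys_0[OF F] by (intro bexI[of _ 0] bexI[of _ 0]) auto
    next
      assume "degree ?f < degree f"
      then show ?thesis using less.hyps fP by blast
    qed
    then obtain q r where qr: "q \<in> polys F" "r \<in> polys F" "?f = q * g + r" "r = 0 \<or> degree r < degree g" by blast
    have "f = (?m + q) * g + r" using qr(3) by (simp add: algebra_simps)
    then show ?thesis using qr polys_add[OF F mP qr(1)] by blast
  qed
qed

lemma le_qcut_refl [simp]: "le_qcut \<delta> \<delta>"
  by (simp add: le_qcut_def)

lemma le_qcut_trans: "le_qcut \<delta> \<epsilon> \<Longrightarrow> le_qcut \<epsilon> \<zeta> \<Longrightarrow> le_qcut \<delta> \<zeta>"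
  by (auto simp: le_qcut_def)

lemma le_qcut_antisym: "le_qcut \<delta> \<epsilon> \<Longrightarrow> le_qcut \<epsilon> \<delta> \<Longrightarrow> \<delta> = \<epsilon>"
  by (auto simp: le_qcut_def prod_eq_iff)

context vfield
begin

lemma lmon_add_ge:
  assumes q: "qcut vb \<delta>" and nz: "f \<noteq> 0" "g \<noteq> 0" "f + g \<noteq> 0"
  shows "le_Gd (cutp \<delta>) (lmon a \<delta> f) (lmon a \<delta> (f + g)) \<or> le_Gd (cutp \<delta>) (lmon a \<delta> g) (lmon a \<delta> (f + g))"
proof -
  obtain u where u: "fst u = fst (lmon a \<delta> (f + g))" "snd u \<le> snd (lmon a \<delta> (f + g))" "u \<in> mterms a f \<or> u \<in> mterms a g"
    using mterms_add[OF lmon_spec(1)[OF q nz(3)]] by blast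
  have "le_Gd (cutp \<delta>) u (lmon a \<delta> (f + g))"
    using u by (cases u; cases "lmon a \<delta> (f + g)") auto
  moreover have "le_Gd (cutp \<delta>) (lmon a \<delta> f) u \<or> le_Gd (cutp \<delta>) (lmon a \<delta> g) u"
    using u lmon_spec(2)[OF q nz(1)] lmon_spec(2)[OF q nz(2)] by blast
  ultimately show ?thesis using le_trans[OF qcut_cutp[OF q]] by blast
qed

lemma lmon_add_eq:
  assumes q: "qcut vb \<delta>" and nz: "f \<noteq> 0" "g \<noteq> 0" and lt: "\<not> le_Gd (cutp \<delta>) (lmon a \<delta> g) (lmon a \<delta> f)"
  shows "f + g \<noteq> 0" "lmon a \<delta> (f + g) = lmon a \<delta> f"
proof -
  show s: "f + g \<noteq> 0"
  proof
    assume "f + g = 0"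
    then have "g = - f" by (simp add: eq_neg_iff_add_eq_0 add.commute)
    then show False using lt by simp
  qed
  have qc: "qcut vb (cutp \<delta>)" using q by simp
  have fg: "le_Gd (cutp \<delta>) (lmon a \<delta> f) (lmon a \<delta> g)"
    using lt le_total[OF qc lmon_in[OF q nz(1)] lmon_in[OF q nz(2)]] by blast
  have "le_Gd (cutp \<delta>) (lmon a \<delta> f) (lmon a \<delta> (f + g))"
    using lmon_add_ge[OF q nz s, of a] le_trans[OF qc fg] by blast
  moreover have "le_Gd (cutp \<delta>) (lmon a \<delta> (f + g)) (lmon a \<delta> f)"
    using lmon_add_ge[OF q s, of "- g" a] nz lt by simp
  ultimately show "lmon a \<delta> (f + g) = lmon a \<delta> f" by (intro le_antisym[OF qc not_principal_cutp])
qed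

text \<open>If the leading exponents differ, one leading monomial is strictly smaller for
  \<open>cutp \<delta>\<close> and survives in the sum. So \<omega>(f + g) is the minimum of
  \<omega>(f) and \<omega>(g).\<close>

lemma qv_add_distinct:
  assumes q: "qcut vb \<delta>" and nz: "f \<noteq> 0" "g \<noteq> 0" and d: "fst (lmon a \<delta> f) \<noteq> fst (lmon a \<delta> g)"
    and s: "qv a \<delta> s (f + g) l"
  shows "qv a \<delta> s f l" "qv a \<delta> s g l"
proof -
  have qc: "qcut vb (cutp \<delta>)" using q by simp
  have *: "qv a \<delta> s f l \<and> qv a \<delta> s g l"
    if nz: "f \<noteq> 0" "g \<noteq> 0" and lt: "\<not> le_Gd (cutp \<delta>) (lmon a \<delta> g) (lmon a \<delta> f)" and s: "qv a \<delta> s (f + g) l" for f g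
  proof -
    have t: "tge \<delta> s (lmon a \<delta> f) l" using s lmon_add_eq[OF q nz lt] by (simp add: qv_tge)
    moreover have "le_Gd \<delta> (lmon a \<delta> f) (lmon a \<delta> g)"
      using lt le_total[OF qc lmon_in[OF q nz(1)] lmon_in[OF q nz(2)]] le_cutpD by blast
    ultimately show ?thesis using tge_mono[OF q] by (auto simp: qv_tge)
  qed
  have "\<not> le_Gd (cutp \<delta>) (lmon a \<delta> g) (lmon a \<delta> f) \<or> \<not> le_Gd (cutp \<delta>) (lmon a \<delta> f) (lmon a \<delta> g)"
    using le_antisym[OF qc not_principal_cutp] d by metis
  then show "qv a \<delta> s f l" "qv a \<delta> s g l"
    using *[of f g] *[of g f] nz s by (auto simp: add.commute)
qed

section \<open>Levels of \<Gamma> against values that may lie in a gap\<close>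

lemma tge_lo: "e \<in> fst \<delta> \<Longrightarrow> 0 \<le> n \<Longrightarrow> tge \<delta> False (n, g) (g + zsm n e)"
  by (cases "n = 0") (auto simp: tge_def le_Gd_iff ngd_def zsm_minus_left)

lemma tge_hi: "r \<in> snd \<delta> \<Longrightarrow> 0 \<le> n \<Longrightarrow> \<not> tge \<delta> True (n, g) (g + zsm n r)"
  by (cases "n = 0") (auto simp: tge_def le_Gd_iff ngd_def zsm_minus_left)

lemma tge_lo_strict:
  assumes "qcut vb \<delta>" "e \<in> \<Gamma>" "e \<notin> snd \<delta>" "0 < n" shows "tge \<delta> True (n, g) (g + zsm n e)"
proof -
  have "zsm n e < zsm n r" if "r \<in> snd \<delta>" for r
    using assms that snd_up[OF assms(1) that] by (metis zsm_strict_mono not_le)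
  then show ?thesis using assms(4) by (auto simp: tge_def le_Gd_iff ngd_def not_le)
qed

lemma tge_hi_strict:
  assumes "qcut vb \<delta>" "e \<in> \<Gamma>" "e \<notin> fst \<delta>" "0 < n" shows "\<not> tge \<delta> False (n, g) (g + zsm n e)"
proof -
  have "zsm n r < zsm n e" if "r \<in> fst \<delta>" for r
    using assms that fst_down[OF assms(1) that] by (metis zsm_strict_mono not_le)
  then show ?thesis using assms(4) by (auto simp: tge_def le_Gd_iff ngd_def not_le zsm_minus_left)
qed

lemma tge_FalseD: "tge \<delta> False (n, g) l \<Longrightarrow> 0 < n \<Longrightarrow> \<exists>e\<in>fst \<delta>. l \<le> g + zsm n e"
  by (auto simp: tge_def le_Gd_iff ngd_def zsm_minus_left algebra_simps)

lemma not_tge_TrueD: "\<not> tge \<delta> True (n, g) l \<Longrightarrow> 0 < n \<Longrightarrow> \<exists>e\<in>snd \<delta>. g + zsm n e \<le> l"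
  by (auto simp: tge_def le_Gd_iff ngd_def zsm_minus_left algebra_simps)

text \<open>A converse of \<open>tge_add\<close>. A product may have its value in a gap of \<Gamma>,
  so a bound on it is distributed over the factors before multiplicativity of another valuation can
  be used. Both factors are tested at one level (\<open>k\<close> or \<open>e\<close>) put in place
  of the radius.\<close>

lemma tge_split:
  assumes q: "qcut vb \<delta>" and t: "tge \<delta> s (n + m, g + h) l" and nn: "0 \<le> n" "0 \<le> m" and G: "g \<in> \<Gamma>" "h \<in> \<Gamma>" "l \<in> \<Gamma>"
  shows "\<exists>s1 s2. \<exists>l1\<in>\<Gamma>. \<exists>l2\<in>\<Gamma>. l1 + l2 = l \<and> (s \<longrightarrow> s1 \<or> s2) \<and> tge \<delta> s1 (n, g) l1 \<and> tge \<delta> s2 (m, h) l2"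
proof (cases "n + m = 0")
  case True
  then have "n = 0" "m = 0" using nn by auto
  then show ?thesis using t G
    by (intro exI[of _ False] exI[of _ s] bexI[of _ g] bexI[of _ "l - g"]) (auto simp: algebra_simps)
next
  case False
  then have pos: "0 < n + m" using nn by simp
  show ?thesis
  proof (cases s)
    case True
    \<comment> \<open>At the level \<open>k\<close> the bound \<open>l\<close> amounts to comparing
      the radius with \<open>k\<close>. A strict bound keeps \<open>k\<close> off the right side,
      and a factor with positive exponent carries the strictness.\<close>
    obtain k where k: "k \<in> \<Gamma>" "zsm (n + m) k = l - (g + h)" using Gam_zdivide[OF _ pos, of "l - (g + h)"] G by auto
    have l: "l = (g + zsm n k) + (h + zsm m k)" using k by (simp add: zsm_add_left algebra_simps)
    have kn: "k \<notin> snd \<delta>" using tge_hi[of k \<delta> "n + m" "g + h"] pos t True k by auto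
    then have kf: "k \<in> fst \<delta>" using qcut_in_or[OF q k(1)] by blast
    show ?thesis
    proof (cases "0 < n")
      case True
      then show ?thesis using tge_lo_strict[OF q k(1) kn True] tge_lo[OF kf nn(2)] l G k(1) by (metis Gam_add Gam_zsm)
    next
      case False
      then have "0 < m" using pos nn by simp
      then show ?thesis using tge_lo_strict[OF q k(1) kn] tge_lo[OF kf nn(1)] l G k(1) by (metis Gam_add Gam_zsm)
    qed
  next
    case False
    obtain e where e: "e \<in> fst \<delta>" "l \<le> g + h + zsm (n + m) e" using tge_FalseD[OF _ pos, of \<delta> "g + h" l] t False by auto
    have eG: "e \<in> \<Gamma>" using e qcut_fst[OF q] by blast
    have 1: "tge \<delta> False (n, g) (g + zsm n e)" by (rule tge_lo[OF e(1) nn(1)])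
    \<comment> \<open>The slack between \<open>l\<close> and the value at level \<open>e\<close> is
      given to the second summand.\<close>
    let ?l = "l - (g + zsm n e)"
    have "?l \<le> h + zsm m e" using e(2) by (simp add: zsm_add_left algebra_simps)
    then have 2: "tge \<delta> False (m, h) ?l"
      using tge_weaken[OF q _ _ _ tge_lo[OF e(1) nn(2), of h], of ?l False] G eG by (force simp: order_le_less)
    show ?thesis
      using 1 2 False G eG by (intro exI[of _ False] bexI[of _ "g + zsm n e"] bexI[of _ ?l]) auto
  qed
qed

text \<open>The dual splitting, for failed bounds, that is for upper bounds on the value. Here the
  strict case is the flag \<open>False\<close>.\<close>

lemma not_tge_split:
  assumes q: "qcut vb \<delta>" and t: "\<not> tge \<delta> s (n + m, g + h) l" and nn: "0 \<le> n" "0 \<le> m" and G: "g \<in> \<Gamma>" "h \<in> \<Gamma>" "l \<in> \<Gamma>"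
  shows "\<exists>s1 s2. \<exists>l1\<in>\<Gamma>. \<exists>l2\<in>\<Gamma>. l1 + l2 = l \<and> (s1 \<and> s2 \<longrightarrow> s) \<and> \<not> tge \<delta> s1 (n, g) l1 \<and> \<not> tge \<delta> s2 (m, h) l2"
proof (cases "n + m = 0")
  case True
  then have "n = 0" "m = 0" using nn by auto
  then show ?thesis using t G
    by (intro exI[of _ True] exI[of _ s] bexI[of _ g] bexI[of _ "l - g"]) (auto simp: algebra_simps)
next
  case False
  then have pos: "0 < n + m" using nn by simp
  show ?thesis
  proof (cases s)
    case False
    obtain k where k: "k \<in> \<Gamma>" "zsm (n + m) k = l - (g + h)" using Gam_zdivide[OF _ pos, of "l - (g + h)"] G by auto
    have l: "l = (g + zsm n k) + (h + zsm m k)" using k by (simp add: zsm_add_left algebra_simps)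
    have kn: "k \<notin> fst \<delta>" using tge_lo[of k \<delta> "n + m" "g + h"] pos t False k by auto
    then have kf: "k \<in> snd \<delta>" using qcut_in_or[OF q k(1)] by blast
    show ?thesis
    proof (cases "0 < n")
      case True
      then show ?thesis using tge_hi_strict[OF q k(1) kn True] tge_hi[OF kf nn(2)] l G k(1) by (metis Gam_add Gam_zsm)
    next
      case False
      then have "0 < m" using pos nn by simp
      then show ?thesis using tge_hi_strict[OF q k(1) kn] tge_hi[OF kf nn(1)] l G k(1) by (metis Gam_add Gam_zsm)
    qed
  next
    case True
    obtain e where e: "e \<in> snd \<delta>" "g + h + zsm (n + m) e \<le> l" using not_tge_TrueD[OF _ pos, of \<delta> "g + h" l] t True by auto
    have eG: "e \<in> \<Gamma>" using e qcut_snd[OF q] by blast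
    have 1: "\<not> tge \<delta> True (n, g) (g + zsm n e)" by (rule tge_hi[OF e(1) nn(1)])
    let ?l = "l - (g + zsm n e)"
    have le: "h + zsm m e \<le> ?l" using e(2) by (simp add: zsm_add_left algebra_simps)
    have 2: "\<not> tge \<delta> True (m, h) ?l"
    proof
      assume "tge \<delta> True (m, h) ?l"
      then have "tge \<delta> True (m, h) (h + zsm m e)"
        using tge_weaken[OF q _ _ _ \<open>tge \<delta> True (m, h) ?l\<close>, of "h + zsm m e" True] G eG le by (force simp: order_le_less)
      then show False using tge_hi[OF e(1) nn(2)] by blast
    qed
    show ?thesis
      using 1 2 True G eG by (intro exI[of _ True] bexI[of _ "g + zsm n e"] bexI[of _ ?l]) auto
  qed
qed

definition below :: "(bool \<Rightarrow> 'l poly \<Rightarrow> 'g \<Rightarrow> bool) \<Rightarrow> (bool \<Rightarrow> 'l poly \<Rightarrow> 'g \<Rightarrow> bool) \<Rightarrow> 'l poly \<Rightarrow> bool" where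
  "below \<rho> \<rho>' f \<longleftrightarrow> (\<forall>s. \<forall>l\<in>\<Gamma>. \<rho> s f l \<longrightarrow> \<rho>' s f l)"

lemma belowD: "below \<rho> \<rho>' f \<Longrightarrow> \<rho> s f l \<Longrightarrow> l \<in> \<Gamma> \<Longrightarrow> \<rho>' s f l"
  by (simp add: below_def)

lemma below_trans: "below \<rho> \<rho>' f \<Longrightarrow> below \<rho>' \<rho>'' f \<Longrightarrow> below \<rho> \<rho>'' f"
  by (simp add: below_def)

section \<open>Change of centre and of radius\<close>

lemma vball_recenter:
  assumes q: "qcut vb \<delta>" and b: "b \<in> vball vb a \<delta>"
  shows "vball vb b \<delta> = vball vb a \<delta>"
proof -
  have tri: "c = a \<or> vb (c - a) \<in> snd \<delta>" if "c = b \<or> vb (c - b) \<in> snd \<delta>" "b = a \<or> vb (b - a) \<in> snd \<delta>" for a b c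
  proof (cases "c = b \<or> b = a \<or> c = a")
    case False
    then have "min (vb (c - b)) (vb (b - a)) \<le> vb (c - a)"
      using v_add[of "c - b" "b - a"] by simp
    moreover have "min (vb (c - b)) (vb (b - a)) \<in> snd \<delta>" using that False by (auto simp: min_def)
    ultimately show ?thesis using snd_up[OF q] False by simp
  qed (use that in auto)
  have ab: "b = a \<or> vb (b - a) \<in> snd \<delta>" using b vball_iff[OF q] by blast
  then have ba: "a = b \<or> vb (a - b) \<in> snd \<delta>" using v_diff_commute[of a b] by auto
  show ?thesis using tri[OF _ ab] tri[OF _ ba] by (auto simp: vball_iff[OF q])
qed

lemma poly_taylor: "f = (\<Sum>i\<le>degree (pcompose f [:a, 1:]). [:coeff (pcompose f [:a, 1:]) i:] * [:- a, 1:] ^ i)" for f :: "'l poly"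
proof -
  let ?p = "pcompose f [:a, 1:]"
  have "f = pcompose ?p [:- a, 1:]"
    by (simp add: pcompose_assoc[symmetric] pcompose_pCons)
  also have "\<dots> = poly (map_poly (\<lambda>x. [:x:]) ?p) [:- a, 1:]" by (rule pcompose_altdef)
  also have "\<dots> = (\<Sum>i\<le>degree ?p. [:coeff ?p i:] * [:- a, 1:] ^ i)"
    unfolding poly_altdef by (simp add: coeff_map_poly degree_map_poly)
  finally show ?thesis .
qed

text \<open>Since b lies in the ball, each power (x - a)^i has, expanded at b, value at least i
  times the radius. So the terms of the expansion of f at a keep their bounds at b.\<close>

lemma qv_recenter_imp:
  assumes q: "qcut vb \<delta>" and b: "b \<in> vball vb a \<delta>" and l: "l \<in> \<Gamma>" and f: "qv a \<delta> s f l"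
  shows "qv b \<delta> s f l"
proof -
  have lin: "le_Gd \<delta> (1, 0) (lmon b \<delta> [:- a, 1:])"
  proof -
    have "lmon b \<delta> [:- a, 1:] \<in> mterms b [:- a, 1:]" by (rule lmon_spec(1)[OF q]) simp
    moreover have "le_Gd \<delta> (1, 0) (0, vb (b - a))" if "b \<noteq> a"
      using b that le_1_0[OF q] by (simp add: vball_iff[OF q])
    ultimately show ?thesis by (auto simp: mterms_linear split: if_splits)
  qed
  have pow: "le_Gd \<delta> (int i, 0) (lmon b \<delta> ([:- a, 1:] ^ i))" for i
  proof (induction i)
    case 0
    have "lmon b \<delta> [:1:] = (0, 0)" using lmon_const[OF q, of 1 b] by simp
    then show ?case by (simp add: one_pCons)
  next
    case (Suc i)
    have "lmon b \<delta> ([:- a, 1:] ^ Suc i) = lmon b \<delta> [:- a, 1:] + lmon b \<delta> ([:- a, 1:] ^ i)"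
      unfolding power_Suc by (rule lmon_mult[OF q]) auto
    then show ?case using le_add_mono[OF q lin Suc] by (simp add: add.commute)
  qed
  let ?p = "pcompose f [:a, 1:]"
  have "qv b \<delta> s ([:coeff ?p i:] * [:- a, 1:] ^ i) l" for i
  proof (cases "coeff ?p i = 0")
    case False
    have "lmon b \<delta> ([:coeff ?p i:] * [:- a, 1:] ^ i) = (0, vb (coeff ?p i)) + lmon b \<delta> ([:- a, 1:] ^ i)"
      using False by (subst lmon_mult[OF q]) (auto simp: lmon_const[OF q])
    moreover have "le_Gd \<delta> ((0, vb (coeff ?p i)) + (int i, 0)) ((0, vb (coeff ?p i)) + lmon b \<delta> ([:- a, 1:] ^ i))"
      using pow[of i] by (simp only: le_add_cancel_left)
    ultimately have "le_Gd \<delta> (int i, vb (coeff ?p i)) (lmon b \<delta> ([:coeff ?p i:] * [:- a, 1:] ^ i))" by simp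
    moreover have "tge \<delta> s (int i, vb (coeff ?p i)) l"
      using f False unfolding qv_mterms[OF q l] by (auto simp: mterms_def)
    ultimately show ?thesis using tge_mono[OF q] by (auto simp: qv_tge)
  qed simp
  then show ?thesis by (subst poly_taylor[of f a]) (intro qv_sum[OF q l])
qed

lemma qv_recenter:
  assumes q: "qcut vb \<delta>" and b: "b \<in> vball vb a \<delta>" and l: "l \<in> \<Gamma>"
  shows "qv b \<delta> s f l \<longleftrightarrow> qv a \<delta> s f l"
proof -
  have "a \<in> vball vb b \<delta>" using vball_recenter[OF q b] by simp
  then show ?thesis using qv_recenter_imp[OF q] b l by blast
qed

text \<open>Exponents are nonnegative, so enlarging the radius can only increase the value of a
  term.\<close>

lemma tge_radius:
  "le_qcut \<delta> \<epsilon> \<Longrightarrow> 0 \<le> fst t \<Longrightarrow> tge \<delta> s t l \<Longrightarrow> tge \<epsilon> s t l"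
  by (cases s; cases "fst t = 0") (auto simp: tge_def le_Gd_iff ngd_def le_qcut_def)

lemma qv_radius:
  assumes "qcut vb \<delta>" "qcut vb \<epsilon>" "le_qcut \<delta> \<epsilon>" "l \<in> \<Gamma>" "qv a \<delta> s f l"
  shows "qv a \<epsilon> s f l"
  using assms tge_radius[OF assms(3)] by (fastforce simp: qv_mterms mterms_def)

lemma qv_ball_mono:
  assumes "qcut vb \<delta>" "qcut vb \<epsilon>" "le_qcut \<delta> \<epsilon>" "b \<in> vball vb a \<delta>"
  shows "below (qv a \<delta>) (qv b \<epsilon>) f"
  using qv_recenter[OF assms(1,4)] qv_radius[OF assms(1-3)] by (simp add: below_def)

lemma vball_radius_mono:
  assumes "qcut vb \<delta>" "qcut vb \<epsilon>" "le_qcut \<delta> \<epsilon>" shows "vball vb a \<epsilon> \<subseteq> vball vb a \<delta>"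
  using assms by (auto simp: vball_iff le_qcut_def)

end


section \<open>Nests and valuations with values compared to the value group\<close>

context vfield
begin

lemma qcut_pq [simp]: "qcut vb (pq vb \<gamma>)"
  by (auto simp: qcut_def pq_def)

lemma pq_simps: "\<gamma> \<in> \<Gamma> \<Longrightarrow> r \<in> snd (pq vb \<gamma>) \<longleftrightarrow> r \<in> \<Gamma> \<and> \<gamma> \<le> r"
  "\<gamma> \<in> \<Gamma> \<Longrightarrow> r \<in> fst (pq vb \<gamma>) \<longleftrightarrow> r \<in> \<Gamma> \<and> r \<le> \<gamma>"
  by (auto simp: pq_def)

lemma vball_pq: "\<gamma> \<in> \<Gamma> \<Longrightarrow> vball vb a (pq vb \<gamma>) = vcball vb a \<gamma>"
proof (rule set_eqI)
  fix x assume "\<gamma> \<in> \<Gamma>"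
  then show "x \<in> vball vb a (pq vb \<gamma>) \<longleftrightarrow> x \<in> vcball vb a \<gamma>"
    by (cases "x = a") (simp_all add: vball_iff pq_simps vcball_def)
qed

lemma vcball_self [simp]: "a \<in> vcball vb a \<gamma>"
  by (simp add: vcball_def)

lemma vcball_recenter: "\<gamma> \<in> \<Gamma> \<Longrightarrow> b \<in> vcball vb a \<gamma> \<Longrightarrow> vcball vb b \<gamma> = vcball vb a \<gamma>"
  using vball_recenter[of "pq vb \<gamma>" b a] by (simp add: vball_pq)

lemma le_qcut_pq: "\<gamma> \<in> \<Gamma> \<Longrightarrow> \<gamma>' \<in> \<Gamma> \<Longrightarrow> le_qcut (pq vb \<gamma>) (pq vb \<gamma>') \<longleftrightarrow> \<gamma> \<le> \<gamma>'"
  by (auto simp: le_qcut_def pq_def)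

lemma vcball_subset_radius:
  assumes "\<gamma> \<in> \<Gamma>" "\<gamma>' \<in> \<Gamma>" "vcball vb a \<gamma> \<subseteq> vcball vb b \<gamma>'"
  shows "\<gamma>' \<le> \<gamma>"
proof -
  obtain z where z: "z \<noteq> 0" "vb z = \<gamma>" using assms(1) by (rule Gam_E)
  have a: "a \<in> vcball vb b \<gamma>'" using assms(3) vcball_self by blast
  have "a + z \<in> vcball vb a \<gamma>" using z by (simp add: vcball_def)
  then have "a + z \<in> vcball vb a \<gamma>'" using assms(3) vcball_recenter[OF assms(2) a] by auto
  then show ?thesis using z by (simp add: vcball_def)
qed

text \<open>If the right side of \<open>\<delta>\<close> missed the left side of
  \<open>\<epsilon>\<close>, the inclusions would reverse and the quasi-cuts coincide. This element
  of \<Gamma> later supplies the closed balls of a nest and the intermediate value demanded by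
  \<open>Vle\<close>.\<close>

lemma qcut_between:
  assumes q: "qcut vb \<delta>" "qcut vb \<epsilon>" and "le_qcut \<delta> \<epsilon>" "\<delta> \<noteq> \<epsilon>"
  shows "\<exists>\<gamma>\<in>\<Gamma>. le_qcut \<delta> (pq vb \<gamma>) \<and> le_qcut (pq vb \<gamma>) \<epsilon>"
proof -
  have "\<exists>\<gamma>. \<gamma> \<in> snd \<delta> \<and> \<gamma> \<in> fst \<epsilon>"
  proof (rule ccontr)
    assume n: "\<nexists>\<gamma>. \<gamma> \<in> snd \<delta> \<and> \<gamma> \<in> fst \<epsilon>"
    have "fst \<epsilon> \<subseteq> fst \<delta>" "snd \<delta> \<subseteq> snd \<epsilon>"
      using n q by (auto simp: qcut_def)
    then show False using assms(3,4) by (auto simp: le_qcut_def prod_eq_iff)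
  qed
  then obtain \<gamma> where g: "\<gamma> \<in> snd \<delta>" "\<gamma> \<in> fst \<epsilon>" by blast
  then have "\<gamma> \<in> \<Gamma>" using qcut_snd[OF q(1)] by blast
  moreover have "le_qcut \<delta> (pq vb \<gamma>)"
    using qcut_le[OF q(1) _ g(1)] qcut_fst[OF q(1)] snd_up[OF q(1) g(1)] by (auto simp: le_qcut_def pq_def)
  moreover have "le_qcut (pq vb \<gamma>) \<epsilon>"
    using qcut_le[OF q(2) g(2)] qcut_snd[OF q(2)] fst_down[OF q(2) g(2)] by (auto simp: le_qcut_def pq_def)
  ultimately show ?thesis by blast
qed

lemma closed_balls_nested:
  assumes "\<gamma> \<in> \<Gamma>" "\<gamma>' \<in> \<Gamma>" "c \<in> vcball vb a \<gamma>" "c \<in> vcball vb b \<gamma>'"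
  shows "vcball vb a \<gamma> \<subseteq> vcball vb b \<gamma>' \<or> vcball vb b \<gamma>' \<subseteq> vcball vb a \<gamma>"
proof -
  have eq: "vcball vb a \<gamma> = vcball vb c \<gamma>" "vcball vb b \<gamma>' = vcball vb c \<gamma>'"
    using vcball_recenter[OF assms(1,3)] vcball_recenter[OF assms(2,4)] by simp_all
  show ?thesis unfolding eq using order_trans[of \<gamma> \<gamma>'] order_trans[of \<gamma>' \<gamma>]
    by (cases "\<gamma> \<le> \<gamma>'") (auto simp: vcball_def)
qed

text \<open>The largest \<omega> along the nest, expressed through bounds: a level is reached as
  soon as one member reaches it.\<close>

definition nqv :: "'l set set \<Rightarrow> bool \<Rightarrow> 'l poly \<Rightarrow> 'g \<Rightarrow> bool" where
  "nqv N s f l \<longleftrightarrow> (\<exists>a \<gamma>. \<gamma> \<in> \<Gamma> \<and> vcball vb a \<gamma> \<in> N \<and> qv a (pq vb \<gamma>) s f l)"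

definition rootfree :: "'l set \<Rightarrow> 'l poly \<Rightarrow> bool" where
  "rootfree B f \<longleftrightarrow> f \<noteq> 0 \<and> (\<forall>c\<in>B. poly f c \<noteq> 0)"

lemma rootfree_unit: "qcut vb \<delta> \<Longrightarrow> rootfree (vball vb a \<delta>) f \<Longrightarrow> unit_at a \<delta> f"
  by (rule no_root_unit) (auto simp: rootfree_def)

lemma nest_ballE:
  assumes "nest vb N" "B \<in> N"
  obtains a \<gamma> where "\<gamma> \<in> \<Gamma>" "B = vcball vb a \<gamma>"
  using assms unfolding nest_def closed_balls_def by blast

text \<open>Each of the finitely many roots is left out by some member, because the intersection is
  empty; as the members form a chain, the smallest of these avoids all roots.\<close>

lemma nest_rootfree:
  assumes N: "nest vb N" and f: "f \<noteq> 0"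
  shows "\<exists>B\<in>N. rootfree B f"
proof -
  have fin: "finite {c. poly f c = 0}" using f by (rule poly_roots_finite)
  have "\<exists>B\<in>N. \<forall>c\<in>A. c \<notin> B" if "finite A" for A
    using that
  proof (induction A)
    case empty
    then show ?case using N by (auto simp: nest_def)
  next
    case (insert c A)
    then obtain B where B: "B \<in> N" "\<forall>c\<in>A. c \<notin> B" by blast
    have "c \<notin> \<Inter>N" using N by (simp add: nest_def)
    then obtain B' where B': "B' \<in> N" "c \<notin> B'" by blast
    have "B \<subseteq> B' \<or> B' \<subseteq> B" using N B B' by (auto simp: nest_def)
    then show ?case using B B' by blast
  qed
  from this[OF fin] show ?thesis using f by (auto simp: rootfree_def)
qed

lemma rootfree_subset: "rootfree B f \<Longrightarrow> B' \<subseteq> B \<Longrightarrow> rootfree B' f"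
  by (auto simp: rootfree_def)

text \<open>Every point b of the ball is a centre, and a polynomial without roots in the ball is a
  unit there; so its value v(f(b)) is constant on the ball.\<close>

lemma qv_rootfree:
  assumes q: "qcut vb \<delta>" and r: "rootfree (vball vb a \<delta>) f" and b: "b \<in> vball vb a \<delta>" and l: "l \<in> \<Gamma>"
  shows "qv a \<delta> s f l \<longleftrightarrow> vge s (poly f b) l"
proof -
  have "unit_at b \<delta> f" using rootfree_unit[OF q, of b] r vball_recenter[OF q b] by simp
  then have "qv b \<delta> s f l \<longleftrightarrow> vge s (poly f b) l"
    using unit_at_qv[OF q _ l, of b f s] by (auto simp: vge_def unit_at_def)
  then show ?thesis using qv_recenter[OF q b l] by simp
qed

text \<open>Once a member contains no root of f, shrinking it further does not change \<omega>(f).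
  So a nest gives a nonzero polynomial a value in \<Gamma>, computed at any point of such a
  member.\<close>

lemma nqv_rootfree:
  assumes N: "nest vb N" and B: "B \<in> N" "rootfree B f" and b: "b \<in> B" and l: "l \<in> \<Gamma>"
  shows "nqv N s f l \<longleftrightarrow> vge s (poly f b) l"
proof -
  obtain a \<gamma> where a: "\<gamma> \<in> \<Gamma>" "B = vcball vb a \<gamma>" using nest_ballE[OF N B(1)] .
  have eqB: "qv a (pq vb \<gamma>) s f l \<longleftrightarrow> vge s (poly f c) l" if "c \<in> B" for c
    using qv_rootfree[OF qcut_pq, of a \<gamma> f c l s] a B that l by (simp add: vball_pq)
  have "vge s (poly f b) l" if n: "nqv N s f l"
  proof -
    obtain c \<gamma>' where c: "\<gamma>' \<in> \<Gamma>" "vcball vb c \<gamma>' \<in> N" "qv c (pq vb \<gamma>') s f l" using n by (auto simp: nqv_def)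
    have "B \<subseteq> vcball vb c \<gamma>' \<or> vcball vb c \<gamma>' \<subseteq> B" using N B c by (auto simp: nest_def)
    then show ?thesis
    proof
      assume sub: "B \<subseteq> vcball vb c \<gamma>'"
      have "\<gamma>' \<le> \<gamma>" using vcball_subset_radius[OF a(1) c(1)] sub a by simp
      moreover have "a \<in> vcball vb c \<gamma>'" using sub a by auto
      ultimately have "below (qv c (pq vb \<gamma>')) (qv a (pq vb \<gamma>)) f"
        by (intro qv_ball_mono) (auto simp: le_qcut_pq a c vball_pq)
      then show ?thesis using c(3) l eqB[OF b] unfolding below_def by blast
    next
      assume sub: "vcball vb c \<gamma>' \<subseteq> B"
      have "vge s (poly f c) l"
        using qv_rootfree[OF qcut_pq, of c \<gamma>' f c l s] c rootfree_subset[OF B(2) sub] l by (simp add: vball_pq)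
      then show ?thesis using eqB[OF b] eqB[OF subsetD[OF sub vcball_self]] by simp
    qed
  qed
  moreover have "nqv N s f l" if "vge s (poly f b) l"
    using that eqB[OF b] a B(1) by (auto simp: nqv_def)
  ultimately show ?thesis by blast
qed

lemma nqv_ball_below:
  assumes "vcball vb a \<gamma> \<in> N" "\<gamma> \<in> \<Gamma>"
  shows "below (qv a (pq vb \<gamma>)) (nqv N) f"
  using assms by (auto simp: below_def nqv_def)

end

section \<open>Valuations on polynomials over a subfield, seen from \<Gamma>\<close>

text \<open>The axioms of a valuation on F[x] extending v, as far as levels of \<Gamma> can see it;
  infinite values are allowed. Lower bounds alone give \<rho>(fg) \<ge> \<rho>(f) + \<rho>(g), and
  the rule for failed bounds supplies the opposite inequality.\<close>

locale qvalued = vfield vb for vb :: "'l::field \<Rightarrow> 'g::linordered_ab_group_add" +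
  fixes F :: "'l set" and \<rho> :: "bool \<Rightarrow> 'l poly \<Rightarrow> 'g \<Rightarrow> bool"
  assumes sub: "subfld F"
    and alg: "\<And>z. \<exists>p\<in>polys F. p \<noteq> 0 \<and> poly p z = 0"
    and rho_weaken: "\<And>s f l s' l'. f \<in> polys F \<Longrightarrow> l \<in> Gam vb \<Longrightarrow> l' \<in> Gam vb \<Longrightarrow> \<rho> s f l \<Longrightarrow>
        l' < l \<or> l' = l \<and> (s' \<longrightarrow> s) \<Longrightarrow> \<rho> s' f l'"
    and rho_add: "\<And>s f g l. f \<in> polys F \<Longrightarrow> g \<in> polys F \<Longrightarrow> l \<in> Gam vb \<Longrightarrow> \<rho> s f l \<Longrightarrow> \<rho> s g l \<Longrightarrow> \<rho> s (f + g) l"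
    and rho_mult: "\<And>s f l s' g l'. f \<in> polys F \<Longrightarrow> g \<in> polys F \<Longrightarrow> l \<in> Gam vb \<Longrightarrow> l' \<in> Gam vb \<Longrightarrow>
        \<rho> s f l \<Longrightarrow> \<rho> s' g l' \<Longrightarrow> \<rho> (s \<or> s') (f * g) (l + l')"
    and rho_mult_neg: "\<And>s f l s' g l'. f \<in> polys F \<Longrightarrow> g \<in> polys F \<Longrightarrow> l \<in> Gam vb \<Longrightarrow> l' \<in> Gam vb \<Longrightarrow>
        \<not> \<rho> s f l \<Longrightarrow> \<not> \<rho> s' g l' \<Longrightarrow> \<not> \<rho> (s \<and> s') (f * g) (l + l')"
    and rho_const: "\<And>s c l. c \<in> F \<Longrightarrow> l \<in> Gam vb \<Longrightarrow> \<rho> s [:c:] l \<longleftrightarrow> vfield.vge vb s c l"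
begin

lemma F_closed: "0 \<in> F" "1 \<in> F" "- 1 \<in> F"
  using sub by (auto simp: subfld_def)

lemma rho_0: "l \<in> \<Gamma> \<Longrightarrow> \<rho> s 0 l"
  using rho_const[of 0 l s] F_closed by simp

lemma rho_minus:
  assumes "f \<in> polys F" "l \<in> \<Gamma>" "\<rho> s f l" shows "\<rho> s (- f) l"
proof -
  have "\<rho> False [:- 1:] 0" using rho_const[of "- 1" 0 False] F_closed by (simp add: vge_def)
  then have "\<rho> (False \<or> s) ([:- 1:] * f) (0 + l)"
    using assms F_closed by (intro rho_mult polys_const sub) auto
  then show ?thesis by simp
qed

lemma rho_diff:
  assumes "f \<in> polys F" "g \<in> polys F" "l \<in> \<Gamma>" "\<rho> s f l" "\<rho> s g l" shows "\<rho> s (f - g) l"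
  using rho_add[of f "- g" l s] rho_minus[of g l s] assms polys_minus[OF sub] by simp

text \<open>A bound on the product is split by \<open>tge_split\<close>, transferred factor by
  factor, and recombined by multiplicativity of \<rho>.\<close>

lemma below_mult:
  assumes q: "qcut vb \<delta>" and P: "f \<in> polys F" "g \<in> polys F" and "below (qv a \<delta>) \<rho> f" "below (qv a \<delta>) \<rho> g"
  shows "below (qv a \<delta>) \<rho> (f * g)"
  unfolding below_def
proof (intro allI ballI impI)
  fix s l assume l: "l \<in> \<Gamma>" and h: "qv a \<delta> s (f * g) l"
  show "\<rho> s (f * g) l"
  proof (cases "f = 0 \<or> g = 0")
    case True
    then show ?thesis using rho_0[OF l] by auto
  next
    case False
    then have nz: "f \<noteq> 0" "g \<noteq> 0" by auto
    obtain n e where ne: "lmon a \<delta> f = (n, e)" by fastforce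
    obtain m d where md: "lmon a \<delta> g = (m, d)" by fastforce
    have "tge \<delta> s (n + m, e + d) l" using h nz ne md by (simp add: qv_tge lmon_mult[OF q])
    then obtain s1 s2 l1 l2 where "l1 \<in> \<Gamma>" "l2 \<in> \<Gamma>" "l1 + l2 = l" "s \<longrightarrow> s1 \<or> s2" "tge \<delta> s1 (n, e) l1" "tge \<delta> s2 (m, d) l2"
      using tge_split[OF q, of s n m e d l] lmon_nonneg[OF q nz(1), of a] lmon_nonneg[OF q nz(2), of a]
        lmon_in[OF q nz(1), of a] lmon_in[OF q nz(2), of a] l ne md by auto
    note w = this
    have "\<rho> s1 f l1" using belowD[OF assms(4), of s1 l1] w ne by (simp add: qv_tge)
    moreover have "\<rho> s2 g l2" using belowD[OF assms(5), of s2 l2] w md by (simp add: qv_tge)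
    ultimately have "\<rho> (s1 \<or> s2) (f * g) l" using rho_mult[OF P w(1,2)] w(3) by blast
    then show ?thesis using rho_weaken[OF polys_mult[OF sub P] l l] w(4) by blast
  qed
qed

lemma above_mult:
  assumes q: "qcut vb \<delta>" and P: "f \<in> polys F" "g \<in> polys F" and "below \<rho> (qv a \<delta>) f" "below \<rho> (qv a \<delta>) g"
  shows "below \<rho> (qv a \<delta>) (f * g)"
  unfolding below_def
proof (intro allI ballI impI, rule ccontr)
  fix s l assume l: "l \<in> \<Gamma>" and r: "\<rho> s (f * g) l" and h: "\<not> qv a \<delta> s (f * g) l"
  have nz: "f \<noteq> 0" "g \<noteq> 0" using h by auto
  obtain n e where ne: "lmon a \<delta> f = (n, e)" by fastforce
  obtain m d where md: "lmon a \<delta> g = (m, d)" by fastforce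
  have "\<not> tge \<delta> s (n + m, e + d) l" using h nz ne md by (simp add: qv_tge lmon_mult[OF q])
  then obtain s1 s2 l1 l2 where "l1 \<in> \<Gamma>" "l2 \<in> \<Gamma>" "l1 + l2 = l" "s1 \<and> s2 \<longrightarrow> s" "\<not> tge \<delta> s1 (n, e) l1" "\<not> tge \<delta> s2 (m, d) l2"
    using not_tge_split[OF q, of s n m e d l] lmon_nonneg[OF q nz(1), of a] lmon_nonneg[OF q nz(2), of a]
      lmon_in[OF q nz(1), of a] lmon_in[OF q nz(2), of a] l ne md by auto
  note w = this
  have "\<not> \<rho> s1 f l1" using belowD[OF assms(4), of s1 l1] w ne nz by (auto simp: qv_tge)
  moreover have "\<not> \<rho> s2 g l2" using belowD[OF assms(5), of s2 l2] w md nz by (auto simp: qv_tge)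
  ultimately have "\<not> \<rho> (s1 \<and> s2) (f * g) l" using rho_mult_neg[OF P w(1,2)] w(3) by blast
  then show False using rho_weaken[OF polys_mult[OF sub P] l l r, of "s1 \<and> s2"] w(4) by blast
qed

text \<open>A polynomial of least degree with a root in the ball plays the role of a minimal polynomial
  of a center: division by it (or of it) compares \<open>\<phi>\<close> with polynomials of smaller degree.\<close>

lemma rootfree_above:
  assumes q: "qcut vb \<delta>" and bel: "\<And>f. f \<in> polys F \<Longrightarrow> below (qv a \<delta>) \<rho> f"
    and phi: "\<phi> \<in> polys F" "rootfree (vball vb a \<delta>) \<phi>"
    and small: "\<And>f. f \<in> polys F \<Longrightarrow> degree f < degree \<phi> \<Longrightarrow> rootfree (vball vb a \<delta>) f \<Longrightarrow> below \<rho> (qv a \<delta>) f"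
  shows "below \<rho> (qv a \<delta>) \<phi>"
proof -
  let ?Z = "vball vb a \<delta>"
  let ?R = "\<lambda>h. h \<in> polys F \<and> h \<noteq> 0 \<and> (\<exists>c\<in>?Z. poly h c = 0)"
  obtain g0 where "?R g0" using alg[of a] vball_self[of a \<delta>] by blast
  then obtain g where g: "?R g" and gmin: "\<And>h. ?R h \<Longrightarrow> degree g \<le> degree h"
    using ex_has_least_nat[of ?R g0 degree] by blast
  obtain b where b: "b \<in> ?Z" "poly g b = 0" using g by blast
  have Zb: "vball vb b \<delta> = ?Z" by (rule vball_recenter[OF q b(1)])
  have rf: "rootfree ?Z h" if "h \<in> polys F" "h \<noteq> 0" "degree h < degree g" for h
    using gmin[of h] that by (force simp: rootfree_def)
  have qb: "qv b \<delta> s f l \<longleftrightarrow> qv a \<delta> s f l" if "l \<in> \<Gamma>" for s f l by (rule qv_recenter[OF q b(1) that])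
  have unit: "qv b \<delta> True (h - [:poly h b:]) (vb (poly h b))" "poly h b \<noteq> 0" if "rootfree ?Z h" for h
    using rootfree_unit[OF q, of b h] that Zb by (auto simp: unit_at_def)
  let ?k = "vb (poly \<phi> b)"
  have pb: "poly \<phi> b \<noteq> 0" by (rule unit(2)[OF phi(2)])
  have k: "?k \<in> \<Gamma>" using pb by simp
  have phinz: "\<phi> \<noteq> 0" using phi by (simp add: rootfree_def)
  \<comment> \<open>As \<open>\<phi>\<close> has no root in the ball, its \<omega> is
    \<open>?k\<close>; it remains to exclude that its value under \<rho> is larger.\<close>
  have key: "\<not> \<rho> True \<phi> ?k"
  proof
    assume gt: "\<rho> True \<phi> ?k"
    have degpos: "degree \<phi> > 0"
    proof (rule ccontr)
      assume "\<not> ?thesis"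
      then obtain c where c: "\<phi> = [:c:]" by (metis degree_eq_zeroE gr0I)
      then have "c \<in> F" using phi(1) by (auto simp: polys_def dest: spec[of _ 0])
      then show False using gt k rho_const[of c ?k True] c pb by (simp add: vge_def)
    qed
    show False
    proof (cases "degree g \<le> degree \<phi>")
      case True
      obtain u r where ur: "u \<in> polys F" "r \<in> polys F" "\<phi> = u * g + r" "r = 0 \<or> degree r < degree g"
        using polys_division[OF sub phi(1), of g] g by blast
      have rb: "poly r b = poly \<phi> b" using ur(3) b(2) by simp
      then have rnz: "r \<noteq> 0" using pb by auto
      then have dr: "degree r < degree g" using ur(4) by blast
      have rr: "rootfree ?Z r" by (rule rf[OF ur(2) rnz dr])
      \<comment> \<open>At the root b of \<open>g\<close> the polynomials \<open>\<phi>\<close> and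
        \<open>r\<close> take the same value, so their constants cancel: \<open>u * g\<close> has
        \<omega>, hence also \<rho>, above \<open>?k\<close>. Then \<rho>(r) exceeds
        \<open>?k\<close> = \<omega>(r), against the hypothesis for smaller degree.\<close>
      have "qv b \<delta> True ((\<phi> - [:poly \<phi> b:]) - (r - [:poly r b:])) ?k"
        by (rule qv_diff[OF q k unit(1)[OF phi(2)]]) (use unit(1)[OF rr] rb in simp)
      moreover have "(\<phi> - [:poly \<phi> b:]) - (r - [:poly r b:]) = u * g"
        unfolding rb by (subst ur(3)) simp
      ultimately have "qv b \<delta> True (u * g) ?k" by simp
      then have "\<rho> True (u * g) ?k"
        using bel[OF polys_mult[OF sub ur(1)], of g] g k by (auto simp: qb below_def)
      then have "\<rho> True (\<phi> - u * g) ?k"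
        using gt phi(1) ur g k by (intro rho_diff polys_mult sub) auto
      then have "\<rho> True r ?k" using ur(3) by simp
      then have "qv a \<delta> True r ?k" using small[OF ur(2) _ rr] dr True k by (auto simp: below_def)
      then show False using qv_rootfree[OF q rr b(1) k, of True] rb by (simp add: vge_def pb)
    next
      case False
      \<comment> \<open>Now \<open>g\<close> has the larger degree and is divided by
        \<open>\<phi>\<close>. Evaluation at b shows that \<open>u * \<phi>\<close> and
        \<open>r\<close> are opposite there, so their constants cancel in \<open>g\<close>;
        minimality of \<open>g\<close> keeps \<open>u\<close> and \<open>r\<close> free of roots in
        the ball.\<close>
      obtain u r where ur: "u \<in> polys F" "r \<in> polys F" "g = u * \<phi> + r" "r = 0 \<or> degree r < degree \<phi>"
        using polys_division[OF sub _ phi(1) phinz, of g] g by blast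
      have dr: "degree r < degree \<phi>" using ur(4) degpos by auto
      have unz: "u \<noteq> 0" using ur(3) dr False by auto
      have "degree (u * \<phi>) = degree u + degree \<phi>" using unz phinz by (rule degree_mult_eq)
      moreover from this have "degree g = degree (u * \<phi>)" using ur(3) dr by (simp add: degree_add_eq_left)
      ultimately have du: "degree u < degree g" using degpos by simp
      have ru: "rootfree ?Z u" by (rule rf[OF ur(1) unz du])
      have ub: "poly u b \<noteq> 0" by (rule unit(2)[OF ru])
      let ?k' = "vb (poly u b) + ?k"
      have rb: "poly r b = - (poly u b * poly \<phi> b)" using ur(3) b(2) by (simp add: eq_neg_iff_add_eq_0 add.commute)
      have rnz: "r \<noteq> 0" using rb ub pb by auto
      have rr: "rootfree ?Z r" using rf[OF ur(2) rnz] dr False by simp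
      have vrb: "vb (poly r b) = ?k'" using rb ub pb by (simp add: v_mult)
      have k': "?k' \<in> \<Gamma>" using ub k by simp
      have rup: "rootfree ?Z (u * \<phi>)" using ru phi(2) by (simp add: rootfree_def)
      have "qv b \<delta> True ((u * \<phi> - [:poly (u * \<phi>) b:]) + (r - [:poly r b:])) ?k'"
        by (rule qv_add[OF q k']) (use unit(1)[OF rup] unit(1)[OF rr] vrb ub pb in \<open>simp_all add: v_mult\<close>)
      moreover have "(u * \<phi> - [:poly (u * \<phi>) b:]) + (r - [:poly r b:]) = g"
        unfolding rb by (subst ur(3)) simp
      ultimately have "qv b \<delta> True g ?k'" by simp
      then have 1: "\<rho> True g ?k'" using bel[of g] g k' by (auto simp: qb below_def)
      have "qv a \<delta> False u (vb (poly u b))" using qv_rootfree[OF q ru b(1), of "vb (poly u b)" False] ub by (simp add: vge_def)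
      then have "\<rho> False u (vb (poly u b))" using bel[OF ur(1)] ub by (auto simp: below_def)
      then have "\<rho> (False \<or> True) (u * \<phi>) ?k'" using gt ub k by (intro rho_mult ur phi) auto
      then have "\<rho> True (g - u * \<phi>) ?k'" using 1 k' g ur phi by (intro rho_diff polys_mult sub) auto
      then have "\<rho> True r ?k'" using ur(3) by simp
      then have "qv a \<delta> True r ?k'" using small[OF ur(2) dr rr] k' by (auto simp: below_def)
      then show False using qv_rootfree[OF q rr b(1) k', of True] vrb rb ub pb by (simp add: vge_def)
    qed
  qed
  show ?thesis unfolding below_def
  proof (intro allI ballI impI)
    fix s l assume l: "l \<in> \<Gamma>" and r: "\<rho> s \<phi> l"
    have "l < ?k \<or> l = ?k \<and> \<not> s" using rho_weaken[OF phi(1) l k r, of True] key by fastforce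
    then show "qv a \<delta> s \<phi> l" using qv_rootfree[OF q phi(2) b(1) l, of s] by (auto simp: vge_def)
  qed
qed

text \<open>In f = u g + r nothing cancels: u g has the root c and thus positive leading exponent,
  while a nonzero r has no root in the open ball and thus exponent 0. So \<omega>(f) is the minimum
  of \<omega>(u g) and \<omega>(r), and induction on the degree handles u. It is enough to test
  \<open>g\<close> and the polynomials of smaller degree.\<close>

lemma expand_below:
  assumes q: "qcut vb \<delta>" and g: "g \<in> polys F" "g \<noteq> 0" "poly g c = 0"
    and rf: "\<And>r. r \<in> polys F \<Longrightarrow> r \<noteq> 0 \<Longrightarrow> degree r < degree g \<Longrightarrow> rootfree (vball vb c (cutp \<delta>)) r"
    and bg: "below (qv c \<delta>) \<rho> g"
    and br: "\<And>r. r \<in> polys F \<Longrightarrow> r \<noteq> 0 \<Longrightarrow> degree r < degree g \<Longrightarrow> below (qv c \<delta>) \<rho> r"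
    and f: "f \<in> polys F"
  shows "below (qv c \<delta>) \<rho> f"
  using f
proof (induction "degree f" arbitrary: f rule: less_induct)
  case less
  have dg: "degree g > 0"
  proof (rule ccontr)
    assume "\<not> ?thesis"
    then obtain e where "g = [:e:]" by (metis degree_eq_zeroE gr0I)
    then show False using g by simp
  qed
  obtain u r where ur: "u \<in> polys F" "r \<in> polys F" "f = u * g + r" "r = 0 \<or> degree r < degree g"
    using polys_division[OF sub less.prems g(1,2)] by blast
  have br': "below (qv c \<delta>) \<rho> r"
    using br[OF ur(2)] ur(4) rho_0 by (cases "r = 0") (auto simp: below_def)
  show ?case
  proof (cases "u = 0")
    case True
    then show ?thesis using br' ur by simp
  next
    case False
    have dr: "degree r < degree g" using ur(4) dg by auto
    have "degree (u * g) = degree u + degree g" using False g(2) by (rule degree_mult_eq)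
    moreover from this have "degree f = degree (u * g)" using ur(3) dr by (simp add: degree_add_eq_left)
    ultimately have "degree u < degree f" using dg by simp
    then have "below (qv c \<delta>) \<rho> u" using less.hyps ur(1) by blast
    then have bug: "below (qv c \<delta>) \<rho> (u * g)" by (rule below_mult[OF q ur(1) g(1) _ bg])
    have ug: "u * g \<noteq> 0" using False g by simp
    show ?thesis unfolding below_def
    proof (intro allI ballI impI)
      fix s l assume l: "l \<in> \<Gamma>" and h: "qv c \<delta> s f l"
      have "qv c \<delta> s (u * g) l \<and> qv c \<delta> s r l"
      proof (cases "r = 0")
        case True
        then show ?thesis using h ur by simp
      next
        case rnz: False
        have "fst (lmon c \<delta> (u * g)) \<ge> 1" by (rule lmon_root[OF q ug, of c]) (use g in auto)
        moreover have "lmon c (cutp \<delta>) r = (0, vb (poly r c))"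
          using rootfree_unit[OF qcut_cutp[OF q] rf[OF ur(2) rnz dr]]
          by (intro unit_at_lmon) (auto simp: q)
        then have "lmon c \<delta> r = (0, vb (poly r c))" by (simp add: lmon_def)
        ultimately have "fst (lmon c \<delta> (u * g)) \<noteq> fst (lmon c \<delta> r)" by simp
        from qv_add_distinct[OF q ug rnz this] h ur(3) show ?thesis by blast
      qed
      then have "\<rho> s (u * g) l" "\<rho> s r l" using bug br' l by (auto simp: below_def)
      then show "\<rho> s f l" unfolding ur(3) using l ur g by (intro rho_add polys_mult sub) auto
    qed
  qed
qed

text \<open>Nests are maximal: one that lies below \<rho> already defines \<rho>. A counterexample
  of least degree has no roots in a deep member, and that member agrees with the nest on all
  polynomials without roots in it, so the argument for balls applies to the member.\<close>

lemma nest_above: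
  assumes N: "nest vb N" and bel: "\<And>f. f \<in> polys F \<Longrightarrow> below (nqv N) \<rho> f" and f: "f \<in> polys F"
  shows "below \<rho> (nqv N) f"
proof (rule ccontr)
  assume "\<not> ?thesis"
  then obtain \<phi> where phi: "\<phi> \<in> polys F" "\<not> below \<rho> (nqv N) \<phi>"
    and pmin: "\<And>h. h \<in> polys F \<Longrightarrow> \<not> below \<rho> (nqv N) h \<Longrightarrow> degree \<phi> \<le> degree h"
    using ex_has_least_nat[of "\<lambda>h. h \<in> polys F \<and> \<not> below \<rho> (nqv N) h" f degree] f by blast
  have "\<phi> \<noteq> 0"
  proof
    assume "\<phi> = 0"
    obtain B where "B \<in> N" using N by (auto simp: nest_def)
    then have "below \<rho> (nqv N) 0" by (metis nest_ballE[OF N] below_def nqv_def qv_0)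
    then show False using phi \<open>\<phi> = 0\<close> by simp
  qed
  then obtain B where B: "B \<in> N" "rootfree B \<phi>" using nest_rootfree[OF N] by blast
  obtain a \<gamma> where a: "\<gamma> \<in> \<Gamma>" "B = vcball vb a \<gamma>" using nest_ballE[OF N B(1)] .
  have vB: "vball vb a (pq vb \<gamma>) = B" using a by (simp add: vball_pq)
  have aB: "a \<in> B" using a by simp
  have eq: "nqv N s h l \<longleftrightarrow> qv a (pq vb \<gamma>) s h l" if "rootfree B h" "l \<in> \<Gamma>" for s h l
    using nqv_rootfree[OF N B(1) that(1) aB that(2)] qv_rootfree[OF qcut_pq _ _ that(2), of a \<gamma> h a s] vB that aB by simp
  have "below \<rho> (qv a (pq vb \<gamma>)) \<phi>"
  proof (rule rootfree_above[OF qcut_pq _ phi(1)])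
    show "below (qv a (pq vb \<gamma>)) \<rho> h" if "h \<in> polys F" for h
      using nqv_ball_below[of a \<gamma> N h] bel[OF that] a B below_trans by blast
    show "below \<rho> (qv a (pq vb \<gamma>)) h" if "h \<in> polys F" "degree h < degree \<phi>" "rootfree (vball vb a (pq vb \<gamma>)) h" for h
    proof -
      have "below \<rho> (nqv N) h" using pmin[of h] that by force
      then show ?thesis using eq that(3) unfolding vB by (auto simp: below_def)
    qed
  qed (use vB B in simp)
  then have "below \<rho> (nqv N) \<phi>" using eq B(2) by (auto simp: below_def)
  then show False using phi by blast
qed

end


section \<open>Lifting balls along an inequality of valuations\<close>

context vfield
begin

text \<open>\<^term>\<open>tval c f l\<close> is \<open>\<omega>\<^bsub>B(c,l)\<^esub>(f)\<close> as a function of the radius \<open>l\<close>; it is an increasing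
  bijection of \<open>\<Gamma>\<close> when \<open>f(c) = 0\<close>.\<close>

definition tval :: "'l \<Rightarrow> 'l poly \<Rightarrow> 'g \<Rightarrow> 'g" where
  "tval c f l = Min ((\<lambda>t. snd t + zsm (fst t) l) ` mterms c f)"

lemma tval_le: "t \<in> mterms c f \<Longrightarrow> tval c f l \<le> snd t + zsm (fst t) l"
  unfolding tval_def by (rule Min_le) (auto simp: mterms_finite)

lemma tval_attained: "f \<noteq> 0 \<Longrightarrow> \<exists>t\<in>mterms c f. tval c f l = snd t + zsm (fst t) l"
proof -
  assume "f \<noteq> 0"
  then have "tval c f l \<in> (\<lambda>t. snd t + zsm (fst t) l) ` mterms c f"
    unfolding tval_def by (intro Min_in) (auto simp: mterms_finite mterms_nonempty)
  then show ?thesis by blast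
qed

lemma tval_in: "f \<noteq> 0 \<Longrightarrow> l \<in> \<Gamma> \<Longrightarrow> tval c f l \<in> \<Gamma>"
  using tval_attained[of f c l] mterms_snd by fastforce

lemma mterms_pos: "poly f c = 0 \<Longrightarrow> t \<in> mterms c f \<Longrightarrow> 0 < fst t"
proof -
  assume "poly f c = 0" "t \<in> mterms c f"
  then obtain n where n: "t = (int n, vb (coeff (pcompose f [:c, 1:]) n))" "coeff (pcompose f [:c, 1:]) n \<noteq> 0"
    by (auto simp: mterms_def)
  have "n \<noteq> 0" using n(2) \<open>poly f c = 0\<close> by (metis coeff_pCons_0 coeff_pcompose_0)
  then show ?thesis using n by simp
qed

lemma tval_strict_mono:
  assumes "f \<noteq> 0" "poly f c = 0" "l < l'" shows "tval c f l < tval c f l'"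
proof -
  obtain t where t: "t \<in> mterms c f" "tval c f l' = snd t + zsm (fst t) l'" using tval_attained[OF assms(1)] by blast
  have "tval c f l \<le> snd t + zsm (fst t) l" by (rule tval_le[OF t(1)])
  also have "\<dots> < snd t + zsm (fst t) l'" using zsm_strict_mono[OF mterms_pos[OF assms(2) t(1)] assms(3)] by simp
  finally show ?thesis using t by simp
qed

text \<open>Each term is an increasing affine function of the radius, onto \<Gamma> by divisibility.
  The largest of the individual solutions is the radius at which all terms have reached
  \<open>k\<close> and one of them equals it.\<close>

lemma tval_surj:
  assumes f: "f \<noteq> 0" "poly f c = 0" and k: "k \<in> \<Gamma>"
  shows "\<exists>l\<in>\<Gamma>. tval c f l = k"
proof -
  have "\<forall>t\<in>mterms c f. \<exists>h\<in>\<Gamma>. zsm (fst t) h = k - snd t"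
    using mterms_pos[OF f(2)] k mterms_snd by (intro ballI Gam_zdivide) auto
  then obtain h where h: "\<And>t. t \<in> mterms c f \<Longrightarrow> h t \<in> \<Gamma>" "\<And>t. t \<in> mterms c f \<Longrightarrow> zsm (fst t) (h t) = k - snd t"
    by metis
  let ?l = "Max (h ` mterms c f)"
  have fin: "finite (h ` mterms c f)" "h ` mterms c f \<noteq> {}" by (simp_all add: mterms_finite mterms_nonempty[OF f(1)])
  obtain t where t: "t \<in> mterms c f" "?l = h t" using Max_in[OF fin] by auto
  have "k \<le> snd u + zsm (fst u) ?l" if "u \<in> mterms c f" for u
  proof -
    have "zsm (fst u) (h u) \<le> zsm (fst u) ?l"
      using mterms_pos[OF f(2) that] fin that by (intro zsm_mono) auto
    then show ?thesis using h(2)[OF that] by (simp add: algebra_simps)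
  qed
  moreover have "k = snd t + zsm (fst t) ?l" using h(2)[OF t(1)] t(2) by simp
  ultimately have "tval c f ?l = k"
    using tval_le[OF t(1), of ?l] tval_attained[OF f(1), of c ?l] by (metis antisym)
  then show ?thesis using h(1)[OF t(1)] t(2) by metis
qed

lemma qv_tval_False:
  assumes q: "qcut vb \<delta>" and f: "f \<noteq> 0" and l: "l \<in> fst \<delta>"
  shows "qv c \<delta> False f (tval c f l)"
proof -
  have lG: "l \<in> \<Gamma>" using l qcut_fst[OF q] by blast
  have "tge \<delta> False t (tval c f l)" if t: "t \<in> mterms c f" for t
  proof -
    have "tge \<delta> False (fst t, snd t) (snd t + zsm (fst t) l)"
      using t by (intro tge_lo[OF l]) (auto simp: mterms_def)
    then show ?thesis
      using tge_weaken[OF q mterms_snd[OF t], of "snd t + zsm (fst t) l" "tval c f l" False False]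
        tval_le[OF t, of l] tval_in[OF f lG] mterms_snd[OF t] lG by (auto simp: order_le_less)
  qed
  then show ?thesis using qv_mterms[OF q tval_in[OF f lG]] by blast
qed

lemma qv_tval_True:
  assumes q: "qcut vb \<delta>" and f: "f \<noteq> 0" "poly f c = 0" and l: "l \<in> \<Gamma>" "l \<notin> snd \<delta>"
  shows "qv c \<delta> True f (tval c f l)"
proof -
  have "tge \<delta> True t (tval c f l)" if t: "t \<in> mterms c f" for t
  proof -
    have "tge \<delta> True (fst t, snd t) (snd t + zsm (fst t) l)"
      using t by (intro tge_lo_strict[OF q l] mterms_pos[OF f(2)])
    then show ?thesis
      using tge_weaken[OF q mterms_snd[OF t], of "snd t + zsm (fst t) l" "tval c f l" True True]
        tval_le[OF t, of l] tval_in[OF f(1) l(1)] mterms_snd[OF t] l by (auto simp: order_le_less)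
  qed
  then show ?thesis using qv_mterms[OF q tval_in[OF f(1) l(1)]] by blast
qed

text \<open>A point other than the centre belongs to the ball of \<open>cutp \<delta>\<close>
  exactly when its distance is not in the left side, so comparing left sides is enough.\<close>

lemma vball_cutp_antimono:
  assumes "qcut vb \<delta>" "qcut vb \<epsilon>" "fst \<delta> \<subseteq> fst \<epsilon>"
  shows "vball vb c (cutp \<epsilon>) \<subseteq> vball vb c (cutp \<delta>)"
proof
  fix x assume "x \<in> vball vb c (cutp \<epsilon>)"
  then have "x = c \<or> vb (x - c) \<in> \<Gamma> \<and> vb (x - c) \<notin> fst \<epsilon>"
    using qcut_snd[OF assms(2)] by (auto simp: vball_iff assms) (auto simp: cutp_def)
  then show "x \<in> vball vb c (cutp \<delta>)"
    using assms qcut_in_or[OF assms(1)] by (auto simp: vball_iff) (auto simp: cutp_def)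
qed

end

context qvalued
begin

text \<open>The MacLane step: \<open>\<phi>\<close> of least degree with \<open>\<omega>\<^sub>Z(\<phi>) < \<rho>(\<phi>)\<close> has a root \<open>c\<close> in the ball, and
  the ball around \<open>c\<close> can be shrunk until \<open>\<omega>(\<phi>) = \<rho>(\<phi>)\<close>.\<close>

lemma ball_step:
  assumes q: "qcut vb \<delta>" and bel: "\<And>f. f \<in> polys F \<Longrightarrow> below (qv a \<delta>) \<rho> f"
    and ex: "\<exists>f\<in>polys F. \<not> below \<rho> (qv a \<delta>) f"
  shows "\<exists>c \<epsilon>. qcut vb \<epsilon> \<and> le_qcut \<delta> \<epsilon> \<and> \<delta> \<noteq> \<epsilon> \<and> c \<in> vball vb a \<delta> \<and> (\<forall>f\<in>polys F. below (qv c \<epsilon>) \<rho> f)"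
proof -
  let ?R = "\<lambda>h. h \<in> polys F \<and> \<not> below \<rho> (qv a \<delta>) h"
  obtain \<phi> where phi: "\<phi> \<in> polys F" "\<not> below \<rho> (qv a \<delta>) \<phi>"
    and pmin: "\<And>h. h \<in> polys F \<Longrightarrow> \<not> below \<rho> (qv a \<delta>) h \<Longrightarrow> degree \<phi> \<le> degree h"
    using ex_has_least_nat[of ?R _ degree] ex by blast
  have nz: "\<phi> \<noteq> 0" using phi by (auto simp: below_def)
  have "\<not> rootfree (vball vb a \<delta>) \<phi>"
    using rootfree_above[OF q bel phi(1)] phi(2) pmin by (meson not_less)
  then obtain c where c: "c \<in> vball vb a \<delta>" "poly \<phi> c = 0" using nz by (auto simp: rootfree_def)
  have qc: "qv c \<delta> s f l \<longleftrightarrow> qv a \<delta> s f l" if "l \<in> \<Gamma>" for s f l by (rule qv_recenter[OF q c(1) that])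
  have bel': "below (qv c \<delta>) \<rho> f" if "f \<in> polys F" for f using bel[OF that] by (simp add: below_def qc)
  have ab: "below \<rho> (qv c \<delta>) f" if "f \<in> polys F" "degree f < degree \<phi>" for f
    using pmin[of f] that by (force simp: below_def qc)
  have nab: "\<not> below \<rho> (qv c \<delta>) \<phi>" using phi(2) by (simp add: below_def qc)
  have lphi: "1 \<le> fst (lmon c \<delta> \<phi>)" by (rule lmon_root[OF q nz c(2)]) simp
  have rf_lmon: "lmon c \<delta> r = (0, vb (poly r c))" if "rootfree (vball vb c (cutp \<delta>)) r" for r
  proof -
    have "lmon c (cutp \<delta>) r = (0, vb (poly r c))"
      using rootfree_unit[OF qcut_cutp[OF q] that] by (intro unit_at_lmon) (auto simp: q)
    then show ?thesis by (simp add: lmon_def)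
  qed
  \<comment> \<open>Polynomials of smaller degree have no root in the open ball around c. Otherwise
    divide \<open>\<phi>\<close> by the least such \<open>g\<close>: in u g + r the part u g leads,
    because \<open>\<phi>\<close> and u g have positive leading exponent and r has exponent 0. So
    \<open>\<phi>\<close> has the same \<omega> as u g, which is at least \<rho>(u g), and this
    bounds the value of \<open>\<phi>\<close> under \<rho> as well.\<close>
  have rf: "rootfree (vball vb c (cutp \<delta>)) r" if r0: "r \<in> polys F" "r \<noteq> 0" "degree r < degree \<phi>" for r
  proof (rule ccontr)
    assume "\<not> ?thesis"
    let ?Q = "\<lambda>h. h \<in> polys F \<and> h \<noteq> 0 \<and> \<not> rootfree (vball vb c (cutp \<delta>)) h"
    obtain g where g: "?Q g" and gmin: "\<And>h. ?Q h \<Longrightarrow> degree g \<le> degree h"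
      using ex_has_least_nat[of ?Q r degree] r0 \<open>\<not> rootfree _ r\<close> by blast
    have dg: "degree g < degree \<phi>" using gmin[of r] r0 \<open>\<not> rootfree _ r\<close> by simp
    obtain d where d: "d \<in> vball vb c (cutp \<delta>)" "poly g d = 0" using g by (auto simp: rootfree_def)
    have dgpos: "degree g > 0"
    proof (rule ccontr)
      assume "\<not> ?thesis"
      then obtain e where "g = [:e:]" by (metis degree_eq_zeroE gr0I)
      then show False using g d by simp
    qed
    obtain u r where ur: "u \<in> polys F" "r \<in> polys F" "\<phi> = u * g + r" "r = 0 \<or> degree r < degree g"
      using polys_division[OF sub phi(1), of g] g by blast
    have dr: "degree r < degree g" using ur(4) dgpos by auto
    have unz: "u \<noteq> 0" using ur(3) dr dg by auto
    have "degree (u * g) = degree u + degree g" using unz g by (intro degree_mult_eq) auto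
    moreover from this have "degree \<phi> = degree (u * g)" using ur(3) dr by (simp add: degree_add_eq_left)
    ultimately have du: "degree u < degree \<phi>" using dgpos by simp
    have abug: "below \<rho> (qv c \<delta>) (u * g)"
      using g by (intro above_mult[OF q ur(1)] ab ur du dg) auto
    have rnz: "r \<noteq> 0" using abug nab ur(3) by auto
    have "rootfree (vball vb c (cutp \<delta>)) r" using gmin[of r] dr ur(2) rnz by force
    then have lr: "lmon c \<delta> r = (0, vb (poly r c))" "poly r c \<noteq> 0"
      using rf_lmon by (auto simp: rootfree_def)
    let ?k = "vb (poly r c)"
    have k: "?k \<in> \<Gamma>" using lr by simp
    have ug: "u * g \<noteq> 0" using unz g by simp
    have lug: "1 \<le> fst (lmon c \<delta> (u * g))" by (rule lmon_root[OF q ug _ d(1)]) (simp add: d)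
    have n1: "le_Gd (cutp \<delta>) (lmon c \<delta> (u * g)) (lmon c \<delta> r)"
    proof (rule ccontr)
      assume "\<not> ?thesis"
      then have "lmon c \<delta> (r + u * g) = lmon c \<delta> r" by (intro lmon_add_eq[OF q rnz ug])
      then show False using lphi lr ur(3) by (simp add: add.commute)
    qed
    then have n2: "\<not> le_Gd (cutp \<delta>) (lmon c \<delta> r) (lmon c \<delta> (u * g))"
      using le_antisym[OF qcut_cutp[OF q] not_principal_cutp n1] lug lr by auto
    then have eq: "lmon c \<delta> \<phi> = lmon c \<delta> (u * g)"
      using lmon_add_eq(2)[OF q ug rnz n2] ur(3) by simp
    \<comment> \<open>The inequality \<omega>(u g) < \<omega>(r) is strict also in the order of
      \<open>\<delta>\<close>: r has the smaller exponent, and in that case \<open>cutp\<close>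
      changes nothing.\<close>
    have n3: "\<not> qv c \<delta> False (u * g) ?k"
      using n2 lug ug unfolding qv_def lr by (simp add: le_cutp_iff)
    have rk: "\<rho> False r ?k" using bel'[OF ur(2)] lr k by (auto simp: below_def qv_tge)
    have "below \<rho> (qv c \<delta>) \<phi>" unfolding below_def
    proof (intro allI ballI impI, rule ccontr)
      fix s l assume l: "l \<in> \<Gamma>" and r1: "\<rho> s \<phi> l" and nq: "\<not> qv c \<delta> s \<phi> l"
      have ug_eq: "u * g = \<phi> - r" using ur(3) by simp
      have ugP: "u * g \<in> polys F" using ur g by (intro polys_mult sub) auto
      show False
      \<comment> \<open>Up to the level \<omega>(r) = \<open>?k\<close> a bound for
        \<open>\<phi>\<close> passes to u g; beyond it, \<rho>(u g) \<ge> \<open>?k\<close> would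
        follow, against \<omega>(u g) < \<open>?k\<close>.\<close>
      proof (cases "l < ?k \<or> l = ?k \<and> \<not> s")
        case True
        then have "qv c \<delta> s r l" using lr by (auto simp: qv_tge)
        then have "\<rho> s r l" using bel'[OF ur(2)] l by (simp add: below_def)
        then have "\<rho> s (u * g) l" unfolding ug_eq using r1 by (intro rho_diff phi ur l)
        then have "qv c \<delta> s (u * g) l" using abug l by (simp add: below_def)
        then show False using nq eq nz ug by (simp add: qv_tge)
      next
        case False
        then have "\<rho> False \<phi> ?k" using rho_weaken[OF phi(1) l k r1, of False] by fastforce
        then have "\<rho> False (u * g) ?k" unfolding ug_eq using rk by (intro rho_diff phi ur k)
        then show False using n3 abug k by (simp add: below_def)
      qed
    qed
    then show False using nab by blast
  qed
  \<comment> \<open>The new radius is the quasi-cut of the levels l at which the ball of radius l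
    around c gives \<open>\<phi>\<close> at most its value under \<rho>. As \<open>tval\<close> is a
    bijection of \<Gamma>, this makes both values of \<open>\<phi>\<close> equal even if they lie in
    a gap.\<close>
  define \<epsilon> where "\<epsilon> = ({l\<in>\<Gamma>. \<rho> False \<phi> (tval c \<phi> l)}, {l\<in>\<Gamma>. \<not> \<rho> True \<phi> (tval c \<phi> l)})"
  have tG: "tval c \<phi> l \<in> \<Gamma>" if "l \<in> \<Gamma>" for l using tval_in[OF nz that] .
  have qe: "qcut vb \<epsilon>"
  proof -
    have "\<rho> False \<phi> (tval c \<phi> l)" if "l \<in> \<Gamma>" "\<rho> True \<phi> (tval c \<phi> l)" for l
      using rho_weaken[OF phi(1) tG tG, of l l True False] that by simp
    moreover have "l \<le> r" if "l \<in> \<Gamma>" "\<rho> False \<phi> (tval c \<phi> l)" "r \<in> \<Gamma>" "\<not> \<rho> True \<phi> (tval c \<phi> r)" for l r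
      using rho_weaken[OF phi(1) tG tG, of l r False True] that tval_strict_mono[OF nz c(2), of r l] by force
    ultimately show ?thesis unfolding qcut_def \<epsilon>_def by auto
  qed
  have le: "le_qcut \<delta> \<epsilon>"
  proof -
    have "l \<in> fst \<epsilon>" if "l \<in> fst \<delta>" for l
    proof -
      have "l \<in> \<Gamma>" using that qcut_fst[OF q] by blast
      then show ?thesis using qv_tval_False[OF q nz that, of c] bel'[OF phi(1)] tG by (auto simp: \<epsilon>_def below_def)
    qed
    moreover have "l \<in> snd \<delta>" if "l \<in> snd \<epsilon>" for l
      using qv_tval_True[OF q nz c(2), of l] bel'[OF phi(1)] tG that by (auto simp: \<epsilon>_def below_def)
    ultimately show ?thesis by (auto simp: le_qcut_def)
  qed
  have ne: "\<delta> \<noteq> \<epsilon>"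
  proof
    assume de: "\<delta> = \<epsilon>"
    obtain s k where sk: "k \<in> \<Gamma>" "\<rho> s \<phi> k" "\<not> qv c \<delta> s \<phi> k" using nab by (auto simp: below_def)
    obtain l where l: "l \<in> \<Gamma>" "tval c \<phi> l = k" using tval_surj[OF nz c(2) sk(1)] by blast
    show False
    proof (cases s)
      case True
      then have "l \<notin> snd \<delta>" using sk l by (simp add: de \<epsilon>_def)
      then show False using qv_tval_True[OF q nz c(2) l(1)] sk l True by simp
    next
      case False
      then have "l \<in> fst \<delta>" using sk l by (simp add: de \<epsilon>_def)
      then show False using qv_tval_False[OF q nz, of l c] sk l False by simp
    qed
  qed
  have bphi: "below (qv c \<epsilon>) \<rho> \<phi>" unfolding below_def
  proof (intro allI ballI impI)
    fix s k assume k: "k \<in> \<Gamma>" and h: "qv c \<epsilon> s \<phi> k"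
    obtain l where l: "l \<in> \<Gamma>" "tval c \<phi> l = k" using tval_surj[OF nz c(2) k] by blast
    obtain t where t: "t \<in> mterms c \<phi>" "k = snd t + zsm (fst t) l" using tval_attained[OF nz, of c l] l by auto
    have tp: "0 < fst t" by (rule mterms_pos[OF c(2) t(1)])
    have tt: "tge \<epsilon> s (fst t, snd t) (snd t + zsm (fst t) l)" using h t unfolding qv_mterms[OF qe k] by auto
    show "\<rho> s \<phi> k"
    proof (cases s)
      case True
      then have "l \<notin> snd \<epsilon>" using tge_hi[of l \<epsilon> "fst t" "snd t"] tt tp by auto
      then show ?thesis using l True by (simp add: \<epsilon>_def)
    next
      case False
      then have "l \<in> fst \<epsilon>" using tge_hi_strict[OF qe l(1) _ tp, of "snd t"] tt by auto
      then show ?thesis using l False by (simp add: \<epsilon>_def)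
    qed
  qed
  \<comment> \<open>Below the degree of \<open>\<phi>\<close> there are no roots in the open ball,
    so the values v(r(c)) do not depend on the radius and stay below \<rho>.\<close>
  have "below (qv c \<epsilon>) \<rho> f" if f: "f \<in> polys F" for f
  proof (rule expand_below[OF qe phi(1) nz c(2) _ bphi _ f])
    show "rootfree (vball vb c (cutp \<epsilon>)) r" if "r \<in> polys F" "r \<noteq> 0" "degree r < degree \<phi>" for r
      using rootfree_subset[OF rf[OF that] vball_cutp_antimono[OF q qe]] le by (simp add: le_qcut_def)
    show "below (qv c \<epsilon>) \<rho> r" if r: "r \<in> polys F" "r \<noteq> 0" "degree r < degree \<phi>" for r
    proof -
      have l1: "lmon c \<delta> r = (0, vb (poly r c))" by (rule rf_lmon[OF rf[OF r]])
      have "rootfree (vball vb c (cutp \<epsilon>)) r"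
        using rootfree_subset[OF rf[OF r] vball_cutp_antimono[OF q qe]] le by (simp add: le_qcut_def)
      then have "lmon c (cutp \<epsilon>) r = (0, vb (poly r c))"
        using rootfree_unit[OF qcut_cutp[OF qe]] by (intro unit_at_lmon) (auto simp: qe)
      then have l2: "lmon c \<epsilon> r = (0, vb (poly r c))" by (simp add: lmon_def)
      show ?thesis using bel'[OF r(1)] r(2) by (simp add: below_def qv_tge l1 l2)
    qed
  qed
  then show ?thesis using qe le ne c(1) by blast
qed

theorem lift:
  assumes q0: "qcut vb \<delta>0" and bel0: "\<forall>f\<in>polys F. below (qv a0 \<delta>0) \<rho> f"
  shows "(\<exists>a \<delta>. qcut vb \<delta> \<and> le_qcut \<delta>0 \<delta> \<and> a \<in> vball vb a0 \<delta>0 \<and>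
            (\<forall>f\<in>polys F. \<forall>s. \<forall>l\<in>\<Gamma>. qv a \<delta> s f l \<longleftrightarrow> \<rho> s f l)) \<or>
         (\<exists>N. nest vb N \<and> (\<exists>B\<in>N. B \<subseteq> vball vb a0 \<delta>0) \<and>
            (\<forall>f\<in>polys F. \<forall>s. \<forall>l\<in>\<Gamma>. nqv N s f l \<longleftrightarrow> \<rho> s f l))"
proof -
  define S where "S = {(a, \<delta>). qcut vb \<delta> \<and> le_qcut \<delta>0 \<delta> \<and> a \<in> vball vb a0 \<delta>0 \<and> (\<forall>f\<in>polys F. below (qv a \<delta>) \<rho> f)}"
  define R where "R = (\<lambda>(a, \<delta>) (b, \<epsilon>). le_qcut \<delta> \<epsilon> \<and> b \<in> vball vb a \<delta>)"
  obtain C where "pred_on.maxchain S R C" using pred_on.Hausdorff by blast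
  then have ch: "pred_on.chain S R C" and mx: "\<And>D. pred_on.chain S R D \<Longrightarrow> \<not> C \<subset> D"
    by (auto simp: pred_on.maxchain_def)
  have CS: "C \<subseteq> S" using ch by (auto simp: pred_on.chain_def)
  have Rrefl: "R x x" for x by (cases x) (auto simp: R_def)
  have tot: "R x y \<or> R y x" if "x \<in> C" "y \<in> C" for x y
    using ch that Rrefl unfolding pred_on.chain_def by blast
  \<comment> \<open>Maximality in usable form. \<open>R\<close> is only a preorder on pairs of
    centre and radius, so upper bounds of \<open>C\<close> need not be unique, but each one in
    \<open>S\<close> belongs to \<open>C\<close>.\<close>
  have ins: "x \<in> C" if "x \<in> S" "\<And>y. y \<in> C \<Longrightarrow> R y x" for x
  proof -
    have "pred_on.chain S R (insert x C)"
      unfolding pred_on.chain_def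
    proof (intro conjI ballI)
      show "insert x C \<subseteq> S" using CS that by simp
      fix y z assume "y \<in> insert x C" "z \<in> insert x C"
      then have "R y z \<or> R z y" using that(2) tot Rrefl by blast
      then show "sup R (=) y z \<or> sup R (=) z y" by blast
    qed
    then show ?thesis using mx[of "insert x C"] by blast
  qed
  have start: "(a0, \<delta>0) \<in> S" using q0 bel0 by (simp add: S_def)
  have Cne: "C \<noteq> {}" using ins[OF start] by auto
  have Sq: "qcut vb \<delta>" "le_qcut \<delta>0 \<delta>" "a \<in> vball vb a0 \<delta>0" "f \<in> polys F \<Longrightarrow> below (qv a \<delta>) \<rho> f" if "(a, \<delta>) \<in> C" for a \<delta> f
    using that CS by (auto simp: S_def)
  show ?thesis
  proof (cases "\<exists>b. \<forall>(a, \<delta>)\<in>C. b \<in> vball vb a \<delta>")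
    case True
    then obtain b where b: "\<And>a \<delta>. (a, \<delta>) \<in> C \<Longrightarrow> b \<in> vball vb a \<delta>" by blast
    \<comment> \<open>The supremum of the radii; the common point b is a centre of every ball of the
      chain.\<close>
    define \<delta> where "\<delta> = ((\<Union>x\<in>C. fst (snd x)), (\<Inter>x\<in>C. snd (snd x)))"
    have cmp: "le_qcut \<epsilon> \<epsilon>' \<or> le_qcut \<epsilon>' \<epsilon>" if "(a, \<epsilon>) \<in> C" "(a', \<epsilon>') \<in> C" for a \<epsilon> a' \<epsilon>'
      using tot[OF that] by (auto simp: R_def)
    have q: "qcut vb \<delta>" unfolding qcut_def
    proof (intro conjI ballI)
      have Sq': "qcut vb (snd x)" if "x \<in> C" for x using Sq(1)[of "fst x" "snd x"] that by simp
      show "fst \<delta> \<union> snd \<delta> = \<Gamma>"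
      proof (intro set_eqI iffI)
        fix g assume "g \<in> fst \<delta> \<union> snd \<delta>"
        moreover obtain x where "x \<in> C" using Cne by blast
        ultimately obtain y where "y \<in> C" "g \<in> fst (snd y) \<or> g \<in> snd (snd y)"
          unfolding \<delta>_def fst_conv snd_conv by blast
        then show "g \<in> \<Gamma>" using qcut_fst[OF Sq'] qcut_snd[OF Sq'] by blast
      next
        fix g assume "g \<in> \<Gamma>"
        then show "g \<in> fst \<delta> \<union> snd \<delta>" unfolding \<delta>_def fst_conv snd_conv using qcut_in_or[OF Sq'] by blast
      qed
      fix l r assume "l \<in> fst \<delta>" "r \<in> snd \<delta>"
      then obtain y where "y \<in> C" "l \<in> fst (snd y)" "r \<in> snd (snd y)"
        unfolding \<delta>_def fst_conv snd_conv by blast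
      then show "l \<le> r" using qcut_le[OF Sq'] by blast
    qed
    have up: "le_qcut \<epsilon> \<delta>" if "(a, \<epsilon>) \<in> C" for a \<epsilon>
      using that unfolding le_qcut_def \<delta>_def by force
    obtain x1 e1 where x1: "(x1, e1) \<in> C" using Cne by fastforce
    \<comment> \<open>A bound on a single term at the limit radius is reached already by a member of
      the chain. Since the radii are comparable, \<open>all\<close> extends this to the finitely
      many terms of f, and so the limit stays below \<rho>.\<close>
    have one: "\<exists>(a, \<epsilon>)\<in>C. tge \<epsilon> s t k" if t: "tge \<delta> s t k" "0 \<le> fst t" "snd t \<in> \<Gamma>" and k: "k \<in> \<Gamma>" for s t k
    proof (cases "fst t = 0")
      case True
      then have "tge e1 s t k" using t(1) by (cases t) auto
      then show ?thesis using x1 by blast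
    next
      case False
      then have tp: "0 < fst t" using t by simp
      have tt: "tge \<delta> s (fst t, snd t) k" using t by simp
      show ?thesis
      proof (cases s)
        case True
        obtain h where h: "h \<in> \<Gamma>" "zsm (fst t) h = k - snd t" using Gam_zdivide[OF _ tp] t k by (metis Gam_diff)
        have "h \<notin> snd \<delta>" using tge_hi[of h \<delta> "fst t" "snd t"] h tp tt True by auto
        then obtain a \<epsilon> where e: "(a, \<epsilon>) \<in> C" "h \<notin> snd \<epsilon>" by (auto simp: \<delta>_def)
        have "tge \<epsilon> True (fst t, snd t) (snd t + zsm (fst t) h)" by (rule tge_lo_strict[OF Sq(1)[OF e(1)] h(1) e(2) tp])
        then show ?thesis using e h True by (intro bexI[of _ "(a, \<epsilon>)"]) auto
      next
        case False
        then obtain l where l: "l \<in> fst \<delta>" "k \<le> snd t + zsm (fst t) l" using tge_FalseD[of \<delta> "fst t" "snd t" k] tt tp by auto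
        then obtain a \<epsilon> where e: "(a, \<epsilon>) \<in> C" "l \<in> fst \<epsilon>" by (auto simp: \<delta>_def)
        have "l \<in> \<Gamma>" using e Sq(1) qcut_fst by blast
        then have "tge \<epsilon> False t k"
          using tge_weaken[OF Sq(1)[OF e(1)] t(3) _ k, of "snd t + zsm (fst t) l" False False] tge_lo[OF e(2), of "fst t" "snd t"] l(2) tp t(3)
          by (auto simp: order_le_less)
        then show ?thesis using e False by (intro bexI[of _ "(a, \<epsilon>)"]) auto
      qed
    qed
    have all: "\<exists>(a, \<epsilon>)\<in>C. \<forall>t\<in>T. tge \<epsilon> s t k" if "finite T" "\<And>t. t \<in> T \<Longrightarrow> tge \<delta> s t k \<and> 0 \<le> fst t \<and> snd t \<in> \<Gamma>" and k: "k \<in> \<Gamma>" for T s k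
      using that(1,2)
    proof (induction T)
      case empty
      then show ?case using x1 by blast
    next
      case (insert t T)
      obtain a \<epsilon> where e: "(a, \<epsilon>) \<in> C" "\<forall>t\<in>T. tge \<epsilon> s t k" using insert by blast
      obtain a' \<epsilon>' where e': "(a', \<epsilon>') \<in> C" "tge \<epsilon>' s t k" using one[of s t k] insert.prems k by blast
      show ?case
      proof (cases "le_qcut \<epsilon> \<epsilon>'")
        case True
        then have "\<forall>t\<in>T. tge \<epsilon>' s t k" using e(2) tge_radius[OF True] insert.prems by blast
        then show ?thesis using e' by blast
      next
        case False
        then have "le_qcut \<epsilon>' \<epsilon>" using cmp e e' by blast
        then have "tge \<epsilon> s t k" using e'(2) tge_radius insert.prems by blast
        then show ?thesis using e by blast
      qed
    qed
    have bel: "below (qv b \<delta>) \<rho> f" if f: "f \<in> polys F" for f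
      unfolding below_def
    proof (intro allI ballI impI)
      fix s k assume k: "k \<in> \<Gamma>" and h: "qv b \<delta> s f k"
      have "\<forall>t\<in>mterms b f. tge \<delta> s t k \<and> 0 \<le> fst t \<and> snd t \<in> \<Gamma>"
        using h mterms_snd unfolding qv_mterms[OF q k] by (auto simp: mterms_def)
      then obtain a \<epsilon> where e: "(a, \<epsilon>) \<in> C" "\<forall>t\<in>mterms b f. tge \<epsilon> s t k" using all[OF mterms_finite _ k, of b f s] by blast
      have "qv b \<epsilon> s f k" using e qv_mterms[OF Sq(1)[OF e(1)] k] by blast
      then have "qv a \<epsilon> s f k" using qv_recenter[OF Sq(1)[OF e(1)] b[OF e(1)] k] by blast
      then show "\<rho> s f k" using Sq(4)[OF e(1) f] k by (simp add: below_def)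
    qed
    have bS: "(b, \<delta>) \<in> S"
    proof -
      have "vball vb x1 e1 \<subseteq> vball vb a0 \<delta>0"
        using vball_radius_mono[OF q0 Sq(1)[OF x1] Sq(2)[OF x1], of x1] vball_recenter[OF q0 Sq(3)[OF x1]] by simp
      then show ?thesis using q bel b[OF x1] le_qcut_trans[OF Sq(2)[OF x1] up[OF x1]] by (auto simp: S_def)
    qed
    have Rb: "R y (b, \<delta>)" if "y \<in> C" for y using that up b by (cases y) (auto simp: R_def)
    have "\<forall>f\<in>polys F. below \<rho> (qv b \<delta>) f"
    proof (rule ccontr)
      assume "\<not> ?thesis"
      \<comment> \<open>Such a ball would be an upper bound of the chain and hence lie in it, while
        all radii in the chain are at most \<open>\<delta>\<close>.\<close>
      then obtain c \<epsilon> where ce: "qcut vb \<epsilon>" "le_qcut \<delta> \<epsilon>" "\<delta> \<noteq> \<epsilon>" "c \<in> vball vb b \<delta>" "\<forall>f\<in>polys F. below (qv c \<epsilon>) \<rho> f"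
        using ball_step[OF q bel] by blast
      have Rc: "R y (c, \<epsilon>)" if "y \<in> C" for y
      proof -
        obtain a \<eta> where y: "y = (a, \<eta>)" by (metis surj_pair)
        have ay: "(a, \<eta>) \<in> C" using that y by simp
        have "c \<in> vball vb b \<eta>" using ce(4) vball_radius_mono[OF Sq(1)[OF ay] q up[OF ay]] by blast
        then have "c \<in> vball vb a \<eta>" using vball_recenter[OF Sq(1)[OF ay] b[OF ay]] by simp
        then show ?thesis using le_qcut_trans[OF up[OF ay] ce(2)] y by (simp add: R_def)
      qed
      have "c \<in> vball vb a0 \<delta>0"
      proof -
        have "vball vb b \<delta> \<subseteq> vball vb b \<delta>0" using bS vball_radius_mono[OF q0 q] by (simp add: S_def)
        also have "vball vb b \<delta>0 = vball vb a0 \<delta>0" using bS vball_recenter[OF q0] by (simp add: S_def)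
        finally show ?thesis using ce(4) by blast
      qed
      moreover have "le_qcut \<delta>0 \<epsilon>" using bS le_qcut_trans[OF _ ce(2)] by (simp add: S_def)
      ultimately have "(c, \<epsilon>) \<in> S" using ce by (simp add: S_def)
      then have "(c, \<epsilon>) \<in> C" using ins Rc by blast
      then show False using up le_qcut_antisym[OF ce(2)] ce(3) by blast
    qed
    then have "\<forall>f\<in>polys F. \<forall>s. \<forall>l\<in>\<Gamma>. qv b \<delta> s f l \<longleftrightarrow> \<rho> s f l" using bel by (auto simp: below_def)
    moreover have "le_qcut \<delta>0 \<delta>" "b \<in> vball vb a0 \<delta>0" using bS by (auto simp: S_def)
    ultimately show ?thesis using q by blast
  next
    case False
    \<comment> \<open>Members of the chain may have cuts as radii, but a nest consists of closed
      balls with radius in \<Gamma>; \<open>N\<close> collects all such balls that precede some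
      member in the order of pointed balls.\<close>
    define N where "N = {vcball vb a \<gamma> | a \<gamma>. \<gamma> \<in> \<Gamma> \<and> (\<exists>(c, \<epsilon>)\<in>C. le_qcut (pq vb \<gamma>) \<epsilon> \<and> c \<in> vcball vb a \<gamma>)}"
    have deeper: "\<exists>V\<in>N. V \<subseteq> vball vb a \<delta>" if aC: "(a, \<delta>) \<in> C" for a \<delta>
    proof -
      \<comment> \<open>No point is common to the chain, so some member misses the centre a. It
        comes later in the chain and has a different radius; a level between the two radii gives a
        closed ball of \<open>N\<close> inside the given ball.\<close>
      obtain b \<epsilon> where be: "(b, \<epsilon>) \<in> C" "a \<notin> vball vb b \<epsilon>" using False by blast
      have "\<not> R (b, \<epsilon>) (a, \<delta>)" using be by (simp add: R_def)
      then have "R (a, \<delta>) (b, \<epsilon>)" using tot[OF aC be(1)] by blast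
      then have ab: "le_qcut \<delta> \<epsilon>" "b \<in> vball vb a \<delta>" by (auto simp: R_def)
      have rc: "vball vb b \<delta> = vball vb a \<delta>" by (rule vball_recenter[OF Sq(1)[OF aC] ab(2)])
      have "\<delta> \<noteq> \<epsilon>" using be rc by auto
      then obtain \<gamma> where g: "\<gamma> \<in> \<Gamma>" "le_qcut \<delta> (pq vb \<gamma>)" "le_qcut (pq vb \<gamma>) \<epsilon>"
        using qcut_between[OF Sq(1)[OF aC] Sq(1)[OF be(1)] ab(1)] by blast
      have "vcball vb b \<gamma> \<subseteq> vball vb b \<delta>" using vball_radius_mono[OF Sq(1)[OF aC] qcut_pq g(2), of b] vball_pq[OF g(1)] by simp
      moreover have "vcball vb b \<gamma> \<in> N" unfolding N_def using g be vcball_self by blast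
      ultimately show ?thesis using rc by blast
    qed
    have nest: "nest vb N" unfolding nest_def
    proof (intro conjI ballI)
      show "N \<noteq> {}" using Cne deeper by fastforce
      show "N \<subseteq> closed_balls vb" by (auto simp: N_def closed_balls_def)
      show "\<Inter>N = {}"
      proof (rule equals0I)
        fix x assume x: "x \<in> \<Inter>N"
        then have "\<forall>(a, \<delta>)\<in>C. x \<in> vball vb a \<delta>" using deeper by blast
        then show False using False by blast
      qed
      fix B B' assume "B \<in> N" "B' \<in> N"
      then obtain a \<gamma> c \<epsilon> a' \<gamma>' c' \<epsilon>' where
        B: "B = vcball vb a \<gamma>" "\<gamma> \<in> \<Gamma>" "(c, \<epsilon>) \<in> C" "le_qcut (pq vb \<gamma>) \<epsilon>" "c \<in> vcball vb a \<gamma>" and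
        B': "B' = vcball vb a' \<gamma>'" "\<gamma>' \<in> \<Gamma>" "(c', \<epsilon>') \<in> C" "le_qcut (pq vb \<gamma>') \<epsilon>'" "c' \<in> vcball vb a' \<gamma>'"
        unfolding N_def by blast
      have sub: "vball vb c \<epsilon> \<subseteq> vcball vb a \<gamma>" if "\<gamma> \<in> \<Gamma>" "(c, \<epsilon>) \<in> C" "le_qcut (pq vb \<gamma>) \<epsilon>" "c \<in> vcball vb a \<gamma>" for a \<gamma> c \<epsilon>
        using vball_radius_mono[OF qcut_pq Sq(1)[OF that(2)] that(3), of c] vball_pq[OF that(1)] vcball_recenter[OF that(1,4)] by simp
      have "R (c, \<epsilon>) (c', \<epsilon>') \<or> R (c', \<epsilon>') (c, \<epsilon>)" using tot B B' by blast
      then have "c' \<in> vcball vb a \<gamma> \<or> c \<in> vcball vb a' \<gamma>'"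
        using sub[OF B(2-5)] sub[OF B'(2-5)] by (auto simp: R_def)
      then show "B \<subseteq> B' \<or> B' \<subseteq> B" using closed_balls_nested[OF B(2) B'(2)] B B' by blast
    qed
    have bel: "below (nqv N) \<rho> f" if f: "f \<in> polys F" for f
      unfolding below_def
    proof (intro allI ballI impI)
      fix s k assume k: "k \<in> \<Gamma>" and h: "nqv N s f k"
      then obtain b \<gamma>' where b: "\<gamma>' \<in> \<Gamma>" "vcball vb b \<gamma>' \<in> N" "qv b (pq vb \<gamma>') s f k" by (auto simp: nqv_def)
      then obtain a \<gamma> c \<epsilon> where a: "vcball vb b \<gamma>' = vcball vb a \<gamma>" "\<gamma> \<in> \<Gamma>" "(c, \<epsilon>) \<in> C" "le_qcut (pq vb \<gamma>) \<epsilon>" "c \<in> vcball vb a \<gamma>"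
        by (auto simp: N_def)
      have "\<gamma> = \<gamma>'" using vcball_subset_radius[OF a(2) b(1)] vcball_subset_radius[OF b(1) a(2)] a(1) by (metis antisym order_refl)
      then have "below (qv b (pq vb \<gamma>')) (qv c \<epsilon>) f"
        using a b by (intro qv_ball_mono qcut_pq Sq(1)[OF a(3)]) (auto simp: vball_pq)
      then show "\<rho> s f k" using b(3) k Sq(4)[OF a(3) f] by (simp add: below_def)
    qed
    have "\<forall>f\<in>polys F. \<forall>s. \<forall>l\<in>\<Gamma>. nqv N s f l \<longleftrightarrow> \<rho> s f l"
      using bel nest_above[OF nest bel] by (auto simp: below_def)
    moreover have "\<exists>B\<in>N. B \<subseteq> vball vb a0 \<delta>0"
    proof -
      obtain x1 e1 where x1: "(x1, e1) \<in> C" using Cne by fastforce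
      have "vball vb x1 e1 \<subseteq> vball vb a0 \<delta>0"
        using vball_radius_mono[OF q0 Sq(1)[OF x1] Sq(2)[OF x1], of x1] vball_recenter[OF q0 Sq(3)[OF x1]] by simp
      then show ?thesis using deeper[OF x1] by blast
    qed
    ultimately show ?thesis using nest by blast
  qed
qed

end


section \<open>Extension of valued homomorphisms\<close>

context vfield
begin

text \<open>The radii \<infinity> and -\<infinity>: the first makes a ball a point, the second makes
  it the whole field.\<close>

definition infc :: "'g set \<times> 'g set" where "infc = (\<Gamma>, {})"
definition minf :: "'g set \<times> 'g set" where "minf = ({}, \<Gamma>)"

lemma infc_simps [simp]: "fst infc = \<Gamma>" "snd infc = {}" and minf_simps [simp]: "fst minf = {}" "snd minf = \<Gamma>"
  by (simp_all add: infc_def minf_def)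

lemma qcut_infc [simp]: "qcut vb infc" and qcut_minf [simp]: "qcut vb minf"
  by (auto simp: qcut_def infc_def minf_def)

lemma vball_infc: "vball vb a infc = {a}"
  using vball_iff[OF qcut_infc] by (auto simp: infc_def)

lemma le_qcut_infc: "qcut vb \<delta> \<Longrightarrow> le_qcut \<delta> infc"
  by (auto simp: le_qcut_def qcut_def)

text \<open>At infinite radius the terms with positive exponent exceed every level of \<Gamma>, so
  only the constant term f(a) counts.\<close>

lemma qv_infc:
  assumes l: "l \<in> \<Gamma>" shows "qv a infc s f l \<longleftrightarrow> vge s (poly f a) l"
proof (cases "poly f a = 0")
  case True
  have "tge infc s t l" if t: "t \<in> mterms a f" for t
  proof -
    have tp: "0 < fst t" by (rule mterms_pos[OF True t])
    obtain e where e: "e \<in> \<Gamma>" "zsm (fst t) e = l - snd t" using Gam_zdivide[OF _ tp] mterms_snd[OF t] l by (metis Gam_diff)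
    have "tge infc True (fst t, snd t) (snd t + zsm (fst t) e)" by (rule tge_lo_strict[OF _ e(1) _ tp]) auto
    moreover have "tge infc False (fst t, snd t) (snd t + zsm (fst t) e)" by (rule tge_lo) (use e tp in auto)
    ultimately show ?thesis using e by (cases s) auto
  qed
  then show ?thesis using qv_mterms[OF qcut_infc l] True by (auto simp: vge_def)
next
  case False
  then have "f \<noteq> 0" by auto
  then show ?thesis using qv_rootfree[OF qcut_infc, of a f a l s] l False by (simp add: vball_infc rootfree_def)
qed

text \<open>An element r of the right side of the radius would bound \<omega>(p) = g + n x from
  above by g + n r. So infinite value of a nonzero polynomial leaves the right side empty.\<close>

lemma infinite_value_ball:
  assumes q: "qcut vb \<delta>" and p: "p \<noteq> 0" and inf: "\<And>l. l \<in> \<Gamma> \<Longrightarrow> qv c \<delta> True p l"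
  shows "\<delta> = infc"
proof -
  have "snd \<delta> = {}"
  proof (rule equals0I)
    fix r assume r: "r \<in> snd \<delta>"
    obtain n g where ng: "lmon c \<delta> p = (n, g)" by fastforce
    have n: "0 \<le> n" "g \<in> \<Gamma>" using lmon_nonneg[OF q p, of c] lmon_in[OF q p, of c] ng by auto
    have rG: "r \<in> \<Gamma>" using r qcut_snd[OF q] by blast
    have "\<not> tge \<delta> True (n, g) (g + zsm n r)" by (rule tge_hi[OF r n(1)])
    then have "\<not> qv c \<delta> True p (g + zsm n r)" using p ng by (simp add: qv_tge)
    then show False using inf n rG by simp
  qed
  then show ?thesis using q by (simp add: qcut_def infc_def prod_eq_iff)
qed

lemma no_infinite_value_nest:
  assumes N: "nest vb N" and p: "p \<noteq> 0" and inf: "\<And>l. l \<in> \<Gamma> \<Longrightarrow> nqv N True p l"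
  shows False
proof -
  obtain B where B: "B \<in> N" "rootfree B p" using nest_rootfree[OF N p] by blast
  obtain a \<gamma> where a: "\<gamma> \<in> \<Gamma>" "B = vcball vb a \<gamma>" using nest_ballE[OF N B(1)] .
  have aB: "a \<in> B" using a by simp
  have pa: "poly p a \<noteq> 0" using B(2) aB by (simp add: rootfree_def)
  show False using nqv_rootfree[OF N B aB, of "vb (poly p a)" True] inf[of "vb (poly p a)"] pa by (simp add: vge_def)
qed

lemma vge_mult: "vge s x l \<Longrightarrow> vge s' y l' \<Longrightarrow> vge (s \<or> s') (x * y) (l + l')"
  by (cases "x = 0 \<or> y = 0")
    (auto simp: vge_def v_mult add_strict_mono add_mono add_less_le_mono add_le_less_mono split: if_splits)

lemma vge_mult_neg: "\<not> vge s x l \<Longrightarrow> \<not> vge s' y l' \<Longrightarrow> \<not> vge (s \<and> s') (x * y) (l + l')"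
  by (auto simp: vge_def v_mult not_le not_less add_strict_mono add_mono add_less_le_mono add_le_less_mono split: if_splits)

lemma vge_weaken: "vge s x l \<Longrightarrow> l' < l \<or> l' = l \<and> (s' \<longrightarrow> s) \<Longrightarrow> vge s' x l'"
  by (auto simp: vge_def split: if_splits)

text \<open>Levels of \<Gamma> suffice because the value of a nonzero element is itself such a
  level.\<close>

lemma vge_cong_eq:
  assumes "\<And>s l. l \<in> \<Gamma> \<Longrightarrow> vge s x l \<longleftrightarrow> vge s y l"
  shows "x = 0 \<longleftrightarrow> y = 0" "x \<noteq> 0 \<Longrightarrow> vb x = vb y"
proof -
  have *: "x = 0" if "y = 0" "\<And>s l. l \<in> \<Gamma> \<Longrightarrow> vge s x l \<longleftrightarrow> vge s y l" for x y
    using that(2)[of "vb x" True] that(1) by (cases "x = 0") (auto simp: vge_def)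
  show z: "x = 0 \<longleftrightarrow> y = 0" using *[of x y] *[of y x] assms by blast
  show "vb x = vb y" if "x \<noteq> 0"
    using assms[of "vb x" False] assms[of "vb y" False] that z by (auto simp: vge_def)
qed

end

text \<open>With the radius below all of \<Gamma>, a term of positive degree violates every bound;
  so only constants have bounds, and on them \<rho> agrees with v.\<close>

lemma (in qvalued) below_minf:
  assumes "f \<in> polys F" shows "below (qv a minf) \<rho> f"
  unfolding below_def
proof (intro allI ballI impI)
  fix s l assume l: "l \<in> \<Gamma>" and h: "qv a minf s f l"
  let ?p = "pcompose f [:a, 1:]"
  show "\<rho> s f l"
  proof (cases "f = 0")
    case True
    then show ?thesis using rho_0[OF l] by simp
  next
    case False
    have "degree ?p = 0"
    proof (rule ccontr)
      assume d: "degree ?p \<noteq> 0"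
      let ?t = "(int (degree ?p), vb (lead_coeff ?p))"
      have lc: "lead_coeff ?p \<noteq> 0" using False shift_eq_0_iff[of f a] by simp
      then have "?t \<in> mterms a f" by (auto simp: mterms_def)
      then have t: "tge minf s ?t l" using h qv_mterms[OF qcut_minf l] by blast
      obtain e where e: "e \<in> \<Gamma>" "zsm (int (degree ?p)) e = l - vb (lead_coeff ?p)"
        using Gam_zdivide[of "l - vb (lead_coeff ?p)" "int (degree ?p)"] d lc l by auto
      have "\<not> tge minf True ?t (vb (lead_coeff ?p) + zsm (int (degree ?p)) e)"
        by (rule tge_hi) (use e in auto)
      moreover have "\<not> tge minf False ?t (vb (lead_coeff ?p) + zsm (int (degree ?p)) e)"
        by (rule tge_hi_strict) (use e d in auto)
      ultimately show False using t unfolding e(2) by (cases s) auto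
    qed
    then have "degree f = 0" by (simp add: degree_pcompose)
    then obtain c where c: "f = [:c:]" by (metis degree_eq_zeroE)
    have "c \<in> F" using assms c by (auto simp: polys_def dest: spec[of _ 0])
    then show ?thesis using h l rho_const qv_const[OF qcut_minf] c by simp
  qed
qed

lemma (in qvalued) representable:
  "(\<exists>a \<delta>. qcut vb \<delta> \<and> (\<forall>f\<in>polys F. \<forall>s. \<forall>l\<in>\<Gamma>. qv a \<delta> s f l \<longleftrightarrow> \<rho> s f l)) \<or>
   (\<exists>N. nest vb N \<and> (\<forall>f\<in>polys F. \<forall>s. \<forall>l\<in>\<Gamma>. nqv N s f l \<longleftrightarrow> \<rho> s f l))"
proof -
  have "\<forall>f\<in>polys F. below (qv 0 minf) \<rho> f" using below_minf by blast
  from lift[OF qcut_minf this] show ?thesis by blast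
qed

section \<open>The base field in its algebraic closure and partial homomorphisms over it\<close>

locale vclosure = vfield vb for vb :: "'l::field \<Rightarrow> 'g::linordered_ab_group_add" +
  fixes iota :: "'k::field \<Rightarrow> 'l"
  assumes hom_add: "\<And>a b. iota (a + b) = iota a + iota b"
    and hom_mult: "\<And>a b. iota (a * b) = iota a * iota b"
    and hom_one: "iota 1 = 1"
    and algebraic: "\<And>z. \<exists>p :: 'k poly. p \<noteq> 0 \<and> poly (map_poly iota p) z = 0"
begin

lemma hom_0 [simp]: "iota 0 = 0"
  using hom_add[of 0 0] add_cancel_left_right[of "iota 0" "iota 0"] by simp

lemma hom_uminus: "iota (- a) = - iota a"
  using hom_add[of a "- a"] by (simp add: eq_neg_iff_add_eq_0 add.commute)

lemma hom_eq_0 [simp]: "iota a = 0 \<longleftrightarrow> a = 0"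
proof
  assume "iota a = 0"
  show "a = 0"
  proof (rule ccontr)
    assume "a \<noteq> 0"
    then have "iota a * iota (inverse a) = 1" using hom_mult[of a "inverse a"] hom_one by simp
    then show False using \<open>iota a = 0\<close> by simp
  qed
qed simp

lemma hom_inverse: "iota (inverse a) = inverse (iota a)"
proof (cases "a = 0")
  case False
  then have "iota a * iota (inverse a) = 1" using hom_mult[of a "inverse a"] hom_one by simp
  then show ?thesis by (simp add: inverse_unique)
qed simp

lemma hom_inj: "iota a = iota b \<longleftrightarrow> a = b"
proof -
  have "iota (a - b) = iota a - iota b" using hom_add[of a "- b"] by (simp add: hom_uminus)
  then show ?thesis using hom_eq_0[of "a - b"] by (metis right_minus_eq)
qed

abbreviation "K \<equiv> range iota"
abbreviation "mp \<equiv> map_poly iota"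

lemma subfld_K: "subfld K"
  unfolding subfld_def
  by (metis (no_types, lifting) hom_0 hom_one hom_add hom_mult hom_uminus hom_inverse imageE rangeI)

lemma hom_sum: "iota (sum h A) = (\<Sum>i\<in>A. iota (h i))"
  by (induction A rule: infinite_finite_induct) (auto simp: hom_add)

lemma mp_coeff [simp]: "coeff (mp f) i = iota (coeff f i)"
  by (simp add: coeff_map_poly)

lemma mp_add: "mp (f + g) = mp f + mp g"
  by (rule poly_eqI) (simp add: hom_add)

lemma mp_mult: "mp (f * g) = mp f * mp g"
  by (rule poly_eqI) (simp add: coeff_mult hom_sum hom_mult)

lemma mp_eq_0 [simp]: "mp f = 0 \<longleftrightarrow> f = 0"
  by (auto simp: poly_eq_iff)

lemma mp_power: "mp (f ^ n) = mp f ^ n"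
proof (induction n)
  case 0
  have "mp [:1:] = [:iota 1:]" by (simp add: map_poly_pCons)
  then show ?case by (simp add: one_pCons hom_one)
qed (simp add: mp_mult)

lemma mp_const: "mp [:c:] = [:iota c:]"
  by (simp add: map_poly_pCons)

lemma mp_in: "mp f \<in> polys K"
  by (simp add: polys_def)

lemma polys_KE:
  assumes "f \<in> polys K" obtains g where "f = mp g"
proof
  show "f = mp (map_poly (inv iota) f)"
  proof (rule poly_eqI)
    fix n
    have "inv iota 0 = 0" using hom_inj by (metis f_inv_into_f hom_0 rangeI)
    then show "coeff f n = coeff (mp (map_poly (inv iota) f)) n"
      using assms by (simp add: coeff_map_poly polys_def f_inv_into_f)
  qed
qed

lemma algebraic_K: "\<exists>p\<in>polys K. p \<noteq> 0 \<and> poly p z = 0"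
  using algebraic[of z] mp_in mp_eq_0 by metis

text \<open>A valued partial homomorphism over \<open>K\<close>, represented by its graph.\<close>

definition vhom :: "('l \<times> 'l) set \<Rightarrow> bool" where
  "vhom H \<longleftrightarrow> (\<forall>k. (iota k, iota k) \<in> H) \<and>
     (\<forall>a b c d. (a, b) \<in> H \<longrightarrow> (c, d) \<in> H \<longrightarrow> (a + c, b + d) \<in> H \<and> (a * c, b * d) \<in> H) \<and>
     (\<forall>a b. (a, b) \<in> H \<longrightarrow> (a = 0 \<longleftrightarrow> b = 0) \<and> (a \<noteq> 0 \<longrightarrow> vb a = vb b))"

definition prel :: "('l \<times> 'l) set \<Rightarrow> 'l poly \<Rightarrow> 'l poly \<Rightarrow> bool" where
  "prel H f g \<longleftrightarrow> (\<forall>i. (coeff f i, coeff g i) \<in> H)"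

context
  fixes H assumes H: "vhom H"
begin

lemma vhom_iota: "(iota k, iota k) \<in> H" using H by (simp add: vhom_def)
lemma vhom_add: "(a, b) \<in> H \<Longrightarrow> (c, d) \<in> H \<Longrightarrow> (a + c, b + d) \<in> H" using H by (simp add: vhom_def)
lemma vhom_mult: "(a, b) \<in> H \<Longrightarrow> (c, d) \<in> H \<Longrightarrow> (a * c, b * d) \<in> H" using H by (simp add: vhom_def)
lemma vhom_0: "(a, b) \<in> H \<Longrightarrow> a = 0 \<longleftrightarrow> b = 0" using H by (simp add: vhom_def)
lemma vhom_v: "(a, b) \<in> H \<Longrightarrow> a \<noteq> 0 \<Longrightarrow> vb a = vb b" using H by (simp add: vhom_def)
lemma vhom_00: "(0, 0) \<in> H" and vhom_11: "(1, 1) \<in> H"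
  using vhom_iota[of 0] vhom_iota[of 1] hom_one by simp_all
lemma vhom_minus: "(a, b) \<in> H \<Longrightarrow> (- a, - b) \<in> H"
  using vhom_mult[OF vhom_iota[of "- 1"], of a b] by (simp add: hom_uminus hom_one)
lemma vhom_diff: "(a, b) \<in> H \<Longrightarrow> (c, d) \<in> H \<Longrightarrow> (a - c, b - d) \<in> H"
  using vhom_add[OF _ vhom_minus, of a b c d] by simp

text \<open>The condition on vanishing, applied to differences, makes the relation single-valued;
  read backwards it gives injectivity.\<close>

lemma vhom_functional: "(a, b) \<in> H \<Longrightarrow> (a, b') \<in> H \<Longrightarrow> b = b'"
  using vhom_0[OF vhom_diff, of a b a b'] by simp
lemma vhom_injective: "(a, b) \<in> H \<Longrightarrow> (a', b) \<in> H \<Longrightarrow> a = a'"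
  using vhom_0[OF vhom_diff, of a b a' b] by simp

lemma vhom_sum: "(\<And>i. i \<in> A \<Longrightarrow> (h i, k i) \<in> H) \<Longrightarrow> (sum h A, sum k A) \<in> H"
  by (induction A rule: infinite_finite_induct) (auto intro: vhom_add vhom_00)

lemma prel_eq: "prel H f g \<Longrightarrow> prel H f' g \<Longrightarrow> f = f'"
  unfolding prel_def by (rule poly_eqI) (metis vhom_injective)

lemma prel_add: "prel H f g \<Longrightarrow> prel H f' g' \<Longrightarrow> prel H (f + f') (g + g')"
  by (simp add: prel_def vhom_add)

lemma prel_mult: "prel H f g \<Longrightarrow> prel H f' g' \<Longrightarrow> prel H (f * f') (g * g')"
  by (auto simp: prel_def coeff_mult intro!: vhom_sum vhom_mult)

lemma prel_const: "(a, b) \<in> H \<Longrightarrow> prel H [:a:] [:b:]"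
  by (auto simp: prel_def coeff_pCons' vhom_00)

lemma prel_K: "f \<in> polys K \<Longrightarrow> prel H f f"
  using vhom_iota unfolding prel_def polys_def by (metis (mono_tags, lifting) imageE mem_Collect_eq)

lemma prel_ex:
  assumes g: "g \<in> polys (Range H)" shows "\<exists>f. prel H f g"
proof -
  define h where "h b = (SOME a. (a, b) \<in> H)" for b
  have h: "(h b, b) \<in> H" if "b \<in> Range H" for b
    using that unfolding h_def by (metis RangeE someI)
  have h0: "h 0 = 0" using h[of 0] vhom_0[of "h 0" 0] vhom_00 by blast
  have "prel H (map_poly h g) g" unfolding prel_def
    using h g by (simp add: coeff_map_poly h0 polys_def)
  then show ?thesis by blast
qed

lemma vhom_poly:
  assumes "prel H f g" "(a, b) \<in> H" shows "(poly f a, poly g b) \<in> H"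
  using assms(1)
proof (induction f arbitrary: g rule: pCons_induct)
  case 0
  have "g = 0" using 0 vhom_0 unfolding prel_def by (intro poly_eqI) (metis coeff_0)
  then show ?case using vhom_00 by simp
next
  case (pCons c f)
  obtain d g' where g: "g = pCons d g'" by (cases g)
  have cd: "(coeff (pCons c f) i, coeff (pCons d g') i) \<in> H" for i using pCons.prems g by (simp add: prel_def)
  have "(c, d) \<in> H" using cd[of 0] by simp
  moreover have "prel H f g'" unfolding prel_def using cd[of "Suc _"] by simp
  ultimately show ?case using g pCons.IH assms(2) by (auto intro!: vhom_add vhom_mult)
qed

text \<open>Only sums and products are built into \<open>vhom\<close>. Since a is algebraic over K,
  a relation of least degree has nonzero constant term, so 1/a is a polynomial in a over K, and the
  same polynomial gives 1/b.\<close>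

lemma vhom_inverse:
  assumes ab: "(a, b) \<in> H" shows "(inverse a, inverse b) \<in> H"
proof (cases "a = 0")
  case True
  then show ?thesis using vhom_0[OF ab] vhom_00 by simp
next
  case False
  let ?Q = "\<lambda>p. p \<in> polys K \<and> p \<noteq> 0 \<and> poly p a = 0"
  obtain p where p: "?Q p" and pmin: "\<And>h. ?Q h \<Longrightarrow> degree p \<le> degree h"
    using ex_has_least_nat[of ?Q _ degree] algebraic_K[of a] by blast
  obtain c p' where cp: "p = pCons c p'" by (cases p)
  have p'K: "p' \<in> polys K" unfolding polys_def
  proof
    show "\<forall>i. coeff p' i \<in> K"
    proof
      fix i
      have "coeff p (Suc i) \<in> K" using p by (simp add: polys_def)
      then show "coeff p' i \<in> K" by (simp add: cp)
    qed
  qed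
  have "coeff p 0 \<in> K" using p by (simp add: polys_def)
  then have cK: "c \<in> K" by (simp add: cp)
  have c: "c \<noteq> 0"
  proof
    assume "c = 0"
    then have "poly p' a = 0" "p' \<noteq> 0" using p cp False by auto
    then have "degree p \<le> degree p'" using pmin[of p'] p'K by blast
    then show False using cp \<open>p' \<noteq> 0\<close> by simp
  qed
  have pab: "(poly p a, poly p b) \<in> H" by (rule vhom_poly[OF prel_K ab]) (use p in blast)
  have inv: "inverse x = - (poly p' x * inverse c)" if "poly p x = 0" for x
  proof -
    have "x * poly p' x = - c" using that cp by (simp add: eq_neg_iff_add_eq_0 add.commute)
    then have "x * - (poly p' x * inverse c) = 1" using c by (simp add: mult.assoc[symmetric])
    then show ?thesis by (rule inverse_unique)
  qed
  have "inverse c \<in> K" using cK subfld_K by (auto simp: subfld_def)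
  then have "(inverse c, inverse c) \<in> H" using vhom_iota by auto
  then have "(- (poly p' a * inverse c), - (poly p' b * inverse c)) \<in> H"
    by (intro vhom_minus vhom_mult vhom_poly prel_K p'K ab)
  then show ?thesis using inv[of a] inv[of b] p vhom_0[OF pab] by simp
qed

lemma subfld_Range: "subfld (Range H)"
  unfolding subfld_def
proof (intro conjI ballI)
  show "0 \<in> Range H" "1 \<in> Range H" using vhom_00 vhom_11 by blast+
next
  fix b d assume "b \<in> Range H" "d \<in> Range H"
  then obtain a c where "(a, b) \<in> H" "(c, d) \<in> H" by blast
  then show "b + d \<in> Range H" "b * d \<in> Range H" using vhom_add vhom_mult by blast+
next
  fix b assume "b \<in> Range H"
  then obtain a where "(a, b) \<in> H" by blast
  then show "- b \<in> Range H" "inverse b \<in> Range H" using vhom_minus vhom_inverse by blast+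
qed

lemma K_subset_Range: "K \<subseteq> Range H"
  using vhom_iota by auto

text \<open>The valuation \<open>f \<mapsto> v(f(b))\<close>, transported along \<open>H\<close>, is some \<open>\<omega>\<^sub>Z\<close> by the lifting theorem, and
  \<open>Z\<close> has to be a point.\<close>

lemma vhom_extend_point: "\<exists>c. \<exists>H'. vhom H' \<and> H \<subseteq> H' \<and> (b, c) \<in> H'"
proof -
  \<comment> \<open>A polynomial over the range of \<open>H\<close> is pulled back along
    \<open>H\<close> and evaluated at the element \<open>b\<close> that is to be adjoined.\<close>
  define \<rho> where "\<rho> s g l \<longleftrightarrow> (\<exists>f. prel H f g \<and> vge s (poly f b) l)" for s g l
  have rho: "\<rho> s g l \<longleftrightarrow> vge s (poly f b) l" if "prel H f g" for s f g l
    unfolding \<rho>_def using prel_eq that by blast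
  interpret qvalued vb "Range H" \<rho>
  proof
    show "subfld (Range H)" by (rule subfld_Range)
    show "\<exists>p\<in>polys (Range H). p \<noteq> 0 \<and> poly p z = 0" for z
      using algebraic_K[of z] K_subset_Range by (auto simp: polys_def) blast
    show "\<rho> s' f l'" if "\<rho> s f l" "l' < l \<or> l' = l \<and> (s' \<longrightarrow> s)" for s f l s' l'
      using that vge_weaken unfolding \<rho>_def by blast
    show "\<rho> s (f + g) l" if "\<rho> s f l" "\<rho> s g l" for s f g l
      using that unfolding \<rho>_def by (metis prel_add vge_add poly_add)
    show "\<rho> (s \<or> s') (f * g) (l + l')" if "\<rho> s f l" "\<rho> s' g l'" for s f l s' g l'
      using that unfolding \<rho>_def by (metis prel_mult vge_mult poly_mult)
    show "\<not> \<rho> (s \<and> s') (f * g) (l + l')" if fg0: "f \<in> polys (Range H)" "g \<in> polys (Range H)" "\<not> \<rho> s f l" "\<not> \<rho> s' g l'" for s f l s' g l'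
    proof -
      obtain f' where "prel H f' f" using prel_ex[OF fg0(1)] by blast
      moreover obtain g' where "prel H g' g" using prel_ex[OF fg0(2)] by blast
      ultimately have fg: "prel H f' f" "prel H g' g" by blast+
      show ?thesis using fg0(3,4) vge_mult_neg[of s "poly f' b" l s' "poly g' b" l']
        rho[OF fg(1)] rho[OF fg(2)] rho[OF prel_mult[OF fg]] by simp
    qed
    show "\<rho> s [:c:] l \<longleftrightarrow> vge s c l" if cR: "c \<in> Range H" for s c l
    proof -
      obtain d where d: "(d, c) \<in> H" using cR by blast
      show ?thesis using rho[OF prel_const[OF d]] vhom_0[OF d] vhom_v[OF d] by (auto simp: vge_def)
    qed
  qed
  obtain p where p: "p \<in> polys K" "p \<noteq> 0" "poly p b = 0" using algebraic_K by blast
  have pR: "p \<in> polys (Range H)" using p(1) K_subset_Range by (auto simp: polys_def)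
  have prho: "\<rho> s p l" for s l using rho[OF prel_K[OF p(1)]] p(3) by simp
  have "\<exists>c. \<forall>g\<in>polys (Range H). \<forall>s. \<forall>l\<in>\<Gamma>. vge s (poly g c) l \<longleftrightarrow> \<rho> s g l"
    using representable
  proof (elim disjE exE conjE)
    fix c \<delta> assume q: "qcut vb \<delta>" and eq: "\<forall>f\<in>polys (Range H). \<forall>s. \<forall>l\<in>\<Gamma>. qv c \<delta> s f l \<longleftrightarrow> \<rho> s f l"
    \<comment> \<open>The polynomial \<open>p\<close> over K vanishes at b and is related to itself
      by \<open>H\<close>, so it has infinite value under \<open>\<rho>\<close>.\<close>
    have "\<delta> = infc" by (rule infinite_value_ball[OF q p(2), of c]) (use eq pR prho in simp)
    then show ?thesis using eq qv_infc by auto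
  next
    fix N assume N: "nest vb N" and eq: "\<forall>f\<in>polys (Range H). \<forall>s. \<forall>l\<in>\<Gamma>. nqv N s f l \<longleftrightarrow> \<rho> s f l"
    have False by (rule no_infinite_value_nest[OF N p(2)]) (use eq pR prho in simp)
    then show ?thesis ..
  qed
  then obtain c where c: "\<And>g s l. g \<in> polys (Range H) \<Longrightarrow> l \<in> \<Gamma> \<Longrightarrow> vge s (poly g c) l \<longleftrightarrow> \<rho> s g l" by blast
  \<comment> \<open>The extension sends f(b) to g(c) for corresponding f and g. Equal bounds give
    equal vanishing and equal values, which already contains well-definedness.\<close>
  define H' where "H' = {(poly f b, poly g c) | f g. prel H f g}"
  have "vhom H'" unfolding vhom_def
  proof (intro conjI allI impI)
    show "(iota k, iota k) \<in> H'" for k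
      using prel_const[OF vhom_iota, of k] by (force simp: H'_def)
  next
    fix x y x' y' assume "(x, y) \<in> H'" "(x', y') \<in> H'"
    then obtain f g f' g' where *: "x = poly f b" "y = poly g c" "prel H f g" "x' = poly f' b" "y' = poly g' c" "prel H f' g'"
      by (auto simp: H'_def)
    show "(x + x', y + y') \<in> H'" using prel_add[OF *(3,6)] unfolding H'_def * by (metis (mono_tags, lifting) mem_Collect_eq poly_add)
    show "(x * x', y * y') \<in> H'" using prel_mult[OF *(3,6)] unfolding H'_def * by (metis (mono_tags, lifting) mem_Collect_eq poly_mult)
  next
    fix x y assume "(x, y) \<in> H'"
    then obtain f g where *: "x = poly f b" "y = poly g c" "prel H f g" by (auto simp: H'_def)
    have gP: "g \<in> polys (Range H)" using *(3) by (auto simp: prel_def polys_def)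
    have "vge s x l \<longleftrightarrow> vge s y l" if "l \<in> \<Gamma>" for s l using c[OF gP that] rho[OF *(3)] * by simp
    from vge_cong_eq[OF this] show "x = 0 \<longleftrightarrow> y = 0" "x \<noteq> 0 \<Longrightarrow> vb x = vb y" by blast+
  qed
  moreover have "H \<subseteq> H'"
  proof clarify
    fix x y assume "(x, y) \<in> H"
    from prel_const[OF this] show "(x, y) \<in> H'" unfolding H'_def by force
  qed
  moreover have "(b, c) \<in> H'"
  proof -
    have "prel H [:0, 1:] [:0, 1:]" using vhom_00 vhom_11 by (auto simp: prel_def coeff_pCons')
    then show ?thesis unfolding H'_def by force
  qed
  ultimately show ?thesis by blast
qed

end

text \<open>A maximal extension is total by \<open>vhom_extend_point\<close>. It is onto because it
  maps the finite set of roots of a polynomial over K injectively into itself.\<close>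

theorem vhom_extend:
  assumes "vhom H0" shows "\<exists>\<sigma>\<in>Gdec iota vb. \<forall>(a, b)\<in>H0. \<sigma> a = b"
proof -
  let ?A = "{H. vhom H \<and> H0 \<subseteq> H}"
  have "\<exists>M\<in>?A. \<forall>X\<in>?A. M \<subseteq> X \<longrightarrow> X = M"
  proof (rule subset_Zorn_nonempty)
    show "?A \<noteq> {}" using assms by blast
    fix C assume C: "C \<noteq> {}" "subset.chain ?A C"
    have CA: "\<And>X. X \<in> C \<Longrightarrow> vhom X \<and> H0 \<subseteq> X" using C(2) by (auto simp: subset.chain_def)
    have two: "\<exists>X\<in>C. x \<in> X \<and> y \<in> X" if xy: "x \<in> \<Union>C" "y \<in> \<Union>C" for x y
    proof -
      obtain X Y where XY: "X \<in> C" "x \<in> X" "Y \<in> C" "y \<in> Y" using xy by blast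
      then have "X \<subseteq> Y \<or> Y \<subseteq> X" using C(2) unfolding subset_chain_def by blast
      then show ?thesis using XY by blast
    qed
    have "vhom (\<Union>C)" unfolding vhom_def
    proof (intro conjI allI impI)
      show "(iota k, iota k) \<in> \<Union>C" for k using C(1) CA vhom_iota by blast
    next
      fix a b c d assume "(a, b) \<in> \<Union>C" "(c, d) \<in> \<Union>C"
      then obtain X where X: "X \<in> C" "(a, b) \<in> X" "(c, d) \<in> X" using two by blast
      then show "(a + c, b + d) \<in> \<Union>C" "(a * c, b * d) \<in> \<Union>C" using CA vhom_add vhom_mult by blast+
    next
      fix a b assume "(a, b) \<in> \<Union>C"
      then obtain X where X: "X \<in> C" "(a, b) \<in> X" by blast
      then show "a = 0 \<longleftrightarrow> b = 0" "a \<noteq> 0 \<Longrightarrow> vb a = vb b" using CA vhom_0 vhom_v by blast+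
    qed
    moreover have "H0 \<subseteq> \<Union>C" using C(1) CA by blast
    ultimately show "\<Union>C \<in> ?A" by blast
  qed
  then obtain M where M0: "M \<in> ?A" "\<forall>X\<in>?A. M \<subseteq> X \<longrightarrow> X = M" by (rule bexE)
  have M: "vhom M" "H0 \<subseteq> M" using M0(1) by simp_all
  have mx: "X = M" if "vhom X" "M \<subseteq> X" for X using M0(2) that M(2) by auto
  have tot: "\<exists>c. (b, c) \<in> M" for b
  proof -
    obtain c H' where "vhom H'" "M \<subseteq> H'" "(b, c) \<in> H'" using vhom_extend_point[OF M(1), of b] by (elim exE conjE)
    then show ?thesis using mx[of H'] by auto
  qed
  define \<sigma> where "\<sigma> a = (THE c. (a, c) \<in> M)" for a
  have s: "(a, \<sigma> a) \<in> M" for a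
    using tot[of a] vhom_functional[OF M(1)] unfolding \<sigma>_def by (metis the_equality)
  have su: "\<sigma> a = c" if "(a, c) \<in> M" for a c using vhom_functional[OF M(1)] s that by blast
  have inj: "inj \<sigma>" using vhom_injective[OF M(1)] s by (metis injI)
  have K: "\<sigma> (iota k) = iota k" for k using su vhom_iota[OF M(1)] by blast
  have ex: "\<exists>x. \<sigma> x = y" for y
  proof -
    obtain p where p: "p \<in> polys K" "p \<noteq> 0" "poly p y = 0" using algebraic_K by blast
    let ?R = "{z. poly p z = 0}"
    have "\<sigma> ` ?R \<subseteq> ?R"
    proof clarify
      fix z assume "poly p z = 0"
      moreover have "(poly p z, poly p (\<sigma> z)) \<in> M" by (rule vhom_poly[OF M(1) prel_K[OF M(1) p(1)] s])
      ultimately show "poly p (\<sigma> z) = 0" using vhom_0[OF M(1)] by blast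
    qed
    then have "\<sigma> ` ?R = ?R"
      using poly_roots_finite[OF p(2)] inj by (intro endo_inj_surj) (auto intro: inj_on_subset)
    moreover have "y \<in> ?R" using p(3) by simp
    ultimately have "y \<in> \<sigma> ` ?R" by simp
    then show ?thesis by blast
  qed
  have "surj \<sigma>" using ex by (metis surjI surj_def)
  moreover have "\<sigma> (a + b) = \<sigma> a + \<sigma> b" "\<sigma> (a * b) = \<sigma> a * \<sigma> b" for a b
    using su vhom_add[OF M(1) s s] vhom_mult[OF M(1) s s] by blast+
  moreover have "vb (\<sigma> a) = vb a" if "a \<noteq> 0" for a using vhom_v[OF M(1) s that] by simp
  ultimately have "\<sigma> \<in> Gdec iota vb" using inj K by (simp add: Gdec_def bij_def)
  moreover have "\<forall>(a, b)\<in>H0. \<sigma> a = b" using su M(2) by blast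
  ultimately show ?thesis by blast
qed

text \<open>The map f(a) \<mapsto> f(c) on K[a] is well defined, injective and value preserving
  because the bounds agree, and it extends to the whole field.\<close>

theorem conjugate_point:
  assumes eq: "\<And>f s l. f \<in> polys K \<Longrightarrow> l \<in> \<Gamma> \<Longrightarrow> vge s (poly f a) l \<longleftrightarrow> vge s (poly f c) l"
  shows "\<exists>\<sigma>\<in>Gdec iota vb. \<sigma> a = c"
proof -
  let ?H = "{(poly f a, poly f c) | f. f \<in> polys K}"
  have "vhom ?H" unfolding vhom_def
  proof (intro conjI allI impI)
    fix k
    show "(iota k, iota k) \<in> ?H" using polys_const[OF subfld_K, of "iota k"] by force
  next
    fix x y x' y' assume "(x, y) \<in> ?H" "(x', y') \<in> ?H"
    then obtain f f' where *: "x = poly f a" "y = poly f c" "f \<in> polys K" "x' = poly f' a" "y' = poly f' c" "f' \<in> polys K"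
      by auto
    show "(x + x', y + y') \<in> ?H" using polys_add[OF subfld_K *(3,6)] unfolding * by (metis (mono_tags, lifting) mem_Collect_eq poly_add)
    show "(x * x', y * y') \<in> ?H" using polys_mult[OF subfld_K *(3,6)] unfolding * by (metis (mono_tags, lifting) mem_Collect_eq poly_mult)
  next
    fix x y assume "(x, y) \<in> ?H"
    then obtain f where *: "x = poly f a" "y = poly f c" "f \<in> polys K" by auto
    have "vge s x l \<longleftrightarrow> vge s y l" if "l \<in> \<Gamma>" for s l using eq[OF *(3) that] * by simp
    from vge_cong_eq[OF this] show "x = 0 \<longleftrightarrow> y = 0" "x \<noteq> 0 \<Longrightarrow> vb x = vb y" by blast+
  qed
  from vhom_extend[OF this] obtain \<sigma> where s: "\<sigma> \<in> Gdec iota vb" "\<forall>(x, y)\<in>?H. \<sigma> x = y" by (rule bexE)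
  have "[:0, 1:] \<in> polys K" using subfld_K by (auto simp: polys_def coeff_pCons' subfld_def)
  then have ac: "(a, c) \<in> ?H" by force
  show ?thesis using s(1) bspec[OF s(2) ac] by auto
qed

end


section \<open>The action of the decomposition group\<close>

context vclosure
begin

abbreviation "G \<equiv> Gdec iota vb"

lemma G_add: "\<sigma> \<in> G \<Longrightarrow> \<sigma> (a + b) = \<sigma> a + \<sigma> b" by (simp add: Gdec_def)
lemma G_mult: "\<sigma> \<in> G \<Longrightarrow> \<sigma> (a * b) = \<sigma> a * \<sigma> b" by (simp add: Gdec_def)
lemma G_iota: "\<sigma> \<in> G \<Longrightarrow> \<sigma> (iota k) = iota k" by (simp add: Gdec_def)
lemma G_v: "\<sigma> \<in> G \<Longrightarrow> a \<noteq> 0 \<Longrightarrow> vb (\<sigma> a) = vb a" by (simp add: Gdec_def)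
lemma G_bij: "\<sigma> \<in> G \<Longrightarrow> bij \<sigma>" by (simp add: Gdec_def)
lemma G_0 [simp]: "\<sigma> \<in> G \<Longrightarrow> \<sigma> 0 = 0" using G_iota[of \<sigma> 0] by simp
lemma G_1 [simp]: "\<sigma> \<in> G \<Longrightarrow> \<sigma> 1 = 1" using G_iota[of \<sigma> 1] by (simp add: hom_one)
lemma G_eq_iff: "\<sigma> \<in> G \<Longrightarrow> \<sigma> a = \<sigma> b \<longleftrightarrow> a = b" using G_bij[of \<sigma>] by (auto simp: bij_def inj_eq)
lemma G_diff: "\<sigma> \<in> G \<Longrightarrow> \<sigma> (a - b) = \<sigma> a - \<sigma> b"
  using G_add[of \<sigma> "a - b" b] by (simp add: eq_diff_eq)

lemma G_id: "id \<in> G" by (simp add: Gdec_def)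

lemma G_inv: assumes s: "\<sigma> \<in> G" shows "inv \<sigma> \<in> G"
proof -
  have b: "bij \<sigma>" by (rule G_bij[OF s])
  have e: "inv \<sigma> x = y \<longleftrightarrow> x = \<sigma> y" for x y using b by (metis bij_inv_eq_iff)
  have i: "\<sigma> (inv \<sigma> x) = x" for x using b by (simp add: bij_is_surj surj_f_inv_f)
  have z: "inv \<sigma> x \<noteq> 0" if "x \<noteq> 0" for x using i[of x] that s by auto
  show ?thesis unfolding Gdec_def
    using b s by (auto simp: e G_add G_mult G_iota i bij_imp_bij_inv) (metis G_v i z)
qed

lemma G_vball: assumes s: "\<sigma> \<in> G" and q: "qcut vb \<delta>" shows "\<sigma> ` vball vb a \<delta> = vball vb (\<sigma> a) \<delta>"
proof -
  have *: "\<sigma> x \<in> vball vb (\<sigma> a) \<delta> \<longleftrightarrow> x \<in> vball vb a \<delta>" for x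
    using G_v[OF s, of "x - a"] by (cases "x = a") (simp_all add: vball_iff[OF q] G_diff[OF s] G_eq_iff[OF s])
  show ?thesis
  proof (intro set_eqI iffI)
    fix y assume "y \<in> vball vb (\<sigma> a) \<delta>"
    moreover obtain x where "y = \<sigma> x" using G_bij[OF s] by (metis bij_pointE)
    ultimately show "y \<in> \<sigma> ` vball vb a \<delta>" using * by auto
  qed (use * in auto)
qed

lemma G_vcball: "\<sigma> \<in> G \<Longrightarrow> \<gamma> \<in> \<Gamma> \<Longrightarrow> \<sigma> ` vcball vb a \<gamma> = vcball vb (\<sigma> a) \<gamma>"
  using G_vball[of \<sigma> "pq vb \<gamma>" a] by (simp add: vball_pq)

lemma G_coeff: assumes "\<sigma> \<in> G" "f \<in> polys K" shows "\<sigma> (coeff f i) = coeff f i"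
proof -
  have "coeff f i \<in> K" using assms(2) by (simp add: polys_def)
  then show ?thesis using G_iota[OF assms(1)] by auto
qed

lemma G_poly:
  assumes s: "\<sigma> \<in> G" and f: "f \<in> polys K" shows "poly f (\<sigma> a) = \<sigma> (poly f a)"
proof -
  have sm: "\<sigma> (sum h A) = (\<Sum>i\<in>A. \<sigma> (h i))" for h and A :: "nat set"
    by (induction A rule: infinite_finite_induct) (auto simp: G_add[OF s] s)
  have pw: "\<sigma> (x ^ n) = \<sigma> x ^ n" for x n by (induction n) (auto simp: G_mult[OF s] s)
  have c: "\<sigma> (coeff f i) = coeff f i" for i by (rule G_coeff[OF s f])
  show ?thesis unfolding poly_altdef by (simp add: sm pw c G_mult[OF s])
qed

text \<open>The coefficients of f are fixed by \<sigma>, so its Taylor coefficients at \<sigma>(a)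
  are the \<sigma>-images of those at a.\<close>

lemma G_mterms:
  assumes s: "\<sigma> \<in> G" and f: "f \<in> polys K" shows "mterms (\<sigma> a) f = mterms a f"
proof -
  have sm: "\<sigma> (sum h A) = (\<Sum>i\<in>A. \<sigma> (h i))" for h and A :: "nat set"
    by (induction A rule: infinite_finite_induct) (auto simp: G_add[OF s] s)
  have c: "coeff (pcompose g [:\<sigma> a, 1:]) n = \<sigma> (coeff (pcompose g [:a, 1:]) n)"
    if "\<And>i. \<sigma> (coeff g i) = coeff g i" for g n
    using that
  proof (induction g arbitrary: n rule: pCons_induct)
    case (pCons b g)
    have g: "\<sigma> (coeff g i) = coeff g i" for i using pCons.prems[of "Suc i"] by simp
    have b: "\<sigma> b = b" using pCons.prems[of 0] by simp
    have 1: "coeff ([:\<sigma> a, 1:] * pcompose g [:\<sigma> a, 1:]) n = \<sigma> (coeff ([:a, 1:] * pcompose g [:a, 1:]) n)" for n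
      by (auto simp: coeff_pCons' pCons.IH[OF g] G_add[OF s] G_mult[OF s] s)
    show ?case unfolding pcompose_pCons coeff_add G_add[OF s] 1
      by (auto simp: coeff_pCons' b s)
  qed (simp add: s)
  have "\<sigma> (coeff f i) = coeff f i" for i by (rule G_coeff[OF s f])
  from c[OF this] have cf: "coeff (pcompose f [:\<sigma> a, 1:]) n = \<sigma> (coeff (pcompose f [:a, 1:]) n)" for n .
  have nz: "\<sigma> x \<noteq> 0 \<longleftrightarrow> x \<noteq> 0" for x using G_eq_iff[OF s, of x 0] s by simp
  show ?thesis unfolding mterms_def cf nz by (intro Collect_cong ex_cong1) (auto simp: G_v[OF s])
qed

lemma G_qv: "\<sigma> \<in> G \<Longrightarrow> f \<in> polys K \<Longrightarrow> qv (\<sigma> a) \<delta> s f l \<longleftrightarrow> qv a \<delta> s f l"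
  by (simp add: qv_def lmon_def G_mterms)

lemma qvalued_qv:
  assumes q: "qcut vb \<delta>" shows "qvalued vb K (qv a \<delta>)"
proof
  show "subfld K" by (rule subfld_K)
  show "\<exists>p\<in>polys K. p \<noteq> 0 \<and> poly p z = 0" for z by (rule algebraic_K)
  show "qv a \<delta> s' f l'" if "l \<in> \<Gamma>" "l' \<in> \<Gamma>" "qv a \<delta> s f l" "l' < l \<or> l' = l \<and> (s' \<longrightarrow> s)" for s f l s' l'
    by (rule qv_weaken[OF q that])
  show "qv a \<delta> s (f + g) l" if "l \<in> \<Gamma>" "qv a \<delta> s f l" "qv a \<delta> s g l" for s f g l
    by (rule qv_add[OF q that])
  show "qv a \<delta> (s \<or> s') (f * g) (l + l')" if "l \<in> \<Gamma>" "l' \<in> \<Gamma>" "qv a \<delta> s f l" "qv a \<delta> s' g l'" for s f l s' g l'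
    by (rule qv_mult[OF q that])
  show "\<not> qv a \<delta> (s \<and> s') (f * g) (l + l')" if "l \<in> \<Gamma>" "l' \<in> \<Gamma>" "\<not> qv a \<delta> s f l" "\<not> qv a \<delta> s' g l'" for s f l s' g l'
    by (rule qv_mult_neg[OF q that])
  show "qv a \<delta> s [:c:] l \<longleftrightarrow> vge s c l" for s c l
    by (rule qv_const[OF q])
qed

text \<open>Take a point of a member avoiding the roots of the product of the nonzero polynomials in
  \<open>S\<close>. The valuation axioms for a nest thereby reduce to those of v, at most three
  polynomials at a time.\<close>

lemma nqv_eval:
  assumes N: "nest vb N" and S: "finite S"
  shows "\<exists>b. \<forall>f\<in>S. \<forall>s. \<forall>l\<in>\<Gamma>. nqv N s f l \<longleftrightarrow> vge s (poly f b) l"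
proof -
  define p where "p = prod id (S - {0})"
  have pnz: "p \<noteq> 0" using S by (simp add: p_def)
  obtain B where B: "B \<in> N" "rootfree B p" using nest_rootfree[OF N pnz] by blast
  obtain b \<gamma> where b: "\<gamma> \<in> \<Gamma>" "B = vcball vb b \<gamma>" using nest_ballE[OF N B(1)] .
  have bB: "b \<in> B" using b by simp
  have "nqv N s f l \<longleftrightarrow> vge s (poly f b) l" if f: "f \<in> S" and l: "l \<in> \<Gamma>" for f s l
  proof (cases "f = 0")
    case True
    then show ?thesis using b B(1) by (auto simp: nqv_def)
  next
    case False
    have "f dvd p" unfolding p_def using S f False dvd_prodI[of "S - {0}" f id] by simp
    then have "rootfree B f" using B(2) False by (auto simp: rootfree_def)
    then show ?thesis using nqv_rootfree[OF N B(1) _ bB l] by blast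
  qed
  then show ?thesis by blast
qed

lemma qvalued_nqv:
  assumes N: "nest vb N" shows "qvalued vb K (nqv N)"
proof
  show "subfld K" by (rule subfld_K)
  show "\<exists>p\<in>polys K. p \<noteq> 0 \<and> poly p z = 0" for z by (rule algebraic_K)
  show "nqv N s' f l'" if "l \<in> \<Gamma>" "l' \<in> \<Gamma>" "nqv N s f l" "l' < l \<or> l' = l \<and> (s' \<longrightarrow> s)" for s f l s' l'
    using nqv_eval[OF N, of "{f}"] that vge_weaken[of s _ l l' s'] by auto
  show "nqv N s (f + g) l" if "l \<in> \<Gamma>" "nqv N s f l" "nqv N s g l" for s f g l
    using nqv_eval[OF N, of "{f, g, f + g}"] that vge_add[of s _ l] by auto
  show "nqv N (s \<or> s') (f * g) (l + l')" if "l \<in> \<Gamma>" "l' \<in> \<Gamma>" "nqv N s f l" "nqv N s' g l'" for s f l s' g l'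
    using nqv_eval[OF N, of "{f, g, f * g}"] that vge_mult[of s _ l s' _ l'] by auto
  show "\<not> nqv N (s \<and> s') (f * g) (l + l')" if "l \<in> \<Gamma>" "l' \<in> \<Gamma>" "\<not> nqv N s f l" "\<not> nqv N s' g l'" for s f l s' g l'
    using nqv_eval[OF N, of "{f, g, f * g}"] that vge_mult_neg[of s _ l s' _ l'] by auto
  show "nqv N s [:c:] l \<longleftrightarrow> vge s c l" if "l \<in> \<Gamma>" for s c l
    using nqv_eval[OF N, of "{[:c:]}"] that by auto
qed

section \<open>Agreement on K[x] and conjugacy\<close>

definition agree :: "(bool \<Rightarrow> 'l poly \<Rightarrow> 'g \<Rightarrow> bool) \<Rightarrow> (bool \<Rightarrow> 'l poly \<Rightarrow> 'g \<Rightarrow> bool) \<Rightarrow> bool" where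
  "agree \<rho> \<rho>' \<longleftrightarrow> (\<forall>f\<in>polys K. \<forall>s. \<forall>l\<in>\<Gamma>. \<rho> s f l \<longleftrightarrow> \<rho>' s f l)"

lemma agreeI: "(\<And>f. f \<in> polys K \<Longrightarrow> below \<rho> \<rho>' f) \<Longrightarrow> (\<And>f. f \<in> polys K \<Longrightarrow> below \<rho>' \<rho> f) \<Longrightarrow> agree \<rho> \<rho>'"
  unfolding agree_def below_def by blast

lemma agree_sym: "agree \<rho> \<rho>' \<Longrightarrow> agree \<rho>' \<rho>"
  by (simp add: agree_def)

lemma agree_below: "agree \<rho> \<rho>' \<Longrightarrow> f \<in> polys K \<Longrightarrow> below \<rho> \<rho>' f"
  by (simp add: agree_def below_def)

text \<open>The lift of the valuation at a still gives infinite value to a polynomial over K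
  vanishing at a, so it is a point c of the ball, and c is conjugate to a.\<close>

lemma lift_point:
  assumes q: "qcut vb \<epsilon>" and bel: "\<And>f. f \<in> polys K \<Longrightarrow> below (qv b \<epsilon>) (qv a infc) f"
  shows "\<exists>\<sigma>\<in>G. \<sigma> a \<in> vball vb b \<epsilon>"
proof -
  interpret qvalued vb K "qv a infc" by (rule qvalued_qv[OF qcut_infc])
  obtain p where p: "p \<in> polys K" "p \<noteq> 0" "poly p a = 0" using algebraic_K by blast
  have pinf: "qv a infc True p l" if "l \<in> \<Gamma>" for l using p(3) that by (simp add: qv_infc vge_def)
  have "\<forall>f\<in>polys K. below (qv b \<epsilon>) (qv a infc) f" using bel by blast
  from lift[OF q this] show ?thesis
  proof (elim disjE exE conjE)
    fix c \<delta> assume *: "qcut vb \<delta>" "c \<in> vball vb b \<epsilon>" "\<forall>f\<in>polys K. \<forall>s. \<forall>l\<in>\<Gamma>. qv c \<delta> s f l \<longleftrightarrow> qv a infc s f l"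
    have "\<delta> = infc" by (rule infinite_value_ball[OF *(1) p(2), of c]) (use *(3) p(1) pinf in simp)
    then have "\<exists>\<sigma>\<in>G. \<sigma> a = c"
      using *(3) qv_infc by (intro conjugate_point) auto
    then show ?thesis using *(2) by blast
  next
    fix N assume *: "nest vb N" "\<forall>f\<in>polys K. \<forall>s. \<forall>l\<in>\<Gamma>. nqv N s f l \<longleftrightarrow> qv a infc s f l"
    have False by (rule no_infinite_value_nest[OF *(1) p(2)]) (use *(2) p(1) pinf in simp)
    then show ?thesis ..
  qed
qed

text \<open>The valuation of a ball lies below that of its centre. If it came from a nest,
  maximality of nests would identify the nest with the valuation at a point, which takes infinite
  values.\<close>

lemma not_agree_ball_nest:
  assumes q: "qcut vb \<delta>" and N: "nest vb N" and ag: "agree (qv a \<delta>) (nqv N)" shows False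
proof -
  interpret qvalued vb K "qv a infc" by (rule qvalued_qv[OF qcut_infc])
  obtain p where p: "p \<in> polys K" "p \<noteq> 0" "poly p a = 0" using algebraic_K by blast
  have pinf: "qv a infc True p l" if "l \<in> \<Gamma>" for l using p(3) that by (simp add: qv_infc vge_def)
  have "below (nqv N) (qv a infc) f" if "f \<in> polys K" for f
    using agree_below[OF agree_sym[OF ag] that] qv_ball_mono[OF q qcut_infc le_qcut_infc[OF q], of a a f] below_trans by auto
  from nest_above[OF N this p(1)] have "nqv N True p l" if "l \<in> \<Gamma>" for l
    using pinf that by (simp add: below_def)
  then show False by (rule no_infinite_value_nest[OF N p(2)])
qed

text \<open>Testing f at the levels \<open>tval c f l\<close> reads off both sides of the quasi-cut;
  this works because f vanishes at c, so that all its terms depend strictly on the radius.\<close>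

lemma tval_qv_False:
  assumes q: "qcut vb \<delta>" and f: "f \<noteq> 0" "poly f c = 0" and l: "l \<in> \<Gamma>"
  shows "qv c \<delta> False f (tval c f l) \<longleftrightarrow> l \<in> fst \<delta>" "qv c \<delta> True f (tval c f l) \<longleftrightarrow> l \<notin> snd \<delta>"
proof -
  obtain t where t: "t \<in> mterms c f" "tval c f l = snd t + zsm (fst t) l" using tval_attained[OF f(1)] by blast
  have tp: "0 < fst t" by (rule mterms_pos[OF f(2) t(1)])
  have T: "tge \<delta> s (fst t, snd t) (snd t + zsm (fst t) l)" if "qv c \<delta> s f (tval c f l)" for s
    using that t unfolding qv_mterms[OF q tval_in[OF f(1) l]] by auto
  show "qv c \<delta> False f (tval c f l) \<longleftrightarrow> l \<in> fst \<delta>"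
    using qv_tval_False[OF q f(1), of l c] T[of False] tge_hi_strict[OF q l _ tp, of "snd t"] by blast
  show "qv c \<delta> True f (tval c f l) \<longleftrightarrow> l \<notin> snd \<delta>"
    using qv_tval_True[OF q f l] T[of True] tge_hi[of l \<delta> "fst t" "snd t"] tp by auto
qed

lemma agree_radius:
  assumes q: "qcut vb \<delta>" "qcut vb \<epsilon>" and ag: "agree (qv c \<delta>) (qv c \<epsilon>)"
  shows "\<delta> = \<epsilon>"
proof -
  obtain p where p: "p \<in> polys K" "p \<noteq> 0" "poly p c = 0" using algebraic_K by blast
  have eq: "l \<in> fst \<delta> \<longleftrightarrow> l \<in> fst \<epsilon>" "l \<in> snd \<delta> \<longleftrightarrow> l \<in> snd \<epsilon>" if l: "l \<in> \<Gamma>" for l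
    using tval_qv_False[OF q(1) p(2,3) l] tval_qv_False[OF q(2) p(2,3) l] ag p(1) tval_in[OF p(2) l, of c]
    by (auto simp: agree_def)
  have "fst \<delta> = fst \<epsilon>" using eq(1) qcut_fst[OF q(1)] qcut_fst[OF q(2)] by blast
  moreover have "snd \<delta> = snd \<epsilon>" using eq(2) qcut_snd[OF q(1)] qcut_snd[OF q(2)] by blast
  ultimately show ?thesis by (simp add: prod_eq_iff)
qed

text \<open>Once a conjugate of a is a centre of the second ball too, the radii are compared by a
  polynomial over K vanishing at that centre.\<close>

theorem agree_balls:
  assumes q: "qcut vb \<delta>" "qcut vb \<epsilon>" and ag: "agree (qv a \<delta>) (qv b \<epsilon>)"
  shows "\<delta> = \<epsilon> \<and> (\<exists>\<sigma>\<in>G. \<sigma> ` vball vb a \<delta> = vball vb b \<epsilon>)"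
proof -
  have "below (qv b \<epsilon>) (qv a infc) f" if "f \<in> polys K" for f
    using agree_below[OF agree_sym[OF ag] that] qv_ball_mono[OF q(1) qcut_infc le_qcut_infc[OF q(1)], of a a f] below_trans by auto
  from lift_point[OF q(2) this] obtain \<sigma> where s: "\<sigma> \<in> G" "\<sigma> a \<in> vball vb b \<epsilon>" by blast
  have "agree (qv (\<sigma> a) \<delta>) (qv (\<sigma> a) \<epsilon>)"
    using ag unfolding agree_def by (simp add: qv_recenter[OF q(2) s(2)] G_qv[OF s(1), of _ a \<delta>])
  then have de: "\<delta> = \<epsilon>" by (rule agree_radius[OF q])
  have "\<sigma> ` vball vb a \<delta> = vball vb b \<epsilon>"
    using G_vball[OF s(1) q(1)] vball_recenter[OF q(2) s(2)] de by simp
  then show ?thesis using de s(1) by blast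
qed

lemma least_root_poly:
  obtains g c where "g \<in> polys K" "g \<noteq> 0" "c \<in> vcball vb a \<gamma>" "poly g c = 0"
    "\<And>r. r \<in> polys K \<Longrightarrow> r \<noteq> 0 \<Longrightarrow> degree r < degree g \<Longrightarrow> rootfree (vcball vb a \<gamma>) r"
proof -
  let ?R = "\<lambda>h. h \<in> polys K \<and> h \<noteq> 0 \<and> (\<exists>c\<in>vcball vb a \<gamma>. poly h c = 0)"
  obtain g0 where "?R g0" using algebraic_K[of a] vcball_self by blast
  then obtain g where g: "?R g" and gmin: "\<And>h. ?R h \<Longrightarrow> degree g \<le> degree h"
    using ex_has_least_nat[of ?R g0 degree] by blast
  then obtain c where "c \<in> vcball vb a \<gamma>" "poly g c = 0" by blast
  moreover have "rootfree (vcball vb a \<gamma>) r" if "r \<in> polys K" "r \<noteq> 0" "degree r < degree g" for r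
    using gmin[of r] that by (force simp: rootfree_def)
  ultimately show thesis using that g by blast
qed

text \<open>This is \<open>expand_below\<close> with the root c as centre: absence of roots in the
  closed ball implies absence in the open ball around c.\<close>

lemma closed_ball_expand:
  assumes "qvalued vb K \<rho>" and ga: "\<gamma> \<in> \<Gamma>" and g: "g \<in> polys K" "g \<noteq> 0" and c: "c \<in> vcball vb a \<gamma>" "poly g c = 0"
    and rf: "\<And>r. r \<in> polys K \<Longrightarrow> r \<noteq> 0 \<Longrightarrow> degree r < degree g \<Longrightarrow> rootfree (vcball vb a \<gamma>) r"
    and bg: "below (qv a (pq vb \<gamma>)) \<rho> g"
    and br: "\<And>r. r \<in> polys K \<Longrightarrow> r \<noteq> 0 \<Longrightarrow> degree r < degree g \<Longrightarrow> below (qv a (pq vb \<gamma>)) \<rho> r"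
    and f: "f \<in> polys K"
  shows "below (qv a (pq vb \<gamma>)) \<rho> f"
proof -
  interpret qvalued vb K \<rho> by fact
  have cb: "c \<in> vball vb a (pq vb \<gamma>)" using c ga by (simp add: vball_pq)
  have eq: "below (qv c (pq vb \<gamma>)) \<rho> h \<longleftrightarrow> below (qv a (pq vb \<gamma>)) \<rho> h" for h
    using qv_recenter[OF qcut_pq cb] by (simp add: below_def)
  have sub: "vball vb c (cutp (pq vb \<gamma>)) \<subseteq> vcball vb a \<gamma>"
  proof -
    have "vball vb c (cutp (pq vb \<gamma>)) \<subseteq> vball vb c (pq vb \<gamma>)"
      by (rule vball_radius_mono) (auto simp: le_qcut_def cutp_def[of "pq vb \<gamma>", THEN arg_cong[of _ _ snd]])
    then show ?thesis using vball_recenter[OF qcut_pq cb] ga by (simp add: vball_pq)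
  qed
  have "below (qv c (pq vb \<gamma>)) \<rho> f"
  proof (rule expand_below[OF qcut_pq g c(2) _ _ _ f])
    show "rootfree (vball vb c (cutp (pq vb \<gamma>))) r" if "r \<in> polys K" "r \<noteq> 0" "degree r < degree g" for r
      using rootfree_subset[OF rf[OF that] sub] .
  qed (use bg br eq in auto)
  then show ?thesis using eq by simp
qed

section \<open>Conjugacy of nests\<close>

text \<open>A nest has no centre to be lifted. Instead a member C of \<open>M\<close> with
  \<open>\<omega>\<^sub>B \<le> \<omega>\<^sub>C\<close> on K[x] is found by comparing the least
  degrees of polynomials with a root in B and in C. The centre of C then has a conjugate in B, and
  the inverse automorphism moves B onto a ball containing C.\<close>

lemma agree_nests_ball:
  assumes N: "nest vb N" and M: "nest vb M" and ag: "agree (nqv N) (nqv M)"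
    and ga: "\<gamma> \<in> \<Gamma>" and B: "vcball vb a \<gamma> \<in> N"
  shows "\<exists>\<sigma>\<in>G. \<exists>C\<in>M. C \<subseteq> vcball vb (\<sigma> a) \<gamma>"
proof -
  let ?B = "vcball vb a \<gamma>" and ?qB = "qv a (pq vb \<gamma>)"
  obtain g c where g: "g \<in> polys K" "g \<noteq> 0" "c \<in> ?B" "poly g c = 0"
    and grf: "\<And>r. r \<in> polys K \<Longrightarrow> r \<noteq> 0 \<Longrightarrow> degree r < degree g \<Longrightarrow> rootfree ?B r"
    using least_root_poly[of a \<gamma>] by metis
  \<comment> \<open>Inside \<open>C0\<close> the valuations of the members of \<open>M\<close> are
    already stationary on \<open>g\<close>.\<close>
  obtain C0 where C0: "C0 \<in> M" "rootfree C0 g" using nest_rootfree[OF M g(2)] by blast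
  have rfeq: "qv d (pq vb \<eta>) s r l \<longleftrightarrow> nqv M' s r l"
    if "nest vb M'" "\<eta> \<in> \<Gamma>" "vcball vb d \<eta> \<in> M'" "rootfree (vcball vb d \<eta>) r" "l \<in> \<Gamma>" for d \<eta> M' s r l
    using nqv_rootfree[OF that(1,3,4) vcball_self that(5)] qv_rootfree[OF qcut_pq, of d \<eta> r d l s] that by (simp add: vball_pq)
  have BN: "below ?qB (nqv M) f" if "f \<in> polys K" for f
    using below_trans[OF nqv_ball_below[OF B ga] agree_below[OF ag that]] .
  have NM: "nqv N s f l \<longleftrightarrow> nqv M s f l" if "f \<in> polys K" "l \<in> \<Gamma>" for f s l
    using ag that by (simp add: agree_def)
  \<comment> \<open>The smaller of the two degrees decides. Below it neither ball contains roots, so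
    both give the common value of the nests. On the least-degree polynomial of one ball, the other
    ball contains no root (for \<open>g\<close> by the choice of \<open>C0\<close>, for
    \<open>h\<close> by minimality of \<open>g\<close>), so it gives the value of the nest, which is
    an upper bound for the first ball.\<close>
  have dich: "(\<forall>f\<in>polys K. below ?qB (qv d (pq vb \<eta>)) f) \<or> (\<forall>f\<in>polys K. below (qv d (pq vb \<eta>)) ?qB f)"
    if d: "\<eta> \<in> \<Gamma>" "vcball vb d \<eta> \<in> M" "vcball vb d \<eta> \<subseteq> C0" for d \<eta>
  proof -
    let ?C = "vcball vb d \<eta>" and ?qC = "qv d (pq vb \<eta>)"
    obtain h e where h: "h \<in> polys K" "h \<noteq> 0" "e \<in> ?C" "poly h e = 0"
      and hrf: "\<And>r. r \<in> polys K \<Longrightarrow> r \<noteq> 0 \<Longrightarrow> degree r < degree h \<Longrightarrow> rootfree ?C r"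
      using least_root_poly[of d \<eta>] by metis
    have eqr: "?qB s r l \<longleftrightarrow> ?qC s r l" if "r \<in> polys K" "rootfree ?B r" "rootfree ?C r" "l \<in> \<Gamma>" for r s l
      using rfeq[OF N ga B that(2,4)] rfeq[OF M d(1,2) that(3,4)] NM[OF that(1,4)] by simp
    show ?thesis
    proof (cases "degree g \<le> degree h")
      case True
      have "below ?qB ?qC f" if f: "f \<in> polys K" for f
      proof (rule closed_ball_expand[OF qvalued_qv[OF qcut_pq] ga g grf _ _ f])
        show "below ?qB ?qC g"
          using BN[OF g(1)] rfeq[OF M d(1,2) rootfree_subset[OF C0(2) d(3)]] by (simp add: below_def)
        show "below ?qB ?qC r" if "r \<in> polys K" "r \<noteq> 0" "degree r < degree g" for r
          using eqr[OF that(1) grf[OF that] hrf] that True by (simp add: below_def)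
      qed
      then show ?thesis by blast
    next
      case False
      have "below ?qC ?qB f" if f: "f \<in> polys K" for f
      proof (rule closed_ball_expand[OF qvalued_qv[OF qcut_pq] d(1) h hrf _ _ f])
        have "rootfree ?B h" using grf[OF h(1,2)] False by simp
        then show "below ?qC ?qB h"
          using nqv_ball_below[OF d(2,1), of h] rfeq[OF N ga B, of h] NM[OF h(1)] by (simp add: below_def)
        show "below ?qC ?qB r" if "r \<in> polys K" "r \<noteq> 0" "degree r < degree h" for r
          using eqr[OF that(1) grf hrf[OF that]] that False by (simp add: below_def)
      qed
      then show ?thesis by blast
    qed
  qed
  have "\<exists>d \<eta>. \<eta> \<in> \<Gamma> \<and> vcball vb d \<eta> \<in> M \<and> (\<forall>f\<in>polys K. below ?qB (qv d (pq vb \<eta>)) f)"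
  proof (rule ccontr)
    \<comment> \<open>Then all members of \<open>M\<close> inside \<open>C0\<close> lie below B, so
      B and \<open>M\<close> define the same valuation, which a ball and a nest cannot.\<close>
    assume no: "\<not> ?thesis"
    have deep: "below (qv d (pq vb \<eta>)) ?qB f" if "\<eta> \<in> \<Gamma>" "vcball vb d \<eta> \<in> M" "vcball vb d \<eta> \<subseteq> C0" "f \<in> polys K" for d \<eta> f
      using dich[OF that(1-3)] no that by blast
    obtain d0 \<eta>0 where d0: "\<eta>0 \<in> \<Gamma>" "C0 = vcball vb d0 \<eta>0" using nest_ballE[OF M C0(1)] .
    have "below (nqv M) ?qB f" if f: "f \<in> polys K" for f
      unfolding below_def
    proof (intro allI ballI impI)
      fix s l assume l: "l \<in> \<Gamma>" and n: "nqv M s f l"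
      obtain d \<eta> where d: "\<eta> \<in> \<Gamma>" "vcball vb d \<eta> \<in> M" "qv d (pq vb \<eta>) s f l" using n by (auto simp: nqv_def)
      have "vcball vb d \<eta> \<subseteq> C0 \<or> C0 \<subseteq> vcball vb d \<eta>" using M d(2) C0(1) by (auto simp: nest_def)
      then show "?qB s f l"
      proof
        assume "vcball vb d \<eta> \<subseteq> C0"
        then show ?thesis using deep[OF d(1,2) _ f] d(3) l by (simp add: below_def)
      next
        assume sub: "C0 \<subseteq> vcball vb d \<eta>"
        then have "\<eta> \<le> \<eta>0" "d0 \<in> vcball vb d \<eta>" using vcball_subset_radius[OF d0(1) d(1)] d0(2) by auto
        then have "below (qv d (pq vb \<eta>)) (qv d0 (pq vb \<eta>0)) f"
          using d(1) d0(1) by (intro qv_ball_mono) (auto simp: le_qcut_pq vball_pq)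
        then show ?thesis using deep[OF d0(1) _ _ f, of d0] d0(2) C0(1) d(3) l by (auto simp: below_def)
      qed
    qed
    then have "agree ?qB (nqv M)" by (intro agreeI BN)
    then show False by (rule not_agree_ball_nest[OF qcut_pq M])
  qed
  then obtain d \<eta> where d: "\<eta> \<in> \<Gamma>" "vcball vb d \<eta> \<in> M" and bel: "\<And>f. f \<in> polys K \<Longrightarrow> below ?qB (qv d (pq vb \<eta>)) f" by blast
  have "below ?qB (qv d infc) f" if "f \<in> polys K" for f
    using below_trans[OF bel[OF that] qv_ball_mono[OF qcut_pq qcut_infc le_qcut_infc[OF qcut_pq] vball_self]] .
  from lift_point[OF qcut_pq this] obtain \<tau> where t: "\<tau> \<in> G" "\<tau> d \<in> ?B" using ga by (auto simp: vball_pq)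
  define \<sigma> where "\<sigma> = inv \<tau>"
  have s: "\<sigma> \<in> G" unfolding \<sigma>_def by (rule G_inv[OF t(1)])
  have sd: "\<sigma> (\<tau> d) = d" unfolding \<sigma>_def using G_bij[OF t(1)] by (simp add: bij_is_inj)
  have dB: "d \<in> vcball vb (\<sigma> a) \<gamma>" using G_vcball[OF s ga, of a] t(2) sd by (metis imageI)
  have Beq: "vcball vb (\<sigma> a) \<gamma> = vcball vb d \<gamma>" using vcball_recenter[OF ga dB] by simp
  \<comment> \<open>Otherwise the ball C and the conjugate of B, both centred at d, would have the
    same valuation on K[x] with different radii.\<close>
  have "\<gamma> \<le> \<eta>"
  proof (rule ccontr)
    assume n: "\<not> \<gamma> \<le> \<eta>"
    have sa: "\<sigma> a \<in> vball vb d (pq vb \<gamma>)" 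
      using vcball_self[of "\<sigma> a" \<gamma>] unfolding Beq vball_pq[OF ga] .
    have qd: "qv d (pq vb \<gamma>) s f l \<longleftrightarrow> ?qB s f l" if "f \<in> polys K" "l \<in> \<Gamma>" for s f l
      using qv_recenter[OF qcut_pq sa that(2), of s f] G_qv[OF s that(1), of a "pq vb \<gamma>" s l] by simp
    have "agree (qv d (pq vb \<eta>)) (qv d (pq vb \<gamma>))"
    proof (rule agreeI)
      show "below (qv d (pq vb \<eta>)) (qv d (pq vb \<gamma>)) f" for f
        using n d ga by (intro qv_ball_mono) (auto simp: le_qcut_pq)
      show "below (qv d (pq vb \<gamma>)) (qv d (pq vb \<eta>)) f" if "f \<in> polys K" for f
        using bel[OF that] qd[OF that] by (simp add: below_def)
    qed
    then have "pq vb \<eta> = pq vb \<gamma>" by (rule agree_radius[OF qcut_pq qcut_pq])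
    then show False using n le_qcut_pq[OF ga d(1)] by simp
  qed
  then have "vcball vb d \<eta> \<subseteq> vcball vb (\<sigma> a) \<gamma>" 
    unfolding Beq by (auto simp: vcball_def dest: order_trans[of \<gamma> \<eta>])
  then show ?thesis using s d(2) by blast
qed

text \<open>\<open>G\<close> is closed in the product of the finite sets of conjugates, hence compact.\<close>

lemma G_compact:
  fixes P :: "'i \<Rightarrow> 'l \<Rightarrow> bool" and a :: "'i \<Rightarrow> 'l"
  assumes fip: "\<And>J. finite J \<Longrightarrow> J \<subseteq> I \<Longrightarrow> \<exists>\<sigma>\<in>G. \<forall>i\<in>J. P i (\<sigma> (a i))"
  shows "\<exists>\<sigma>\<in>G. \<forall>i\<in>I. P i (\<sigma> (a i))"
proof -
  obtain p where p: "\<And>z. p z \<in> polys K" "\<And>z. p z \<noteq> 0" "\<And>z. poly (p z) z = 0"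
    using algebraic_K by metis
  define R where "R z = {x. poly (p z) x = 0}" for z
  have finR: "finite (R z)" for z unfolding R_def by (rule poly_roots_finite[OF p(2)])
  define X where "X = product_topology (\<lambda>z. discrete_topology (R z)) UNIV"
  have tX: "topspace X = (\<Pi>\<^sub>E z\<in>UNIV. R z)" by (simp add: X_def)
  have comp: "compact_space X" unfolding X_def compact_space_product_topology
    using finR by (simp add: compact_space_discrete_topology)
  have GR: "\<sigma> z \<in> R z" if "\<sigma> \<in> G" for \<sigma> z
    using G_poly[OF that p(1), of z z] p(3)[of z] that by (simp add: R_def)
  have cl1: "closedin X {\<sigma>\<in>topspace X. \<sigma> z = x}" for z x
  proof -
    have "continuous_map X (discrete_topology (R z)) (\<lambda>\<sigma>. \<sigma> z)"
      unfolding X_def by (rule continuous_map_product_projection) simp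
    then have "closedin X {\<sigma>\<in>topspace X. \<sigma> z \<in> {x} \<inter> R z}"
      by (rule closedin_continuous_map_preimage) simp
    moreover have "{\<sigma>\<in>topspace X. \<sigma> z \<in> {x} \<inter> R z} = {\<sigma>\<in>topspace X. \<sigma> z = x}"
      unfolding tX by (auto simp: PiE_iff)
    ultimately show ?thesis by simp
  qed
  \<comment> \<open>Every condition used below involves at most three coordinates with finite
    ranges, so it is a finite union of sets with these coordinates fixed.\<close>
  have cl3: "closedin X {\<sigma>\<in>topspace X. Q (\<sigma> x) (\<sigma> y) (\<sigma> z)}" for Q x y z
  proof -
    let ?T = "{(u, v, w). (u, v, w) \<in> R x \<times> R y \<times> R z \<and> Q u v w}"
    have fin: "finite ?T" by (rule finite_subset[of _ "R x \<times> R y \<times> R z"]) (auto simp: finR)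
    have "{\<sigma>\<in>topspace X. Q (\<sigma> x) (\<sigma> y) (\<sigma> z)} = (\<Union>(u, v, w)\<in>?T. {\<sigma>\<in>topspace X. \<sigma> x = u} \<inter> {\<sigma>\<in>topspace X. \<sigma> y = v} \<inter> {\<sigma>\<in>topspace X. \<sigma> z = w})"
      unfolding tX by (auto simp: PiE_iff)
    moreover have "closedin X \<dots>" using fin by (intro closedin_Union) (auto intro!: closedin_Int cl1)
    ultimately show ?thesis by simp
  qed
  \<comment> \<open>Bijectivity is not a condition on finitely many coordinates. It is recovered
    afterwards: \<open>vhom_extend\<close> returns an automorphism that coincides with the given
    value-preserving homomorphism.\<close>
  have Gset: "\<sigma> \<in> G" if add: "\<And>x y. \<sigma> (x + y) = \<sigma> x + \<sigma> y" and mult: "\<And>x y. \<sigma> (x * y) = \<sigma> x * \<sigma> y"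
    and io: "\<And>k. \<sigma> (iota k) = iota k" and v: "\<And>x. (x = 0 \<longleftrightarrow> \<sigma> x = 0) \<and> (x \<noteq> 0 \<longrightarrow> vb x = vb (\<sigma> x))" for \<sigma>
  proof -
    let ?H = "{(x, y). y = \<sigma> x}"
    have "vhom ?H" unfolding vhom_def mem_Collect_eq case_prod_conv
    proof (intro conjI allI impI)
      show "iota k = \<sigma> (iota k)" for k by (simp add: io)
      show "b + d = \<sigma> (a + c)" "b * d = \<sigma> (a * c)" if "b = \<sigma> a" "d = \<sigma> c" for a b c d
        using that add mult by simp_all
      show "a = 0 \<longleftrightarrow> b = 0" if "b = \<sigma> a" for a b unfolding that using v[of a] by blast
      show "vb a = vb b" if "b = \<sigma> a" "a \<noteq> 0" for a b unfolding that(1) using v[of a] that(2) by blast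
    qed
    from vhom_extend[OF this] obtain \<tau> where t: "\<tau> \<in> G" "\<forall>(x, y)\<in>?H. \<tau> x = y" by (rule bexE)
    have "\<tau> x = \<sigma> x" for x using bspec[OF t(2), of "(x, \<sigma> x)"] by simp
    then have "\<tau> = \<sigma>" by (rule ext)
    then show ?thesis using t(1) by simp
  qed
  define C where "C = (\<lambda>i. {\<sigma>\<in>topspace X. P i (\<sigma> (a i))}) ` I
    \<union> (\<lambda>(x, y). {\<sigma>\<in>topspace X. \<sigma> (x + y) = \<sigma> x + \<sigma> y}) ` UNIV
    \<union> (\<lambda>(x, y). {\<sigma>\<in>topspace X. \<sigma> (x * y) = \<sigma> x * \<sigma> y}) ` UNIV
    \<union> (\<lambda>k. {\<sigma>\<in>topspace X. \<sigma> (iota k) = iota k}) ` UNIV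
    \<union> (\<lambda>x. {\<sigma>\<in>topspace X. (x = 0 \<longleftrightarrow> \<sigma> x = 0) \<and> (x \<noteq> 0 \<longrightarrow> vb x = vb (\<sigma> x))}) ` UNIV"
  have cl: "closedin X D" if "D \<in> C" for D
    using that unfolding C_def
  proof (elim UnE imageE)
    fix i assume "D = {\<sigma> \<in> topspace X. P i (\<sigma> (a i))}"
    then show ?thesis using cl3[of "\<lambda>u v w. P i u" "a i"] by simp
  next
    fix xy :: "'l \<times> 'l" assume "D = (case xy of (x, y) \<Rightarrow> {\<sigma> \<in> topspace X. \<sigma> (x + y) = \<sigma> x + \<sigma> y})"
    then show ?thesis using cl3[of "\<lambda>u v w. u = v + w" "fst xy + snd xy" "fst xy" "snd xy"] by (simp add: case_prod_unfold)
  next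
    fix xy :: "'l \<times> 'l" assume "D = (case xy of (x, y) \<Rightarrow> {\<sigma> \<in> topspace X. \<sigma> (x * y) = \<sigma> x * \<sigma> y})"
    then show ?thesis using cl3[of "\<lambda>u v w. u = v * w" "fst xy * snd xy" "fst xy" "snd xy"] by (simp add: case_prod_unfold)
  next
    fix k assume "D = {\<sigma> \<in> topspace X. \<sigma> (iota k) = iota k}"
    then show ?thesis using cl1 by simp
  next
    fix x assume "D = {\<sigma> \<in> topspace X. (x = 0 \<longleftrightarrow> \<sigma> x = 0) \<and> (x \<noteq> 0 \<longrightarrow> vb x = vb (\<sigma> x))}"
    then show ?thesis using cl3[of "\<lambda>u v w. (x = 0 \<longleftrightarrow> u = 0) \<and> (x \<noteq> 0 \<longrightarrow> vb x = vb u)" x] by simp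
  qed
  have ne: "\<Inter>D \<noteq> {}" if D: "finite D" "D \<subseteq> C" for D
  proof -
    \<comment> \<open>The hypothesis is applied to the finitely many conditions of the family
      \<open>P\<close>; all the others hold for every element of \<open>G\<close>.\<close>
    obtain J where J: "finite J" "J \<subseteq> I" "D \<inter> (\<lambda>i. {\<sigma>\<in>topspace X. P i (\<sigma> (a i))}) ` I = (\<lambda>i. {\<sigma>\<in>topspace X. P i (\<sigma> (a i))}) ` J"
      using finite_subset_image[of "D \<inter> (\<lambda>i. {\<sigma>\<in>topspace X. P i (\<sigma> (a i))}) ` I" "\<lambda>i. {\<sigma>\<in>topspace X. P i (\<sigma> (a i))}" I] D(1) by blast
    obtain \<sigma> where s: "\<sigma> \<in> G" "\<forall>i\<in>J. P i (\<sigma> (a i))" using fip[OF J(1,2)] by blast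
    have sX: "\<sigma> \<in> topspace X" unfolding tX using GR[OF s(1)] by auto
    have z: "x = 0 \<longleftrightarrow> \<sigma> x = 0" for x using G_eq_iff[OF s(1), of x 0] s(1) by simp
    have "\<sigma> \<in> E" if E: "E \<in> D" for E
    proof (cases "E \<in> (\<lambda>i. {\<sigma>\<in>topspace X. P i (\<sigma> (a i))}) ` I")
      case True
      then have "E \<in> (\<lambda>i. {\<sigma>\<in>topspace X. P i (\<sigma> (a i))}) ` J" using E J(3) by blast
      then show ?thesis using s(2) sX by auto
    next
      case False
      have "E \<in> C" using E D(2) by blast
      then show ?thesis unfolding C_def
      proof (elim UnE imageE)
        fix i assume "E = {\<sigma> \<in> topspace X. P i (\<sigma> (a i))}" "i \<in> I"
        then show ?thesis using False by blast
      next
        fix xy :: "'l \<times> 'l" assume "E = (case xy of (x, y) \<Rightarrow> {\<sigma> \<in> topspace X. \<sigma> (x + y) = \<sigma> x + \<sigma> y})"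
        then show ?thesis using sX G_add[OF s(1)] by (simp add: case_prod_unfold)
      next
        fix xy :: "'l \<times> 'l" assume "E = (case xy of (x, y) \<Rightarrow> {\<sigma> \<in> topspace X. \<sigma> (x * y) = \<sigma> x * \<sigma> y})"
        then show ?thesis using sX G_mult[OF s(1)] by (simp add: case_prod_unfold)
      next
        fix k assume "E = {\<sigma> \<in> topspace X. \<sigma> (iota k) = iota k}"
        then show ?thesis using sX G_iota[OF s(1)] by simp
      next
        fix x assume "E = {\<sigma> \<in> topspace X. (x = 0 \<longleftrightarrow> \<sigma> x = 0) \<and> (x \<noteq> 0 \<longrightarrow> vb x = vb (\<sigma> x))}"
        then show ?thesis using sX z[of x] G_v[OF s(1), of x] by simp
      qed
    qed
    then show ?thesis by blast
  qed
  have "(\<forall>D\<in>C. closedin X D) \<and> (\<forall>D. finite D \<and> D \<subseteq> C \<longrightarrow> \<Inter>D \<noteq> {})"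
    using cl ne by simp
  then have "\<Inter>C \<noteq> {}" by (rule comp[unfolded compact_space_fip, THEN spec, THEN mp])
  then obtain \<sigma> where s: "\<And>D. D \<in> C \<Longrightarrow> \<sigma> \<in> D" by blast
  have "\<sigma> \<in> G"
  proof (rule Gset)
    show "\<sigma> (x + y) = \<sigma> x + \<sigma> y" for x y
    proof -
      have "(case (x, y) of (x, y) \<Rightarrow> {\<sigma> \<in> topspace X. \<sigma> (x + y) = \<sigma> x + \<sigma> y}) \<in> C" unfolding C_def by blast
      then show ?thesis using s by fastforce
    qed
    show "\<sigma> (x * y) = \<sigma> x * \<sigma> y" for x y
    proof -
      have "(case (x, y) of (x, y) \<Rightarrow> {\<sigma> \<in> topspace X. \<sigma> (x * y) = \<sigma> x * \<sigma> y}) \<in> C" unfolding C_def by blast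
      then show ?thesis using s by fastforce
    qed
    show "\<sigma> (iota k) = iota k" for k using s[of "{\<sigma>\<in>topspace X. \<sigma> (iota k) = iota k}"] unfolding C_def by blast
    show "(x = 0 \<longleftrightarrow> \<sigma> x = 0) \<and> (x \<noteq> 0 \<longrightarrow> vb x = vb (\<sigma> x))" for x
      using s[of "{\<sigma>\<in>topspace X. (x = 0 \<longleftrightarrow> \<sigma> x = 0) \<and> (x \<noteq> 0 \<longrightarrow> vb x = vb (\<sigma> x))}"] unfolding C_def by blast
  qed
  moreover have "P i (\<sigma> (a i))" if "i \<in> I" for i
    using s[of "{\<sigma>\<in>topspace X. P i (\<sigma> (a i))}"] that unfolding C_def by blast
  ultimately show ?thesis by blast
qed

theorem agree_nests:
  assumes N: "nest vb N" and M: "nest vb M" and ag: "agree (nqv N) (nqv M)"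
  shows "\<exists>\<sigma>\<in>G. cofinal_eq ((`) \<sigma> ` N) M"
proof -
  have "\<exists>x. snd x \<in> \<Gamma> \<and> B = vcball vb (fst x) (snd x)" if "B \<in> N" for B
    by (rule nest_ballE[OF N that]) auto
  then obtain h where h: "\<forall>B\<in>N. snd (h B) \<in> \<Gamma> \<and> B = vcball vb (fst (h B)) (snd (h B))"
    using bchoice[of N "\<lambda>B x. snd x \<in> \<Gamma> \<and> B = vcball vb (fst x) (snd x)"] by blast
  define ce ra where "ce B = fst (h B)" and "ra B = snd (h B)" for B
  have cr: "\<And>B. B \<in> N \<Longrightarrow> ra B \<in> \<Gamma>" "\<And>B. B \<in> N \<Longrightarrow> B = vcball vb (ce B) (ra B)"
    using h by (simp_all add: ce_def ra_def)
  have sB: "\<sigma> ` B = vcball vb (\<sigma> (ce B)) (ra B)" if "\<sigma> \<in> G" "B \<in> N" for \<sigma> B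
    using G_vcball[OF that(1) cr(1)[OF that(2)], of "ce B"] unfolding cr(2)[OF that(2), symmetric] .
  have "\<exists>\<sigma>\<in>G. \<forall>B\<in>N. \<exists>C\<in>M. C \<subseteq> vcball vb (\<sigma> (ce B)) (ra B)"
  proof (rule G_compact)
    fix J assume J: "finite J" "J \<subseteq> N"
    show "\<exists>\<sigma>\<in>G. \<forall>B\<in>J. \<exists>C\<in>M. C \<subseteq> vcball vb (\<sigma> (ce B)) (ra B)"
    proof (cases "J = {}")
      case True
      then show ?thesis using G_id by blast
    next
      case False
      \<comment> \<open>A finite part of the chain has a least member, and an automorphism adapted
        to it serves all larger members.\<close>
      have "\<exists>B\<in>J. \<forall>B'\<in>J. B \<subseteq> B'"
        by (rule finite_preorder_min[OF J(1) False, of "(\<subseteq>)"]) (use N J(2) in \<open>auto simp: nest_def subset_iff\<close>)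
      then obtain B where B: "B \<in> J" "\<And>B'. B' \<in> J \<Longrightarrow> B \<subseteq> B'" by blast
      have BN: "B \<in> N" using B J by blast
      have "vcball vb (ce B) (ra B) \<in> N" using BN unfolding cr(2)[OF BN, symmetric] .
      from agree_nests_ball[OF N M ag cr(1)[OF BN] this]
      obtain \<sigma> C where s: "\<sigma> \<in> G" "C \<in> M" "C \<subseteq> vcball vb (\<sigma> (ce B)) (ra B)" by blast
      have "C \<subseteq> vcball vb (\<sigma> (ce B')) (ra B')" if "B' \<in> J" for B'
        using s(3) sB[OF s(1) BN] sB[OF s(1), of B'] B(2)[OF that] J(2) that by blast
      then show ?thesis using s(1,2) by blast
    qed
  qed
  then obtain \<sigma> where s: "\<sigma> \<in> G" and sC0: "\<forall>B\<in>N. \<exists>C\<in>M. C \<subseteq> vcball vb (\<sigma> (ce B)) (ra B)" by (rule bexE)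
  have sC: "\<exists>C\<in>M. C \<subseteq> \<sigma> ` B" if "B \<in> N" for B using sC0 that sB[OF s that] by simp
  \<comment> \<open>The other half of cofinality is automatic. Choose B so that its image misses the
    centre of C: the image cannot contain C, but it meets C because it contains a member of
    \<open>M\<close> lying in C.\<close>
  have Cs: "\<exists>B\<in>N. \<sigma> ` B \<subseteq> C" if C: "C \<in> M" for C
  proof -
    obtain d \<eta> where d: "\<eta> \<in> \<Gamma>" "C = vcball vb d \<eta>" using nest_ballE[OF M C] .
    have "inv \<sigma> d \<notin> \<Inter>N" using N by (simp add: nest_def)
    then obtain B where B: "B \<in> N" "inv \<sigma> d \<notin> B" by blast
    have dB: "d \<notin> \<sigma> ` B" using B(2) G_bij[OF s] by (metis bij_inv_eq_iff imageE)
    obtain C' where C': "C' \<in> M" "C' \<subseteq> \<sigma> ` B" using sC[OF B(1)] by blast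
    obtain d' \<eta>' where d': "\<eta>' \<in> \<Gamma>" "C' = vcball vb d' \<eta>'" using nest_ballE[OF M C'(1)] .
    have "C \<subseteq> C' \<or> C' \<subseteq> C" using M C C'(1) by (auto simp: nest_def)
    moreover have "\<not> C \<subseteq> C'" using C'(2) dB d(2) vcball_self by blast
    ultimately have "d' \<in> C" using d'(2) vcball_self by blast
    moreover have "d' \<in> \<sigma> ` B" using C'(2) d'(2) vcball_self by blast
    ultimately have "\<sigma> ` B \<subseteq> C \<or> C \<subseteq> \<sigma> ` B"
      using closed_balls_nested[OF cr(1)[OF B(1)] d(1), of d' "\<sigma> (ce B)" d] sB[OF s B(1)] d(2) by simp
    then show ?thesis using dB d(2) vcball_self B(1) by blast
  qed
  have "cofinal_eq ((`) \<sigma> ` N) M" unfolding cofinal_eq_def using sC Cs by simp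
  then show ?thesis using s by (rule bexI)
qed

end


section \<open>Valuations on the rational function field\<close>

abbreviation fr :: "'a::field poly \<Rightarrow> 'a poly fract" where "fr f \<equiv> Fract f 1"

lemma fr_eq_0 [simp]: "fr f = 0 \<longleftrightarrow> f = 0"
  by (simp add: Zero_fract_def eq_fract)

lemma fr_mult: "fr (f * g) = fr f * fr g"
  by simp

lemma fr_add: "fr (f + g) = fr f + fr g"
  by simp

lemma fr_power: "fr (f ^ n) = fr f ^ n"
  by (induction n) (simp_all add: One_fract_def fr_mult del: mult_fract)

lemma Fract_nonzero: "q \<noteq> 0 \<Longrightarrow> Fract p q = 0 \<longleftrightarrow> p = 0"
  by (simp add: Zero_fract_def eq_fract)

lemma cst_mult: "cst (c * d) = cst c * cst d"
  by (simp add: cst_def mult.commute)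

lemma cst_eq_0 [simp]: "cst c = 0 \<longleftrightarrow> c = 0"
  by (simp add: cst_def)

lemma cst_1 [simp]: "cst 1 = 1"
  by (simp add: cst_def One_fract_def one_pCons)

lemma cst_minus_1: "cst (- 1) = - 1"
  by (simp add: cst_def One_fract_def one_pCons)

lemma cst_power: "cst (c ^ n) = cst c ^ n"
  by (induction n) (simp_all add: cst_mult)

lemma cst_inverse: "c \<noteq> 0 \<Longrightarrow> cst (inverse c) * cst c = 1"
  by (simp flip: cst_mult)

text \<open>Axioms for the relation \<open>\<mu>(u) \<le> \<mu>(w)\<close> of a valuation \<open>\<mu>\<close> on \<open>K(x)\<close> extending \<open>v\<close>.\<close>

locale valrel = vclosure vb iota for vb :: "'l::field \<Rightarrow> 'g::linordered_ab_group_add" and iota :: "'k::field \<Rightarrow> 'l" +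
  fixes R :: "('k poly fract \<times> 'k poly fract) set"
  assumes nonzero: "\<And>u w. (u, w) \<in> R \<Longrightarrow> u \<noteq> 0 \<and> w \<noteq> 0"
    and total: "\<And>u w. u \<noteq> 0 \<Longrightarrow> w \<noteq> 0 \<Longrightarrow> (u, w) \<in> R \<or> (w, u) \<in> R"
    and R_trans: "\<And>u w t. (u, w) \<in> R \<Longrightarrow> (w, t) \<in> R \<Longrightarrow> (u, t) \<in> R"
    and R_mult: "\<And>u w t. (u, w) \<in> R \<Longrightarrow> t \<noteq> 0 \<Longrightarrow> (u * t, w * t) \<in> R"
    and R_add: "\<And>u w. u \<noteq> 0 \<Longrightarrow> w \<noteq> 0 \<Longrightarrow> u + w \<noteq> 0 \<Longrightarrow> (u, u + w) \<in> R \<or> (w, u + w) \<in> R"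
    and R_const: "\<And>c d. c \<noteq> 0 \<Longrightarrow> d \<noteq> 0 \<Longrightarrow> (cst c, cst d) \<in> R \<longleftrightarrow> vb (iota c) \<le> vb (iota d)"
begin

lemma R_refl: "u \<noteq> 0 \<Longrightarrow> (u, u) \<in> R"
  using total by blast

lemma R_cong:
  assumes "(u, u') \<in> R" "(u', u) \<in> R" "(w, w') \<in> R" "(w', w) \<in> R"
  shows "(u, w) \<in> R \<longleftrightarrow> (u', w') \<in> R"
proof
  show "(u', w') \<in> R" if "(u, w) \<in> R" by (rule R_trans[OF assms(2) R_trans[OF that assms(3)]])
  show "(u, w) \<in> R" if "(u', w') \<in> R" by (rule R_trans[OF assms(1) R_trans[OF that assms(4)]])
qed

lemma R_cancel: assumes "t \<noteq> 0" shows "(u * t, w * t) \<in> R \<longleftrightarrow> (u, w) \<in> R"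
proof
  assume "(u * t, w * t) \<in> R"
  from R_mult[OF this, of "inverse t"] show "(u, w) \<in> R" using assms by (simp add: mult.assoc)
qed (use R_mult assms in blast)

lemma R_mult2: "(u, w) \<in> R \<Longrightarrow> (u', w') \<in> R \<Longrightarrow> (u * u', w * w') \<in> R"
proof -
  assume a: "(u, w) \<in> R" "(u', w') \<in> R"
  have "(u * u', w * u') \<in> R" using R_mult a nonzero by blast
  moreover have "(w * u', w * w') \<in> R" using R_mult[OF a(2), of w] nonzero[OF a(1)] by (simp add: mult.commute)
  ultimately show ?thesis by (rule R_trans)
qed

lemma R_mult2_strict: "(u, w) \<notin> R \<Longrightarrow> (u', w') \<notin> R \<Longrightarrow> u \<noteq> 0 \<Longrightarrow> w \<noteq> 0 \<Longrightarrow> u' \<noteq> 0 \<Longrightarrow> w' \<noteq> 0 \<Longrightarrow> (u * u', w * w') \<notin> R"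
proof
  assume a: "(u, w) \<notin> R" "(u', w') \<notin> R" "u \<noteq> 0" "w \<noteq> 0" "u' \<noteq> 0" "w' \<noteq> 0" "(u * u', w * w') \<in> R"
  then have "(w, u) \<in> R" using total by blast
  then have "(w * w', u * w') \<in> R" using R_mult a by blast
  then have "(u * u', u * w') \<in> R" using R_trans a by blast
  then have "(u', w') \<in> R" using R_cancel[of u u' w'] a by (simp add: mult.commute)
  then show False using a by blast
qed

lemma R_mult_strict1: "(u, w) \<notin> R \<Longrightarrow> (w', u') \<in> R \<Longrightarrow> u \<noteq> 0 \<Longrightarrow> w \<noteq> 0 \<Longrightarrow> (u * u', w * w') \<notin> R"
proof
  assume a: "(u, w) \<notin> R" "(w', u') \<in> R" "u \<noteq> 0" "w \<noteq> 0" "(u * u', w * w') \<in> R"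
  have "u' \<noteq> 0" "w' \<noteq> 0" using nonzero a by blast+
  have "(w * w', w * u') \<in> R" using R_mult[OF a(2) a(4)] by (simp add: mult.commute)
  then have "(u * u', w * u') \<in> R" using R_trans a by blast
  then show False using R_cancel[OF \<open>u' \<noteq> 0\<close>] a by blast
qed

lemma R_power: assumes "u \<noteq> 0" "w \<noteq> 0" "0 < n" shows "(u ^ n, w ^ n) \<in> R \<longleftrightarrow> (u, w) \<in> R"
proof -
  have 1: "(u ^ n, w ^ n) \<in> R" if "(u, w) \<in> R" "u \<noteq> 0" for n and u w
    using that R_mult2 R_refl[of 1] by (induction n) auto
  have 2: "(u ^ Suc n, w ^ Suc n) \<notin> R" if "(u, w) \<notin> R" for n
    using that R_mult2_strict assms by (induction n) auto
  obtain m where "n = Suc m" using assms(3) by (cases n) auto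
  then show ?thesis using 1[of u w n] 2[of m] assms by blast
qed

lemma R_add_strict:
  assumes "u \<noteq> 0" "w \<noteq> 0" "(w, u) \<notin> R" shows "u + w \<noteq> 0" "(u, u + w) \<in> R" "(u + w, u) \<in> R"
proof -
  have m: "(- w, w) \<in> R" "(w, - w) \<in> R"
  proof -
    have "(cst (-1), cst 1) \<in> R" "(cst 1, cst (-1)) \<in> R"
      using R_const[of "-1" 1] R_const[of 1 "-1"] by (simp_all add: hom_uminus hom_one)
    from R_mult[OF this(1) assms(2)] R_mult[OF this(2) assms(2)] show "(- w, w) \<in> R" "(w, - w) \<in> R"
      by (simp_all add: cst_minus_1)
  qed
  show nz: "u + w \<noteq> 0"
  proof
    assume "u + w = 0"
    then have "u = - w" by (simp add: eq_neg_iff_add_eq_0)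
    then show False using assms(3) m by simp
  qed
  have uw: "(u, w) \<in> R" using total assms by blast
  show "(u, u + w) \<in> R" using R_add[OF assms(1,2) nz] R_trans[OF uw] by blast
  show "(u + w, u) \<in> R"
    using R_add[OF nz, of "- w"] assms m R_trans[OF m(2)] by auto
qed

end

section \<open>The divisible hull of the value group of K\<close>

context vclosure
begin

text \<open>In a vanishing sum at least two terms share the least value. Equating two such terms of
  a polynomial over K vanishing at z makes a positive multiple of v(z) the value of a quotient of
  coefficients.\<close>

lemma divisible_hull:
  assumes "g \<in> \<Gamma>" shows "\<exists>n>0. \<exists>c. c \<noteq> 0 \<and> vb (iota c) = nsm n g"
proof -
  obtain z where z: "z \<noteq> 0" "vb z = g" using assms by (rule Gam_E)
  obtain p where p: "p \<noteq> 0" "poly (mp p) z = 0" using algebraic by blast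
  let ?T = "{i. i \<le> degree (mp p) \<and> coeff p i \<noteq> 0}"
  let ?t = "\<lambda>i. iota (coeff p i) * z ^ i"
  have "degree (mp p) \<in> ?T" using p(1) leading_coeff_0_iff[of "mp p"] by auto
  then have ne: "?T \<noteq> {}" by blast
  have "\<exists>i\<in>?T. \<forall>j\<in>?T. vb (?t i) \<le> vb (?t j)"
    by (rule finite_preorder_min[OF _ ne]) (simp, rule linear, rule order_trans)
  then obtain i where i: "i \<in> ?T" and imin: "\<And>j. j \<in> ?T \<Longrightarrow> vb (?t i) \<le> vb (?t j)" by blast
  have tnz: "?t j \<noteq> 0" if "j \<in> ?T" for j using that z by simp
  have "\<exists>j\<in>?T. j \<noteq> i \<and> vb (?t j) = vb (?t i)"
  proof (rule ccontr)
    assume "\<not> ?thesis"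
    then have gt: "vb (?t i) < vb (?t j)" if "j \<in> ?T" "j \<noteq> i" for j using imin[OF that(1)] that by force
    have "poly (mp p) z = (\<Sum>j\<le>degree (mp p). ?t j)" by (simp add: poly_altdef)
    also have "\<dots> = ?t i + (\<Sum>j\<in>{..degree (mp p)} - {i}. ?t j)" using i by (subst sum.remove[of _ i]) auto
    finally have "?t i + (\<Sum>j\<in>{..degree (mp p)} - {i}. ?t j) = 0" using p(2) by simp
    moreover have "vge True (\<Sum>j\<in>{..degree (mp p)} - {i}. ?t j) (vb (?t i))"
    proof (rule vge_sum)
      fix j assume "j \<in> {..degree (mp p)} - {i}"
      then show "vge True (?t j) (vb (?t i))" using gt[of j] by (auto simp: vge_def)
    qed
    ultimately show False using v_add_eq(1)[OF tnz[OF i]] by blast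
  qed
  then obtain j where j: "j \<in> ?T" "j \<noteq> i" "vb (?t j) = vb (?t i)" by blast
  have *: ?thesis if "i < j" "coeff p i \<noteq> 0" "coeff p j \<noteq> 0" "vb (?t i) = vb (?t j)" for i j
  proof -
    let ?c = "coeff p i * inverse (coeff p j)"
    have "vb (iota (coeff p i)) + nsm i g = vb (iota (coeff p j)) + nsm j g"
      using that z by (simp add: v_mult v_power)
    moreover have "nsm j g = nsm i g + nsm (j - i) g" using that nsm_add_left[of i "j - i" g] by simp
    ultimately have "vb (iota (coeff p i)) - vb (iota (coeff p j)) = nsm (j - i) g" by (simp add: algebra_simps)
    moreover have "vb (iota ?c) = vb (iota (coeff p i)) - vb (iota (coeff p j))"
      using that by (simp add: hom_mult hom_inverse v_mult v_inverse)
    ultimately show ?thesis using that by (intro exI[of _ "j - i"] conjI exI[of _ ?c]) auto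
  qed
  show ?thesis using *[of i j] *[of j i] i j by (cases "i < j") auto
qed

lemma v_iota_power: "c \<noteq> 0 \<Longrightarrow> vb (iota (c ^ n)) = nsm n (vb (iota c))"
proof -
  assume c: "c \<noteq> 0"
  have "iota (c ^ n) = iota c ^ n" by (induction n) (simp_all add: hom_one hom_mult)
  then show ?thesis using c by (simp add: v_power)
qed

lemma divisible_hull2:
  assumes "g \<in> \<Gamma>" "h \<in> \<Gamma>"
  shows "\<exists>n>0. \<exists>c d. c \<noteq> 0 \<and> d \<noteq> 0 \<and> vb (iota c) = nsm n g \<and> vb (iota d) = nsm n h"
proof -
  obtain n c where n: "n > 0" "c \<noteq> 0" "vb (iota c) = nsm n g" using divisible_hull[OF assms(1)] by blast
  obtain m d where m: "m > 0" "d \<noteq> 0" "vb (iota d) = nsm m h" using divisible_hull[OF assms(2)] by blast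
  show ?thesis
    using n m by (intro exI[of _ "m * n"] conjI exI[of _ "c ^ m"] exI[of _ "d ^ n"])
      (simp_all add: v_iota_power nsm_nsm mult.commute)
qed

end

section \<open>The levels of a class of valuations on K(x)\<close>

context valrel
begin

text \<open>A level \<open>l\<close> of \<Gamma> need not be a value of K, so \<open>R\<close> is
  consulted for a power of f and a constant whose value is the corresponding multiple of
  \<open>l\<close>.\<close>

definition rho :: "bool \<Rightarrow> 'l poly \<Rightarrow> 'g \<Rightarrow> bool" where
  "rho s g l \<longleftrightarrow> g = 0 \<or> (\<exists>f n c. g = mp f \<and> 0 < n \<and> c \<noteq> 0 \<and> vb (iota c) = nsm n l \<and>
     (if s then (fr (f ^ n), cst c) \<notin> R else (cst c, fr (f ^ n)) \<in> R))"

lemma mp_inj: "mp f = mp g \<Longrightarrow> f = g"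
  by (simp add: poly_eq_iff hom_inj)

text \<open>All admissible pairs of exponent and constant give the same answer: each comparison is
  raised to the exponent of the other, and constants of equal value are interchangeable.\<close>

lemma rho_iff:
  assumes f: "f \<noteq> 0" and n: "0 < n" "c \<noteq> 0" "vb (iota c) = nsm n l"
  shows "rho s (mp f) l \<longleftrightarrow> (if s then (fr (f ^ n), cst c) \<notin> R else (cst c, fr (f ^ n)) \<in> R)"
proof -
  have indep: "((cst c, fr (f ^ n)) \<in> R \<longleftrightarrow> (cst d, fr (f ^ m)) \<in> R) \<and> ((fr (f ^ n), cst c) \<in> R \<longleftrightarrow> (fr (f ^ m), cst d) \<in> R)"
    if m: "0 < m" "d \<noteq> 0" "vb (iota d) = nsm m l" for m d
  proof -
    have v: "vb (iota (c ^ m)) = vb (iota (d ^ n))" using n m by (simp add: v_iota_power nsm_nsm mult.commute)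
    have cd: "(cst (c ^ m), cst (d ^ n)) \<in> R" "(cst (d ^ n), cst (c ^ m)) \<in> R"
      using R_const[of "c ^ m" "d ^ n"] R_const[of "d ^ n" "c ^ m"] n m v by simp_all
    have fpow: "fr (f ^ n) ^ m = fr (f ^ m) ^ n" by (simp add: fr_power flip: power_mult) (simp add: mult.commute)
    have 1: "(cst c, fr (f ^ n)) \<in> R \<longleftrightarrow> (cst (c ^ m), fr (f ^ m) ^ n) \<in> R"
      using R_power[of "cst c" "fr (f ^ n)" m] f n m fpow by (simp add: cst_power)
    have 2: "(cst d, fr (f ^ m)) \<in> R \<longleftrightarrow> (cst (d ^ n), fr (f ^ m) ^ n) \<in> R"
      using R_power[of "cst d" "fr (f ^ m)" n] f n m by (simp add: cst_power)
    have 3: "(fr (f ^ n), cst c) \<in> R \<longleftrightarrow> (fr (f ^ m) ^ n, cst (c ^ m)) \<in> R"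
      using R_power[of "fr (f ^ n)" "cst c" m] f n m fpow by (simp add: cst_power)
    have 4: "(fr (f ^ m), cst d) \<in> R \<longleftrightarrow> (fr (f ^ m) ^ n, cst (d ^ n)) \<in> R"
      using R_power[of "fr (f ^ m)" "cst d" n] f n m by (simp add: cst_power)
    show ?thesis unfolding 1 2 3 4 using R_cong[OF cd R_refl R_refl] R_cong[OF R_refl R_refl cd] f by simp
  qed
  show ?thesis
  proof
    assume "rho s (mp f) l"
    then obtain f' m d where m: "mp f = mp f'" "0 < m" "d \<noteq> 0" "vb (iota d) = nsm m l"
      "if s then (fr (f' ^ m), cst d) \<notin> R else (cst d, fr (f' ^ m)) \<in> R" using f unfolding rho_def by auto
    then show "if s then (fr (f ^ n), cst c) \<notin> R else (cst c, fr (f ^ n)) \<in> R"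
      using indep[OF m(2-4)] mp_inj[OF m(1)] by simp
  next
    assume "if s then (fr (f ^ n), cst c) \<notin> R else (cst c, fr (f ^ n)) \<in> R"
    then show "rho s (mp f) l" unfolding rho_def using n by blast
  qed
qed

lemma qvalued_rho: "qvalued vb K rho"
proof
  show "subfld K" by (rule subfld_K)
  show "\<exists>p\<in>polys K. p \<noteq> 0 \<and> poly p z = 0" for z by (rule algebraic_K)
next
  fix s g l s' l' assume a: "g \<in> polys K" "l \<in> \<Gamma>" "l' \<in> \<Gamma>" "rho s g l" "l' < l \<or> l' = l \<and> (s' \<longrightarrow> s)"
  obtain f where f: "g = mp f" using polys_KE[OF a(1)] .
  show "rho s' g l'"
  proof (cases "f = 0")
    case True
    then show ?thesis by (simp add: rho_def f)
  next
    case False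
    \<comment> \<open>One exponent for both levels, so that both become constants compared with the
      same power of f.\<close>
    obtain n c d where n: "n > 0" "c \<noteq> 0" "d \<noteq> 0" "vb (iota c) = nsm n l" "vb (iota d) = nsm n l'"
      using divisible_hull2[OF a(2,3)] by blast
    have r: "rho s g l \<longleftrightarrow> (if s then (fr (f ^ n), cst c) \<notin> R else (cst c, fr (f ^ n)) \<in> R)" unfolding f using rho_iff[OF False n(1,2,4)] .
    have r': "rho s' g l' \<longleftrightarrow> (if s' then (fr (f ^ n), cst d) \<notin> R else (cst d, fr (f ^ n)) \<in> R)" unfolding f using rho_iff[OF False n(1,3,5)] .
    have ge: "(cst c, fr (f ^ n)) \<in> R" using a(4) r total[of "fr (f ^ n)" "cst c"] False n by (auto split: if_splits)
    show ?thesis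
    proof (cases "l' < l")
      case True
      have dc: "vb (iota d) < vb (iota c)" using n nsm_strict_mono[OF True n(1)] by simp
      have "(cst d, fr (f ^ n)) \<in> R" using R_trans[OF _ ge, of "cst d"] R_const[of d c] n dc by simp
      moreover have "(fr (f ^ n), cst d) \<notin> R" using R_trans[OF ge, of "cst d"] R_const[of c d] n dc by auto
      ultimately show ?thesis using r' by simp
    next
      case lF: False
      then have l: "l' = l" "s' \<longrightarrow> s" using a(5) by auto
      have r'': "rho s' g l' \<longleftrightarrow> (if s' then (fr (f ^ n), cst c) \<notin> R else (cst c, fr (f ^ n)) \<in> R)" unfolding f l using rho_iff[OF False n(1,2,4)] .
      show ?thesis using r r'' l(2) a(4) ge by auto
    qed
  qed
next
  fix s g h l assume a: "g \<in> polys K" "h \<in> polys K" "l \<in> \<Gamma>" "rho s g l" "rho s h l"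
  obtain f f' where f: "g = mp f" "h = mp f'" using polys_KE[OF a(1)] polys_KE[OF a(2)] by metis
  show "rho s (g + h) l"
  proof (cases "f = 0 \<or> f' = 0 \<or> f + f' = 0")
    case True
    then show ?thesis using a f by (auto simp: mp_add[symmetric]) (simp add: rho_def)
  next
    case False
    obtain n c where n: "n > 0" "c \<noteq> 0" "vb (iota c) = nsm n l" using divisible_hull[OF a(3)] by blast
    have r: "rho s (mp k) l \<longleftrightarrow> (if s then (fr (k ^ n), cst c) \<notin> R else (cst c, fr (k ^ n)) \<in> R)" if "k \<noteq> 0" for k using rho_iff[OF that n] .
    have "(fr f, fr (f + f')) \<in> R \<or> (fr f', fr (f + f')) \<in> R"
      using R_add[of "fr f" "fr f'"] False by simp
    then have "(fr (f ^ n), fr ((f + f') ^ n)) \<in> R \<or> (fr (f' ^ n), fr ((f + f') ^ n)) \<in> R"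
      using R_power[OF _ _ n(1)] False by (simp add: fr_power)
    then have "rho s (mp (f + f')) l" using r[of f] r[of f'] r[of "f + f'"] False a(4,5) f R_trans by (auto split: if_splits)
    then show ?thesis by (simp add: f mp_add)
  qed
next
  fix s g l s' h l' assume a: "g \<in> polys K" "h \<in> polys K" "l \<in> \<Gamma>" "l' \<in> \<Gamma>"
  obtain f f' where f: "g = mp f" "h = mp f'" using polys_KE[OF a(1)] polys_KE[OF a(2)] by metis
  obtain n c d where n: "n > 0" "c \<noteq> 0" "d \<noteq> 0" "vb (iota c) = nsm n l" "vb (iota d) = nsm n l'"
    using divisible_hull2[OF a(3,4)] by blast
  have cd: "c * d \<noteq> 0" "vb (iota (c * d)) = nsm n (l + l')" using n by (simp_all add: hom_mult v_mult nsm_add_right)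
  have r: "rho s (mp k) l \<longleftrightarrow> (if s then (fr (k ^ n), cst c) \<notin> R else (cst c, fr (k ^ n)) \<in> R)" if "k \<noteq> 0" for k s using rho_iff[OF that n(1,2,4)] .
  have r': "rho s (mp k) l' \<longleftrightarrow> (if s then (fr (k ^ n), cst d) \<notin> R else (cst d, fr (k ^ n)) \<in> R)" if "k \<noteq> 0" for k s using rho_iff[OF that n(1,3,5)] .
  have r'': "rho s (mp k) (l + l') \<longleftrightarrow> (if s then (fr (k ^ n), cst (c * d)) \<notin> R else (cst (c * d), fr (k ^ n)) \<in> R)" if "k \<noteq> 0" for k s using rho_iff[OF that n(1) cd] .
  have prod: "fr ((f * f') ^ n) = fr (f ^ n) * fr (f' ^ n)" by (simp add: power_mult_distrib)
  show "rho (s \<or> s') (g * h) (l + l')" if b: "rho s g l" "rho s' h l'"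
  proof (cases "f = 0 \<or> f' = 0")
    case True
    then show ?thesis by (auto simp: f rho_def)
  next
    case False
    let ?u = "fr (f ^ n)" and ?w = "fr (f' ^ n)"
    have nz: "?u \<noteq> 0" "?w \<noteq> 0" "cst c \<noteq> 0" "cst d \<noteq> 0" using False n by auto
    have ge: "(cst c, ?u) \<in> R" "(cst d, ?w) \<in> R"
      using b False r[of f s] r'[of f' s'] total[OF nz(1,3)] total[OF nz(2,4)] f by (auto split: if_splits)
    have "(cst c * cst d, ?u * ?w) \<in> R" using R_mult2[OF ge] .
    moreover have "(?u * ?w, cst c * cst d) \<notin> R" if "s \<or> s'"
    proof (cases s)
      case True
      then have "(?u, cst c) \<notin> R" using b(1) r[of f s] False f by simp
      then show ?thesis by (rule R_mult_strict1[OF _ ge(2) nz(1,3)])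
    next
      case sF: False
      then have "(?w, cst d) \<notin> R" using that b(2) r'[of f' s'] False f by simp
      then have "(?w * ?u, cst d * cst c) \<notin> R" by (rule R_mult_strict1[OF _ ge(1) nz(2,4)])
      then show ?thesis by (simp add: mult.commute)
    qed
    ultimately show ?thesis using r''[of "f * f'" "s \<or> s'"] False unfolding f mp_mult[symmetric] prod cst_mult by auto
  qed
  show "\<not> rho (s \<and> s') (g * h) (l + l')" if b: "\<not> rho s g l" "\<not> rho s' h l'"
  proof -
    have False': "f \<noteq> 0" "f' \<noteq> 0" using b f by (auto simp: rho_def)
    let ?u = "fr (f ^ n)" and ?w = "fr (f' ^ n)"
    have nz: "?u \<noteq> 0" "?w \<noteq> 0" "cst c \<noteq> 0" "cst d \<noteq> 0" using False' n by auto
    have le: "(?u, cst c) \<in> R" "(?w, cst d) \<in> R"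
      using b False' r[of f s] r'[of f' s'] total[OF nz(1,3)] total[OF nz(2,4)] f by (auto split: if_splits)
    have "(?u * ?w, cst c * cst d) \<in> R" using R_mult2[OF le] .
    moreover have "(cst c * cst d, ?u * ?w) \<notin> R" if "\<not> (s \<and> s')"
    proof (cases s)
      case False
      then have "(cst c, ?u) \<notin> R" using b(1) r[of f s] False' f by simp
      then show ?thesis by (rule R_mult_strict1[OF _ le(2) nz(3,1)])
    next
      case True
      then have "(cst d, ?w) \<notin> R" using that b(2) r'[of f' s'] False' f by simp
      then have "(cst d * cst c, ?w * ?u) \<notin> R" by (rule R_mult_strict1[OF _ le(1) nz(4,2)])
      then show ?thesis by (simp add: mult.commute)
    qed
    ultimately show ?thesis using r''[of "f * f'" "s \<and> s'"] False' unfolding f mp_mult[symmetric] prod cst_mult by auto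
  qed
next
  fix s c l assume "c \<in> K" and l: "l \<in> \<Gamma>"
  then obtain k where k: "c = iota k" by blast
  show "rho s [:c:] l \<longleftrightarrow> vge s c l"
  proof (cases "k = 0")
    case True
    then show ?thesis using k by (simp add: rho_def)
  next
    case False
    obtain n d where n: "n > 0" "d \<noteq> 0" "vb (iota d) = nsm n l" using divisible_hull[OF l] by blast
    have kn: "fr ([:k:] ^ n) = cst (k ^ n)" unfolding cst_power fr_power by (simp add: cst_def)
    have "rho s (mp [:k:]) l \<longleftrightarrow> (if s then (cst (k ^ n), cst d) \<notin> R else (cst d, cst (k ^ n)) \<in> R)"
      using rho_iff[OF _ n, of "[:k:]" s] False unfolding kn by simp
    moreover have "(cst (k ^ n), cst d) \<in> R \<longleftrightarrow> vb (iota k) \<le> l"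
      using R_const[of "k ^ n" d] False n(1,2) nsm_le_iff[OF n(1), of "vb (iota k)" l] unfolding n(3) v_iota_power[OF False] by simp
    moreover have "(cst d, cst (k ^ n)) \<in> R \<longleftrightarrow> l \<le> vb (iota k)"
      using R_const[of d "k ^ n"] False n(1,2) nsm_le_iff[OF n(1), of l "vb (iota k)"] unfolding n(3) v_iota_power[OF False] by simp
    ultimately show ?thesis using False unfolding mp_const k vge_def by (simp add: not_le)
  qed
qed

end

text \<open>Expand in powers of a polynomial \<open>\<phi>\<close> of least degree whose value does not lie in \<open>\<Gamma>\<close>.\<close>

lemma valrel_unique:
  fixes vb :: "'l::field \<Rightarrow> 'g::linordered_ab_group_add" and iota :: "'k::field \<Rightarrow> 'l"
  assumes "valrel vb iota R" "valrel vb iota S"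
    and eq: "\<And>f c. f \<noteq> 0 \<Longrightarrow> c \<noteq> 0 \<Longrightarrow> ((cst c, fr f) \<in> R \<longleftrightarrow> (cst c, fr f) \<in> S) \<and> ((fr f, cst c) \<in> R \<longleftrightarrow> (fr f, cst c) \<in> S)"
  shows "R = S"
proof -
  interpret R: valrel vb iota R by fact
  interpret S: valrel vb iota S by fact
  \<comment> \<open>The value of f lies in the divisible hull of the values of K. Such f can be
    replaced by constants after passing to a power.\<close>
  define princ where "princ f \<longleftrightarrow> (\<exists>n>0. \<exists>c. c \<noteq> 0 \<and> (fr f ^ n, cst c) \<in> R \<and> (cst c, fr f ^ n) \<in> R)" for f
  have princS: "(fr f ^ n, cst c) \<in> S \<and> (cst c, fr f ^ n) \<in> S" if "f \<noteq> 0" "c \<noteq> 0" "(fr f ^ n, cst c) \<in> R" "(cst c, fr f ^ n) \<in> R" for f n c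
    using eq[of "f ^ n" c] that by (simp add: fr_power)
  \<comment> \<open>If all nonzero polynomials are of this kind, 1 is a harmless default: every
    expansion below is then trivial.\<close>
  define \<phi> where "\<phi> = (if \<forall>f. f \<noteq> 0 \<longrightarrow> princ f then 1 else ARG_MIN degree f. f \<noteq> 0 \<and> \<not> princ f)"
  have phi: "(\<phi> = 1 \<and> (\<forall>f. f \<noteq> 0 \<longrightarrow> princ f)) \<or>
     (\<phi> \<noteq> 0 \<and> \<not> princ \<phi> \<and> (\<forall>f. f \<noteq> 0 \<longrightarrow> degree f < degree \<phi> \<longrightarrow> princ f))"
  proof (cases "\<forall>f. f \<noteq> 0 \<longrightarrow> princ f")
    case False
    then obtain f0 where f0: "f0 \<noteq> 0 \<and> \<not> princ f0" by blast
    have "\<phi> \<noteq> 0 \<and> \<not> princ \<phi>"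
      using arg_min_natI[of "\<lambda>f. f \<noteq> 0 \<and> \<not> princ f" f0 degree] f0 False by (simp add: \<phi>_def)
    moreover have "princ f" if "f \<noteq> 0" "degree f < degree \<phi>" for f
      using arg_min_nat_le[of "\<lambda>f. f \<noteq> 0 \<and> \<not> princ f" f degree] that False by (auto simp: \<phi>_def)
    ultimately show ?thesis by blast
  qed (simp add: \<phi>_def)
  have phinz: "\<phi> \<noteq> 0" using phi by auto
  let ?m = "\<lambda>a i. fr a * fr \<phi> ^ i"
  \<comment> \<open>Cancelling the smaller power of \<open>\<phi>\<close> and one constant leaves a
    constant against a power of \<open>\<phi>\<close>, where the hypothesis on \<open>R\<close> and
    \<open>S\<close> applies.\<close>
  have const_cmp: "((cst c * fr \<phi> ^ i, cst d * fr \<phi> ^ j) \<in> R \<longleftrightarrow> (cst c * fr \<phi> ^ i, cst d * fr \<phi> ^ j) \<in> S)"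
    if "c \<noteq> 0" "d \<noteq> 0" for c d i j
  proof (cases "i \<le> j")
    case True
    have e: "cst c * fr \<phi> ^ i = (cst (c * inverse d)) * (cst d * fr \<phi> ^ i)"
      "cst d * fr \<phi> ^ j = fr (\<phi> ^ (j - i)) * (cst d * fr \<phi> ^ i)"
      using that True cst_inverse[of d] by (auto simp: cst_mult fr_power mult_ac power_add[symmetric] simp del: mult_fract)
    have nz: "cst d * fr \<phi> ^ i \<noteq> 0" using that phinz by simp
    show ?thesis unfolding e R.R_cancel[OF nz] S.R_cancel[OF nz] using eq[of "\<phi> ^ (j - i)" "c * inverse d"] that phinz by simp
  next
    case False
    then have ji: "j \<le> i" by simp
    have e: "cst d * fr \<phi> ^ j = (cst (d * inverse c)) * (cst c * fr \<phi> ^ j)"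
      "cst c * fr \<phi> ^ i = fr (\<phi> ^ (i - j)) * (cst c * fr \<phi> ^ j)"
      using that ji cst_inverse[of c] by (auto simp: cst_mult fr_power mult_ac power_add[symmetric] simp del: mult_fract)
    have nz: "cst c * fr \<phi> ^ j \<noteq> 0" using that phinz by simp
    show ?thesis unfolding e R.R_cancel[OF nz] S.R_cancel[OF nz] using eq[of "\<phi> ^ (i - j)" "d * inverse c"] that phinz by simp
  qed
  have common: "\<exists>N>0. \<exists>c d. c \<noteq> 0 \<and> d \<noteq> 0 \<and> (fr a ^ N, cst c) \<in> R \<and> (cst c, fr a ^ N) \<in> R \<and> (fr b ^ N, cst d) \<in> R \<and> (cst d, fr b ^ N) \<in> R"
    if ab: "a \<noteq> 0" "b \<noteq> 0" "princ a" "princ b" for a b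
  proof -
    obtain n c where n: "n > 0" "c \<noteq> 0" "(fr a ^ n, cst c) \<in> R" "(cst c, fr a ^ n) \<in> R" using ab(3) by (auto simp: princ_def)
    obtain m d where m: "m > 0" "d \<noteq> 0" "(fr b ^ m, cst d) \<in> R" "(cst d, fr b ^ m) \<in> R" using ab(4) by (auto simp: princ_def)
    have "(fr a ^ (n * m), cst (c ^ m)) \<in> R" "(cst (c ^ m), fr a ^ (n * m)) \<in> R"
      using n m R.R_power[of "fr a ^ n" "cst c" m] R.R_power[of "cst c" "fr a ^ n" m] ab by (simp_all add: power_mult cst_power)
    moreover have "(fr b ^ (n * m), cst (d ^ n)) \<in> R" "(cst (d ^ n), fr b ^ (n * m)) \<in> R"
      using n m R.R_power[of "fr b ^ m" "cst d" n] R.R_power[of "cst d" "fr b ^ m" n] ab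
      by (simp_all add: power_mult[symmetric] cst_power mult.commute)
    ultimately show ?thesis using n m by (intro exI[of _ "n * m"] conjI exI[of _ "c ^ m"] exI[of _ "d ^ n"]) auto
  qed
  \<comment> \<open>Raising to the power \<open>N\<close> replaces the two coefficients by constants
    of the same value.\<close>
  have red: "(?m a i, ?m b j) \<in> T \<longleftrightarrow> (cst c * fr \<phi> ^ (i * N), cst d * fr \<phi> ^ (j * N)) \<in> T"
    if T: "valrel vb iota T" and "a \<noteq> 0" "b \<noteq> 0" "N > 0" "c \<noteq> 0" "d \<noteq> 0"
      "(fr a ^ N, cst c) \<in> T" "(cst c, fr a ^ N) \<in> T" "(fr b ^ N, cst d) \<in> T" "(cst d, fr b ^ N) \<in> T" for T a b i j N c d
  proof -
    interpret T: valrel vb iota T by fact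
    have A: "(?m a i ^ N, cst c * fr \<phi> ^ (i * N)) \<in> T" "(cst c * fr \<phi> ^ (i * N), ?m a i ^ N) \<in> T"
      using that phinz T.R_mult[OF that(7), of "fr \<phi> ^ (i * N)"] T.R_mult[OF that(8), of "fr \<phi> ^ (i * N)"]
      by (simp_all add: power_mult_distrib power_mult)
    have B: "(?m b j ^ N, cst d * fr \<phi> ^ (j * N)) \<in> T" "(cst d * fr \<phi> ^ (j * N), ?m b j ^ N) \<in> T"
      using that phinz T.R_mult[OF that(9), of "fr \<phi> ^ (j * N)"] T.R_mult[OF that(10), of "fr \<phi> ^ (j * N)"]
      by (simp_all add: power_mult_distrib power_mult)
    have "(?m a i, ?m b j) \<in> T \<longleftrightarrow> (?m a i ^ N, ?m b j ^ N) \<in> T"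
      using T.R_power[of "?m a i" "?m b j" N] that phinz by simp
    also have "\<dots> \<longleftrightarrow> (cst c * fr \<phi> ^ (i * N), cst d * fr \<phi> ^ (j * N)) \<in> T" by (rule T.R_cong[OF A B])
    finally show ?thesis .
  qed
  have cmp: "(?m a i, ?m b j) \<in> R \<longleftrightarrow> (?m a i, ?m b j) \<in> S" if ab: "a \<noteq> 0" "b \<noteq> 0" "princ a" "princ b" for a b i j
  proof -
    obtain N c d where N: "N > 0" "c \<noteq> 0" "d \<noteq> 0" "(fr a ^ N, cst c) \<in> R" "(cst c, fr a ^ N) \<in> R" "(fr b ^ N, cst d) \<in> R" "(cst d, fr b ^ N) \<in> R"
      using common[OF ab] by blast
    have SN: "(fr a ^ N, cst c) \<in> S" "(cst c, fr a ^ N) \<in> S" "(fr b ^ N, cst d) \<in> S" "(cst d, fr b ^ N) \<in> S"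
      using princS[OF ab(1) N(2,4,5)] princS[OF ab(2) N(3,6,7)] by auto
    show ?thesis
      using red[OF assms(1) ab(1,2) N, of i j] red[OF assms(2) ab(1,2) N(1-3) SN, of i j] const_cmp[OF N(2,3)] by simp
  qed
  \<comment> \<open>Every f has the value of one monomial a \<open>\<phi>\<close>^i, the same for
    both relations. In the division by \<open>\<phi>\<close> the quotient part and a nonzero
    remainder never have equal value, so the smaller one determines the value of f, and the
    induction runs on the quotient.\<close>
  have expand: "\<exists>a i. a \<noteq> 0 \<and> princ a \<and> (\<forall>T\<in>{R, S}. (fr f, ?m a i) \<in> T \<and> (?m a i, fr f) \<in> T)" if "f \<noteq> 0" for f
    using that
  proof (induction "degree f" arbitrary: f rule: less_induct)
    case less
    have triv: ?case if "princ f"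
      using that less.prems R.R_refl[of "fr f"] S.R_refl[of "fr f"] by (intro exI[of _ f] exI[of _ 0]) simp
    show ?case
    proof (cases "princ f")
      case False
      then have np: "\<not> princ \<phi>" and pm: "\<And>h. h \<noteq> 0 \<Longrightarrow> degree h < degree \<phi> \<Longrightarrow> princ h" using phi less.prems by auto
      have dphi: "degree \<phi> > 0"
      proof (rule ccontr)
        assume "\<not> ?thesis"
        then obtain c where c: "\<phi> = [:c:]" by (metis degree_eq_zeroE gr0I)
        then have "fr \<phi> ^ 1 = cst c" "c \<noteq> 0" using phinz by (auto simp: cst_def)
        then have "princ \<phi>" unfolding princ_def using R.R_refl[of "cst c"] by (metis cst_eq_0 zero_less_one)
        then show False using np by blast
      qed
      let ?q = "f div \<phi>" and ?r = "f mod \<phi>"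
      have f: "f = ?q * \<phi> + ?r" by simp
      have dr: "?r = 0 \<or> degree ?r < degree \<phi>" using degree_mod_less[OF phinz] by blast
      have df: "\<not> degree f < degree \<phi>" using pm[of f] less.prems False by blast
      have qnz: "?q \<noteq> 0" using df dr f dphi by (metis add_0 degree_0 mult_zero_left)
      have "degree (?q * \<phi>) = degree ?q + degree \<phi>" using qnz phinz by (rule degree_mult_eq)
      moreover have "degree f = degree (?q * \<phi>)"
        using f dr dphi calculation by (metis add_0_right degree_add_eq_left le_add2 less_le_trans)
      ultimately have "degree ?q < degree f" using dphi by simp
      from less.hyps[OF this qnz] obtain a i where a: "a \<noteq> 0" "princ a" "\<forall>T\<in>{R, S}. (fr ?q, ?m a i) \<in> T \<and> (?m a i, fr ?q) \<in> T" by blast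
      have qphi: "(fr (?q * \<phi>), ?m a (Suc i)) \<in> T \<and> (?m a (Suc i), fr (?q * \<phi>)) \<in> T" if T: "T \<in> {R, S}" for T
      proof -
        interpret T: valrel vb iota T using T assms by blast
        have "fr (?q * \<phi>) = fr ?q * fr \<phi>" "?m a (Suc i) = ?m a i * fr \<phi>"
          by (rule fr_mult) (simp only: power_Suc2 mult.assoc)
        note e = this
        have x: "(fr ?q, ?m a i) \<in> T" "(?m a i, fr ?q) \<in> T" using a(3) T by blast+
        have "fr \<phi> \<noteq> 0" using phinz by simp
        then show ?thesis unfolding e using T.R_mult[OF x(1)] T.R_mult[OF x(2)] by blast
      qed
      show ?thesis
      proof (cases "?r = 0")
        case True
        then have "f = ?q * \<phi>" using f by simp
        then show ?thesis using qphi a(1,2) by metis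
      next
        case rnz: False
        then have pr: "princ ?r" using pm dr by blast
        have m0: "?m ?r 0 = fr ?r" by simp
        have cmp1: "(fr ?r, ?m a (Suc i)) \<in> R \<longleftrightarrow> (fr ?r, ?m a (Suc i)) \<in> S" using cmp[OF rnz a(1) pr a(2), of 0 "Suc i"] m0 by simp
        have cmp2: "(?m a (Suc i), fr ?r) \<in> R \<longleftrightarrow> (?m a (Suc i), fr ?r) \<in> S" using cmp[OF a(1) rnz a(2) pr, of "Suc i" 0] m0 by simp
        \<comment> \<open>Equal values would give a positive power of \<open>\<phi>\<close> the
          value of a constant, contrary to the choice of \<open>\<phi>\<close>.\<close>
        have neq: "\<not> ((fr ?r, ?m a (Suc i)) \<in> R \<and> (?m a (Suc i), fr ?r) \<in> R)"
        proof
          assume e: "(fr ?r, ?m a (Suc i)) \<in> R \<and> (?m a (Suc i), fr ?r) \<in> R"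
          obtain N c d where N: "N > 0" "c \<noteq> 0" "d \<noteq> 0" "(fr ?r ^ N, cst c) \<in> R" "(cst c, fr ?r ^ N) \<in> R" "(fr a ^ N, cst d) \<in> R" "(cst d, fr a ^ N) \<in> R"
            using common[OF rnz a(1) pr a(2)] by blast
          have 1: "(cst c * fr \<phi> ^ (0 * N), cst d * fr \<phi> ^ (Suc i * N)) \<in> R" using red[OF assms(1) rnz a(1) N, of 0 "Suc i"] e m0 by simp
          have 2: "(cst d * fr \<phi> ^ (Suc i * N), cst c * fr \<phi> ^ (0 * N)) \<in> R"
            using red[OF assms(1) a(1) rnz N(1,3,2,6,7,4,5), of "Suc i" 0] e m0 by simp
          have cd: "cst c * fr \<phi> ^ (0 * N) = cst (c * inverse d) * cst d" using N cst_inverse[of d] by (simp add: cst_mult mult.assoc)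
          have dd: "cst d * fr \<phi> ^ (Suc i * N) = fr \<phi> ^ (Suc i * N) * cst d" by (simp add: mult.commute)
          have dnz: "cst d \<noteq> 0" using N by simp
          have "(cst (c * inverse d), fr \<phi> ^ (Suc i * N)) \<in> R" using 1 unfolding cd dd R.R_cancel[OF dnz] .
          moreover have "(fr \<phi> ^ (Suc i * N), cst (c * inverse d)) \<in> R" using 2 unfolding cd dd R.R_cancel[OF dnz] .
          moreover have "Suc i * N > 0" "c * inverse d \<noteq> 0" using N by auto
          ultimately have "princ \<phi>" unfolding princ_def by blast
          then show False using np by blast
        qed
        have nzs: "fr ?r \<noteq> 0" "?m a (Suc i) \<noteq> 0" "fr (?q * \<phi>) \<noteq> 0" using rnz a(1) phinz qnz by auto
        have frf: "fr f = fr (?q * \<phi>) + fr ?r" "fr f = fr ?r + fr (?q * \<phi>)" using f fr_add[of "?q * \<phi>" ?r] by (auto simp only: add.commute)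
        show ?thesis
        proof (cases "(fr ?r, ?m a (Suc i)) \<in> R")
          case True
          have "(fr f, fr ?r) \<in> T \<and> (fr ?r, fr f) \<in> T" if T: "T \<in> {R, S}" for T
          proof -
            interpret T: valrel vb iota T using T assms by blast
            have "(?m a (Suc i), fr ?r) \<notin> T" using T True neq cmp2 by auto
            then have "(fr (?q * \<phi>), fr ?r) \<notin> T" using qphi[OF T] T.R_trans by blast
            from T.R_add_strict[OF nzs(1,3) this] show ?thesis unfolding frf(2) by blast
          qed
          then show ?thesis using rnz pr m0 by (intro exI[of _ ?r] exI[of _ 0]) simp
        next
          case F: False
          have "(fr f, ?m a (Suc i)) \<in> T \<and> (?m a (Suc i), fr f) \<in> T" if T: "T \<in> {R, S}" for T
          proof -
            interpret T: valrel vb iota T using T assms by blast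
            have "(fr ?r, ?m a (Suc i)) \<notin> T" using T F cmp1 by auto
            then have "(fr ?r, fr (?q * \<phi>)) \<notin> T" using qphi[OF T] T.R_trans by blast
            from T.R_add_strict[OF nzs(3,1) this] show ?thesis unfolding frf(1) using qphi[OF T] T.R_trans by blast
          qed
          then show ?thesis using a(1,2) by blast
        qed
      qed
    qed (rule triv)
  qed
  have poly_eq: "(fr f, fr g) \<in> R \<longleftrightarrow> (fr f, fr g) \<in> S" if fg: "f \<noteq> 0" "g \<noteq> 0" for f g
  proof -
    obtain a i where a: "a \<noteq> 0" "princ a" "\<forall>T\<in>{R, S}. (fr f, ?m a i) \<in> T \<and> (?m a i, fr f) \<in> T" using expand[OF fg(1)] by blast
    obtain b j where b: "b \<noteq> 0" "princ b" "\<forall>T\<in>{R, S}. (fr g, ?m b j) \<in> T \<and> (?m b j, fr g) \<in> T" using expand[OF fg(2)] by blast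
    have "(fr f, fr g) \<in> R \<longleftrightarrow> (?m a i, ?m b j) \<in> R" by (rule R.R_cong) (use a(3) b(3) in simp_all)
    moreover have "(fr f, fr g) \<in> S \<longleftrightarrow> (?m a i, ?m b j) \<in> S" by (rule S.R_cong) (use a(3) b(3) in simp_all)
    ultimately show ?thesis using cmp[OF a(1) b(1) a(2) b(2)] by simp
  qed
  have "(u, w) \<in> R \<longleftrightarrow> (u, w) \<in> S" for u w
  proof (cases "u = 0 \<or> w = 0")
    case True
    then show ?thesis using R.nonzero S.nonzero by blast
  next
    case False
    obtain p q where p: "u = Fract p q" "q \<noteq> 0" by (cases u)
    obtain r s where r: "w = Fract r s" "s \<noteq> 0" by (cases w)
    have pr: "p \<noteq> 0" "r \<noteq> 0" using False p r by (auto simp: Fract_nonzero)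
    have nz: "fr (q * s) \<noteq> 0" using p r by simp
    have 1: "u * fr (q * s) = fr (p * s)" using p r by (simp add: eq_fract)
    have 2: "w * fr (q * s) = fr (r * q)" using p r by (simp add: eq_fract)
    show ?thesis
      using R.R_cancel[OF nz, of u w] S.R_cancel[OF nz, of u w] poly_eq[of "p * s" "r * q"] p r pr unfolding 1 2 by simp
  qed
  then show ?thesis by auto
qed


section \<open>From valuations on polynomials to classes\<close>

lemma oag_inverse: "oag Gc le add z \<Longrightarrow> \<forall>x\<in>Gc. \<exists>y\<in>Gc. add x y = z"
  unfolding oag_def by (elim conjE)

lemma oag_closed: "oag Gc le add z \<Longrightarrow> \<forall>x\<in>Gc. \<forall>y\<in>Gc. add x y \<in> Gc"
  unfolding oag_def by (elim conjE)

lemma oag_mono: "oag Gc le add z \<Longrightarrow> \<forall>x\<in>Gc. \<forall>y\<in>Gc. \<forall>w\<in>Gc. le x y \<longrightarrow> le (add x w) (add y w)"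
  unfolding oag_def by (elim conjE)

lemma oag_total: "oag Gc le add z \<Longrightarrow> \<forall>x\<in>Gc. \<forall>y\<in>Gc. le x y \<or> le y x"
  unfolding oag_def by (elim conjE)

lemma oag_trans: "oag Gc le add z \<Longrightarrow> \<forall>x\<in>Gc. \<forall>y\<in>Gc. \<forall>w\<in>Gc. le x y \<and> le y w \<longrightarrow> le x w"
  unfolding oag_def by (elim conjE)

lemma (in qvalued) rho_power:
  assumes "f \<in> polys F" "l \<in> \<Gamma>" "0 < n" shows "\<rho> s (f ^ n) (nsm n l) \<longleftrightarrow> \<rho> s f l"
proof -
  have pw: "f ^ Suc n \<in> polys F" for n by (induction n) (use assms polys_mult[OF sub] in auto)
  have 1: "\<rho> s (f ^ Suc n) (nsm (Suc n) l)" if "\<rho> s f l" for n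
  proof (induction n)
    case (Suc n)
    from rho_mult[OF assms(1) pw assms(2) _ that Suc.IH] show ?case using assms(2) by (simp add: add.commute)
  qed (simp add: that)
  have 2: "\<not> \<rho> s (f ^ Suc n) (nsm (Suc n) l)" if "\<not> \<rho> s f l" for n
  proof (induction n)
    case (Suc n)
    from rho_mult_neg[OF assms(1) pw assms(2) _ that Suc.IH] show ?case using assms(2) by (simp add: add.commute)
  qed (simp add: that)
  obtain m where "n = Suc m" using assms(3) by (cases n) auto
  then show ?thesis using 1 2 by blast
qed

context vfield
begin

lemma principal_pq:
  assumes q: "qcut vb \<delta>" and p: "is_principal \<delta>"
  shows "pval \<delta> \<in> \<Gamma>" "\<delta> = pq vb (pval \<delta>)"
proof -
  obtain g where g: "g \<in> fst \<delta>" "g \<in> snd \<delta>" using p by (auto simp: is_principal_def)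
  have pv: "pval \<delta> = g" unfolding pval_def
    by (rule the_equality) (use g q in \<open>auto simp: qcut_def intro: antisym\<close>)
  show G: "pval \<delta> \<in> \<Gamma>" using pv g qcut_fst[OF q] by simp
  have "fst \<delta> = fst (pq vb g)" using g qcut_le[OF q _ g(2)] qcut_fst[OF q] fst_down[OF q g(1)] by (auto simp: pq_def)
  moreover have "snd \<delta> = snd (pq vb g)" using g qcut_le[OF q g(1)] qcut_snd[OF q] snd_up[OF q g(2)] by (auto simp: pq_def)
  ultimately show "\<delta> = pq vb (pval \<delta>)" using pv by (simp add: prod_eq_iff)
qed

lemma is_principal_pq: "g \<in> \<Gamma> \<Longrightarrow> is_principal (pq vb g)"
  by (auto simp: is_principal_def pq_def)

lemma pval_pq: assumes "g \<in> \<Gamma>" shows "pval (pq vb g) = g"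
  unfolding pval_def by (rule the_equality) (use assms in \<open>auto simp: pq_def intro: antisym\<close>)

lemma ngd_pq:
  assumes g: "g \<in> \<Gamma>" shows "ngd (pq vb g) k c \<longleftrightarrow> zsm k g + c \<le> 0"
proof (cases k "0::int" rule: linorder_cases)
  case less
  have "zsm k g + c \<le> 0" if "l \<le> g" "zsm k l + c \<le> 0" for l
    using order_trans[OF add_right_mono[OF zsm_antimono[of k l g], of c] that(2)] less that by simp
  then show ?thesis using less g by (auto simp: ngd_def pq_def)
next
  case greater
  have "zsm k g + c \<le> 0" if "g \<le> l" "zsm k l + c \<le> 0" for l
    using order_trans[OF add_right_mono[OF zsm_mono[of k g l], of c] that(2)] greater that by simp
  then show ?thesis using greater g by (auto simp: ngd_def pq_def)
qed (auto simp: ngd_def)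

lemma le_pq:
  assumes "g \<in> \<Gamma>" shows "le_Gd (pq vb g) s t \<longleftrightarrow> snd s + zsm (fst s) g \<le> snd t + zsm (fst t) g"
proof -
  have e: "zsm (fst s - fst t) g + (snd s - snd t) = (snd s + zsm (fst s) g) - (snd t + zsm (fst t) g)"
    by (simp add: zsm_diff_left algebra_simps)
  show ?thesis unfolding le_Gd_iff ngd_pq[OF assms] e by simp
qed

lemma norm_le: assumes q: "qcut vb \<delta>" shows "le_Gd \<delta> (norm_Gd \<delta> s) (norm_Gd \<delta> t) \<longleftrightarrow> le_Gd \<delta> s t"
proof (cases "is_principal \<delta>")
  case True
  note p = principal_pq[OF q True]
  show ?thesis using le_pq[OF p(1), of s t] unfolding p(2)[symmetric] by (simp add: norm_Gd_def True)
qed (simp add: norm_Gd_def)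

lemma norm_add: "norm_Gd \<delta> (s + t) = norm_Gd \<delta> s + norm_Gd \<delta> t"
  by (simp add: norm_Gd_def zsm_add_left algebra_simps)

lemma norm_0 [simp]: "norm_Gd \<delta> (0, g) = (0, g)"
  by (simp add: norm_Gd_def)

lemma norm_norm [simp]: "norm_Gd \<delta> (norm_Gd \<delta> s) = norm_Gd \<delta> s"
  by (simp add: norm_Gd_def)

lemma norm_minus: "norm_Gd \<delta> (- s) = - norm_Gd \<delta> s"
  by (simp add: norm_Gd_def zsm_minus_left)

lemma norm_in: "qcut vb \<delta> \<Longrightarrow> snd s \<in> \<Gamma> \<Longrightarrow> snd (norm_Gd \<delta> s) \<in> \<Gamma>"
  using principal_pq(1) by (auto simp: norm_Gd_def)

lemma norm_antisym:
  assumes q: "qcut vb \<delta>" and st: "le_Gd \<delta> s t" "le_Gd \<delta> t s" shows "norm_Gd \<delta> s = norm_Gd \<delta> t"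
proof (cases "is_principal \<delta>")
  case True
  note p = principal_pq[OF q True]
  show ?thesis using st le_pq[OF p(1), of s t] le_pq[OF p(1), of t s] unfolding p(2)[symmetric] by (simp add: norm_Gd_def True)
next
  case False
  then show ?thesis using le_antisym[OF q False st] by simp
qed

text \<open>The definition of \<open>omega\<close> picks an arbitrary minimal term,
  \<open>lmon\<close> a particular one. Both are minimal for \<open>\<delta>\<close>, so their
  values are equal and \<open>norm_Gd\<close> identifies them.\<close>

lemma omega_lmon:
  assumes q: "qcut vb \<delta>" and f: "f \<noteq> 0" shows "omega vb a \<delta> f = norm_Gd \<delta> (lmon a \<delta> f)"
proof -
  let ?P = "\<lambda>t. t \<in> mterms a f \<and> (\<forall>s\<in>mterms a f. le_Gd \<delta> t s)"
  have P: "?P (lmon a \<delta> f)" using lmon_spec(1)[OF q f, of a] le_cutpD[OF lmon_spec(2)[OF q f]] by blast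
  then have "?P (SOME t. ?P t)" by (rule someI)
  then have "norm_Gd \<delta> (SOME t. ?P t) = norm_Gd \<delta> (lmon a \<delta> f)" using P by (intro norm_antisym[OF q]) auto
  then show ?thesis by (simp add: omega_def mterms_def Let_def)
qed

text \<open>The carrier consists of normal forms: all of int \<times> \<Gamma> for a cut, the pairs
  (0, g) for a principal radius. In the principal case the order on all pairs is only a
  preorder.\<close>

lemma oag_Gd:
  assumes q: "qcut vb \<delta>" shows "oag {t. snd t \<in> \<Gamma> \<and> norm_Gd \<delta> t = t} (le_Gd \<delta>) (+) 0"
  unfolding oag_def
proof (intro conjI ballI impI)
  let ?G = "{t. snd t \<in> \<Gamma> \<and> norm_Gd \<delta> t = t}"
  show "0 \<in> ?G" by (simp add: zero_prod_def)
  fix x assume x: "x \<in> ?G"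
  show "0 + x = x" by simp
  show "\<exists>y\<in>?G. x + y = 0" using x by (intro bexI[of _ "- x"]) (auto simp: norm_minus)
  show "le_Gd \<delta> x x" by simp
  fix y assume y: "y \<in> ?G"
  show "x + y \<in> ?G" using x y by (auto simp: norm_add)
  show "x + y = y + x" by (rule add.commute)
  show "x = y" if "le_Gd \<delta> x y \<and> le_Gd \<delta> y x" using norm_antisym[OF q, of x y] that x y by auto
  show "le_Gd \<delta> x y \<or> le_Gd \<delta> y x" using le_total[OF q] x y by blast
  fix w assume w: "w \<in> ?G"
  show "x + y + w = x + (y + w)" by (rule add.assoc)
  show "le_Gd \<delta> x w" if "le_Gd \<delta> x y \<and> le_Gd \<delta> y w" using le_trans[OF q] that by blast
  show "le_Gd \<delta> (x + w) (y + w)" if "le_Gd \<delta> x y" using that by simp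
qed

text \<open>The maximum along the nest is attained at every member without roots of f, so
  \<open>Greatest\<close> does find a value.\<close>

lemma omega_nest_eq:
  assumes N: "nest vb N" and f: "f \<noteq> 0" and B: "B \<in> N" "rootfree B f" "b \<in> B"
  shows "omega_nest vb N f = vb (poly f b)"
proof -
  let ?k = "vb (poly f b)"
  have fb: "poly f b \<noteq> 0" using B by (auto simp: rootfree_def)
  have om: "snd (omega vb a (pq vb \<gamma>) f) \<in> \<Gamma>" "qv a (pq vb \<gamma>) False f l \<longleftrightarrow> l \<le> snd (omega vb a (pq vb \<gamma>) f)" if "\<gamma> \<in> \<Gamma>" for a \<gamma> l
  proof -
    have o: "snd (omega vb a (pq vb \<gamma>) f) = snd (lmon a (pq vb \<gamma>) f) + zsm (fst (lmon a (pq vb \<gamma>) f)) \<gamma>"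
      using omega_lmon[OF qcut_pq f] that by (simp add: norm_Gd_def is_principal_pq pval_pq)
    show "snd (omega vb a (pq vb \<gamma>) f) \<in> \<Gamma>" unfolding o using lmon_in[OF qcut_pq f] that by simp
    show "qv a (pq vb \<gamma>) False f l \<longleftrightarrow> l \<le> snd (omega vb a (pq vb \<gamma>) f)"
      unfolding o using f le_pq[OF that, of "(0, l)" "lmon a (pq vb \<gamma>) f"] by (simp add: qv_def)
  qed
  obtain a0 \<gamma>0 where a0: "\<gamma>0 \<in> \<Gamma>" "B = vcball vb a0 \<gamma>0" using nest_ballE[OF N B(1)] .
  have val: "nqv N s f l \<longleftrightarrow> vge s (poly f b) l" if "l \<in> \<Gamma>" for s l by (rule nqv_rootfree[OF N B that])
  have kB: "snd (omega vb a0 (pq vb \<gamma>0) f) = ?k"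
  proof (rule antisym)
    have qB: "qv a0 (pq vb \<gamma>0) False f l \<longleftrightarrow> vge False (poly f b) l" if "l \<in> \<Gamma>" for l
      using qv_rootfree[OF qcut_pq, of a0 \<gamma>0 f b l False] B a0 that by (simp add: vball_pq)
    show "snd (omega vb a0 (pq vb \<gamma>0) f) \<le> ?k" using qB om[OF a0(1), of a0] fb by (auto simp: vge_def)
    show "?k \<le> snd (omega vb a0 (pq vb \<gamma>0) f)" using qB[of ?k] om(2)[OF a0(1), of a0 ?k] fb by (auto simp: vge_def)
  qed
  show ?thesis unfolding omega_nest_def
  proof (rule Greatest_equality)
    show "\<exists>B\<in>N. \<exists>a \<gamma>. \<gamma> \<in> \<Gamma> \<and> B = vcball vb a \<gamma> \<and> ?k = snd (omega vb a (pq vb \<gamma>) f)"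
      using B(1) a0 kB by metis
  next
    fix t assume "\<exists>B\<in>N. \<exists>a \<gamma>. \<gamma> \<in> \<Gamma> \<and> B = vcball vb a \<gamma> \<and> t = snd (omega vb a (pq vb \<gamma>) f)"
    then obtain a \<gamma> where a: "\<gamma> \<in> \<Gamma>" "vcball vb a \<gamma> \<in> N" "t = snd (omega vb a (pq vb \<gamma>) f)" by blast
    have t: "t \<in> \<Gamma>" using om(1)[OF a(1)] a(3) by simp
    have "nqv N False f t" using a om(2)[OF a(1), of a t] by (auto simp: nqv_def)
    then show "t \<le> ?k" using val[OF t] fb by (simp add: vge_def)
  qed
qed

end

section \<open>Extension from polynomials to rational functions\<close>

context vclosure
begin

text \<open>Values of fractions are differences of values of polynomials. The order
  \<open>le\<close> and its carrier are left open, so that the statement covers balls, whose order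
  depends on the quasi-cut, and nests, where the first component is constantly 0.\<close>

lemma valuation_relation:
  fixes w :: "'k poly \<Rightarrow> int \<times> 'g"
  assumes o: "oag Gc le (+) 0" and wG: "\<And>p. p \<noteq> 0 \<Longrightarrow> w p \<in> Gc"
    and wm: "\<And>p q. p \<noteq> 0 \<Longrightarrow> q \<noteq> 0 \<Longrightarrow> w (p * q) = w p + w q"
    and wa: "\<And>p q. p \<noteq> 0 \<Longrightarrow> q \<noteq> 0 \<Longrightarrow> p + q \<noteq> 0 \<Longrightarrow> le (w p) (w (p + q)) \<or> le (w q) (w (p + q))"
    and wc: "\<And>c. c \<noteq> 0 \<Longrightarrow> w [:c:] = (0, vb (iota c))"
    and le0: "\<And>g h. le (0, g) (0, h) \<longleftrightarrow> g \<le> h"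
    and R: "R = {(u, u'). \<exists>p q r s. p \<noteq> 0 \<and> q \<noteq> 0 \<and> r \<noteq> 0 \<and> s \<noteq> 0 \<and>
      u = Fract p q \<and> u' = Fract r s \<and> le (w (p * s)) (w (r * q))}"
  shows "R \<in> Vset iota vb TYPE(int \<times> 'g)"
    and "\<And>p q r s. p \<noteq> 0 \<Longrightarrow> q \<noteq> 0 \<Longrightarrow> r \<noteq> 0 \<Longrightarrow> s \<noteq> 0 \<Longrightarrow> (Fract p q, Fract r s) \<in> R \<longleftrightarrow> le (w (p * s)) (w (r * q))"
proof -
  \<comment> \<open>The representation chosen for the fraction does not matter, by multiplicativity
    of \<open>w\<close>.\<close>
  define \<mu> where "\<mu> u = (let pq = SOME pq. snd pq \<noteq> 0 \<and> u = Fract (fst pq) (snd pq) in w (fst pq) - w (snd pq))" for u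
  have mu: "\<mu> (Fract p q) = w p - w q" if "p \<noteq> 0" "q \<noteq> 0" for p q
  proof -
    let ?P = "\<lambda>pq. snd pq \<noteq> 0 \<and> Fract p q = Fract (fst pq) (snd pq)"
    have "?P (p, q)" using that by simp
    then have "?P (SOME pq. ?P pq)" by (rule someI)
    then obtain p' q' where pq: "(SOME pq. ?P pq) = (p', q')" "q' \<noteq> 0" "Fract p q = Fract p' q'" by (cases "SOME pq. ?P pq") auto
    have e: "p * q' = p' * q" using pq that by (simp add: eq_fract)
    have "p' \<noteq> 0" using e that pq by auto
    then have "w p + w q' = w p' + w q" using wm that pq e by metis
    then have "w p - w q = w p' - w q'" by (simp add: algebra_simps)
    then show ?thesis unfolding \<mu>_def Let_def pq(1) by simp
  qed
  note o_inv = oag_inverse[OF o] and o_add = oag_closed[OF o] and o_mono = oag_mono[OF o]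
  have Gm: "- x \<in> Gc" if x: "x \<in> Gc" for x
  proof -
    obtain y where "y \<in> Gc" "x + y = 0" using o_inv x by blast
    then show ?thesis using minus_unique[of x y] by simp
  qed
  have Ga: "x + y \<in> Gc" if "x \<in> Gc" "y \<in> Gc" for x y using o_add that by blast
  have lec: "le (x + z) (y + z) \<longleftrightarrow> le x y" if "x \<in> Gc" "y \<in> Gc" "z \<in> Gc" for x y z
  proof
    assume "le (x + z) (y + z)"
    then have "le (x + z + - z) (y + z + - z)" using o_mono that Ga Gm by blast
    then show "le x y" by simp
  next
    assume "le x y"
    then show "le (x + z) (y + z)" using o_mono that by blast
  qed
  have muG: "\<mu> u \<in> Gc" if "u \<noteq> 0" for u
  proof -
    obtain p q where p: "u = Fract p q" "q \<noteq> 0" by (cases u)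
    then have "p \<noteq> 0" using that by (auto simp: Fract_nonzero)
    then show ?thesis using mu[of p q] p Ga[OF wG Gm[OF wG], of p q] by simp
  qed
  have lemu: "le (\<mu> (Fract p q)) (\<mu> (Fract r s)) \<longleftrightarrow> le (w (p * s)) (w (r * q))"
    if nz: "p \<noteq> 0" "q \<noteq> 0" "r \<noteq> 0" "s \<noteq> 0" for p q r s
  proof -
    have "le (\<mu> (Fract p q)) (\<mu> (Fract r s)) \<longleftrightarrow> le (\<mu> (Fract p q) + (w q + w s)) (\<mu> (Fract r s) + (w q + w s))"
      using nz by (intro lec[symmetric] muG Ga wG) (auto simp: Fract_nonzero)
    also have "\<mu> (Fract p q) + (w q + w s) = w (p * s)" using nz by (simp add: mu wm)
    also have "\<mu> (Fract r s) + (w q + w s) = w (r * q)" using nz by (simp add: mu wm algebra_simps)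
    finally show ?thesis .
  qed
  have Rv: "R = vrel le \<mu>"
  proof (intro set_eqI iffI)
    fix x assume "x \<in> R"
    then show "x \<in> vrel le \<mu>" unfolding R vrel_def using lemu by (auto simp: Fract_nonzero)
  next
    fix x assume x: "x \<in> vrel le \<mu>"
    obtain u u' where uu: "x = (u, u')" by (cases x)
    have nz: "u \<noteq> 0" "u' \<noteq> 0" "le (\<mu> u) (\<mu> u')" using x uu by (auto simp: vrel_def)
    obtain p q where p: "u = Fract p q" "q \<noteq> 0" by (cases u)
    obtain r s where r: "u' = Fract r s" "s \<noteq> 0" by (cases u')
    have "p \<noteq> 0" "r \<noteq> 0" using nz p r by (auto simp: Fract_nonzero)
    then show "x \<in> R" using nz(3) lemu[of p q r s] p r unfolding R uu by blast
  qed
  show main: "(Fract p q, Fract r s) \<in> R \<longleftrightarrow> le (w (p * s)) (w (r * q))" if nz: "p \<noteq> 0" "q \<noteq> 0" "r \<noteq> 0" "s \<noteq> 0" for p q r s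
    unfolding Rv vrel_def using lemu[OF nz] nz by (simp add: Fract_nonzero)
  have "is_valKx Gc le (+) 0 \<mu>" unfolding is_valKx_def
  proof (intro conjI allI impI)
    show "oag Gc le (+) 0" by (rule o)
    show "\<mu> u \<in> Gc" if "u \<noteq> 0" for u by (rule muG[OF that])
  next
    fix u u' :: "'k poly fract" assume nz: "u \<noteq> 0" "u' \<noteq> 0"
    obtain p q where p: "u = Fract p q" "q \<noteq> 0" by (cases u)
    obtain r s where r: "u' = Fract r s" "s \<noteq> 0" by (cases u')
    have pr: "p \<noteq> 0" "r \<noteq> 0" using nz p r by (auto simp: Fract_nonzero)
    have "u * u' = Fract (p * r) (q * s)" using p r by simp
    then show "\<mu> (u * u') = \<mu> u + \<mu> u'" using p r pr mu[of "p * r" "q * s"] by (simp add: mu wm)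
    assume "u + u' \<noteq> 0"
    moreover have su: "u + u' = Fract (p * s + r * q) (q * s)" using p r by simp
    ultimately have t: "p * s + r * q \<noteq> 0" using p r by (simp add: Fract_nonzero)
    have 1: "u = Fract (p * s) (q * s)" "u' = Fract (r * q) (q * s)" using p r by (simp_all add: eq_fract)
    have c: "le (\<mu> (Fract x (q * s))) (\<mu> (Fract y (q * s))) \<longleftrightarrow> le (w x) (w y)" if "x \<noteq> 0" "y \<noteq> 0" for x y
      using lec[of "w x" "w y" "- w (q * s)"] that p r wG Gm[OF wG, of "q * s"] by (simp add: mu)
    show "le (\<mu> u) (\<mu> (u + u')) \<or> le (\<mu> u') (\<mu> (u + u'))"
      unfolding su unfolding 1 using c wa[of "p * s" "r * q"] t p r pr by simp
  qed
  moreover have "restr_equiv iota vb le \<mu>" unfolding restr_equiv_def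
  proof (intro exI[of _ snd] conjI ballI allI impI)
    have w1: "w 1 = (0, 0)" using wc[of 1] by (simp add: one_pCons hom_one)
    have muc: "\<mu> (cst c) = (0, vb (iota c))" if "c \<noteq> 0" for c
      using that mu[of "[:c:]" 1] by (simp add: cst_def wc w1)
    have im: "(\<lambda>c. \<mu> (cst c)) ` (UNIV - {0}) = (\<lambda>g. (0, g)) ` (\<lambda>c. vb (iota c)) ` (UNIV - {0})"
      using muc by (auto simp: image_iff)
    show "bij_betw snd ((\<lambda>c. \<mu> (cst c)) ` (UNIV - {0})) ((\<lambda>c. vb (iota c)) ` (UNIV - {0}))"
      unfolding im by (auto simp: bij_betw_def inj_on_def image_image)
    show "le x y \<longleftrightarrow> snd x \<le> snd y" if "x \<in> (\<lambda>c. \<mu> (cst c)) ` (UNIV - {0})" "y \<in> (\<lambda>c. \<mu> (cst c)) ` (UNIV - {0})" for x y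
      using that le0 unfolding im by auto
    show "snd (\<mu> (cst c)) = vb (iota c)" if "c \<noteq> 0" for c using muc[OF that] by simp
  qed
  ultimately show "R \<in> Vset iota vb TYPE(int \<times> 'g)" unfolding Vset_def Rv by blast
qed

lemma Vset_valrel:
  assumes "R \<in> Vset iota vb TYPE('c)" shows "valrel vb iota R"
proof -
  obtain Gc :: "'c set" and le add z \<mu> where R: "R = vrel le \<mu>" and v: "is_valKx Gc le add z \<mu>" and re: "restr_equiv iota vb le \<mu>"
    using assms unfolding Vset_def by blast
  have G: "\<mu> u \<in> Gc" if "u \<noteq> 0" for u using v that unfolding is_valKx_def by blast
  have o: "oag Gc le add z" using v unfolding is_valKx_def by blast
  note o_total = oag_total[OF o] and o_trans = oag_trans[OF o] and o_mono = oag_mono[OF o]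
  obtain j where j: "\<forall>x\<in>(\<lambda>c. \<mu> (cst c)) ` (UNIV - {0}). \<forall>y\<in>(\<lambda>c. \<mu> (cst c)) ` (UNIV - {0}). le x y \<longleftrightarrow> j x \<le> j y"
    "\<forall>c. c \<noteq> 0 \<longrightarrow> j (\<mu> (cst c)) = vb (iota c)" using re unfolding restr_equiv_def by blast
  show ?thesis
  proof
    show "u \<noteq> 0 \<and> w \<noteq> 0" if "(u, w) \<in> R" for u w using that by (simp add: R vrel_def)
    show "(u, w) \<in> R \<or> (w, u) \<in> R" if "u \<noteq> 0" "w \<noteq> 0" for u w
      using that G o_total unfolding R vrel_def by simp
    show "(u, t) \<in> R" if a: "(u, w) \<in> R" "(w, t) \<in> R" for u w t
    proof -
      have "u \<noteq> 0" "w \<noteq> 0" "t \<noteq> 0" "le (\<mu> u) (\<mu> w)" "le (\<mu> w) (\<mu> t)" using a by (auto simp: R vrel_def)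
      moreover from this have "le (\<mu> u) (\<mu> t)" using o_trans G by blast
      ultimately show ?thesis by (simp add: R vrel_def)
    qed
    show "(u * t, w * t) \<in> R" if a: "(u, w) \<in> R" "t \<noteq> 0" for u w t
    proof -
      have nz: "u \<noteq> 0" "w \<noteq> 0" "le (\<mu> u) (\<mu> w)" using a by (auto simp: R vrel_def)
      then have "le (add (\<mu> u) (\<mu> t)) (add (\<mu> w) (\<mu> t))" using o_mono G a(2) by blast
      then have "le (\<mu> (u * t)) (\<mu> (w * t))" using v nz a(2) unfolding is_valKx_def by metis
      then show ?thesis using nz a(2) by (simp add: R vrel_def)
    qed
    show "(u, u + w) \<in> R \<or> (w, u + w) \<in> R" if "u \<noteq> 0" "w \<noteq> 0" "u + w \<noteq> 0" for u w
      using v that unfolding is_valKx_def R vrel_def by auto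
    show "(cst c, cst d) \<in> R \<longleftrightarrow> vb (iota c) \<le> vb (iota d)" if "c \<noteq> 0" "d \<noteq> 0" for c d
      using j that unfolding R vrel_def by auto
  qed
qed

text \<open>The bridge between classes on K(x) and bounds on polynomials. It mentions only values of
  constants of K: these determine the class by \<open>valrel_unique\<close>, and the remaining
  levels of \<Gamma> are reached through powers.\<close>

definition represents :: "('k poly fract \<times> 'k poly fract) set \<Rightarrow> (bool \<Rightarrow> 'l poly \<Rightarrow> 'g \<Rightarrow> bool) \<Rightarrow> bool" where
  "represents R \<rho> \<longleftrightarrow> valrel vb iota R \<and> qvalued vb K \<rho> \<and>
     (\<forall>f c. f \<noteq> 0 \<longrightarrow> c \<noteq> 0 \<longrightarrow> ((cst c, fr f) \<in> R \<longleftrightarrow> \<rho> False (mp f) (vb (iota c))) \<and>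
        ((fr f, cst c) \<in> R \<longleftrightarrow> \<not> \<rho> True (mp f) (vb (iota c))))"

lemma representsD:
  assumes "represents R \<rho>" "f \<noteq> 0" "c \<noteq> 0"
  shows "(cst c, fr f) \<in> R \<longleftrightarrow> \<rho> False (mp f) (vb (iota c))" "(fr f, cst c) \<in> R \<longleftrightarrow> \<not> \<rho> True (mp f) (vb (iota c))"
  using assms by (simp_all add: represents_def)

text \<open>One direction is uniqueness of a class with given comparisons to constants. For the
  other, a level of \<Gamma> becomes the value of a constant after passing to a power of f.\<close>

lemma represents_eq_iff:
  assumes R: "represents R \<rho>" and S: "represents S \<rho>'" shows "R = S \<longleftrightarrow> agree \<rho> \<rho>'"
proof
  assume "agree \<rho> \<rho>'"
  then have "\<rho> s (mp f) (vb (iota c)) \<longleftrightarrow> \<rho>' s (mp f) (vb (iota c))" if "c \<noteq> 0" for s f c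
    using mp_in that by (simp add: agree_def)
  then show "R = S" using R S unfolding represents_def by (intro valrel_unique[of vb iota R S]) simp_all
next
  assume RS: "R = S"
  interpret r: qvalued vb K \<rho> using R by (simp add: represents_def)
  interpret r': qvalued vb K \<rho>' using S by (simp add: represents_def)
  show "agree \<rho> \<rho>'" unfolding agree_def
  proof (intro ballI allI)
    fix g s l assume g: "g \<in> polys K" and l: "l \<in> \<Gamma>"
    obtain f where f: "g = mp f" using polys_KE[OF g] .
    show "\<rho> s g l \<longleftrightarrow> \<rho>' s g l"
    proof (cases "f = 0")
      case True
      then show ?thesis using f r.rho_0[OF l] r'.rho_0[OF l] by simp
    next
      case False
      obtain n c where n: "n > 0" "c \<noteq> 0" "vb (iota c) = nsm n l" using divisible_hull[OF l] by blast
      have fn: "f ^ n \<noteq> 0" using False by simp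
      have "\<rho> s (mp (f ^ n)) (vb (iota c)) \<longleftrightarrow> \<rho>' s (mp (f ^ n)) (vb (iota c))"
        using representsD[OF R fn n(2)] representsD[OF S fn n(2)] unfolding RS by (cases s) simp_all
      then show ?thesis using r.rho_power[OF g l n(1), of s] r'.rho_power[OF g l n(1), of s] unfolding n(3) f mp_power by simp
    qed
  qed
qed

abbreviation "RB a \<delta> \<equiv> restr_rel iota (omega vb a \<delta>) (le_Gd \<delta>)"
abbreviation "RN N \<equiv> restr_rel iota (omega_nest vb N) (\<le>)"

lemma ball_relation:
  assumes q: "qcut vb \<delta>"
  shows "RB a \<delta> \<in> Vset iota vb TYPE(int \<times> 'g)" "represents (RB a \<delta>) (qv a \<delta>)"
proof -
  let ?w = "\<lambda>p. omega vb a \<delta> (mp p)"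
  have w: "?w p = norm_Gd \<delta> (lmon a \<delta> (mp p))" if "p \<noteq> 0" for p using that by (simp add: omega_lmon[OF q])
  note V = valuation_relation[of "{t. snd t \<in> \<Gamma> \<and> norm_Gd \<delta> t = t}" "le_Gd \<delta>" ?w "RB a \<delta>"]
  have 1: "?w p \<in> {t. snd t \<in> \<Gamma> \<and> norm_Gd \<delta> t = t}" if "p \<noteq> 0" for p
    using that lmon_in[OF q, of "mp p" a] by (simp add: w norm_in[OF q])
  have 2: "?w (p * r) = ?w p + ?w r" if "p \<noteq> 0" "r \<noteq> 0" for p r
    using that w[of "p * r"] by (simp add: w mp_mult lmon_mult[OF q] norm_add)
  have 3: "le_Gd \<delta> (?w p) (?w (p + r)) \<or> le_Gd \<delta> (?w r) (?w (p + r))" if "p \<noteq> 0" "r \<noteq> 0" "p + r \<noteq> 0" for p r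
  proof -
    have "mp p + mp r \<noteq> 0" using that(3) by (simp flip: mp_add)
    then have "le_Gd (cutp \<delta>) (lmon a \<delta> (mp p)) (lmon a \<delta> (mp p + mp r)) \<or> le_Gd (cutp \<delta>) (lmon a \<delta> (mp r)) (lmon a \<delta> (mp p + mp r))"
      using that lmon_add_ge[OF q, of "mp p" "mp r" a] by simp
    then have "le_Gd \<delta> (lmon a \<delta> (mp p)) (lmon a \<delta> (mp p + mp r)) \<or> le_Gd \<delta> (lmon a \<delta> (mp r)) (lmon a \<delta> (mp p + mp r))"
      using le_cutpD by blast
    then show ?thesis using that w[of "p + r"] by (simp add: w norm_le[OF q] mp_add)
  qed
  have 4: "?w [:c:] = (0, vb (iota c))" if "c \<noteq> 0" for c
    using that w[of "[:c:]"] by (simp add: mp_const lmon_const[OF q])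
  have 5: "RB a \<delta> = {(u, u'). \<exists>p q r s. p \<noteq> 0 \<and> q \<noteq> 0 \<and> r \<noteq> 0 \<and> s \<noteq> 0 \<and>
      u = Fract p q \<and> u' = Fract r s \<and> le_Gd \<delta> (?w (p * s)) (?w (r * q))}"
    by (simp add: restr_rel_def)
  note V = V[OF oag_Gd[OF q] 1 2 3 4 le_same_fst 5]
  show mem: "RB a \<delta> \<in> Vset iota vb TYPE(int \<times> 'g)" by (rule V(1))
  have iff: "(fr f, fr g) \<in> RB a \<delta> \<longleftrightarrow> le_Gd \<delta> (lmon a \<delta> (mp f)) (lmon a \<delta> (mp g))" if "f \<noteq> 0" "g \<noteq> 0" for f g
    using V(2)[of f 1 g 1] that by (simp add: w norm_le[OF q])
  show "represents (RB a \<delta>) (qv a \<delta>)" unfolding represents_def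
  proof (intro conjI allI impI)
    show "valrel vb iota (RB a \<delta>)" by (rule Vset_valrel[OF mem])
    show "qvalued vb K (qv a \<delta>)" by (rule qvalued_qv[OF q])
    fix f c assume nz: "f \<noteq> (0::'k poly)" "c \<noteq> (0::'k)"
    have lc: "lmon a \<delta> (mp [:c:]) = (0, vb (iota c))" using nz by (simp add: mp_const lmon_const[OF q])
    have cc: "cst c = fr [:c:]" by (simp add: cst_def)
    show "(cst c, fr f) \<in> RB a \<delta> \<longleftrightarrow> qv a \<delta> False (mp f) (vb (iota c))"
      unfolding cc using iff[of "[:c:]" f] nz lc by (simp add: qv_def)
    show "(fr f, cst c) \<in> RB a \<delta> \<longleftrightarrow> \<not> qv a \<delta> True (mp f) (vb (iota c))"
      unfolding cc using iff[of f "[:c:]"] nz lc by (simp add: qv_def)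
  qed
qed

lemma nest_relation:
  assumes N: "nest vb N"
  shows "RN N \<in> Vset iota vb TYPE(int \<times> 'g)" "represents (RN N) (nqv N)"
proof -
  let ?w = "\<lambda>p. (0 :: int, omega_nest vb N (mp p))" and ?le = "\<lambda>s t :: int \<times> 'g. snd s \<le> snd t"
  \<comment> \<open>On finitely many polynomials the nest acts as evaluation at a common point, so
    the valuation axioms are inherited from v.\<close>
  have ev: "\<exists>b. \<forall>f\<in>S. f \<noteq> 0 \<longrightarrow> poly f b \<noteq> 0 \<and> omega_nest vb N f = vb (poly f b)" if S: "finite S" for S
  proof -
    define p where "p = prod id (S - {0})"
    have pnz: "p \<noteq> 0" using S by (simp add: p_def)
    obtain B where B: "B \<in> N" "rootfree B p" using nest_rootfree[OF N pnz] by blast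
    obtain b \<gamma> where b: "\<gamma> \<in> \<Gamma>" "B = vcball vb b \<gamma>" using nest_ballE[OF N B(1)] .
    have bB: "b \<in> B" using b by simp
    have "poly f b \<noteq> 0 \<and> omega_nest vb N f = vb (poly f b)" if f: "f \<in> S" "f \<noteq> 0" for f
    proof -
      have "f dvd p" unfolding p_def using S f dvd_prodI[of "S - {0}" f id] by simp
      then have "rootfree B f" using B(2) f by (auto simp: rootfree_def)
      then show ?thesis using omega_nest_eq[OF N f(2) B(1) _ bB] bB by (auto simp: rootfree_def)
    qed
    then show ?thesis by blast
  qed
  note V = valuation_relation[of "{t. fst t = 0 \<and> snd t \<in> \<Gamma>}" ?le ?w "RN N"]
  have 0: "oag {t. fst t = (0::int) \<and> snd t \<in> \<Gamma>} ?le (+) 0"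
    unfolding oag_def
  proof (intro conjI ballI impI)
    fix x :: "int \<times> 'g" assume x: "x \<in> {t. fst t = 0 \<and> snd t \<in> \<Gamma>}"
    show "\<exists>y\<in>{t. fst t = 0 \<and> snd t \<in> \<Gamma>}. x + y = 0" using x by (intro bexI[of _ "- x"]) auto
  qed (auto simp: prod_eq_iff add_ac)
  have 1: "?w p \<in> {t. fst t = 0 \<and> snd t \<in> \<Gamma>}" if "p \<noteq> 0" for p using ev[of "{mp p}"] that by auto
  have 2: "?w (p * r) = ?w p + ?w r" if "p \<noteq> 0" "r \<noteq> 0" for p r
    using ev[of "{mp p, mp r, mp p * mp r}"] that by (auto simp: mp_mult v_mult)
  have 3: "?le (?w p) (?w (p + r)) \<or> ?le (?w r) (?w (p + r))" if nz: "p \<noteq> 0" "r \<noteq> 0" "p + r \<noteq> 0" for p r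
  proof -
    have s: "mp p + mp r \<noteq> 0" using nz(3) by (simp flip: mp_add)
    obtain b where b: "\<forall>f\<in>{mp p, mp r, mp p + mp r}. f \<noteq> 0 \<longrightarrow> poly f b \<noteq> 0 \<and> omega_nest vb N f = vb (poly f b)"
      using ev[of "{mp p, mp r, mp p + mp r}"] by auto
    then show ?thesis using v_add[of "poly (mp p) b" "poly (mp r) b"] nz s by (auto simp: mp_add min_def split: if_splits)
  qed
  have 4: "?w [:c:] = (0, vb (iota c))" if "c \<noteq> 0" for c using ev[of "{mp [:c:]}"] that by (auto simp: mp_const)
  have 5: "RN N = {(u, u'). \<exists>p q r s. p \<noteq> 0 \<and> q \<noteq> 0 \<and> r \<noteq> 0 \<and> s \<noteq> 0 \<and>
      u = Fract p q \<and> u' = Fract r s \<and> ?le (?w (p * s)) (?w (r * q))}"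
    by (simp add: restr_rel_def)
  note V = V[OF 0 1 2 3 4 _ 5]
  show mem: "RN N \<in> Vset iota vb TYPE(int \<times> 'g)" by (rule V(1)) auto
  have iff: "(fr f, fr g) \<in> RN N \<longleftrightarrow> omega_nest vb N (mp f) \<le> omega_nest vb N (mp g)" if "f \<noteq> 0" "g \<noteq> 0" for f g
    using V(2)[of f 1 g 1] that by simp
  show "represents (RN N) (nqv N)" unfolding represents_def
  proof (intro conjI allI impI)
    show "valrel vb iota (RN N)" by (rule Vset_valrel[OF mem])
    show "qvalued vb K (nqv N)" by (rule qvalued_nqv[OF N])
    fix f c assume nz: "f \<noteq> (0::'k poly)" "c \<noteq> (0::'k)"
    obtain B where B: "B \<in> N" "rootfree B (mp f)" using nest_rootfree[OF N, of "mp f"] nz by auto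
    obtain b \<gamma> where b: "\<gamma> \<in> \<Gamma>" "B = vcball vb b \<gamma>" using nest_ballE[OF N B(1)] .
    have bB: "b \<in> B" using b by simp
    have of: "omega_nest vb N (mp f) = vb (poly (mp f) b)" using omega_nest_eq[OF N _ B bB] nz by simp
    have fb: "poly (mp f) b \<noteq> 0" using B bB by (auto simp: rootfree_def)
    have nq: "nqv N s (mp f) (vb (iota c)) \<longleftrightarrow> vge s (poly (mp f) b) (vb (iota c))" for s
      using nqv_rootfree[OF N B bB] nz by simp
    have oc: "omega_nest vb N (mp [:c:]) = vb (iota c)" using 4[OF nz(2)] by simp
    have cc: "cst c = fr [:c:]" by (simp add: cst_def)
    show "(cst c, fr f) \<in> RN N \<longleftrightarrow> nqv N False (mp f) (vb (iota c))"
      unfolding cc using iff[of "[:c:]" f] nz oc fb by (simp add: nq vge_def of)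
    show "(fr f, cst c) \<in> RN N \<longleftrightarrow> \<not> nqv N True (mp f) (vb (iota c))"
      unfolding cc using iff[of f "[:c:]"] nz oc fb by (simp add: nq vge_def of not_less)
  qed
qed

end


section \<open>The isomorphism\<close>

lemma cofinal_eq_refl: "cofinal_eq N N"
  by (auto simp: cofinal_eq_def)

lemma cofinal_eq_sym: "cofinal_eq N M \<Longrightarrow> cofinal_eq M N"
  by (simp add: cofinal_eq_def)

lemma cofinal_eq_trans: "cofinal_eq N M \<Longrightarrow> cofinal_eq M L \<Longrightarrow> cofinal_eq N L"
  unfolding cofinal_eq_def by (meson order_trans)

lemma cofinal_eq_image: "cofinal_eq N M \<Longrightarrow> cofinal_eq ((`) \<sigma> ` N) ((`) \<sigma> ` M)"
  unfolding cofinal_eq_def by (simp add: image_iff) (meson image_mono)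

context vclosure
begin

definition cls :: "'l set set \<Rightarrow> 'l set set set" where
  "cls N = {M. nest vb M \<and> cofinal_eq N M}"

lemma cls_eq: "cofinal_eq N M \<Longrightarrow> cls N = cls M"
  unfolding cls_def using cofinal_eq_trans cofinal_eq_sym by blast

lemma nqv_cofinal_imp:
  assumes N: "nest vb N" and M: "nest vb M" and c: "cofinal_eq N M" and l: "l \<in> \<Gamma>" and n: "nqv N s f l"
  shows "nqv M s f l"
proof -
  obtain a \<gamma> where a: "\<gamma> \<in> \<Gamma>" "vcball vb a \<gamma> \<in> N" "qv a (pq vb \<gamma>) s f l" using n by (auto simp: nqv_def)
  obtain B where B: "B \<in> M" "B \<subseteq> vcball vb a \<gamma>" using c a(2) by (auto simp: cofinal_eq_def)
  obtain b \<eta> where b: "\<eta> \<in> \<Gamma>" "B = vcball vb b \<eta>" using nest_ballE[OF M B(1)] .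
  have "\<gamma> \<le> \<eta>" using vcball_subset_radius[OF b(1) a(1)] B(2) b(2) by simp
  moreover have "b \<in> vcball vb a \<gamma>" using B(2) b(2) vcball_self by blast
  ultimately have "below (qv a (pq vb \<gamma>)) (qv b (pq vb \<eta>)) f"
    using a(1) b(1) by (intro qv_ball_mono) (auto simp: le_qcut_pq vball_pq)
  then have "qv b (pq vb \<eta>) s f l" using a(3) l by (simp add: below_def)
  then show ?thesis using b B(1) by (auto simp: nqv_def)
qed

lemma nqv_cofinal:
  assumes "nest vb N" "nest vb M" "cofinal_eq N M" "l \<in> \<Gamma>"
  shows "nqv N s f l \<longleftrightarrow> nqv M s f l"
  using nqv_cofinal_imp[OF assms] nqv_cofinal_imp[OF assms(2,1) cofinal_eq_sym[OF assms(3)] assms(4)] by blast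

lemma nest_image:
  assumes s: "\<sigma> \<in> G" and N: "nest vb N" shows "nest vb ((`) \<sigma> ` N)"
  unfolding nest_def
proof (intro conjI)
  show "(`) \<sigma> ` N \<noteq> {}" using N by (auto simp: nest_def)
  show "(`) \<sigma> ` N \<subseteq> closed_balls vb"
  proof
    fix B assume "B \<in> (`) \<sigma> ` N"
    then obtain B0 where B0: "B0 \<in> N" "B = \<sigma> ` B0" by blast
    obtain a \<gamma> where a: "\<gamma> \<in> \<Gamma>" "B0 = vcball vb a \<gamma>" using nest_ballE[OF N B0(1)] .
    have "B = vcball vb (\<sigma> a) \<gamma>" using B0(2) a G_vcball[OF s] by simp
    then show "B \<in> closed_balls vb" using a(1) by (auto simp: closed_balls_def)
  qed
  show "\<forall>B\<in>(`) \<sigma> ` N. \<forall>B'\<in>(`) \<sigma> ` N. B \<subseteq> B' \<or> B' \<subseteq> B"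
    using N unfolding nest_def by (auto dest: image_mono[of _ _ \<sigma>]) (metis image_mono subsetD imageI)
  show "\<Inter>((`) \<sigma> ` N) = {}"
  proof (rule equals0I)
    fix y assume y: "y \<in> \<Inter>((`) \<sigma> ` N)"
    have "inv \<sigma> y \<in> B" if "B \<in> N" for B
      using y that G_bij[OF s] by (auto simp: bij_is_inj)
    then have "inv \<sigma> y \<in> \<Inter>N" by blast
    then show False using N unfolding nest_def by simp
  qed
qed

lemma image_inv_image: "\<sigma> \<in> G \<Longrightarrow> (`) \<sigma> ` (`) (inv \<sigma>) ` N = N"
  using G_bij[of \<sigma>] by (simp add: image_image bij_is_surj surj_f_inv_f)

lemma inv_image_image: "\<sigma> \<in> G \<Longrightarrow> (`) (inv \<sigma>) ` (`) \<sigma> ` N = N"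
  using G_bij[of \<sigma>] by (simp add: image_image bij_is_inj)

lemma G_nqv_imp:
  assumes s: "\<sigma> \<in> G" and f: "f \<in> polys K" and n: "nqv N s' f l" shows "nqv ((`) \<sigma> ` N) s' f l"
proof -
  obtain a \<gamma> where a: "\<gamma> \<in> \<Gamma>" "vcball vb a \<gamma> \<in> N" "qv a (pq vb \<gamma>) s' f l" using n by (auto simp: nqv_def)
  have "vcball vb (\<sigma> a) \<gamma> \<in> (`) \<sigma> ` N" using a(2) G_vcball[OF s a(1), of a, symmetric] by simp
  then show ?thesis using a G_qv[OF s f, of a "pq vb \<gamma>" s' l] unfolding nqv_def by blast
qed

lemma G_nqv:
  assumes s: "\<sigma> \<in> G" and f: "f \<in> polys K" shows "nqv ((`) \<sigma> ` N) s' f l \<longleftrightarrow> nqv N s' f l"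
  using G_nqv_imp[OF s f, of N s' l] G_nqv_imp[OF G_inv[OF s] f, of "(`) \<sigma> ` N" s' l] inv_image_image[OF s] by auto

lemma act_ball: "\<sigma> \<in> G \<Longrightarrow> qcut vb \<delta> \<Longrightarrow> act \<sigma> (Inl (vball vb a \<delta>, \<delta>)) = Inl (vball vb (\<sigma> a) \<delta>, \<delta>)"
  by (simp add: G_vball)

lemma act_cls:
  assumes s: "\<sigma> \<in> G" shows "act \<sigma> (Inr (cls N) :: ('l, 'g) bspace) = Inr (cls ((`) \<sigma> ` N))"
proof -
  have sub: "(`) \<tau> ` M \<in> cls ((`) \<tau> ` L)" if "\<tau> \<in> G" "M \<in> cls L" for \<tau> M L
    using that nest_image[OF that(1)] cofinal_eq_image by (auto simp: cls_def)
  have "(\<lambda>M. (`) \<sigma> ` M) ` cls N = cls ((`) \<sigma> ` N)"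
  proof (intro set_eqI iffI)
    fix M assume "M \<in> cls ((`) \<sigma> ` N)"
    from sub[OF G_inv[OF s] this] have "(`) (inv \<sigma>) ` M \<in> cls N" by (simp only: inv_image_image[OF s])
    then show "M \<in> (\<lambda>M. (`) \<sigma> ` M) ` cls N" using image_inv_image[OF s, of M] by (metis imageI)
  qed (use sub[OF s] in auto)
  then show ?thesis by simp
qed

text \<open>A relation rather than a function: a ball has many centres and a class many nests, and
  each proof may use the representative at hand.\<close>

definition codes :: "('l, 'g) bspace \<Rightarrow> (bool \<Rightarrow> 'l poly \<Rightarrow> 'g \<Rightarrow> bool) \<Rightarrow> bool" where
  "codes X \<rho> \<longleftrightarrow> (\<exists>a \<delta>. qcut vb \<delta> \<and> X = Inl (vball vb a \<delta>, \<delta>) \<and> \<rho> = qv a \<delta>) \<or>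
     (\<exists>N. nest vb N \<and> X = Inr (cls N) \<and> \<rho> = nqv N)"

lemma codesE:
  assumes "codes X \<rho>"
  obtains a \<delta> where "qcut vb \<delta>" "X = Inl (vball vb a \<delta>, \<delta>)" "\<rho> = qv a \<delta>"
    | N where "nest vb N" "X = Inr (cls N)" "\<rho> = nqv N"
  using assms unfolding codes_def by blast

lemma codes_ball: "qcut vb \<delta> \<Longrightarrow> codes (Inl (vball vb a \<delta>, \<delta>)) (qv a \<delta>)"
  unfolding codes_def by blast

lemma codes_nest: "nest vb N \<Longrightarrow> codes (Inr (cls N)) (nqv N)"
  unfolding codes_def by blast

lemma codes_in: assumes "codes X \<rho>" shows "X \<in> BB vb"
  using assms
proof (cases rule: codesE)
  case (1 a \<delta>)
  then show ?thesis unfolding BB_def Bqcut_def by blast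
next
  case (2 N)
  then show ?thesis unfolding BB_def Binf_def cls_def by blast
qed

lemma codes_ex: assumes "X \<in> BB vb" shows "\<exists>\<rho>. codes X \<rho>"
  using assms unfolding BB_def Bqcut_def Binf_def cls_def[symmetric]
  by (auto intro: codes_ball codes_nest)

lemma codes_qvalued: assumes "codes X \<rho>" shows "qvalued vb K \<rho>"
  using assms by (cases rule: codesE) (auto intro: qvalued_qv qvalued_nqv)

lemma represents_agree:
  assumes "represents R \<rho>" "qvalued vb K \<rho>'" "agree \<rho> \<rho>'" shows "represents R \<rho>'"
proof -
  have "\<rho> s (mp f) (vb (iota c)) \<longleftrightarrow> \<rho>' s (mp f) (vb (iota c))" if "c \<noteq> 0" for s f c
    using assms(3) mp_in that by (simp add: agree_def)
  then show ?thesis using assms(1,2) unfolding represents_def by simp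
qed

text \<open>The representatives that \<open>SOME\<close> picks in \<open>Phi\<close> may differ from
  the given ones; recentring and cofinality show that the bounds are the same.\<close>

lemma codes_Phi:
  assumes "codes X \<rho>" shows "Phi iota vb X \<in> Vset iota vb TYPE(int \<times> 'g)" "represents (Phi iota vb X) \<rho>"
proof -
  have "Phi iota vb X \<in> Vset iota vb TYPE(int \<times> 'g) \<and> represents (Phi iota vb X) \<rho>"
    using assms
  proof (cases rule: codesE)
    case (1 a \<delta>)
    define b where "b = (SOME b. vball vb a \<delta> = vball vb b \<delta>)"
    have b: "vball vb a \<delta> = vball vb b \<delta>" unfolding b_def by (rule someI[of _ a]) simp
    have P: "Phi iota vb X = RB b \<delta>" by (simp add: 1(2) b_def)
    have "b \<in> vball vb a \<delta>" unfolding b by simp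
    then have "agree (qv b \<delta>) (qv a \<delta>)" using qv_recenter[OF 1(1)] by (simp add: agree_def)
    then have "represents (RB b \<delta>) (qv a \<delta>)"
      by (rule represents_agree[OF ball_relation(2)[OF 1(1)] qvalued_qv[OF 1(1)]])
    then show ?thesis using ball_relation(1)[OF 1(1)] P 1(3) by simp
  next
    case (2 N)
    define M where "M = (SOME M. M \<in> cls N)"
    have "N \<in> cls N" using 2(1) cofinal_eq_refl by (simp add: cls_def)
    then have "M \<in> cls N" unfolding M_def by (rule someI)
    then have M: "nest vb M" "cofinal_eq N M" by (simp_all add: cls_def)
    have P: "Phi iota vb X = RN M" by (simp add: 2(2) M_def)
    have "agree (nqv M) (nqv N)" using nqv_cofinal[OF 2(1) M] by (simp add: agree_def)
    then have "represents (RN M) (nqv N)"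
      by (rule represents_agree[OF nest_relation(2)[OF M(1)] qvalued_nqv[OF 2(1)]])
    then show ?thesis using nest_relation(1)[OF M(1)] P 2(3) by simp
  qed
  then show "Phi iota vb X \<in> Vset iota vb TYPE(int \<times> 'g)" "represents (Phi iota vb X) \<rho>" by blast+
qed

lemma Phi_eq_iff: "codes X \<rho> \<Longrightarrow> codes Y \<rho>' \<Longrightarrow> Phi iota vb X = Phi iota vb Y \<longleftrightarrow> agree \<rho> \<rho>'"
  by (rule represents_eq_iff[OF codes_Phi(2) codes_Phi(2)])

lemma codes_act:
  assumes c: "codes X \<rho>" and s: "\<sigma> \<in> G" shows "\<exists>\<rho>'. codes (act \<sigma> X) \<rho>' \<and> agree \<rho> \<rho>'"
  using c
proof (cases rule: codesE)
  case (1 a \<delta>)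
  have "codes (act \<sigma> X) (qv (\<sigma> a) \<delta>)" unfolding 1(2) act_ball[OF s 1(1)] by (rule codes_ball[OF 1(1)])
  moreover have "agree (qv a \<delta>) (qv (\<sigma> a) \<delta>)" using G_qv[OF s, of _ a \<delta>] by (simp add: agree_def)
  ultimately show ?thesis unfolding 1(3) by blast
next
  case (2 N)
  have "codes (act \<sigma> X) (nqv ((`) \<sigma> ` N))" unfolding 2(2) act_cls[OF s] by (rule codes_nest[OF nest_image[OF s 2(1)]])
  moreover have "agree (nqv N) (nqv ((`) \<sigma> ` N))" using G_nqv[OF s, of _ N] by (simp add: agree_def)
  ultimately show ?thesis unfolding 2(3) by blast
qed

lemma agree_orbit:
  assumes X: "codes X \<rho>" and Y: "codes Y \<rho>'" and ag: "agree \<rho> \<rho>'" shows "\<exists>\<sigma>\<in>G. Y = act \<sigma> X"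
  using X
proof (cases rule: codesE)
  case x: (1 a \<delta>)
  show ?thesis using Y
  proof (cases rule: codesE)
    case y: (1 b \<epsilon>)
    have "agree (qv a \<delta>) (qv b \<epsilon>)" using ag x(3) y(3) by simp
    from agree_balls[OF x(1) y(1) this] obtain \<sigma> where "\<sigma> \<in> G" "\<delta> = \<epsilon>" "\<sigma> ` vball vb a \<delta> = vball vb b \<epsilon>" by blast
    then show ?thesis using x(2) y(2) by (intro bexI[of _ \<sigma>]) auto
  next
    case y: (2 M)
    then show ?thesis using not_agree_ball_nest[OF x(1) y(1), of a] ag x(3) by simp
  qed
next
  case x: (2 N)
  show ?thesis using Y
  proof (cases rule: codesE)
    case y: (1 b \<epsilon>)
    then show ?thesis using not_agree_ball_nest[OF y(1) x(1), of b] agree_sym[OF ag] x(3) by simp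
  next
    case y: (2 M)
    have "agree (nqv N) (nqv M)" using ag x(3) y(3) by simp
    from agree_nests[OF x(1) y(1) this] obtain \<sigma> where s: "\<sigma> \<in> G" "cofinal_eq ((`) \<sigma> ` N) M" by blast
    have "Y = act \<sigma> X" unfolding x(2) y(2) act_cls[OF s(1)] cls_eq[OF s(2)] ..
    then show ?thesis using s(1) by blast
  qed
qed

section \<open>Comparison of the two orders\<close>

lemma vcball_subset_vball:
  assumes q: "qcut vb \<delta>" and e: "\<eta> \<in> \<Gamma>" and sub: "vcball vb c \<eta> \<subseteq> vball vb a \<delta>"
  shows "c \<in> vball vb a \<delta>" "le_qcut \<delta> (pq vb \<eta>)"
proof -
  show c: "c \<in> vball vb a \<delta>" using sub vcball_self by blast
  obtain z where z: "z \<noteq> 0" "vb z = \<eta>" using e by (rule Gam_E)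
  have "c + z \<in> vcball vb c \<eta>" using z by (simp add: vcball_def)
  then have "c + z \<in> vball vb c \<delta>" using sub vball_recenter[OF q c] by blast
  then have "\<eta> \<in> snd \<delta>" using z by (simp add: vball_iff[OF q])
  then show "le_qcut \<delta> (pq vb \<eta>)"
    using qcut_le[OF q, of _ \<eta>] qcut_fst[OF q] snd_up[OF q, of \<eta>] by (auto simp: le_qcut_def pq_def)
qed

lemma pq_value:
  assumes g: "\<gamma> \<in> \<Gamma>" and f: "f \<noteq> 0"
  shows "\<exists>k\<in>\<Gamma>. qv b (pq vb \<gamma>) False f k \<and> \<not> qv b (pq vb \<gamma>) True f k"
proof -
  let ?t = "lmon b (pq vb \<gamma>) f"
  let ?k = "snd ?t + zsm (fst ?t) \<gamma>"
  have "?k \<in> \<Gamma>" using lmon_in[OF qcut_pq f] g by simp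
  moreover have "le_Gd (pq vb \<gamma>) (0, ?k) ?t" "le_Gd (pq vb \<gamma>) ?t (0, ?k)" unfolding le_pq[OF g] by simp_all
  ultimately show ?thesis using f by (auto simp: qv_def)
qed

text \<open>The value in between comes from an intermediate object. If the radii of two balls
  differ, a closed ball with radius in \<Gamma> fits between them, and its \<omega>(f) lies in
  \<Gamma>. Below a nest, v(f(d)) at a point d deep in the nest serves.\<close>

lemma leB_between:
  assumes X: "codes X \<rho>" and Y: "codes Y \<rho>'" and le: "leB X Y"
  shows "X = Y \<or> (\<forall>f\<in>polys K. f \<noteq> 0 \<longrightarrow> (\<exists>k\<in>\<Gamma>. \<not> \<rho> True f k \<and> \<rho>' False f k))"
  using X
proof (cases rule: codesE)
  case x: (1 a \<delta>)
  show ?thesis using Y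
  proof (cases rule: codesE)
    case y: (1 b \<epsilon>)
    have l: "vball vb b \<epsilon> \<subseteq> vball vb a \<delta>" "le_qcut \<delta> \<epsilon>" using le x(2) y(2) by auto
    have b: "b \<in> vball vb a \<delta>" using l(1) vball_self by blast
    show ?thesis
    proof (cases "\<delta> = \<epsilon>")
      case True
      then show ?thesis using x(2) y(2) vball_recenter[OF x(1) b] by simp
    next
      case False
      obtain \<gamma> where g: "\<gamma> \<in> \<Gamma>" "le_qcut \<delta> (pq vb \<gamma>)" "le_qcut (pq vb \<gamma>) \<epsilon>" using qcut_between[OF x(1) y(1) l(2) False] by blast
      have "\<exists>k\<in>\<Gamma>. \<not> \<rho> True f k \<and> \<rho>' False f k" if f: "f \<noteq> 0" for f
      proof -
        obtain k where k: "k \<in> \<Gamma>" "qv b (pq vb \<gamma>) False f k" "\<not> qv b (pq vb \<gamma>) True f k" using pq_value[OF g(1) f] by blast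
        have "below (qv a \<delta>) (qv b (pq vb \<gamma>)) f" by (rule qv_ball_mono[OF x(1) qcut_pq g(2) b])
        moreover have "below (qv b (pq vb \<gamma>)) (qv b \<epsilon>) f" by (rule qv_ball_mono[OF qcut_pq y(1) g(3) vball_self])
        ultimately show ?thesis using k unfolding below_def x(3) y(3) by blast
      qed
      then show ?thesis by blast
    qed
  next
    case y: (2 N)
    obtain M B where M: "M \<in> cls N" "B \<in> M" "B \<subseteq> vball vb a \<delta>" using le x(2) y(2) by auto
    have MN: "nest vb M" "cofinal_eq N M" using M(1) by (simp_all add: cls_def)
    obtain c \<eta> where c: "\<eta> \<in> \<Gamma>" "B = vcball vb c \<eta>" using nest_ballE[OF MN(1) M(2)] .
    have sub: "vcball vb c \<eta> \<subseteq> vball vb a \<delta>" using M(3) c(2) by simp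
    have "\<exists>k\<in>\<Gamma>. \<not> \<rho> True f k \<and> \<rho>' False f k" if f: "f \<noteq> 0" for f
    proof -
      obtain C where C: "C \<in> M" "rootfree C f" using nest_rootfree[OF MN(1) f] by blast
      obtain d \<theta> where d: "\<theta> \<in> \<Gamma>" "C = vcball vb d \<theta>" using nest_ballE[OF MN(1) C(1)] .
      have dC: "d \<in> C" using d(2) by simp
      let ?k = "vb (poly f d)"
      have fd: "poly f d \<noteq> 0" using C(2) dC by (auto simp: rootfree_def)
      have k: "?k \<in> \<Gamma>" using fd by simp
      have n: "nqv M s f ?k \<longleftrightarrow> vge s (poly f d) ?k" for s by (rule nqv_rootfree[OF MN(1) C dC k])
      have "below (qv a \<delta>) (qv c (pq vb \<eta>)) f"
        by (rule qv_ball_mono[OF x(1) qcut_pq vcball_subset_vball(2)[OF x(1) c(1) sub] vcball_subset_vball(1)[OF x(1) c(1) sub]])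
      then have "below (qv a \<delta>) (nqv M) f" using nqv_ball_below[of c \<eta> M f] M(2) c below_trans by blast
      then have "\<not> qv a \<delta> True f ?k" using n[of True] k fd by (auto simp: below_def vge_def)
      moreover have "nqv N False f ?k" using nqv_cofinal[OF y(1) MN k] n[of False] fd by (simp add: vge_def)
      ultimately show ?thesis using k x(3) y(3) by auto
    qed
    then show ?thesis by blast
  qed
next
  case x: (2 N)
  show ?thesis using Y le x(2) by (cases rule: codesE) auto
qed

text \<open>A level of \<Gamma> becomes the value of a constant of K only after multiplication by
  some n; this is the role of the powers of f in \<open>Vle\<close>.\<close>

lemma Vle_intro:
  assumes R: "represents R \<rho>" and S: "represents S \<rho>'"
    and btw: "\<And>f. f \<in> polys K \<Longrightarrow> f \<noteq> 0 \<Longrightarrow> \<exists>k\<in>\<Gamma>. \<not> \<rho> True f k \<and> \<rho>' False f k"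
  shows "Vle R S"
proof -
  interpret r: qvalued vb K \<rho> using R by (simp add: represents_def)
  interpret r': qvalued vb K \<rho>' using S by (simp add: represents_def)
  have "\<exists>c n. c \<noteq> 0 \<and> 0 < n \<and> (fr (f ^ n), cst c) \<in> R \<and> (cst c, fr (f ^ n)) \<in> S" if f: "f \<noteq> 0" for f
  proof -
    obtain k where k: "k \<in> \<Gamma>" "\<not> \<rho> True (mp f) k" "\<rho>' False (mp f) k" using btw[OF mp_in, of f] f by auto
    obtain n c where n: "n > 0" "c \<noteq> 0" "vb (iota c) = nsm n k" using divisible_hull[OF k(1)] by blast
    have fn: "f ^ n \<noteq> 0" using f by simp
    have "(fr (f ^ n), cst c) \<in> R"
      using representsD(2)[OF R fn n(2)] r.rho_power[OF mp_in k(1) n(1), of True f] k(2) unfolding n(3) mp_power by blast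
    moreover have "(cst c, fr (f ^ n)) \<in> S"
      using representsD(1)[OF S fn n(2)] r'.rho_power[OF mp_in k(1) n(1), of False f] k(3) unfolding n(3) mp_power by blast
    ultimately show ?thesis using n by blast
  qed
  then show ?thesis unfolding Vle_def by blast
qed

text \<open>For distinct classes, a level k between the two values of f caps every bound that holds
  for \<rho>, and all bounds up to k hold for the larger valuation.\<close>

lemma Vle_below:
  assumes R: "represents R \<rho>" and S: "represents S \<rho>'" and le: "Vle R S" and g: "g \<in> polys K"
  shows "below \<rho> \<rho>' g"
proof (cases "R = S")
  case True
  then show ?thesis using agree_below[OF _ g] represents_eq_iff[OF R S] by blast
next
  case False
  interpret r: qvalued vb K \<rho> using R by (simp add: represents_def)
  interpret r': qvalued vb K \<rho>' using S by (simp add: represents_def)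
  obtain f where f: "g = mp f" using polys_KE[OF g] .
  show ?thesis
  proof (cases "f = 0")
    case True
    then show ?thesis using f r'.rho_0 by (simp add: below_def)
  next
    case fnz: False
    obtain c n where n: "c \<noteq> 0" "0 < n" "(fr (f ^ n), cst c) \<in> R" "(cst c, fr (f ^ n)) \<in> S"
      using le False fnz unfolding Vle_def by blast
    have fn: "f ^ n \<noteq> 0" using fnz by simp
    obtain k where k: "k \<in> \<Gamma>" "nsm n k = vb (iota c)" using Gam_divide[of "vb (iota c)" n] n by auto
    have 1: "\<not> \<rho> True g k"
      using representsD(2)[OF R fn n(1)] n(3) r.rho_power[OF g k(1) n(2), of True] unfolding k(2) f mp_power by blast
    have 2: "\<rho>' False g k"
      using representsD(1)[OF S fn n(1)] n(4) r'.rho_power[OF g k(1) n(2), of False] unfolding k(2) f mp_power by blast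
    show ?thesis unfolding below_def
    proof (intro allI ballI impI)
      fix s l assume l: "l \<in> \<Gamma>" and h: "\<rho> s g l"
      have "l < k \<or> l = k \<and> \<not> s" using r.rho_weaken[OF g l k(1) h, of True] 1 by fastforce
      then show "\<rho>' s g l" using r'.rho_weaken[OF g k(1) l 2, of s] by blast
    qed
  qed
qed

text \<open>For a ball, lifting yields some Z above X with the same valuation as Y, and Z is a
  conjugate of Y. For a nest, maximality turns the inequality into equality, so X itself is a
  conjugate of Y.\<close>

lemma below_leB:
  assumes X: "codes X \<rho>" and Y: "codes Y \<rho>'" and bel: "\<And>f. f \<in> polys K \<Longrightarrow> below \<rho> \<rho>' f"
  shows "\<exists>\<sigma>\<in>G. leB X (act \<sigma> Y)"
  using X
proof (cases rule: codesE)
  case x: (1 a \<delta>)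
  interpret r: qvalued vb K \<rho>' by (rule codes_qvalued[OF Y])
  have "\<forall>f\<in>polys K. below (qv a \<delta>) \<rho>' f" using bel x(3) by blast
  from r.lift[OF x(1) this] have "\<exists>Z \<rho>''. codes Z \<rho>'' \<and> leB X Z \<and> agree \<rho>'' \<rho>'"
  proof (elim disjE exE conjE)
    fix b \<epsilon> assume b: "qcut vb \<epsilon>" "le_qcut \<delta> \<epsilon>" "b \<in> vball vb a \<delta>" "\<forall>f\<in>polys K. \<forall>s. \<forall>l\<in>\<Gamma>. qv b \<epsilon> s f l \<longleftrightarrow> \<rho>' s f l"
    have "leB X (Inl (vball vb b \<epsilon>, \<epsilon>))"
      using vball_radius_mono[OF x(1) b(1,2), of b] vball_recenter[OF x(1) b(3)] b(2) x(2) by simp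
    moreover have "agree (qv b \<epsilon>) \<rho>'" using b(4) by (simp add: agree_def)
    ultimately show ?thesis using codes_ball[OF b(1)] by blast
  next
    fix N assume N: "nest vb N" "\<exists>B\<in>N. B \<subseteq> vball vb a \<delta>" "\<forall>f\<in>polys K. \<forall>s. \<forall>l\<in>\<Gamma>. nqv N s f l \<longleftrightarrow> \<rho>' s f l"
    have "N \<in> cls N" using N(1) cofinal_eq_refl by (simp add: cls_def)
    then have "leB X (Inr (cls N))" using N(2) x(2) by auto
    moreover have "agree (nqv N) \<rho>'" using N(3) by (simp add: agree_def)
    ultimately show ?thesis using codes_nest[OF N(1)] by blast
  qed
  then obtain Z \<rho>'' where Z: "codes Z \<rho>''" "leB X Z" "agree \<rho>'' \<rho>'" by blast
  obtain \<sigma> where "\<sigma> \<in> G" "Z = act \<sigma> Y" using agree_orbit[OF Y Z(1) agree_sym[OF Z(3)]] by blast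
  then show ?thesis using Z(2) by blast
next
  case x: (2 N)
  interpret r: qvalued vb K \<rho>' by (rule codes_qvalued[OF Y])
  have bel': "below (nqv N) \<rho>' f" if "f \<in> polys K" for f using bel[OF that] x(3) by simp
  have "agree \<rho> \<rho>'" unfolding x(3) by (rule agreeI[OF bel' r.nest_above[OF x(1) bel']])
  then obtain \<sigma> where s: "\<sigma> \<in> G" "X = act \<sigma> Y" using agree_orbit[OF Y X agree_sym] by blast
  have "leB X (act \<sigma> Y)" unfolding s(2)[symmetric] x(2) by simp
  then show ?thesis using s(1) by blast
qed

text \<open>The bounds \<open>R.rho\<close> attached to the class come from a ball or a nest, and
  agreement of bounds means equality of classes.\<close>

lemma Phi_surj:
  assumes "R \<in> Vset iota vb TYPE('c)" shows "\<exists>X\<in>BB vb. Phi iota vb X = R"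
proof -
  interpret R: valrel vb iota R by (rule Vset_valrel[OF assms])
  interpret r: qvalued vb K R.rho by (rule R.qvalued_rho)
  have rep: "represents R R.rho" unfolding represents_def
  proof (intro conjI allI impI)
    show "valrel vb iota R" "qvalued vb K R.rho" by unfold_locales
    fix f c assume "f \<noteq> (0::'k poly)" "c \<noteq> (0::'k)"
    from R.rho_iff[OF this(1) _ this(2), of 1 "vb (iota c)"]
    show "(cst c, fr f) \<in> R \<longleftrightarrow> R.rho False (mp f) (vb (iota c))" "(fr f, cst c) \<in> R \<longleftrightarrow> \<not> R.rho True (mp f) (vb (iota c))"
      by simp_all
  qed
  have "\<exists>X \<rho>. codes X \<rho> \<and> agree \<rho> R.rho"
    using r.representable
  proof (elim disjE exE conjE)
    fix a \<delta> assume "qcut vb \<delta>" "\<forall>f\<in>polys K. \<forall>s. \<forall>l\<in>\<Gamma>. qv a \<delta> s f l \<longleftrightarrow> R.rho s f l"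
    then show ?thesis using codes_ball[of \<delta> a] unfolding agree_def by blast
  next
    fix N assume "nest vb N" "\<forall>f\<in>polys K. \<forall>s. \<forall>l\<in>\<Gamma>. nqv N s f l \<longleftrightarrow> R.rho s f l"
    then show ?thesis using codes_nest[of N] unfolding agree_def by blast
  qed
  then obtain X \<rho> where X: "codes X \<rho>" "agree \<rho> R.rho" by blast
  then have "Phi iota vb X = R" using represents_eq_iff[OF codes_Phi(2)[OF X(1)] rep] by blast
  then show ?thesis using codes_in[OF X(1)] by blast
qed

lemma act_in: assumes "X \<in> BB vb" "\<sigma> \<in> G" shows "act \<sigma> X \<in> BB vb"
proof -
  obtain \<rho> where "codes X \<rho>" using codes_ex[OF assms(1)] by blast
  from codes_act[OF this assms(2)] show ?thesis using codes_in by blast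
qed

lemma Phi_act: assumes "X \<in> BB vb" "\<sigma> \<in> G" shows "Phi iota vb (act \<sigma> X) = Phi iota vb X"
proof -
  obtain \<rho> where X: "codes X \<rho>" using codes_ex[OF assms(1)] by blast
  obtain \<rho>' where X': "codes (act \<sigma> X) \<rho>'" "agree \<rho> \<rho>'" using codes_act[OF X assms(2)] by blast
  show ?thesis using Phi_eq_iff[OF X X'(1)] X'(2) by simp
qed

lemma Phi_eq_orbit:
  assumes "X \<in> BB vb" "Y \<in> BB vb" shows "Phi iota vb X = Phi iota vb Y \<longleftrightarrow> (\<exists>\<sigma>\<in>G. Y = act \<sigma> X)"
proof -
  obtain \<rho> where X: "codes X \<rho>" using codes_ex[OF assms(1)] by blast
  obtain \<rho>' where Y: "codes Y \<rho>'" using codes_ex[OF assms(2)] by blast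
  show ?thesis using Phi_eq_iff[OF X Y] agree_orbit[OF X Y] Phi_act[OF assms(1)] by auto
qed

lemma act_id: "act id X = X" for X :: "('l, 'g) bspace"
proof (cases X)
  case (Inl p)
  then show ?thesis by (cases p) simp
qed simp

lemma act_comp: "act (\<sigma> \<circ> \<tau>) X = act \<sigma> (act \<tau> X)" for X :: "('l, 'g) bspace"
proof (cases X)
  case (Inl p)
  then show ?thesis by (cases p) (simp add: image_comp)
next
  case (Inr C)
  then show ?thesis by (simp add: image_image comp_def)
qed

lemma Vle_iff_leB:
  assumes X: "X \<in> BB vb" and Y: "Y \<in> BB vb"
  shows "Vle (Phi iota vb X) (Phi iota vb Y) \<longleftrightarrow> (\<exists>\<sigma>\<in>G. \<exists>\<tau>\<in>G. leB (act \<sigma> X) (act \<tau> Y))"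
proof
  assume le: "Vle (Phi iota vb X) (Phi iota vb Y)"
  obtain \<rho> where cX: "codes X \<rho>" using codes_ex[OF X] by blast
  obtain \<rho>' where cY: "codes Y \<rho>'" using codes_ex[OF Y] by blast
  obtain \<tau> where "\<tau> \<in> G" "leB X (act \<tau> Y)"
    using below_leB[OF cX cY Vle_below[OF codes_Phi(2)[OF cX] codes_Phi(2)[OF cY] le]] by blast
  \<comment> \<open>Lifting moves only \<open>Y\<close>, so the identity serves for
    \<open>X\<close>.\<close>
  then show "\<exists>\<sigma>\<in>G. \<exists>\<tau>\<in>G. leB (act \<sigma> X) (act \<tau> Y)" using G_id act_id[of X] by metis
next
  assume "\<exists>\<sigma>\<in>G. \<exists>\<tau>\<in>G. leB (act \<sigma> X) (act \<tau> Y)"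
  then obtain \<sigma> \<tau> where s: "\<sigma> \<in> G" "\<tau> \<in> G" "leB (act \<sigma> X) (act \<tau> Y)" by blast
  obtain \<rho> where cX: "codes (act \<sigma> X) \<rho>" using codes_ex[OF act_in[OF X s(1)]] by blast
  obtain \<rho>' where cY: "codes (act \<tau> Y) \<rho>'" using codes_ex[OF act_in[OF Y s(2)]] by blast
  have "Vle (Phi iota vb (act \<sigma> X)) (Phi iota vb (act \<tau> Y))"
    using leB_between[OF cX cY s(3)]
  proof
    assume "act \<sigma> X = act \<tau> Y"
    then show ?thesis by (simp add: Vle_def)
  next
    assume "\<forall>f\<in>polys K. f \<noteq> 0 \<longrightarrow> (\<exists>k\<in>\<Gamma>. \<not> \<rho> True f k \<and> \<rho>' False f k)"
    then show ?thesis by (intro Vle_intro[OF codes_Phi(2)[OF cX] codes_Phi(2)[OF cY]]) blast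
  qed
  then show "Vle (Phi iota vb X) (Phi iota vb Y)" using Phi_act[OF X s(1)] Phi_act[OF Y s(2)] by simp
qed

end

theorem theorem3p1:
  fixes iota :: "'k::field \<Rightarrow> 'l::field" and vb :: "'l \<Rightarrow> 'g::linordered_ab_group_add"
  assumes hom_add: "\<forall>a b. iota (a + b) = iota a + iota b"
    and hom_mult: "\<forall>a b. iota (a * b) = iota a * iota b"
    and hom_one: "iota 1 = 1"
    and alg_closed: "\<forall>p :: 'l poly. degree p > 0 \<longrightarrow> (\<exists>z. poly p z = 0)"
    and algebraic: "\<forall>z. \<exists>p :: 'k poly. p \<noteq> 0 \<and> poly (map_poly iota p) z = 0"
    and val: "is_val_L vb"
  shows
    "(\<forall>\<sigma>\<in>Gdec iota vb. \<forall>X\<in>BB vb. act \<sigma> X \<in> BB vb)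
   \<and> (\<forall>X\<in>BB vb. act id X = X)
   \<and> (\<forall>\<sigma>\<in>Gdec iota vb. \<forall>\<tau>\<in>Gdec iota vb. \<forall>X\<in>BB vb. act (\<sigma> \<circ> \<tau>) X = act \<sigma> (act \<tau> X))
   \<and> (\<forall>\<sigma>\<in>Gdec iota vb. \<forall>X\<in>BB vb. Phi iota vb (act \<sigma> X) = Phi iota vb X)
   \<and> (\<forall>X\<in>BB vb. Phi iota vb X \<in> Vset iota vb TYPE(int \<times> 'g))
   \<and> (\<forall>R\<in>Vset iota vb TYPE('c). \<exists>X\<in>BB vb. Phi iota vb X = R)
   \<and> (\<forall>X\<in>BB vb. \<forall>Y\<in>BB vb. Phi iota vb X = Phi iota vb Y \<longleftrightarrow> (\<exists>\<sigma>\<in>Gdec iota vb. Y = act \<sigma> X))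
   \<and> (\<forall>X\<in>BB vb. \<forall>Y\<in>BB vb. Vle (Phi iota vb X) (Phi iota vb Y)
        \<longleftrightarrow> (\<exists>\<sigma>\<in>Gdec iota vb. \<exists>\<tau>\<in>Gdec iota vb. leB (act \<sigma> X) (act \<tau> Y)))"
proof -
  interpret vclosure vb iota
    using assms by unfold_locales blast+
  show ?thesis
  proof (intro conjI ballI)
    fix X assume X: "X \<in> BB vb"
    show "act id X = X" by (rule act_id)
    obtain \<rho> where "codes X \<rho>" using codes_ex[OF X] by blast
    then show "Phi iota vb X \<in> Vset iota vb TYPE(int \<times> 'g)" by (rule codes_Phi(1))
    fix Y assume Y: "Y \<in> BB vb"
    show "Phi iota vb X = Phi iota vb Y \<longleftrightarrow> (\<exists>\<sigma>\<in>G. Y = act \<sigma> X)" by (rule Phi_eq_orbit[OF X Y])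
    show "Vle (Phi iota vb X) (Phi iota vb Y) \<longleftrightarrow> (\<exists>\<sigma>\<in>G. \<exists>\<tau>\<in>G. leB (act \<sigma> X) (act \<tau> Y))" by (rule Vle_iff_leB[OF X Y])
  next
    fix \<sigma> X assume s: "\<sigma> \<in> G" and X: "X \<in> BB vb"
    show "act \<sigma> X \<in> BB vb" by (rule act_in[OF X s])
    show "Phi iota vb (act \<sigma> X) = Phi iota vb X" by (rule Phi_act[OF X s])
  next
    fix \<sigma> \<tau> :: "'l \<Rightarrow> 'l" and X :: "('l, 'g) bspace"
    show "act (\<sigma> \<circ> \<tau>) X = act \<sigma> (act \<tau> X)" by (rule act_comp)
  next
    fix R assume "R \<in> Vset iota vb TYPE('c)"
    then show "\<exists>X\<in>BB vb. Phi iota vb X = R" by (rule Phi_surj)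
  qed
qed

end
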